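(* Let $\varphi_0,\varphi\in L^2(\mathbb{R}^2)$ satisfy the window assumptions (i)–(iii) of the context with covering constants $0<A\le B<\infty$. Let $\varepsilon>0$ satisfy $\varepsilon\|\widehat\varphi\|_*<A$, let $\psi$, $\widetilde m$, and the system $\{\widetilde{\varphi_{0,\lambda}}\}\cup\{\widetilde{\varphi}_{j,k,\lambda}\}$ be constructed from $\varepsilon$ as in the context, and let $\Lambda$ be a lattice with parameters $a,b$ and $\Delta(\Lambda)<A-\varepsilon\|\widehat\varphi\|_*$. Then every $f\in L^2(\mathbb{R}^2)$ admits the approximate expansion $$\widetilde f:=|\Lambda|\Big(\sum_{\lambda\in\Lambda}\langle f,\widetilde{\varphi_{0,\lambda}}\rangle\varphi_{0,\lambda}+\sum_{j\ge1}\sum_{k=0}^{2^j-1}\sum_{\lambda\in\Lambda}\langle f,\widetilde\varphi_{j,k,\lambda}\rangle\varphi_{j,k,\lambda}\Big),$$ with $$\|f-\widetilde f\|_2\le\frac{\Delta(\Lambda)}{A-\varepsilon\|\widehat\varphi\|_*}\|f\|_2\lesssim\big(e^{-\tau/a^2}+e^{-\tau/b^2}\big)\|f\|_2,$$ where $\tau>0$ and the implicit constant do not depend on $f$ or $\Lambda$.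
   Context: Notation. $|x|$ is the Euclidean norm on $\mathbb{R}^2$. The Fourier transform is $\widehat f(\xi)=\int_{\mathbb{R}^2} f(x)e^{-2\pi i \xi\cdot x}\,dx$ (extended to $L^2$). $T_yf(x)=f(x-y)$, $\mathrm{Dil}_Af(x)=|\det A|^{1/2}f(Ax)$. Let $$D_j=\begin{bmatrix}4^j&0\\0&2^j\end{bmatrix},\quad R_\theta=\begin{bmatrix}\cos\theta&-\sin\theta\\ \sin\theta&\cos\theta\end{bmatrix},\quad A_{j,k}=D_jR_{2k\pi/2^j},\quad B_{j,k}=(A_{j,k}^* )^{-1}=D_j^{-1}R_{2k\pi/2^j}.$$ A lattice is a set $\Lambda=P\mathbb{Z}^2$ with $P\in\mathbb{R}^{2\times2}$ invertible; its volume is $|\Lambda|=|\det P|$, its dual lattice is $\Gamma=(P^{-1})^*\mathbb{Z}^2$, and its parameters $a,b>0$ are the singular values of $P$. Window assumptions on $\varphi_0,\varphi\in L^2(\mathbb{R}^2)$: (i) there are constants $0<A\le B<\infty$ with $A\le |\widehat{\varphi_0}(\xi)|^2+\sum_{j\ge1}\sum_{k=0}^{2^j-1}|\widehat{\varphi}(B_{j,k}\xi)|^2\le B$ for (almost) every $\xi\in\mathbb{R}^2$; (ii) $|\widehat{\varphi_0}(\xi)|\lesssim e^{-\delta|\xi|^2}$; (iii) $|\widehat{\varphi}(\xi)|\lesssim \min(1,|\xi_1|^{\varsigma})e^{-\delta|\xi|^2}$, for some $\delta>0$ and $\varsigma>2$. Here $X\lesssim Y$ means $X\le cY$ for a constant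 $c>0$. Wavepackets: $\varphi_{0,\lambda}=T_\lambda\varphi_0$ and $\varphi_{j,k,\lambda}=\mathrm{Dil}_{A_{j,k}}T_\lambda\varphi$, i.e. $\varphi_{j,k,\lambda}(x)=8^{j/2}\varphi(A_{j,k}x-\lambda)$, for $\lambda\in\Lambda$, $j\ge1$, $0\le k\le2^j-1$. Star-norm: $\|g\|_*=\operatorname{ess\,sup}_{\xi\in\mathbb{R}^2}\sum_{j\ge1}\sum_{k=0}^{2^j-1}|g(B_{j,k}\xi)|$; one has $\|\widehat\varphi\|_*<\infty$ under (iii). Correlation: $\Theta(\zeta)=\operatorname{ess\,sup}_{\xi}\big(|\widehat{\varphi_0}(\xi)||\widehat{\varphi_0}(\xi-\zeta)|+\sum_{j\ge1}\sum_{k=0}^{2^j-1}|\widehat{\varphi}(B_{j,k}\xi)||\widehat{\varphi}(B_{j,k}\xi-\zeta)|\big)$ and $\Delta(\Lambda)=\sum_{\gamma\in\Gamma\setminus\{0\}}\max\{\Theta(\gamma),\Theta(-\gamma)\}$. Approximate dual system: given $\varepsilon>0$, let $E_\varepsilon=\{\xi:|\widehat\varphi(\xi)|>\varepsilon\}$ (bounded, at positive distance from the origin). Let $\eta:\mathbb{R}^2\to[0,1]$ be a smooth function with compact support not containing the origin and $\eta\equiv1$ on $E_\varepsilon$, and define $\psi\in L^2(\mathbb{R}^2)$ by $\widehat\psi=\eta\widehat\varphi$. Let $$\widetilde m(\xi)=|\widehat{\varphi_0}(\xi)|^2+\sum_{j\ge1}\sum_{k=0}^{2^j-1}\widehat\varphi(B_{j,k}\xi)\overline{\widehat\psi(B_{j,k}\xi)}.$$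 When $\varepsilon\|\widehat\varphi\|_*<A$ one has $0<A-\varepsilon\|\widehat\varphi\|_*\le\widetilde m\le B+\varepsilon\|\widehat\varphi\|_*$ almost everywhere. The functions $\widetilde{\varphi_{0,\lambda}}$, $\widetilde\varphi_{j,k,\lambda}$ ($\lambda\in\Lambda$, $j\ge1$, $0\le k\le2^j-1$) are defined by $\widehat{\widetilde{\varphi_{0,\lambda}}}=\widetilde m^{-1}\,\widehat{T_\lambda\varphi_0}$ and $\widehat{\widetilde\varphi_{j,k,\lambda}}=\widetilde m^{-1}\,\widehat{\mathrm{Dil}_{A_{j,k}}T_\lambda\psi}$. *)

theory Defs
  imports "HOL-Analysis.Analysis" "HOL-Probability.Essential_Supremum"
begin

section \<open>Square-integrable functions and the Fourier transform on the plane\<close>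

text \<open>
  Elements of $L^2$ are represented by Borel functions (every class has a Borel representative);
  all notions below are insensitive to changes on null sets.
\<close>

definition L2 :: "(real^2 \<Rightarrow> complex) set" where
  "L2 = {f \<in> borel_measurable lborel. integrable lborel (\<lambda>x. (norm (f x))\<^sup>2)}"

definition L2_norm :: "(real^2 \<Rightarrow> complex) \<Rightarrow> real" where
  "L2_norm f = sqrt (LINT x|lborel. (norm (f x))\<^sup>2)"

definition L2_inner :: "(real^2 \<Rightarrow> complex) \<Rightarrow> (real^2 \<Rightarrow> complex) \<Rightarrow> complex" where
  "L2_inner f g = (LINT x|lborel. f x * cnj (g x))"

text \<open>
  Convergence in $L^2$ is stated with the nonnegative integral, so that a divergent integral
  counts as infinite and not as zero.
\<close>

definition L2_tendsto ::
    "('i \<Rightarrow> real^2 \<Rightarrow> complex) \<Rightarrow> (real^2 \<Rightarrow> complex) \<Rightarrow> 'i filter \<Rightarrow> bool" where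
  "L2_tendsto F g net \<longleftrightarrow>
     ((\<lambda>i. \<integral>\<^sup>+x. ennreal ((norm (F i x - g x))\<^sup>2) \<partial>lborel) \<longlongrightarrow> 0) net"

text \<open>Unconditional convergence of a series in $L^2$ (net limit over finite partial sums).\<close>

definition L2_has_sum ::
    "('i \<Rightarrow> real^2 \<Rightarrow> complex) \<Rightarrow> 'i set \<Rightarrow> (real^2 \<Rightarrow> complex) \<Rightarrow> bool" where
  "L2_has_sum F I g \<longleftrightarrow>
     g \<in> L2 \<and> L2_tendsto (\<lambda>J x. \<Sum>i\<in>J. F i x) g (finite_subsets_at_top I)"

definition L1_fourier :: "(real^2 \<Rightarrow> complex) \<Rightarrow> real^2 \<Rightarrow> complex" where
  "L1_fourier f \<xi> = (LINT x|lborel. f x * exp (- 2 * of_real pi * \<i> * of_real (\<xi> \<bullet> x)))"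

text \<open>
  The extension by continuity from $L^1 \cap L^2$ to $L^2$. The value is a representative of the
  transform, which is determined up to null sets; hence pointwise conditions on a transform
  are always imposed almost everywhere.
\<close>

definition L2_fourier :: "(real^2 \<Rightarrow> complex) \<Rightarrow> real^2 \<Rightarrow> complex" where
  "L2_fourier f = (SOME g. g \<in> L2 \<and>
     (\<exists>h :: nat \<Rightarrow> real^2 \<Rightarrow> complex.
        (\<forall>n. h n \<in> L2 \<and> integrable lborel (h n)) \<and>
        L2_tendsto h f sequentially \<and>
        L2_tendsto (\<lambda>n. L1_fourier (h n)) g sequentially))"

definition L2_inv_fourier :: "(real^2 \<Rightarrow> complex) \<Rightarrow> real^2 \<Rightarrow> complex" where
  "L2_inv_fourier g = (SOME f. f \<in> L2 \<and> (AE \<xi> in lborel. L2_fourier f \<xi> = g \<xi>))"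


section \<open>Translations, dilations and wavepackets\<close>

definition translate :: "real^2 \<Rightarrow> (real^2 \<Rightarrow> complex) \<Rightarrow> real^2 \<Rightarrow> complex" where
  "translate y f = (\<lambda>x. f (x - y))"

definition dilate :: "real^2^2 \<Rightarrow> (real^2 \<Rightarrow> complex) \<Rightarrow> real^2 \<Rightarrow> complex" where
  "dilate M f = (\<lambda>x. of_real (sqrt \<bar>det M\<bar>) * f (M *v x))"

definition scaling_matrix :: "nat \<Rightarrow> real^2^2" where
  "scaling_matrix j = vector [vector [4 ^ j, 0], vector [0, 2 ^ j]]"

definition rotation_matrix :: "real \<Rightarrow> real^2^2" where
  "rotation_matrix \<theta> = vector [vector [cos \<theta>, - sin \<theta>], vector [sin \<theta>, cos \<theta>]]"

definition A_mat :: "nat \<Rightarrow> nat \<Rightarrow> real^2^2" where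
  "A_mat j k = scaling_matrix j ** rotation_matrix (2 * real k * pi / 2 ^ j)"

definition B_mat :: "nat \<Rightarrow> nat \<Rightarrow> real^2^2" where
  "B_mat j k = matrix_inv (transpose (A_mat j k))"

datatype wp_index = Coarse "real^2" | Fine nat nat "real^2"

definition wp_indices :: "(real^2) set \<Rightarrow> wp_index set" where
  "wp_indices \<Lambda> = Coarse ` \<Lambda> \<union> {Fine j k \<mu> |j k \<mu>. 1 \<le> j \<and> k \<le> 2 ^ j - 1 \<and> \<mu> \<in> \<Lambda>}"

fun wavepacket ::
    "(real^2 \<Rightarrow> complex) \<Rightarrow> (real^2 \<Rightarrow> complex) \<Rightarrow> wp_index \<Rightarrow> real^2 \<Rightarrow> complex" where
  "wavepacket \<phi>\<^sub>0 \<phi> (Coarse \<mu>) = translate \<mu> \<phi>\<^sub>0"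
| "wavepacket \<phi>\<^sub>0 \<phi> (Fine j k \<mu>) = dilate (A_mat j k) (translate \<mu> \<phi>)"


section \<open>Window assumptions\<close>

text \<open>
  Sums over the scales $j \ge 1$ are written as sums over all natural numbers
  with \<open>Suc j\<close> in place of $j$.
\<close>

definition covering_sum ::
    "(real^2 \<Rightarrow> complex) \<Rightarrow> (real^2 \<Rightarrow> complex) \<Rightarrow> real^2 \<Rightarrow> ennreal" where
  "covering_sum \<phi>\<^sub>0 \<phi> \<xi> =
     ennreal ((norm (L2_fourier \<phi>\<^sub>0 \<xi>))\<^sup>2) +
     (\<Sum>j. \<Sum>k\<le>2 ^ Suc j - 1. ennreal ((norm (L2_fourier \<phi> (B_mat (Suc j) k *v \<xi>)))\<^sup>2))"

definition window_assumptions ::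
    "(real^2 \<Rightarrow> complex) \<Rightarrow> (real^2 \<Rightarrow> complex) \<Rightarrow> real \<Rightarrow> real \<Rightarrow> bool" where
  "window_assumptions \<phi>\<^sub>0 \<phi> A B \<longleftrightarrow>
     \<phi>\<^sub>0 \<in> L2 \<and> \<phi> \<in> L2 \<and> 0 < A \<and> A \<le> B \<and>
     (AE \<xi> in lborel. ennreal A \<le> covering_sum \<phi>\<^sub>0 \<phi> \<xi> \<and> covering_sum \<phi>\<^sub>0 \<phi> \<xi> \<le> ennreal B) \<and>
     (\<exists>\<delta>>0. \<exists>\<sigma>>2.
        (\<exists>c>0. AE \<xi> in lborel. norm (L2_fourier \<phi>\<^sub>0 \<xi>) \<le> c * exp (- \<delta> * (norm \<xi>)\<^sup>2)) \<and>
        (\<exists>c>0. AE \<xi> in lborel. norm (L2_fourier \<phi> \<xi>) \<le>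
                  c * (min 1 (\<bar>\<xi> $ 1\<bar> powr \<sigma>) * exp (- \<delta> * (norm \<xi>)\<^sup>2))))"

definition star_norm :: "(real^2 \<Rightarrow> complex) \<Rightarrow> ennreal" where
  "star_norm g = esssup lborel
     (\<lambda>\<xi>. \<Sum>j. \<Sum>k\<le>2 ^ Suc j - 1. ennreal (norm (g (B_mat (Suc j) k *v \<xi>))))"


section \<open>Lattices and the correlation functional\<close>

definition lattice_of :: "real^2^2 \<Rightarrow> (real^2) set" where
  "lattice_of P = {P *v n |n. \<forall>i. n $ i \<in> \<int>}"

definition lattice_volume :: "real^2^2 \<Rightarrow> real" where
  "lattice_volume P = \<bar>det P\<bar>"

definition dual_lattice_of :: "real^2^2 \<Rightarrow> (real^2) set" where
  "dual_lattice_of P = lattice_of (transpose (matrix_inv P))"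

text \<open>
  \<open>a\<close> and \<open>b\<close> are the square roots of the eigenvalues of the Gram matrix $P^*P$, counted with
  multiplicity (the roots of its characteristic polynomial).
\<close>

definition singular_values :: "real^2^2 \<Rightarrow> real \<Rightarrow> real \<Rightarrow> bool" where
  "singular_values P a b \<longleftrightarrow> 0 \<le> a \<and> 0 \<le> b \<and>
     (\<forall>t. det (mat t - transpose P ** P) = (t - a\<^sup>2) * (t - b\<^sup>2))"

definition Theta ::
    "(real^2 \<Rightarrow> complex) \<Rightarrow> (real^2 \<Rightarrow> complex) \<Rightarrow> real^2 \<Rightarrow> ennreal" where
  "Theta \<phi>\<^sub>0 \<phi> \<zeta> = esssup lborel
     (\<lambda>\<xi>. ennreal (norm (L2_fourier \<phi>\<^sub>0 \<xi>) * norm (L2_fourier \<phi>\<^sub>0 (\<xi> - \<zeta>))) +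
       (\<Sum>j. \<Sum>k\<le>2 ^ Suc j - 1.
          ennreal (norm (L2_fourier \<phi> (B_mat (Suc j) k *v \<xi>)) *
                   norm (L2_fourier \<phi> (B_mat (Suc j) k *v \<xi> - \<zeta>)))))"

definition Delta ::
    "(real^2 \<Rightarrow> complex) \<Rightarrow> (real^2 \<Rightarrow> complex) \<Rightarrow> real^2^2 \<Rightarrow> ennreal" where
  "Delta \<phi>\<^sub>0 \<phi> P =
     (\<Sum>\<^sub>\<infinity>\<gamma>\<in>dual_lattice_of P - {0}. max (Theta \<phi>\<^sub>0 \<phi> \<gamma>) (Theta \<phi>\<^sub>0 \<phi> (- \<gamma>)))"


section \<open>The approximate dual system\<close>

primrec Ck :: "nat \<Rightarrow> (real^2 \<Rightarrow> real) \<Rightarrow> bool" where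
  "Ck 0 f \<longleftrightarrow> continuous_on UNIV f"
| "Ck (Suc n) f \<longleftrightarrow>
     (\<forall>x. f differentiable at x) \<and> (\<forall>v. Ck n (\<lambda>x. frechet_derivative f (at x) v))"

definition smooth :: "(real^2 \<Rightarrow> real) \<Rightarrow> bool" where
  "smooth f \<longleftrightarrow> (\<forall>n. Ck n f)"

definition cutoff :: "real \<Rightarrow> (real^2 \<Rightarrow> complex) \<Rightarrow> (real^2 \<Rightarrow> real) \<Rightarrow> bool" where
  "cutoff \<epsilon> \<phi> \<eta> \<longleftrightarrow>
     smooth \<eta> \<and> range \<eta> \<subseteq> {0..1} \<and>
     compact (closure {\<xi>. \<eta> \<xi> \<noteq> 0}) \<and> 0 \<notin> closure {\<xi>. \<eta> \<xi> \<noteq> 0} \<and>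
     (AE \<xi> in lborel. norm (L2_fourier \<phi> \<xi>) > \<epsilon> \<longrightarrow> \<eta> \<xi> = 1)"

definition dual_window :: "(real^2 \<Rightarrow> complex) \<Rightarrow> (real^2 \<Rightarrow> real) \<Rightarrow> real^2 \<Rightarrow> complex" where
  "dual_window \<phi> \<eta> = L2_inv_fourier (\<lambda>\<xi>. of_real (\<eta> \<xi>) * L2_fourier \<phi> \<xi>)"

definition multiplier ::
    "(real^2 \<Rightarrow> complex) \<Rightarrow> (real^2 \<Rightarrow> complex) \<Rightarrow> (real^2 \<Rightarrow> complex) \<Rightarrow> real^2 \<Rightarrow> complex"
  where
  "multiplier \<phi>\<^sub>0 \<phi> \<psi> \<xi> =
     of_real ((norm (L2_fourier \<phi>\<^sub>0 \<xi>))\<^sup>2) +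
     (\<Sum>j. \<Sum>k\<le>2 ^ Suc j - 1.
        L2_fourier \<phi> (B_mat (Suc j) k *v \<xi>) * cnj (L2_fourier \<psi> (B_mat (Suc j) k *v \<xi>)))"

definition dual_wavepacket ::
    "(real^2 \<Rightarrow> complex) \<Rightarrow> (real^2 \<Rightarrow> complex) \<Rightarrow> (real^2 \<Rightarrow> real) \<Rightarrow>
     wp_index \<Rightarrow> real^2 \<Rightarrow> complex" where
  "dual_wavepacket \<phi>\<^sub>0 \<phi> \<eta> i =
     (let \<psi> = dual_window \<phi> \<eta> in
      L2_inv_fourier (\<lambda>\<xi>. inverse (multiplier \<phi>\<^sub>0 \<phi> \<psi> \<xi>) * L2_fourier (wavepacket \<phi>\<^sub>0 \<psi> i) \<xi>))"

definition approx_expansion ::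
    "(real^2 \<Rightarrow> complex) \<Rightarrow> (real^2 \<Rightarrow> complex) \<Rightarrow> (real^2 \<Rightarrow> real) \<Rightarrow> real^2^2 \<Rightarrow>
     (real^2 \<Rightarrow> complex) \<Rightarrow> (real^2 \<Rightarrow> complex) \<Rightarrow> bool" where
  "approx_expansion \<phi>\<^sub>0 \<phi> \<eta> P f f' \<longleftrightarrow>
     (\<exists>S. L2_has_sum
            (\<lambda>i x. L2_inner f (dual_wavepacket \<phi>\<^sub>0 \<phi> \<eta> i) * wavepacket \<phi>\<^sub>0 \<phi> i x)
            (wp_indices (lattice_of P)) S \<and>
          f' = (\<lambda>x. of_real (lattice_volume P) * S x))"

end

theory Submission
  imports Defs
begin

text \<open>
  On the frequency side the expansion splits into channels: the coarse window and, for every scale and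
  orientation, a copy of the fine window composed with \<open>B\<^bsub>j,k\<^esub>\<close>. Within a channel the coefficients of
  a function at the lattice points are Fourier coefficients over the dual lattice, so Parseval's identity
  turns the sum over the lattice into a sum of correlations of translates by dual lattice vectors \<open>\<gamma>\<close>.
  The terms with \<open>\<gamma> = 0\<close> add up to multiplication by \<open>m\<close>, which the dual system inverts; by a Schur
  test the terms with a fixed \<open>\<gamma> \<noteq> 0\<close> form an operator of norm at most \<open>max (\<Theta> \<gamma>) (\<Theta> (-\<gamma>))\<close>, which
  gives both the convergence of the series and the error bound.
  The Gaussian bounds on the windows make \<open>\<Theta>\<close> decay like a Gaussian, and a nonzero dual lattice vector
  is at least \<open>1 / max a b\<close> long.

  The Plancherel theorem is obtained from Fourier series. For \<open>f\<close> supported in the unit cell, Parseval's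
  identity gives \<open>\<Sum>\<^bsub>n\<^esub> |\<F> f (n + \<theta>)|\<^sup>2 = \<parallel>f\<parallel>\<^sup>2\<close> for every \<open>\<theta>\<close>, and integrating over the cell yields
  the isometry; dilation and truncation remove the support condition.
\<close>

text \<open>The dual system is never shown to be a Bessel family. Its coefficients against f are
  rewritten as conjugate coefficients of \<open>G\<close>, the transform of f divided by the
  multiplier, against atoms of the truncated window. That window is dominated pointwise by the
  transform of \<phi>, so the bounds by \<Theta> for the original windows govern both sides. The
  term \<gamma> = 0, where \<Theta> is at most B, enters the Bessel bound behind the convergence and
  stays out of the error bound. The error k is tested against itself: its squared norm is its
  pairing with f minus the scaled series, where the sesquilinear estimate leaves only \<gamma>
  \<noteq> 0. Sums over channels and lattice points are integrals over \<open>count_space\<close>,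
  so that Tonelli and Fubini justify the interchanges. The Gaussian bound on \<Delta> is proved
  uniformly only for lattices with max a b \<le> 1; for the others the hypothesis on \<Delta>
  already bounds the quotient by 1, while the larger Gaussian factor is at least exp(-\<tau>), and
  the constant absorbs the difference.\<close>

section \<open>Square-integrable functions over an arbitrary measure\<close>

definition sqint :: "'a measure \<Rightarrow> ('a \<Rightarrow> complex) set" where
  "sqint M = {f \<in> borel_measurable M. integrable M (\<lambda>x. (norm (f x))\<^sup>2)}"

definition sqnorm :: "'a measure \<Rightarrow> ('a \<Rightarrow> complex) \<Rightarrow> real" where
  "sqnorm M f = sqrt (LINT x|M. (norm (f x))\<^sup>2)"

definition sqinner :: "'a measure \<Rightarrow> ('a \<Rightarrow> complex) \<Rightarrow> ('a \<Rightarrow> complex) \<Rightarrow> complex" where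
  "sqinner M f g = (LINT x|M. f x * cnj (g x))"

lemma borel_measurable_cnj [measurable (raw)]:
  "f \<in> borel_measurable M \<Longrightarrow> (\<lambda>x. cnj (f x)) \<in> borel_measurable M"
  by (rule borel_measurable_continuous_on[OF _ , of cnj]) (auto intro: continuous_intros)

text \<open>Meaningful also when infinite, so that Tonelli arguments can run before square
  integrability is known.\<close>

abbreviation sqmass :: "'a measure \<Rightarrow> ('a \<Rightarrow> complex) \<Rightarrow> ennreal" where
  "sqmass M f \<equiv> \<integral>\<^sup>+x. ennreal ((norm (f x))\<^sup>2) \<partial>M"

text \<open>The calculus is generic in the measure because it serves twice: over
  \<open>lborel\<close> for functions and over \<open>count_space\<close> for coefficient sequences.
  These identities tie the first case to the notions of the statement.\<close>

lemma L2_eq_sqint: "L2 = sqint lborel"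
  and L2_norm_eq_sqnorm: "L2_norm = sqnorm lborel"
  and L2_inner_eq_sqinner: "L2_inner = sqinner lborel"
  by (auto simp: L2_def sqint_def L2_norm_def sqnorm_def L2_inner_def sqinner_def fun_eq_iff)

lemma sqint_measurable [measurable_dest]: "f \<in> sqint M \<Longrightarrow> f \<in> borel_measurable M"
  by (simp add: sqint_def)

lemma sqint_integrable: "f \<in> sqint M \<Longrightarrow> integrable M (\<lambda>x. (norm (f x))\<^sup>2)"
  by (simp add: sqint_def)

lemma sqint_bound:
  assumes "h \<in> borel_measurable M" "f \<in> sqint M" "g \<in> sqint M"
    and "AE x in M. (norm (h x))\<^sup>2 \<le> c * ((norm (f x))\<^sup>2 + (norm (g x))\<^sup>2)"
  shows "h \<in> sqint M"
  unfolding sqint_def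
proof (intro CollectI conjI)
  show "integrable M (\<lambda>x. (norm (h x))\<^sup>2)"
  proof (rule Bochner_Integration.integrable_bound)
    show "integrable M (\<lambda>x. c * ((norm (f x))\<^sup>2 + (norm (g x))\<^sup>2))"
      using assms(2,3) by (intro integrable_mult_right Bochner_Integration.integrable_add sqint_integrable)
    show "AE x in M. norm ((norm (h x))\<^sup>2) \<le> norm (c * ((norm (f x))\<^sup>2 + (norm (g x))\<^sup>2))"
      using assms(4) by eventually_elim auto
  qed (use assms in measurable)
qed (use assms in auto)

lemma sqint_dominated:
  assumes "h \<in> borel_measurable M" "f \<in> sqint M" "AE x in M. norm (h x) \<le> norm (f x)"
  shows "h \<in> sqint M"
  using assms(1,2,2)
proof (rule sqint_bound)
  show "AE x in M. (norm (h x))\<^sup>2 \<le> 1 * ((norm (f x))\<^sup>2 + (norm (f x))\<^sup>2)"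
    using assms(3)
  proof eventually_elim
    case (elim x)
    then have "(norm (h x))\<^sup>2 \<le> (norm (f x))\<^sup>2" by (intro power_mono) auto
    moreover have "0 \<le> (norm (f x))\<^sup>2" by simp
    ultimately show ?case unfolding mult_1 by linarith
  qed
qed

lemma sqint_iff_nn:
  "f \<in> sqint M \<longleftrightarrow> f \<in> borel_measurable M \<and> sqmass M f < \<infinity>"
  unfolding sqint_def by (auto simp: integrable_iff_bounded)

lemma sqnorm_nn: "f \<in> sqint M \<Longrightarrow> (sqmass M f) = ennreal ((sqnorm M f)\<^sup>2)"
  by (subst nn_integral_eq_integral) (auto intro: sqint_integrable simp: sqnorm_def integral_nonneg_AE)

lemma sqnorm_nonneg [simp]: "0 \<le> sqnorm M f"
  by (simp add: sqnorm_def integral_nonneg_AE)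

lemma sqint_zero [simp]: "(\<lambda>x. 0) \<in> sqint M" by (simp add: sqint_def)

lemma sqint_cmult [intro]: "f \<in> sqint M \<Longrightarrow> (\<lambda>x. c * f x) \<in> sqint M"
  by (auto simp: sqint_def norm_mult power_mult_distrib)

lemma norm_add_sq_le: "(norm (a + b :: complex))\<^sup>2 \<le> 2 * ((norm a)\<^sup>2 + (norm b)\<^sup>2)"
proof -
  have "(norm (a + b))\<^sup>2 \<le> (norm a + norm b)\<^sup>2"
    by (intro power_mono norm_triangle_ineq) auto
  also have "\<dots> \<le> 2 * ((norm a)\<^sup>2 + (norm b)\<^sup>2)"
    using sum_squares_bound[of "norm a" "norm b"] by (simp add: power2_sum)
  finally show ?thesis .
qed

lemma sqint_add [intro]: "f \<in> sqint M \<Longrightarrow> g \<in> sqint M \<Longrightarrow> (\<lambda>x. f x + g x) \<in> sqint M"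
  by (rule sqint_bound[where f = f and g = g and c = 2]) (auto intro: sqint_measurable borel_measurable_add intro!: AE_I2 norm_add_sq_le simp del: distrib_left_numeral)

lemma sqint_diff [intro]: "f \<in> sqint M \<Longrightarrow> g \<in> sqint M \<Longrightarrow> (\<lambda>x. f x - g x) \<in> sqint M"
  using sqint_add[of f M "\<lambda>x. -1 * g x"] sqint_cmult[of g M "-1"] by simp

lemma sqint_sum [intro]: "(\<And>i. i \<in> J \<Longrightarrow> f i \<in> sqint M) \<Longrightarrow> (\<lambda>x. \<Sum>i\<in>J. f i x) \<in> sqint M"
  by (induction J rule: infinite_finite_induct) auto

lemma sqint_prod:
  assumes "f \<in> sqint M" "g \<in> sqint M"
  shows "integrable M (\<lambda>x. f x * cnj (g x))"
proof (rule Bochner_Integration.integrable_bound)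
  show "integrable M (\<lambda>x. (norm (f x))\<^sup>2 + (norm (g x))\<^sup>2)"
    using assms by (intro Bochner_Integration.integrable_add sqint_integrable)
  have [measurable]: "f \<in> borel_measurable M" "g \<in> borel_measurable M"
    using assms by (auto intro: sqint_measurable)
  show "(\<lambda>x. f x * cnj (g x)) \<in> borel_measurable M" by measurable
  show "AE x in M. norm (f x * cnj (g x)) \<le> norm ((norm (f x))\<^sup>2 + (norm (g x))\<^sup>2)"
  proof (intro AE_I2)
    fix x
    have "2 * (norm (f x) * norm (g x)) \<le> (norm (f x))\<^sup>2 + (norm (g x))\<^sup>2"
      using sum_squares_bound[of "norm (f x)" "norm (g x)"] by simp
    moreover have "0 \<le> norm (f x) * norm (g x)" by simp
    ultimately show "norm (f x * cnj (g x)) \<le> norm ((norm (f x))\<^sup>2 + (norm (g x))\<^sup>2)"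
      unfolding norm_mult complex_mod_cnj real_norm_def by linarith
  qed
qed

lemma sqinner_add_left:
  "f \<in> sqint M \<Longrightarrow> g \<in> sqint M \<Longrightarrow> k \<in> sqint M \<Longrightarrow>
    sqinner M (\<lambda>x. f x + g x) k = sqinner M f k + sqinner M g k"
  unfolding sqinner_def distrib_right by (intro Bochner_Integration.integral_add sqint_prod)

lemma sqinner_diff_left:
  "f \<in> sqint M \<Longrightarrow> g \<in> sqint M \<Longrightarrow> k \<in> sqint M \<Longrightarrow>
    sqinner M (\<lambda>x. f x - g x) k = sqinner M f k - sqinner M g k"
  unfolding sqinner_def left_diff_distrib by (intro Bochner_Integration.integral_diff sqint_prod)

lemma sqinner_cmult_left: "sqinner M (\<lambda>x. c * f x) k = c * sqinner M f k"
  by (simp add: sqinner_def mult.assoc)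

lemma sqinner_cnj: "cnj (sqinner M f g) = sqinner M g f"
proof -
  have "cnj (sqinner M f g) = (LINT x|M. cnj (f x * cnj (g x)))"
    unfolding sqinner_def by (simp only: Bochner_Integration.integral_cnj)
  then show ?thesis by (simp add: sqinner_def mult.commute del: Bochner_Integration.integral_cnj)
qed

lemma sqinner_sum_left:
  "(\<And>i. i \<in> J \<Longrightarrow> f i \<in> sqint M) \<Longrightarrow> k \<in> sqint M \<Longrightarrow>
    sqinner M (\<lambda>x. \<Sum>i\<in>J. f i x) k = (\<Sum>i\<in>J. sqinner M (f i) k)"
proof (induction J rule: infinite_finite_induct)
  case (insert i J)
  then show ?case by (simp add: sqinner_add_left sqint_sum)
qed (simp_all add: sqinner_def)

lemma sqinner_self: "sqinner M f f = of_real ((sqnorm M f)\<^sup>2)"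
proof -
  have "sqinner M f f = (LINT x|M. of_real ((norm (f x))\<^sup>2))"
    unfolding sqinner_def complex_norm_square[symmetric] by simp
  also have "\<dots> = of_real (LINT x|M. (norm (f x))\<^sup>2)" by (rule integral_complex_of_real)
  finally show ?thesis by (simp add: sqnorm_def integral_nonneg_AE)
qed

lemma sqnorm_cmult: "sqnorm M (\<lambda>x. c * f x) = norm c * sqnorm M f"
  by (simp add: sqnorm_def norm_mult power_mult_distrib real_sqrt_mult)

lemma sqnorm_add_sq:
  assumes "f \<in> sqint M" "g \<in> sqint M"
  shows "(sqnorm M (\<lambda>x. f x + g x))\<^sup>2 = (sqnorm M f)\<^sup>2 + 2 * Re (sqinner M f g) + (sqnorm M g)\<^sup>2"
proof -
  have "complex_of_real ((sqnorm M (\<lambda>x. f x + g x))\<^sup>2) = sqinner M (\<lambda>x. f x + g x) (\<lambda>x. f x + g x)"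
    by (simp add: sqinner_self)
  also have "\<dots> = sqinner M f (\<lambda>x. f x + g x) + sqinner M g (\<lambda>x. f x + g x)"
    using assms by (intro sqinner_add_left) auto
  also have "\<dots> = cnj (sqinner M (\<lambda>x. f x + g x) f) + cnj (sqinner M (\<lambda>x. f x + g x) g)"
    by (simp add: sqinner_cnj)
  also have "\<dots> = cnj (sqinner M f f + sqinner M g f) + cnj (sqinner M f g + sqinner M g g)"
    using assms by (simp add: sqinner_add_left)
  finally have "complex_of_real ((sqnorm M (\<lambda>x. f x + g x))\<^sup>2) =
      cnj (sqinner M f f + sqinner M g f) + cnj (sqinner M f g + sqinner M g g)" .
  then have "Re (complex_of_real ((sqnorm M (\<lambda>x. f x + g x))\<^sup>2)) =
      Re (cnj (sqinner M f f + sqinner M g f) + cnj (sqinner M f g + sqinner M g g))" by simp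
  moreover have "Re (sqinner M g f) = Re (sqinner M f g)"
    by (metis cnj.simps(1) sqinner_cnj)
  ultimately show ?thesis by (simp add: sqinner_self)
qed

lemma sqnorm_zero_ip:
  assumes "f \<in> sqint M" "g \<in> sqint M" "sqnorm M f = 0"
  shows "sqinner M f g = 0"
proof -
  have "AE x in M. (norm (f x))\<^sup>2 = 0"
    using assms(1,3) by (subst (asm) sqnorm_def) (simp add: integral_nonneg_eq_0_iff_AE sqint_integrable)
  then have "AE x in M. f x * cnj (g x) = 0" by eventually_elim auto
  then show ?thesis unfolding sqinner_def by (rule integral_eq_zero_AE)
qed

lemma sqnorm_eq_0_AE:
  assumes "f \<in> sqint M" "sqnorm M f = 0"
  shows "AE x in M. f x = 0"
proof -
  have "AE x in M. (norm (f x))\<^sup>2 = 0"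
    using assms by (subst (asm) sqnorm_def) (simp add: integral_nonneg_eq_0_iff_AE sqint_integrable)
  then show ?thesis by eventually_elim auto
qed

lemma sq_Cauchy_Schwarz:
  assumes f: "f \<in> sqint M" and g: "g \<in> sqint M"
  shows "norm (sqinner M f g) \<le> sqnorm M f * sqnorm M g"
proof (cases "sqnorm M g = 0")
  case True
  then have "sqinner M g f = 0" using sqnorm_zero_ip[OF g f] by simp
  then have "sqinner M f g = 0" by (metis complex_cnj_zero sqinner_cnj)
  then show ?thesis by simp
next
  case False
  define n where "n = (sqnorm M g)\<^sup>2"
  define z where "z = sqinner M f g"
  have n: "n > 0" using False by (simp add: n_def)
  \<comment> \<open>The minimiser of the norm of f + c g: minus the coefficient of the projection of
    f onto g.\<close>
  define c where "c = - (z / of_real n)"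
  have "0 \<le> (sqnorm M (\<lambda>x. f x + c * g x))\<^sup>2" by simp
  also have "\<dots> = (sqnorm M f)\<^sup>2 + 2 * Re (sqinner M f (\<lambda>x. c * g x)) + (norm c)\<^sup>2 * n"
    using f g by (subst sqnorm_add_sq) (auto simp: sqnorm_cmult power_mult_distrib n_def)
  also have "sqinner M f (\<lambda>x. c * g x) = cnj c * z"
    by (metis sqinner_cnj sqinner_cmult_left complex_cnj_mult z_def)
  also have "cnj c * z = - of_real ((norm z)\<^sup>2 / n)"
    using complex_norm_square[of z] by (simp add: c_def mult.commute)
  also have "(norm c)\<^sup>2 * n = (norm z)\<^sup>2 / n"
    using n by (simp add: c_def norm_divide power_divide power2_eq_square)
  finally have "(norm z)\<^sup>2 / n \<le> (sqnorm M f)\<^sup>2" by simp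
  then have "(norm z)\<^sup>2 \<le> (sqnorm M f * sqnorm M g)\<^sup>2"
    using n by (simp add: divide_le_eq n_def power_mult_distrib)
  then show ?thesis unfolding z_def by (rule power2_le_imp_le) simp
qed

lemma sqnorm_triangle:
  assumes "f \<in> sqint M" "g \<in> sqint M"
  shows "sqnorm M (\<lambda>x. f x + g x) \<le> sqnorm M f + sqnorm M g"
proof (rule power2_le_imp_le)
  have "Re (sqinner M f g) \<le> sqnorm M f * sqnorm M g"
    using sq_Cauchy_Schwarz[OF assms] complex_Re_le_cmod order_trans by blast
  then show "(sqnorm M (\<lambda>x. f x + g x))\<^sup>2 \<le> (sqnorm M f + sqnorm M g)\<^sup>2"
    by (subst sqnorm_add_sq[OF assms]) (simp add: power2_sum)
qed simp

lemma sqnorm_minus_commute: "sqnorm M (\<lambda>x. f x - g x) = sqnorm M (\<lambda>x. g x - f x)"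
  by (simp add: sqnorm_def norm_minus_commute)

lemma sqnorm_triangle_diff:
  assumes "f \<in> sqint M" "g \<in> sqint M" "h \<in> sqint M"
  shows "sqnorm M (\<lambda>x. f x - h x) \<le> sqnorm M (\<lambda>x. f x - g x) + sqnorm M (\<lambda>x. g x - h x)"
  using sqnorm_triangle[of "\<lambda>x. f x - g x" M "\<lambda>x. g x - h x"] assms by auto

lemma sqnorm_abs_diff:
  assumes "f \<in> sqint M" "g \<in> sqint M"
  shows "\<bar>sqnorm M f - sqnorm M g\<bar> \<le> sqnorm M (\<lambda>x. f x - g x)"
  using sqnorm_triangle_diff[OF assms(1,2) sqint_zero] sqnorm_triangle_diff[OF assms(2,1) sqint_zero]
    sqnorm_minus_commute[of M f g] by auto

lemma sqnorm_cong_AE: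
  "f \<in> borel_measurable M \<Longrightarrow> g \<in> borel_measurable M \<Longrightarrow> AE x in M. f x = g x \<Longrightarrow> sqnorm M f = sqnorm M g"
  unfolding sqnorm_def by (intro arg_cong[where f = sqrt] integral_cong_AE) auto

lemma sqinner_cong_AE:
  assumes "f \<in> borel_measurable M" "f' \<in> borel_measurable M" "g \<in> borel_measurable M" "g' \<in> borel_measurable M"
   "AE x in M. f x = f' x" "AE x in M. g x = g' x"
  shows "sqinner M f g = sqinner M f' g'"
proof -
  note [measurable] = assms(1-4)
  show ?thesis unfolding sqinner_def
  proof (rule integral_cong_AE)
    show "AE x in M. f x * cnj (g x) = f' x * cnj (g' x)"
      using assms(5,6) by eventually_elim simp
  qed measurable
qed

text \<open>All four terms have the form f + c g, so a map that is isometric on such combinations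
  preserves inner products. Used for the Fourier transform and for Parseval on the cell.\<close>

lemma sqinner_polarization:
  assumes "f \<in> sqint M" "g \<in> sqint M"
  shows "sqinner M f g =
    (of_real ((sqnorm M (\<lambda>x. f x + g x))\<^sup>2) - of_real ((sqnorm M (\<lambda>x. f x + (-1) * g x))\<^sup>2)
     + \<i> * of_real ((sqnorm M (\<lambda>x. f x + \<i> * g x))\<^sup>2) - \<i> * of_real ((sqnorm M (\<lambda>x. f x + (-\<i>) * g x))\<^sup>2)) / 4"
proof -
  have c: "(sqnorm M (\<lambda>x. f x + c * g x))\<^sup>2 =
    (sqnorm M f)\<^sup>2 + 2 * Re (cnj c * sqinner M f g) + (norm c * sqnorm M g)\<^sup>2" for c
  proof -
    have "sqinner M f (\<lambda>x. c * g x) = cnj c * sqinner M f g"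
      by (metis sqinner_cnj sqinner_cmult_left complex_cnj_mult)
    then show ?thesis using assms by (subst sqnorm_add_sq) (auto simp: sqnorm_cmult)
  qed
  show ?thesis using c[of 1] c[of "-1"] c[of \<i>] c[of "-\<i>"]
    by (simp add: complex_eq_iff)
qed

text \<open>Both Bessel's inequality and the best-approximation property of Fourier sums are read off
  this identity.\<close>

lemma orthonormal_approx:
  assumes U: "U \<in> sqint M" and N: "finite N" and e: "\<And>n. n \<in> N \<Longrightarrow> e n \<in> sqint M"
    and on: "\<And>n m. n \<in> N \<Longrightarrow> m \<in> N \<Longrightarrow> sqinner M (e n) (e m) = (if n = m then 1 else 0)"
  shows "(sqnorm M (\<lambda>x. U x - (\<Sum>n\<in>N. c n * e n x)))\<^sup>2 =
    (sqnorm M U)\<^sup>2 - (\<Sum>n\<in>N. (norm (sqinner M U (e n)))\<^sup>2) + (\<Sum>n\<in>N. (norm (c n - sqinner M U (e n)))\<^sup>2)"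
proof -
  define p where "p = (\<lambda>x. \<Sum>n\<in>N. - c n * e n x)"
  have p: "p \<in> sqint M" unfolding p_def using e by (intro sqint_sum sqint_cmult)
  have pe: "sqinner M p (e m) = - c m" if "m \<in> N" for m
  proof -
    have "sqinner M p (e m) = (\<Sum>n\<in>N. sqinner M (\<lambda>x. - c n * e n x) (e m))"
      unfolding p_def using e that by (intro sqinner_sum_left sqint_cmult)
    also have "\<dots> = (\<Sum>n\<in>N. - c n * (if n = m then 1 else 0))"
      unfolding sqinner_cmult_left using on that by (intro sum.cong) auto
    also have "\<dots> = - c m" using N that by (simp add: if_distrib cong: if_cong)
    finally show ?thesis .
  qed
  have pf: "sqinner M p f = (\<Sum>n\<in>N. - c n * sqinner M (e n) f)" if "f \<in> sqint M" for f
    unfolding p_def sqinner_cmult_left[symmetric] using e that by (intro sqinner_sum_left sqint_cmult)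
  have "sqinner M p p = (\<Sum>n\<in>N. - c n * cnj (- c n))"
    unfolding pf[OF p] using pe by (intro sum.cong refl) (metis sqinner_cnj)
  then have pp: "(sqnorm M p)\<^sup>2 = (\<Sum>n\<in>N. (norm (c n))\<^sup>2)"
    unfolding sqinner_self by (simp add: complex_norm_square[symmetric] del: of_real_power flip: of_real_sum)
  have Up: "sqinner M U p = (\<Sum>n\<in>N. - cnj (c n) * sqinner M U (e n))"
    using arg_cong[OF pf[OF U], of cnj] by (simp add: sqinner_cnj)
  have "(sqnorm M (\<lambda>x. U x - (\<Sum>n\<in>N. c n * e n x)))\<^sup>2 = (sqnorm M (\<lambda>x. U x + p x))\<^sup>2"
    by (simp add: p_def sum_negf)
  also have "\<dots> = (sqnorm M U)\<^sup>2 + (\<Sum>n\<in>N. (norm (c n))\<^sup>2 + 2 * Re (- cnj (c n) * sqinner M U (e n)))"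
    unfolding sqnorm_add_sq[OF U p] Up pp by (simp add: sum.distrib sum_distrib_left)
  also have "(\<Sum>n\<in>N. (norm (c n))\<^sup>2 + 2 * Re (- cnj (c n) * sqinner M U (e n))) =
     (\<Sum>n\<in>N. (norm (c n - sqinner M U (e n)))\<^sup>2 - (norm (sqinner M U (e n)))\<^sup>2)"
    unfolding cmod_power2 by (intro sum.cong refl) (simp add: power2_eq_square algebra_simps)
  finally show ?thesis by (simp add: sum_subtractf)
qed

lemma ennreal_le_suminf: "t k \<le> suminf (t :: nat \<Rightarrow> ennreal)"
  using sum_le_suminf[OF summableI, of "{k}" t] by simp

text \<open>Riesz-Fischer. A subsequence with consecutive distances below 2^-k converges almost
  everywhere, and Fatou's lemma upgrades the pointwise limit to a limit in norm of the whole
  sequence.\<close>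

lemma sq_complete:
  assumes f: "\<And>n. f n \<in> sqint M"
    and C: "\<And>e. e > 0 \<Longrightarrow> \<exists>N. \<forall>m\<ge>N. \<forall>n\<ge>N. sqnorm M (\<lambda>x. f m x - f n x) < e"
  shows "\<exists>g\<in>sqint M. (\<lambda>n. sqnorm M (\<lambda>x. f n x - g x)) \<longlonglongrightarrow> 0"
proof -
  have [measurable]: "f n \<in> borel_measurable M" for n using f by (rule sqint_measurable)
  have "\<exists>N. \<forall>k. (\<forall>m\<ge>N k. \<forall>n\<ge>N k. sqnorm M (\<lambda>x. f m x - f n x) < (1/2)^k) \<and> N k < N (Suc k)"
  proof (rule dependent_nat_choice)
    show "\<exists>N. \<forall>m\<ge>N. \<forall>n\<ge>N. sqnorm M (\<lambda>x. f m x - f n x) < (1/2)^0" using C[of 1] by simp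
  next
    fix N k
    obtain N' where "\<forall>m\<ge>N'. \<forall>n\<ge>N'. sqnorm M (\<lambda>x. f m x - f n x) < (1/2)^(Suc k)"
      using C[of "(1/2)^(Suc k)"] by auto
    then have "\<forall>m\<ge>max N' (Suc N). \<forall>n\<ge>max N' (Suc N). sqnorm M (\<lambda>x. f m x - f n x) < (1/2)^(Suc k)"
      by simp
    moreover have "N < max N' (Suc N)" by simp
    ultimately show "\<exists>y. (\<forall>m\<ge>y. \<forall>n\<ge>y. sqnorm M (\<lambda>x. f m x - f n x) < (1/2)^(Suc k)) \<and> N < y" by blast
  qed
  then obtain r where r: "\<And>k m n. m \<ge> r k \<Longrightarrow> n \<ge> r k \<Longrightarrow> sqnorm M (\<lambda>x. f m x - f n x) < (1/2)^k"
    and rS: "\<And>k. r k < r (Suc k)" by blast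
  have sm: "strict_mono r" using rS by (simp add: strict_mono_Suc_iff)
  \<comment> \<open>The squared gaps are summed with weight 2^k: the integral of the weighted series
    is still bounded by a geometric sum, and where the series is finite the gaps decay like
    2^(-k/2), hence are summable.\<close>
  define d where "d k x = norm (f (r (Suc k)) x - f (r k) x)" for k x
  have [measurable]: "d k \<in> borel_measurable M" for k unfolding d_def by measurable
  have "(\<integral>\<^sup>+x. (\<Sum>k. ennreal (2^k * (d k x)\<^sup>2)) \<partial>M) = (\<Sum>k. \<integral>\<^sup>+x. ennreal (2^k * (d k x)\<^sup>2) \<partial>M)"
    by (rule nn_integral_suminf) measurable
  also have "\<dots> \<le> (\<Sum>k. ennreal ((1/2)^k))"
  proof (rule suminf_le)
    fix k
    have "(\<integral>\<^sup>+x. ennreal (2^k * (d k x)\<^sup>2) \<partial>M) = (\<integral>\<^sup>+x. 2^k * ennreal ((d k x)\<^sup>2) \<partial>M)"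
      by (simp add: ennreal_mult ennreal_power[symmetric])
    also have "\<dots> = 2^k * (\<integral>\<^sup>+x. ennreal ((d k x)\<^sup>2) \<partial>M)"
      by (rule nn_integral_cmult) measurable
    also have "(\<integral>\<^sup>+x. ennreal ((d k x)\<^sup>2) \<partial>M) = ennreal ((sqnorm M (\<lambda>x. f (r (Suc k)) x - f (r k) x))\<^sup>2)"
      unfolding d_def by (rule sqnorm_nn) (auto intro: f)
    also have "2^k * \<dots> \<le> 2^k * ennreal (((1/2)^k)\<^sup>2)"
      using r[of k "r (Suc k)" "r k"] rS[of k]
      by (intro mult_left_mono ennreal_leI power_mono) auto
    also have "2^k * ennreal (((1/2)^k)\<^sup>2) = ennreal (2^k * ((1/2)^k)\<^sup>2)"
      by (simp add: ennreal_mult ennreal_power[symmetric])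
    also have "2^k * ((1/2::real)^k)\<^sup>2 = (1/2)^k"
      by (simp add: power2_eq_square power_divide)
    finally show "(\<integral>\<^sup>+x. ennreal (2^k * (d k x)\<^sup>2) \<partial>M) \<le> ennreal ((1/2)^k)" .
  qed auto
  also have "\<dots> = ennreal (\<Sum>k. (1/2)^k)"
    by (rule suminf_ennreal2) (auto simp: summable_geometric)
  also have "\<dots> < \<infinity>" by simp
  finally have fin: "(\<integral>\<^sup>+x. (\<Sum>k. ennreal (2^k * (d k x)\<^sup>2)) \<partial>M) \<noteq> \<infinity>" by simp
  have "AE x in M. (\<Sum>k. ennreal (2^k * (d k x)\<^sup>2)) \<noteq> \<infinity>"
    by (rule nn_integral_PInf_AE[OF _ fin]) measurable
  then have conv: "AE x in M. convergent (\<lambda>k. f (r k) x)"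
  proof eventually_elim
    case (elim x)
    define K where "K = enn2real (\<Sum>k. ennreal (2^k * (d k x)\<^sup>2))"
    have K0: "0 \<le> K" by (simp add: K_def)
    have "d k x \<le> sqrt K * sqrt (1/2) ^ k" for k
    proof -
      have "ennreal (2^k * (d k x)\<^sup>2) \<le> (\<Sum>k. ennreal (2^k * (d k x)\<^sup>2))"
        by (rule ennreal_le_suminf)
      also have "\<dots> = ennreal K" using elim by (simp add: K_def top.not_eq_extremum)
      finally have "2^k * (d k x)\<^sup>2 \<le> K" using K0 by simp
      then have "(d k x)\<^sup>2 \<le> K * (1/2)^k" by (simp add: field_simps power_divide)
      then have "sqrt ((d k x)\<^sup>2) \<le> sqrt (K * (1/2)^k)" by (rule real_sqrt_le_mono)
      then have "sqrt ((d k x)\<^sup>2) \<le> sqrt K * sqrt (1/2) ^ k" by (simp only: real_sqrt_mult real_sqrt_power)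
      moreover have "0 \<le> d k x" by (simp add: d_def)
      ultimately show ?thesis by (simp only: real_sqrt_unique[OF refl] real_sqrt_abs abs_of_nonneg)
    qed
    moreover have "summable (\<lambda>k. sqrt K * sqrt (1/2) ^ k)"
      by (intro summable_mult summable_geometric) (simp add: real_sqrt_divide abs_of_nonneg)
    ultimately have "summable (\<lambda>k. f (r (Suc k)) x - f (r k) x)"
      unfolding d_def by (rule summable_comparison_test'[where N = 0 and g = "\<lambda>k. sqrt K * sqrt (1/2) ^ k", rotated])
    then have "convergent (\<lambda>n. \<Sum>k<n. f (r (Suc k)) x - f (r k) x)"
      by (simp add: summable_iff_convergent)
    then have "convergent (\<lambda>n. f (r n) x - f (r 0) x)" by (simp only: sum_lessThan_telescope[of "\<lambda>k. f (r k) x"])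
    then have "convergent (\<lambda>n. (f (r n) x - f (r 0) x) + f (r 0) x)" by (rule convergent_add[OF _ convergent_const])
    then show ?case by (simp only: diff_add_cancel)
  qed
  define g where "g x = lim (\<lambda>k. f (r k) x)" for x
  have [measurable]: "g \<in> borel_measurable M" unfolding g_def by measurable
  have lim: "AE x in M. (\<lambda>k. f (r k) x) \<longlonglongrightarrow> g x"
    using conv by eventually_elim (simp add: g_def convergent_LIMSEQ_iff)
  \<comment> \<open>Fatou applied to the differences with the subsequence; the bound holds for every
    n beyond \<open>r k\<close>, not only along the subsequence.\<close>
  have bd: "sqmass M (\<lambda>x. f n x - g x) \<le> ennreal (((1/2)^k)\<^sup>2)" if n: "n \<ge> r k" for n k
  proof -
    have "sqmass M (\<lambda>x. f n x - g x) =
       (\<integral>\<^sup>+x. liminf (\<lambda>i. ennreal ((norm (f n x - f (r i) x))\<^sup>2)) \<partial>M)"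
    proof (rule nn_integral_cong_AE, use lim in eventually_elim)
      case (elim x)
      have "(\<lambda>i. ennreal ((norm (f n x - f (r i) x))\<^sup>2)) \<longlonglongrightarrow> ennreal ((norm (f n x - g x))\<^sup>2)"
        by (intro tendsto_ennrealI tendsto_intros elim)
      then show ?case using lim_imp_Liminf[OF sequentially_bot] by metis
    qed
    also have "\<dots> \<le> liminf (\<lambda>i. \<integral>\<^sup>+x. ennreal ((norm (f n x - f (r i) x))\<^sup>2) \<partial>M)"
      by (rule nn_integral_liminf) measurable
    also have "\<dots> \<le> liminf (\<lambda>i. ennreal (((1/2)^k)\<^sup>2))"
    proof (rule Liminf_mono, rule eventually_sequentiallyI)
      fix i assume "k \<le> i"
      then have "r k \<le> r i" using sm by (simp add: strict_mono_less_eq)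
      then have "sqnorm M (\<lambda>x. f n x - f (r i) x) \<le> (1/2)^k" using r[OF n] by (simp add: less_imp_le)
      then show "sqmass M (\<lambda>x. f n x - f (r i) x) \<le> ennreal (((1/2)^k)\<^sup>2)"
        by (subst sqnorm_nn) (auto intro!: f ennreal_leI power_mono)
    qed
    also have "\<dots> = ennreal (((1/2)^k)\<^sup>2)" by (simp add: Liminf_const)
    finally show ?thesis .
  qed
  have fg: "(\<lambda>x. f (r 0) x - g x) \<in> sqint M"
    unfolding sqint_iff_nn using bd[of 0 "r 0"] by (auto simp: top.not_eq_extremum[symmetric] top_unique)
  have "(\<lambda>x. f (r 0) x - (f (r 0) x - g x)) \<in> sqint M" using f fg by (rule sqint_diff)
  then have g: "g \<in> sqint M" by simp
  have bd': "sqnorm M (\<lambda>x. f n x - g x) \<le> (1/2)^k" if "n \<ge> r k" for n k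
    using bd[OF that] by (subst (asm) sqnorm_nn) (auto intro: f g simp: power2_le_iff_abs_le)
  show ?thesis
  proof (rule bexI[OF _ g], rule LIMSEQ_I)
    fix e :: real assume "e > 0"
    then obtain k where "(1/2::real)^k < e" using real_arch_pow_inv[of e "1/2"] by auto
    then show "\<exists>N. \<forall>n\<ge>N. norm (sqnorm M (\<lambda>x. f n x - g x) - 0) < e"
      using bd'[of k] by (intro exI[of _ "r k"]) (auto intro: le_less_trans)
  qed
qed

text \<open>Applied to the difference of two nested partial sums, the synthesis bound compares it
  with a piece of a convergent series of squares, which is a Cauchy criterion for the net of finite
  partial sums.\<close>

lemma bessel_summable:
  fixes \<phi> :: "'i \<Rightarrow> 'a \<Rightarrow> complex"
  assumes \<phi>: "\<And>i. i \<in> I \<Longrightarrow> \<phi> i \<in> sqint M"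
    and bes: "\<And>J. finite J \<Longrightarrow> J \<subseteq> I \<Longrightarrow> (sqnorm M (\<lambda>x. \<Sum>i\<in>J. a i * \<phi> i x))\<^sup>2 \<le> C * (\<Sum>i\<in>J. (norm (a i))\<^sup>2)"
    and sum: "(\<lambda>i. (norm (a i))\<^sup>2) summable_on I" and C: "C > 0"
  shows "\<exists>S\<in>sqint M. ((\<lambda>J. sqnorm M (\<lambda>x. (\<Sum>i\<in>J. a i * \<phi> i x) - S x)) \<longlongrightarrow> 0) (finite_subsets_at_top I)"
proof -
  define F where "F J x = (\<Sum>i\<in>J. a i * \<phi> i x)" for J x
  have F: "F J \<in> sqint M" if "J \<subseteq> I" for J unfolding F_def using that \<phi> by (intro sqint_sum sqint_cmult) auto
  have Fdiff: "(sqnorm M (\<lambda>x. F J' x - F J x))\<^sup>2 \<le> C * (\<Sum>i\<in>J' - J. (norm (a i))\<^sup>2)"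
    if "finite J'" "J \<subseteq> J'" "J' \<subseteq> I" for J J'
  proof -
    have "(\<lambda>x. F J' x - F J x) = (\<lambda>x. \<Sum>i\<in>J' - J. a i * \<phi> i x)"
      unfolding F_def using that by (simp add: sum_diff fun_eq_iff)
    then show ?thesis using bes[of "J' - J"] that by auto
  qed
  have ex: "\<exists>J. finite J \<and> J \<subseteq> I \<and> (\<forall>J'. finite J' \<and> J \<subseteq> J' \<and> J' \<subseteq> I \<longrightarrow> sqnorm M (\<lambda>x. F J' x - F J x) < e)"
    if e: "e > 0" for e
  proof -
    define s where "s = infsum (\<lambda>i. (norm (a i))\<^sup>2) I"
    have hs: "((\<lambda>i. (norm (a i))\<^sup>2) has_sum s) I" using sum by (simp add: s_def)
    have "s - e\<^sup>2 / C < s" using e C by simp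
    then have "\<forall>\<^sub>F J in finite_subsets_at_top I. s - e\<^sup>2 / C < (\<Sum>i\<in>J. (norm (a i))\<^sup>2)"
      using order_tendstoD(1)[OF hs[unfolded has_sum_def]] by auto
    then obtain J where J: "finite J" "J \<subseteq> I" "s - e\<^sup>2 / C < (\<Sum>i\<in>J. (norm (a i))\<^sup>2)"
      by (auto simp: eventually_finite_subsets_at_top)
    have "sqnorm M (\<lambda>x. F J' x - F J x) < e" if J': "finite J'" "J \<subseteq> J'" "J' \<subseteq> I" for J'
    proof -
      have "(\<Sum>i\<in>J'. (norm (a i))\<^sup>2) \<le> s"
        unfolding s_def using sum J' by (intro finite_sum_le_infsum) auto
      moreover have "(\<Sum>i\<in>J' - J. (norm (a i))\<^sup>2) = (\<Sum>i\<in>J'. (norm (a i))\<^sup>2) - (\<Sum>i\<in>J. (norm (a i))\<^sup>2)"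
        using J' by (simp add: sum_diff)
      ultimately have "(\<Sum>i\<in>J' - J. (norm (a i))\<^sup>2) < e\<^sup>2 / C" using J(3) by linarith
      then have "C * (\<Sum>i\<in>J' - J. (norm (a i))\<^sup>2) < e\<^sup>2" using C by (simp add: field_simps)
      then have "(sqnorm M (\<lambda>x. F J' x - F J x))\<^sup>2 < e\<^sup>2" using Fdiff[of J' J] J' by linarith
      then show ?thesis using e by (simp add: power_less_imp_less_base)
    qed
    then show ?thesis using J by blast
  qed
  then have "\<forall>n. \<exists>J. finite J \<and> J \<subseteq> I \<and>
      (\<forall>J'. finite J' \<and> J \<subseteq> J' \<and> J' \<subseteq> I \<longrightarrow> sqnorm M (\<lambda>x. F J' x - F J x) < inverse (real (Suc n)))"
    by (intro allI ex) simp
  then obtain J where J: "\<And>n. finite (J n)" "\<And>n. J n \<subseteq> I"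
    and JJ: "\<And>n J'. finite J' \<Longrightarrow> J n \<subseteq> J' \<Longrightarrow> J' \<subseteq> I \<Longrightarrow> sqnorm M (\<lambda>x. F J' x - F (J n) x) < inverse (real (Suc n))"
    by metis
  \<comment> \<open>\<open>sq_complete\<close> speaks of sequences, so the limit is found along an
    increasing sequence of index sets; every finite set containing \<open>J n\<close> is then close
    to it.\<close>
  define K where "K n = (\<Union>m\<le>n. J m)" for n
  have K: "finite (K n)" "K n \<subseteq> I" "n \<le> m \<Longrightarrow> J n \<subseteq> K m" for n m
    using J by (auto simp: K_def)
  have near: "sqnorm M (\<lambda>x. F J' x - F (K m) x) < 2 * inverse (real (Suc n))"
    if "finite J'" "J n \<subseteq> J'" "J' \<subseteq> I" "n \<le> m" for J' m n
  proof -
    have "sqnorm M (\<lambda>x. F J' x - F (K m) x) \<le> sqnorm M (\<lambda>x. F J' x - F (J n) x) + sqnorm M (\<lambda>x. F (J n) x - F (K m) x)"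
      using that K J by (intro sqnorm_triangle_diff F) auto
    moreover have "sqnorm M (\<lambda>x. F (J n) x - F (K m) x) < inverse (real (Suc n))"
      by (subst sqnorm_minus_commute) (use that K in \<open>intro JJ; auto\<close>)
    ultimately show ?thesis using JJ[of J' n] that by linarith
  qed
  have small: "\<exists>n. 2 * inverse (real (Suc n)) < e" if "e > 0" for e
    using reals_Archimedean[of "e/2"] that by (auto simp: mult.commute simp del: of_nat_Suc)
  have "\<exists>g\<in>sqint M. (\<lambda>n. sqnorm M (\<lambda>x. F (K n) x - g x)) \<longlonglongrightarrow> 0"
  proof (rule sq_complete)
    show "F (K n) \<in> sqint M" for n using K by (intro F)
    fix e :: real assume "e > 0"
    then obtain N where N: "2 * inverse (real (Suc N)) < e" using small by blast
    show "\<exists>N. \<forall>m\<ge>N. \<forall>n\<ge>N. sqnorm M (\<lambda>x. F (K m) x - F (K n) x) < e"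
    proof (intro exI[of _ N] allI impI)
      fix m n assume "N \<le> m" "N \<le> n"
      then have "sqnorm M (\<lambda>x. F (K m) x - F (K n) x) < 2 * inverse (real (Suc N))"
        by (intro near K) auto
      then show "sqnorm M (\<lambda>x. F (K m) x - F (K n) x) < e" using N by linarith
    qed
  qed
  then obtain S where S: "S \<in> sqint M" "(\<lambda>n. sqnorm M (\<lambda>x. F (K n) x - S x)) \<longlonglongrightarrow> 0" by blast
  show ?thesis
  proof (rule bexI[OF _ S(1)], rule tendstoI)
    fix e :: real assume e: "e > 0"
    obtain n where n: "2 * inverse (real (Suc n)) < e/2" using small[of "e/2"] e by auto
    have "\<forall>\<^sub>F m in sequentially. sqnorm M (\<lambda>x. F (K m) x - S x) < e/2 \<and> m \<ge> n"
      using order_tendstoD(2)[OF S(2), of "e/2"] e eventually_ge_at_top[of n] by (auto intro: eventually_conj)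
    then obtain m where m: "sqnorm M (\<lambda>x. F (K m) x - S x) < e/2" "m \<ge> n"
      by (auto simp: eventually_sequentially)
    show "\<forall>\<^sub>F J in finite_subsets_at_top I. dist (sqnorm M (\<lambda>x. (\<Sum>i\<in>J. a i * \<phi> i x) - S x)) 0 < e"
      unfolding eventually_finite_subsets_at_top
    proof (intro exI[of _ "J n"] conjI J allI impI)
      fix Y assume Y: "finite Y \<and> J n \<subseteq> Y \<and> Y \<subseteq> I"
      have "sqnorm M (\<lambda>x. F Y x - S x) \<le> sqnorm M (\<lambda>x. F Y x - F (K m) x) + sqnorm M (\<lambda>x. F (K m) x - S x)"
        using Y K S by (intro sqnorm_triangle_diff F) auto
      also have "\<dots> < e" using near[of Y n m] Y m n by auto
      finally show "dist (sqnorm M (\<lambda>x. (\<Sum>i\<in>Y. a i * \<phi> i x) - S x)) 0 < e" by (simp add: F_def)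
    qed
  qed
qed

lemma sqinner_tendsto:
  assumes "\<And>i. f i \<in> sqint M" "g \<in> sqint M" "k \<in> sqint M" "((\<lambda>i. sqnorm M (\<lambda>x. f i x - g x)) \<longlongrightarrow> 0) F"
  shows "((\<lambda>i. sqinner M (f i) k) \<longlongrightarrow> sqinner M g k) F"
proof (rule tendsto_dist_iff[THEN iffD2], rule tendsto_sandwich[OF _ _ tendsto_const])
  show "((\<lambda>i. sqnorm M (\<lambda>x. f i x - g x) * sqnorm M k) \<longlongrightarrow> 0) F"
    using tendsto_mult_left_zero[OF assms(4)] .
  show "\<forall>\<^sub>F i in F. dist (sqinner M (f i) k) (sqinner M g k) \<le> sqnorm M (\<lambda>x. f i x - g x) * sqnorm M k"
    using assms by (intro always_eventually allI)
      (simp add: dist_norm sqinner_diff_left[symmetric] sq_Cauchy_Schwarz sqint_diff)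
qed simp

lemma sqnorm_tendsto:
  assumes "\<And>i. f i \<in> sqint M" "g \<in> sqint M" "((\<lambda>i. sqnorm M (\<lambda>x. f i x - g x)) \<longlongrightarrow> 0) F"
  shows "((\<lambda>i. sqnorm M (f i)) \<longlongrightarrow> sqnorm M g) F"
proof (rule tendsto_dist_iff[THEN iffD2], rule tendsto_sandwich[OF _ _ tendsto_const])
  show "\<forall>\<^sub>F i in F. dist (sqnorm M (f i)) (sqnorm M g) \<le> sqnorm M (\<lambda>x. f i x - g x)"
    using assms by (intro always_eventually allI) (simp add: dist_real_def sqnorm_abs_diff)
qed (use assms in auto)

lemma L2_tendsto_iff:
  assumes "\<And>i. f i \<in> L2" "g \<in> L2"
  shows "L2_tendsto f g F \<longleftrightarrow> ((\<lambda>i. sqnorm lborel (\<lambda>x. f i x - g x)) \<longlongrightarrow> 0) F"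
proof -
  have d: "(\<lambda>x. f i x - g x) \<in> sqint lborel" for i
    using assms unfolding L2_eq_sqint by auto
  have "L2_tendsto f g F \<longleftrightarrow> ((\<lambda>i. ennreal ((sqnorm lborel (\<lambda>x. f i x - g x))\<^sup>2)) \<longlongrightarrow> ennreal 0) F"
    unfolding L2_tendsto_def sqnorm_nn[OF d] by simp
  also have "\<dots> \<longleftrightarrow> ((\<lambda>i. (sqnorm lborel (\<lambda>x. f i x - g x))\<^sup>2) \<longlongrightarrow> 0) F"
    by (rule tendsto_ennreal_iff) auto
  also have "\<dots> \<longleftrightarrow> ((\<lambda>i. sqnorm lborel (\<lambda>x. f i x - g x)) \<longlongrightarrow> 0) F"
  proof
    assume "((\<lambda>i. (sqnorm lborel (\<lambda>x. f i x - g x))\<^sup>2) \<longlongrightarrow> 0) F"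
    from tendsto_real_sqrt[OF this] show "((\<lambda>i. sqnorm lborel (\<lambda>x. f i x - g x)) \<longlongrightarrow> 0) F" by simp
  next
    assume "((\<lambda>i. sqnorm lborel (\<lambda>x. f i x - g x)) \<longlongrightarrow> 0) F"
    from tendsto_power[OF this, of 2] show "((\<lambda>i. (sqnorm lborel (\<lambda>x. f i x - g x))\<^sup>2) \<longlongrightarrow> 0) F" by simp
  qed
  finally show ?thesis .
qed

lemma sqnorm_dominated:
  assumes [measurable]: "\<And>n. f n \<in> borel_measurable M" "g \<in> borel_measurable M"
    and lim: "AE x in M. (\<lambda>n. f n x) \<longlonglongrightarrow> g x"
    and w: "integrable M w" and bd: "\<And>n. AE x in M. (norm (f n x - g x))\<^sup>2 \<le> w x"
  shows "(\<lambda>n. sqnorm M (\<lambda>x. f n x - g x)) \<longlonglongrightarrow> 0"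
proof -
  have "(\<lambda>n. LINT x|M. (norm (f n x - g x))\<^sup>2) \<longlonglongrightarrow> (LINT x|M. 0)"
  proof (rule integral_dominated_convergence[OF _ _ w])
    show "AE x in M. (\<lambda>n. (norm (f n x - g x))\<^sup>2) \<longlonglongrightarrow> 0"
      using lim
    proof eventually_elim
      case (elim x)
      then have "(\<lambda>n. (norm (f n x - g x))\<^sup>2) \<longlonglongrightarrow> (norm (g x - g x))\<^sup>2"
        by (intro tendsto_intros)
      then show ?case by simp
    qed
    show "AE x in M. norm ((norm (f n x - g x))\<^sup>2) \<le> w x" for n using bd[of n] by simp
  qed measurable
  then have "(\<lambda>n. sqrt (LINT x|M. (norm (f n x - g x))\<^sup>2)) \<longlonglongrightarrow> sqrt 0"
    by (intro tendsto_real_sqrt) simp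
  then show ?thesis by (simp add: sqnorm_def)
qed

lemma has_sum_imp_nn_integral:
  fixes f :: "'i \<Rightarrow> real"
  assumes "(f has_sum s) A" "\<And>x. x \<in> A \<Longrightarrow> f x \<ge> 0"
  shows "(\<integral>\<^sup>+x. ennreal (f x) \<partial>count_space A) = ennreal s"
proof -
  have "(\<lambda>x. norm (f x)) summable_on A \<longleftrightarrow> f summable_on A"
    using assms(2) by (intro summable_on_cong) auto
  then have "Infinite_Set_Sum.abs_summable_on f A"
    using has_sum_imp_summable[OF assms(1)] abs_summable_equivalent by blast
  then show ?thesis
    using assms by (simp add: nn_integral_conv_infsetsum infsetsum_infsum infsumI)
qed

section \<open>Fourier series in one variable\<close>

definition unit_int :: "real set" where "unit_int = {-1/2..<1/2}"

text \<open>The indicator places the exponentials in the square-integrable functions over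
  \<open>lborel\<close> itself, rather than over a measure restricted to the period.\<close>

definition echar :: "int \<Rightarrow> real \<Rightarrow> complex" where
  "echar n x = indicator unit_int x * cis (2 * pi * of_int n * x)"

lemma unit_int_borel [measurable]: "unit_int \<in> sets borel" by (simp add: unit_int_def)

lemma emeasure_unit_int: "emeasure lborel unit_int = 1" by (simp add: unit_int_def)

lemma cis_measurable [measurable (raw)]:
  "f \<in> borel_measurable M \<Longrightarrow> (\<lambda>x. cis (f x)) \<in> borel_measurable M"
  by (rule borel_measurable_continuous_on[of cis]) (auto intro: continuous_intros)

lemma echar_measurable [measurable]: "echar n \<in> borel_measurable borel"
  unfolding echar_def by measurable

lemma integrable_unit_int: "integrable lborel (\<lambda>x. indicator unit_int x :: real)"
  by (simp add: emeasure_unit_int)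

lemma norm_echar: "norm (echar n x) = indicator unit_int x"
  by (auto simp: echar_def indicator_def)

lemma indicator_sq: "(indicator A x)\<^sup>2 = (indicator A x :: 'a :: comm_semiring_1)"
  by (simp add: indicator_def)

lemma echar_sqint: "echar n \<in> sqint lborel"
  unfolding sqint_def mem_Collect_eq norm_echar indicator_sq using integrable_unit_int by simp

lemma integral_echar: "(LINT x|lborel. echar n x) = (if n = 0 then 1 else 0)"
proof (cases "n = 0")
  case True
  then have "(LINT x|lborel. echar n x) = (LINT x|lborel. of_real (indicator unit_int x))"
    by (simp add: echar_def of_real_indicator)
  also have "\<dots> = 1" using emeasure_unit_int by (simp add: measure_def)
  finally show ?thesis using True by simp
next
  case False
  define F where "F x = cis (2 * pi * of_int n * x) / (2 * pi * of_int n * \<i>)" for x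
  have "has_bochner_integral lborel (\<lambda>x. indicator {-1/2..1/2} x *\<^sub>R cis (2 * pi * of_int n * x)) (F (1/2) - F (-1/2))"
  proof (rule has_bochner_integral_FTC_Icc)
    fix x :: real
    have "(F has_vector_derivative (2 * pi * of_int n * \<i> * cis (2 * pi * of_int n * x)) / (2 * pi * of_int n * \<i>)) (at x within {-1/2..1/2})"
      unfolding F_def cis_conv_exp
      by (rule has_vector_derivative_real_field derivative_eq_intros has_vector_derivative_divide | simp)+
    then show "(F has_vector_derivative cis (2 * pi * of_int n * x)) (at x within {-1/2..1/2})"
      using False by simp
  qed (auto intro!: continuous_intros)
  also have "F (1/2) - F (-1/2) = 0"
    by (simp add: F_def complex_eq_iff cis.code Re_divide Im_divide)
  finally have "(LINT x|lborel. indicator {-1/2..1/2} x *\<^sub>R cis (2 * pi * of_int n * x)) = 0"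
    by (rule has_bochner_integral_integral_eq)
  \<comment> \<open>The closed interval of the fundamental theorem and the half-open
    \<open>unit_int\<close> differ in one point.\<close>
  also have "(LINT x|lborel. indicator {-1/2..1/2} x *\<^sub>R cis (2 * pi * of_int n * x)) = (LINT x|lborel. echar n x)"
  proof (rule integral_cong_AE)
    show "AE x in lborel. indicator {-1/2..1/2} x *\<^sub>R cis (2 * pi * of_int n * x) = echar n x"
      using AE_lborel_singleton[of "1/2::real"]
      by eventually_elim (auto simp: echar_def unit_int_def indicator_def)
  qed measurable
  finally show ?thesis using False by simp
qed

lemma echar_orthonormal: "sqinner lborel (echar n) (echar m) = (if n = m then 1 else 0)"
proof -
  have "echar n x * cnj (echar m x) = echar (n - m) x" for x
    by (simp add: echar_def cis_cnj cis_mult indicator_def algebra_simps)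
  then show ?thesis by (simp add: sqinner_def integral_echar)
qed

text \<open>Generated by closure under sums rather than given as explicit finite sums, so that
  closure under products is an induction; \<open>trigpoly_sum\<close> recovers the explicit
  form.\<close>

inductive trigpoly :: "(real \<Rightarrow> complex) \<Rightarrow> bool" where
  mono: "trigpoly (\<lambda>x. c * cis (2 * pi * of_int n * x))"
| add: "trigpoly p \<Longrightarrow> trigpoly q \<Longrightarrow> trigpoly (\<lambda>x. p x + q x)"

lemma trigpoly_const: "trigpoly (\<lambda>x. c)"
  using trigpoly.mono[of c 0] by simp

lemma trigpoly_mult:
  assumes "trigpoly p" "trigpoly q"
  shows "trigpoly (\<lambda>x. p x * q x)"
  using assms(1)
proof induction
  case (mono c n)
  show ?case using assms(2)
  proof induction
    case (mono d m)
    show ?case using trigpoly.mono[of "c * d" "n + m"]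
      by (simp add: cis_mult[symmetric] distrib_left distrib_right mult_ac)
  next
    case (add p q)
    then show ?case by (simp add: distrib_left trigpoly.add)
  qed
next
  case (add p p')
  then show ?case by (simp add: distrib_right trigpoly.add)
qed

text \<open>A real linear functional of \<open>cis t\<close> is a combination of cos t and sin t,
  hence of \<open>cis t\<close> and \<open>cis (- t)\<close>; sums and products are covered by the
  closure lemmas.\<close>

lemma trigpoly_real_polynomial:
  assumes "real_polynomial_function p"
  shows "trigpoly (\<lambda>x. of_real (p (cis (2 * pi * x))))"
  using assms
proof induction
  case (linear f)
  interpret bounded_linear f by fact
  have f: "f z = Re z * f 1 + Im z * f \<i>" for z
  proof -
    have "Re z *\<^sub>R 1 + Im z *\<^sub>R \<i> = z" by (simp add: complex_eq_iff)
    then have "f z = f (Re z *\<^sub>R 1) + f (Im z *\<^sub>R \<i>)" by (metis add)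
    also have "\<dots> = Re z * f 1 + Im z * f \<i>" unfolding scaleR by simp
    finally show ?thesis .
  qed
  have "of_real (f (cis t)) = ((f 1 - \<i> * f \<i>) / 2) * cis t + ((f 1 + \<i> * f \<i>) / 2) * cis (- t)" for t
    by (simp add: f[of "cis t"] complex_eq_iff field_simps)
  then have "(\<lambda>x. of_real (f (cis (2 * pi * x)))) =
    (\<lambda>x. ((f 1 - \<i> * f \<i>) / 2) * cis (2 * pi * of_int 1 * x) + ((f 1 + \<i> * f \<i>) / 2) * cis (2 * pi * of_int (-1) * x))"
    by (simp add: fun_eq_iff)
  then show ?case by (simp only:) (intro trigpoly.intros)
qed (simp_all add: trigpoly_const trigpoly.add trigpoly_mult)

lemma trigpoly_polynomial:
  fixes p :: "complex \<Rightarrow> complex"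
  assumes "polynomial_function p"
  shows "trigpoly (\<lambda>x. p (cis (2 * pi * x)))"
proof -
  have "real_polynomial_function (Re \<circ> p)" "real_polynomial_function (Im \<circ> p)"
    using assms bounded_linear_Re bounded_linear_Im by (auto simp: polynomial_function_def)
  from this[THEN trigpoly_real_polynomial]
  have "trigpoly (\<lambda>x. of_real (Re (p (cis (2 * pi * x)))) + \<i> * of_real (Im (p (cis (2 * pi * x)))))"
    by (intro trigpoly.add trigpoly_mult trigpoly_const) (simp_all add: o_def)
  then show ?thesis by (simp only: complex_eq[symmetric])
qed

lemma trigpoly_sum:
  assumes "trigpoly p"
  shows "\<exists>N c. finite N \<and> (\<forall>x. p x = (\<Sum>n\<in>N. c n * cis (2 * pi * of_int n * x)))"
  using assms
proof induction
  case (mono c n)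
  then show ?case by (intro exI[of _ "{n}"] exI[of _ "\<lambda>_. c"]) simp
next
  case (add p q)
  then obtain N c N' c' where *: "finite N" "\<And>x. p x = (\<Sum>n\<in>N. c n * cis (2 * pi * of_int n * x))"
    "finite N'" "\<And>x. q x = (\<Sum>n\<in>N'. c' n * cis (2 * pi * of_int n * x))" by blast
  have 1: "p x = (\<Sum>n\<in>N \<union> N'. (if n \<in> N then c n else 0) * cis (2 * pi * of_int n * x))" for x
    unfolding *(2) using * by (intro sum.mono_neutral_cong_left) auto
  have 2: "q x = (\<Sum>n\<in>N \<union> N'. (if n \<in> N' then c' n else 0) * cis (2 * pi * of_int n * x))" for x
    unfolding *(4) using * by (intro sum.mono_neutral_cong_left) auto
  show ?case
    by (intro exI[of _ "N \<union> N'"] exI[of _ "\<lambda>n. (if n \<in> N then c n else 0) + (if n \<in> N' then c' n else 0)"])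
      (use * 1 2 in \<open>simp add: distrib_right sum.distrib\<close>)
qed

text \<open>Since h vanishes near both ends of the period, it descends to a continuous function
  \<open>G\<close> on the unit circle; Stone-Weierstrass supplies a polynomial there, which in x is
  a trigonometric polynomial.\<close>

lemma trig_approx_continuous:
  fixes h :: "real \<Rightarrow> complex"
  assumes h: "continuous_on UNIV h" and \<delta>: "\<delta> > 0" "\<delta> < 1/2" and h0: "\<And>x. \<bar>x\<bar> \<ge> 1/2 - \<delta> \<Longrightarrow> h x = 0"
    and \<epsilon>: "\<epsilon> > 0"
  shows "\<exists>N c. finite N \<and> (\<forall>x\<in>unit_int. norm (h x - (\<Sum>n\<in>N. c n * cis (2 * pi * of_int n * x))) < \<epsilon>)"
proof -
  define G where "G z = h (Arg z / (2 * pi))" for z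
  \<comment> \<open>Real part at the angle where h starts to vanish: the closed arc with
    \<open>Re z \<le> b\<close> contains the jump of \<open>Arg\<close> and \<open>G\<close> is 0 on
    it, while \<open>Arg\<close> is continuous on the arc with \<open>Re z \<ge> b\<close>.\<close>
  define b where "b = cos (2 * pi * (1/2 - \<delta>))"
  have b: "b > -1"
  proof -
    have "cos pi < cos (2 * pi * (1/2 - \<delta>))"
      using \<delta> by (intro cos_monotone_0_pi) (auto simp: field_simps)
    then show ?thesis by (simp add: b_def)
  qed
  have ReArg: "Re z = cos \<bar>Arg z\<bar>" if "z \<in> sphere 0 1" for z
    using that cis_Arg[of z] by (metis cis.simps(1) cos_abs_real mem_sphere_0 norm_zero sgn_div_norm inverse_1 scaleR_one zero_neq_one)
  have "continuous_on ((sphere 0 1 \<inter> {z. Re z \<le> b}) \<union> (sphere 0 1 \<inter> {z. Re z \<ge> b})) G"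
  proof (rule continuous_on_closed_Un)
    show "closed (sphere 0 1 \<inter> {z. Re z \<le> b})" "closed (sphere 0 1 \<inter> {z. Re z \<ge> b})"
      by (intro closed_Int closed_sphere closed_Collect_le continuous_intros)+
    show "continuous_on (sphere 0 1 \<inter> {z. Re z \<le> b}) G"
    proof (rule continuous_on_eq[OF continuous_on_const])
      fix z :: complex assume z: "z \<in> sphere 0 1 \<inter> {z. Re z \<le> b}"
      have "\<not> \<bar>Arg z\<bar> < 2 * pi * (1/2 - \<delta>)"
      proof
        assume "\<bar>Arg z\<bar> < 2 * pi * (1/2 - \<delta>)"
        then have "b < cos \<bar>Arg z\<bar>" unfolding b_def using \<delta> by (intro cos_monotone_0_pi) auto
        then show False using z ReArg[of z] by simp
      qed
      then have "1/2 - \<delta> \<le> \<bar>Arg z / (2 * pi)\<bar>" by (simp add: field_simps)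
      then show "0 = G z" using h0 by (simp add: G_def)
    qed
    have "continuous_on (sphere 0 1 \<inter> {z. Re z \<ge> b}) Arg"
    proof (rule continuous_on_Arg'[OF continuous_on_id])
      fix z :: complex assume z: "z \<in> sphere 0 1 \<inter> {z. Re z \<ge> b}"
      have "z \<notin> \<real>\<^sub>\<le>\<^sub>0"
      proof
        assume "z \<in> \<real>\<^sub>\<le>\<^sub>0"
        then obtain r where "z = of_real r" "r \<le> 0" by (auto elim: nonpos_Reals_cases)
        then show False using z b by auto
      qed
      then show "z \<notin> \<real>\<^sub>\<le>\<^sub>0" .
    qed
    then show "continuous_on (sphere 0 1 \<inter> {z. Re z \<ge> b}) G"
      unfolding G_def
      by (intro continuous_on_compose2[OF h _ subset_UNIV] continuous_on_divide continuous_on_const) auto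
  qed
  also have "(sphere 0 1 \<inter> {z. Re z \<le> b}) \<union> (sphere 0 1 \<inter> {z. Re z \<ge> b}) = sphere 0 1" by auto
  finally obtain p where p: "polynomial_function p" "\<And>z. z \<in> sphere 0 1 \<Longrightarrow> norm (G z - p z) < \<epsilon>"
    using Stone_Weierstrass_polynomial_function[OF compact_sphere _ \<epsilon>] by metis
  obtain N c where N: "finite N" "\<And>x. p (cis (2 * pi * x)) = (\<Sum>n\<in>N. c n * cis (2 * pi * of_int n * x))"
    using trigpoly_sum[OF trigpoly_polynomial[OF p(1)]] by auto
  have "norm (h x - (\<Sum>n\<in>N. c n * cis (2 * pi * of_int n * x))) < \<epsilon>" if x: "x \<in> unit_int" for x
  \<comment> \<open>At the left end \<open>Arg\<close> returns pi instead of -pi, so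
    \<open>G\<close> is h evaluated at 1/2; both values of h are 0.\<close>
  proof (cases "x = -1/2")
    case True
    have "G (cis (2 * pi * x)) = 0"
    proof -
      have "cis (2 * pi * x) = of_real (-1)" by (simp add: True complex_eq_iff)
      then have "Arg (cis (2 * pi * x)) = pi" by (simp only: Arg_of_real) simp
      then show ?thesis using h0[of "1/2"] \<delta> by (simp add: G_def)
    qed
    moreover have "h x = 0" using True h0[of x] \<delta> by auto
    ultimately show ?thesis using p(2)[of "cis (2 * pi * x)"] by (simp add: N)
  next
    case False
    then have "-1 < 2 * x" "2 * x \<le> 1" using x by (auto simp: unit_int_def)
    then have "pi * (-1) < pi * (2 * x)" "pi * (2 * x) \<le> pi * 1"
      using pi_gt_zero by (intro mult_left_mono mult_strict_left_mono; simp)+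
    then have "Arg (cis (2 * pi * x)) = 2 * pi * x"
      by (intro Arg_cis) (auto simp: mult_ac)
    then have "G (cis (2 * pi * x)) = h x" by (simp add: G_def)
    then show ?thesis using p(2)[of "cis (2 * pi * x)"] by (simp add: N)
  qed
  then show ?thesis using N(1) by blast
qed

text \<open>Three approximations, each costing at most a third of \<epsilon>: truncation of the
  values, a continuous function vanishing near the ends of the period, and a trigonometric
  polynomial.\<close>

lemma trig_dense:
  assumes U: "U \<in> sqint lborel" and U0: "\<And>x. x \<notin> unit_int \<Longrightarrow> U x = 0" and \<epsilon>: "\<epsilon> > 0"
  shows "\<exists>N c. finite N \<and> sqnorm lborel (\<lambda>x. U x - (\<Sum>n\<in>N. c n * echar n x)) < \<epsilon>"
proof -
  have [measurable]: "U \<in> borel_measurable borel" using U by (auto dest: sqint_measurable)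
  define T where "T k x = (if norm (U x) \<le> real k then U x else 0)" for k x
  have Tm [measurable]: "T k \<in> borel_measurable borel" for k unfolding T_def by measurable
  have T: "T k \<in> sqint lborel" for k
    by (rule sqint_dominated[OF _ U]) (auto simp: T_def)
  have "(\<lambda>k. sqnorm lborel (\<lambda>x. T k x - U x)) \<longlonglongrightarrow> 0"
  proof (rule sqnorm_dominated)
    show "integrable lborel (\<lambda>x. (norm (U x))\<^sup>2)" using U by (rule sqint_integrable)
    show "AE x in lborel. (\<lambda>n. T n x) \<longlonglongrightarrow> U x"
    proof (rule AE_I2, rule tendsto_eventually)
      fix x
      obtain k where "norm (U x) \<le> real k" using real_arch_simple by blast
      then show "\<forall>\<^sub>F n in sequentially. T n x = U x"
        by (intro eventually_sequentiallyI[of k]) (auto simp: T_def)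
    qed
  qed (auto simp: T_def)
  then have "\<forall>\<^sub>F k in sequentially. sqnorm lborel (\<lambda>x. T k x - U x) < \<epsilon>/3"
    using \<epsilon> by (intro order_tendstoD) auto
  then obtain k where "sqnorm lborel (\<lambda>x. T k x - U x) < \<epsilon>/3" by (auto simp: eventually_sequentially)
  then have k: "sqnorm lborel (\<lambda>x. U x - T k x) < \<epsilon>/3" by (simp add: sqnorm_minus_commute)
  \<comment> \<open>This notion provides continuous functions that converge almost everywhere, with
    no bound and no support condition; \<open>r\<close> and \<open>cut\<close> below restore
    both.\<close>
  have "T k measurable_on UNIV"
    by (rule lebesgue_measurable_imp_measurable_on) (auto intro!: measurable_completion simp del: lebesgue_on_UNIV_eq)
  then obtain Z g where Z: "negligible Z" and g: "\<And>n. continuous_on UNIV (g n)"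
    and glim: "\<And>x. x \<notin> Z \<Longrightarrow> (\<lambda>n. g n x) \<longlonglongrightarrow> T k x"
    unfolding measurable_on_def by auto
  have Zae: "AE x in lborel. x \<notin> Z"
  proof -
    have "AE x in lebesgue. x \<notin> Z" using Z by (intro AE_not_in) (simp add: negligible_iff_null_sets)
    then show ?thesis by (simp add: AE_completion_iff)
  qed
  \<comment> \<open>Radial retraction onto the disc of radius k + 1: continuous, and the identity on
    the values of \<open>T k\<close>, so it bounds the approximants without changing their
    limit.\<close>
  define r :: "complex \<Rightarrow> complex" where "r z = z /\<^sub>R max 1 (norm z / (real k + 1))" for z
  have rc: "continuous_on UNIV r" unfolding r_def by (intro continuous_intros) auto
  have rb: "norm (r z) \<le> real k + 1" for z
    by (simp add: r_def divide_simps max_def)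
  have rid: "r z = z" if "norm z \<le> real k + 1" for z
    using that by (simp add: r_def max_def)
  \<comment> \<open>For n > 0 this is 0 where 1/2 - |x| is at most 1/n and 1 where it is at least
    2/n.\<close>
  define cut where "cut n x = max 0 (min 1 (real n * (1/2 - \<bar>x\<bar>) - 1))" for n x
  define h where "h n x = of_real (cut n x) * r (g n x)" for n x
  have hc: "continuous_on UNIV (h n)" for n
    unfolding h_def cut_def by (intro continuous_intros continuous_on_compose2[OF rc] g) auto
  have [measurable]: "h n \<in> borel_measurable borel" for n using hc by (rule borel_measurable_continuous_onI)
  have h0: "h n x = 0" if "\<bar>x\<bar> \<ge> 1/2 - 1 / (real n + 1)" for n x
  proof -
    have "real n * (1/2 - \<bar>x\<bar>) \<le> real n * (1 / (real n + 1))" using that by (intro mult_left_mono) auto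
    also have "\<dots> \<le> 1" by simp
    finally show ?thesis by (simp add: h_def cut_def)
  qed
  have hb: "norm (h n x) \<le> (real k + 1) * indicator unit_int x" for n x
  proof (cases "x \<in> unit_int")
    case True
    have "norm (h n x) \<le> 1 * (real k + 1)"
      unfolding h_def norm_mult by (intro mult_mono rb) (auto simp: cut_def)
    then show ?thesis using True by simp
  next
    case False
    then have "\<bar>x\<bar> \<ge> 1/2" by (auto simp: unit_int_def)
    moreover have "0 \<le> 1 / (real n + 1)" by simp
    ultimately have "\<bar>x\<bar> \<ge> 1/2 - 1 / (real n + 1)" by linarith
    then show ?thesis using h0 by simp
  qed
  have Tb: "norm (T k x) \<le> (real k + 1) * indicator unit_int x" for x
    using U0[of x] by (auto simp: T_def indicator_def)
  have hs: "h n \<in> sqint lborel" for n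
    by (rule sqint_dominated[of _ _ "\<lambda>x. of_real (real k + 1) * echar 0 x"])
      (use hb in \<open>auto simp: norm_mult norm_echar simp del: of_real_add intro!: sqint_cmult echar_sqint\<close>)
  have "(\<lambda>n. sqnorm lborel (\<lambda>x. h n x - T k x)) \<longlonglongrightarrow> 0"
  proof (rule sqnorm_dominated)
    show "integrable lborel (\<lambda>x. (2 * (real k + 1))\<^sup>2 * indicator unit_int x)"
      using integrable_unit_int by (intro integrable_mult_right)
    fix n
    show "AE x in lborel. (norm (h n x - T k x))\<^sup>2 \<le> (2 * (real k + 1))\<^sup>2 * indicator unit_int x"
    proof (rule AE_I2)
      fix x
      have "norm (h n x - T k x) \<le> 2 * (real k + 1) * indicator unit_int x"
        using norm_triangle_ineq4[of "h n x" "T k x"] hb[of n x] Tb[of x] by linarith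
      then have "(norm (h n x - T k x))\<^sup>2 \<le> (2 * (real k + 1) * indicator unit_int x)\<^sup>2"
        by (intro power_mono) auto
      then show "(norm (h n x - T k x))\<^sup>2 \<le> (2 * (real k + 1))\<^sup>2 * indicator unit_int x"
        by (simp add: power_mult_distrib indicator_sq)
    qed
  next
    show "AE x in lborel. (\<lambda>n. h n x) \<longlonglongrightarrow> T k x"
      using Zae AE_lborel_singleton[of "-1/2::real"]
    proof eventually_elim
      case (elim x)
      have "isCont r (T k x)" using rc by (simp add: continuous_on_eq_continuous_at)
      then have "(\<lambda>n. r (g n x)) \<longlonglongrightarrow> r (T k x)"
        using glim[OF elim(1)] by (rule isCont_tendsto_compose)
      moreover have "r (T k x) = T k x" by (intro rid) (auto simp: T_def)
      ultimately have rg: "(\<lambda>n. r (g n x)) \<longlonglongrightarrow> T k x" by simp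
      show ?case
      proof (cases "\<bar>x\<bar> < 1/2")
        case True
        obtain m where m: "2 / (1/2 - \<bar>x\<bar>) \<le> real m" using real_arch_simple by blast
        have "h n x = r (g n x)" if "n \<ge> m" for n
        proof -
          have "2 / (1/2 - \<bar>x\<bar>) \<le> real n" using m that by linarith
          then have "2 \<le> real n * (1/2 - \<bar>x\<bar>)" using True by (simp add: field_simps)
          then show ?thesis by (simp add: h_def cut_def)
        qed
        then have "\<forall>\<^sub>F n in sequentially. r (g n x) = h n x" by (intro eventually_sequentiallyI[of m]) simp
        then show ?thesis by (rule Lim_transform_eventually[OF rg])
      next
        case False
        then have "x \<notin> unit_int" using elim by (auto simp: unit_int_def)
        then have "T k x = 0" using U0 by (simp add: T_def)
        moreover have "h n x = 0" for n
        proof (rule h0)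
          have "0 \<le> 1 / (real n + 1)" by simp
          then show "\<bar>x\<bar> \<ge> 1/2 - 1 / (real n + 1)" using False by linarith
        qed
        ultimately show ?thesis by simp
      qed
    qed
  qed measurable
  then have "\<forall>\<^sub>F n in sequentially. sqnorm lborel (\<lambda>x. h n x - T k x) < \<epsilon>/3 \<and> 2 \<le> n"
    using \<epsilon> by (intro eventually_conj order_tendstoD eventually_ge_at_top) auto
  then obtain n where n: "sqnorm lborel (\<lambda>x. h n x - T k x) < \<epsilon>/3" "2 \<le> n" by (auto simp: eventually_sequentially)
  \<comment> \<open>The condition \<open>2 \<le> n\<close> makes the margin 1/(n + 1) smaller than
    1/2, as the approximation of \<open>h n\<close> requires.\<close>
  obtain N c where N: "finite N"
    and app: "\<And>x. x \<in> unit_int \<Longrightarrow> norm (h n x - (\<Sum>m\<in>N. c m * cis (2 * pi * of_int m * x))) < \<epsilon>/3"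
    using trig_approx_continuous[OF hc[of n] _ _ h0, of "1 / (real n + 1)" "\<epsilon>/3"] n(2) \<epsilon> by (auto simp: field_simps)
  define p where "p x = (\<Sum>m\<in>N. c m * echar m x)" for x
  have p: "p \<in> sqint lborel" unfolding p_def by (intro sqint_sum sqint_cmult echar_sqint)
  have "norm (h n x - p x) \<le> norm (of_real (\<epsilon>/3) * echar 0 x)" for x
  proof (cases "x \<in> unit_int")
    case True
    then show ?thesis using app[of x] \<epsilon> by (simp add: p_def echar_def norm_mult)
  next
    case False
    then have "h n x = 0" using hb[of n x] by simp
    then show ?thesis using False by (simp add: p_def echar_def)
  qed
  then have "sqnorm lborel (\<lambda>x. h n x - p x) \<le> sqnorm lborel (\<lambda>x. of_real (\<epsilon>/3) * echar 0 x)"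
    unfolding sqnorm_def
    by (intro real_sqrt_le_mono integral_mono power_mono sqint_integrable sqint_diff hs p sqint_cmult echar_sqint) auto
  also have "\<dots> = \<epsilon>/3"
  proof -
    have "(sqnorm lborel (echar 0))\<^sup>2 = 1"
      using echar_orthonormal[of 0 0] unfolding sqinner_self by (metis of_real_eq_1_iff)
    then have "sqnorm lborel (echar 0) = 1" by (simp add: power2_eq_1_iff) (smt (verit) sqnorm_nonneg)
    then show ?thesis unfolding sqnorm_cmult using \<epsilon> by simp
  qed
  finally have hp: "sqnorm lborel (\<lambda>x. h n x - p x) \<le> \<epsilon>/3" .
  have "sqnorm lborel (\<lambda>x. U x - p x) \<le> sqnorm lborel (\<lambda>x. U x - T k x) + sqnorm lborel (\<lambda>x. T k x - p x)"
    by (intro sqnorm_triangle_diff U T p)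
  also have "sqnorm lborel (\<lambda>x. T k x - p x) \<le> sqnorm lborel (\<lambda>x. T k x - h n x) + sqnorm lborel (\<lambda>x. h n x - p x)"
    by (intro sqnorm_triangle_diff T p hs)
  finally have "sqnorm lborel (\<lambda>x. U x - p x) < \<epsilon>" using k n(1) hp sqnorm_minus_commute[of lborel "h n" "T k"] by linarith
  then show ?thesis using N by (auto simp: p_def)
qed

text \<open>The identity \<open>orthonormal_approx\<close> gives both halves: with the Fourier
  coefficients as \<open>c\<close> it is Bessel's inequality, and with the dense trigonometric sums
  it shows that the partial sums come arbitrarily close to the squared norm.\<close>

lemma parseval_interval:
  assumes U: "U \<in> sqint lborel" and U0: "\<And>x. x \<notin> unit_int \<Longrightarrow> U x = 0"
  shows "sqmass (count_space UNIV) (\<lambda>n. LINT x|lborel. U x * cis (- (2 * pi * of_int n * x)))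
    = sqmass lborel U"
proof -
  define a where "a n = sqinner lborel U (echar n)" for n
  have a: "(LINT x|lborel. U x * cis (- (2 * pi * of_int n * x))) = a n" for n
    unfolding a_def sqinner_def
    by (intro Bochner_Integration.integral_cong refl) (use U0 in \<open>auto simp: echar_def indicator_def cis_cnj\<close>)
  have key: "(sqnorm lborel (\<lambda>x. U x - (\<Sum>n\<in>N. c n * echar n x)))\<^sup>2 =
    (sqnorm lborel U)\<^sup>2 - (\<Sum>n\<in>N. (norm (a n))\<^sup>2) + (\<Sum>n\<in>N. (norm (c n - a n))\<^sup>2)" if "finite N" for N c
    unfolding a_def using U that echar_sqint by (intro orthonormal_approx) (auto simp: echar_orthonormal)
  have le: "(\<Sum>n\<in>N. (norm (a n))\<^sup>2) \<le> (sqnorm lborel U)\<^sup>2" if "finite N" for N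
    using key[OF that, of a] zero_le_power2[of "sqnorm lborel (\<lambda>x. U x - (\<Sum>n\<in>N. a n * echar n x))"] by simp
  have "((\<lambda>n. (norm (a n))\<^sup>2) has_sum (sqnorm lborel U)\<^sup>2) UNIV"
    unfolding has_sum_def
  proof (rule order_tendstoI)
    fix y assume "(sqnorm lborel U)\<^sup>2 < y"
    then show "\<forall>\<^sub>F N in finite_subsets_at_top UNIV. (\<Sum>n\<in>N. (norm (a n))\<^sup>2) < y"
      using le by (intro eventually_finite_subsets_at_top_weakI) (meson le_less_trans)
  next
    fix y assume y: "y < (sqnorm lborel U)\<^sup>2"
    define \<epsilon> where "\<epsilon> = sqrt ((sqnorm lborel U)\<^sup>2 - y)"
    have \<epsilon>: "\<epsilon> > 0" "\<epsilon>\<^sup>2 = (sqnorm lborel U)\<^sup>2 - y" using y by (auto simp: \<epsilon>_def)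
    obtain N c where N: "finite N" "sqnorm lborel (\<lambda>x. U x - (\<Sum>n\<in>N. c n * echar n x)) < \<epsilon>"
      using trig_dense[OF U U0 \<epsilon>(1)] by auto
    have "(sqnorm lborel (\<lambda>x. U x - (\<Sum>n\<in>N. c n * echar n x)))\<^sup>2 < \<epsilon>\<^sup>2"
      using N(2) by (intro power_strict_mono) auto
    moreover have "0 \<le> (\<Sum>n\<in>N. (norm (c n - a n))\<^sup>2)" by (intro sum_nonneg) auto
    ultimately have "y < (\<Sum>n\<in>N. (norm (a n))\<^sup>2)" using key[OF N(1), of c] \<epsilon>(2) by linarith
    then show "\<forall>\<^sub>F N in finite_subsets_at_top UNIV. y < (\<Sum>n\<in>N. (norm (a n))\<^sup>2)"
      unfolding eventually_finite_subsets_at_top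
      using N(1) by (intro exI[of _ N] conjI allI impI) (auto intro: order.strict_trans2[OF _ sum_mono2])
  qed
  then have hs: "((\<lambda>n. (norm (a n))\<^sup>2) has_sum (sqnorm lborel U)\<^sup>2) UNIV" .
  have "sqmass (count_space UNIV) a = ennreal ((sqnorm lborel U)\<^sup>2)"
    using hs by (rule has_sum_imp_nn_integral) simp
  then show ?thesis unfolding a using sqnorm_nn[OF U] by simp
qed

section \<open>Lebesgue measure on the plane\<close>

lemma inner_vec2: "(x :: real^2) \<bullet> y = x $ 1 * y $ 1 + x $ 2 * y $ 2"
  by (simp add: inner_vec_def sum_2)

lemma vec2_as_axis: "vector [a, b] = a *\<^sub>R axis 1 1 + b *\<^sub>R (axis 2 1 :: real^2)"
  by (simp add: vec_eq_iff forall_2 axis_def)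

lemma vec2_measurable [measurable (raw)]:
  assumes "f \<in> borel_measurable M" "g \<in> borel_measurable M"
  shows "(\<lambda>x. vector [f x, g x] :: real^2) \<in> borel_measurable M"
  unfolding vec2_as_axis using assms by measurable

lemma Basis_vec2: "(Basis :: (real^2) set) = {axis 1 1, axis 2 1}"
  by (auto simp: Basis_vec_def UNIV_2)

text \<open>Lebesgue measure is determined by its values on boxes, and there both sides are the
  product of the side lengths. This opens the Fubini theorems of product measures for the
  plane.\<close>

lemma lborel_vec2:
  "(lborel :: (real^2) measure) = distr (lborel \<Otimes>\<^sub>M lborel) borel (\<lambda>(x, y). vector [x, y])"
proof (rule lborel_eqI)
  fix l u :: "real^2" assume lu: "\<And>b. b \<in> Basis \<Longrightarrow> l \<bullet> b \<le> u \<bullet> b"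
  have le: "l $ 1 \<le> u $ 1" "l $ 2 \<le> u $ 2"
    using lu[of "axis 1 1"] lu[of "axis 2 1"] by (auto simp: Basis_vec2 inner_axis)
  have vb: "(\<lambda>(x, y). vector [x, y] :: real^2) -` box l u = {l $ 1<..<u $ 1} \<times> {l $ 2<..<u $ 2}"
    by (auto simp: mem_box_cart forall_2)
  have "emeasure (distr (lborel \<Otimes>\<^sub>M lborel) borel (\<lambda>(x, y). vector [x, y] :: real^2)) (box l u)
     = emeasure (lborel \<Otimes>\<^sub>M lborel) ({l $ 1<..<u $ 1} \<times> {l $ 2<..<u $ 2})"
    by (subst emeasure_distr) (auto simp: vb space_pair_measure)
  also have "\<dots> = ennreal ((u $ 1 - l $ 1) * (u $ 2 - l $ 2))"
    using le by (subst lborel.emeasure_pair_measure_Times) (auto simp: ennreal_mult)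
  also have "(u $ 1 - l $ 1) * (u $ 2 - l $ 2) = (\<Prod>b\<in>Basis. (u - l) \<bullet> b)"
    by (simp add: Basis_vec2 inner_axis axis_eq_axis)
  finally show "emeasure (distr (lborel \<Otimes>\<^sub>M lborel) borel (\<lambda>(x, y). vector [x, y])) (box l u)
      = ennreal (\<Prod>b\<in>Basis. (u - l) \<bullet> b)" .
qed simp

lemma nn_integral_vec2:
  fixes h :: "real^2 \<Rightarrow> ennreal"
  assumes [measurable]: "h \<in> borel_measurable borel"
  shows "(\<integral>\<^sup>+x. h x \<partial>lborel) = (\<integral>\<^sup>+a. \<integral>\<^sup>+b. h (vector [a, b]) \<partial>lborel \<partial>lborel)"
  by (subst lborel_vec2, subst nn_integral_distr, simp, simp, subst lborel.nn_integral_fst[symmetric])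
    (auto simp: case_prod_beta)

lemma integral_vec2:
  fixes h :: "real^2 \<Rightarrow> complex"
  assumes "integrable lborel h"
  shows "(LINT x|lborel. h x) = (LINT a|lborel. LINT b|lborel. h (vector [a, b]))"
proof -
  have [measurable]: "h \<in> borel_measurable borel" using assms by auto
  have "integrable (lborel \<Otimes>\<^sub>M lborel) (\<lambda>p. h (case p of (x, y) \<Rightarrow> vector [x, y]))"
    using assms by (subst (asm) lborel_vec2) (simp add: integrable_distr_eq)
  then have "integrable (lborel \<Otimes>\<^sub>M lborel) (\<lambda>(x, y). h (vector [x, y]))"
    by (simp add: case_prod_unfold)
  from lborel_pair.integral_fst[OF this]
  have "(LINT a|lborel. LINT b|lborel. h (vector [a, b])) = (LINT p|(lborel \<Otimes>\<^sub>M lborel). h (case p of (x, y) \<Rightarrow> vector [x, y]))"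
    by (simp add: case_prod_unfold)
  also have "\<dots> = (LINT x|lborel. h x)"
    by (subst lborel_vec2, subst integral_distr) auto
  finally show ?thesis by simp
qed

lemma matrix_measurable [measurable (raw)]:
  fixes A :: "real^2^2" and f :: "'a \<Rightarrow> real^2"
  shows "f \<in> borel_measurable M \<Longrightarrow> (\<lambda>x. A *v f x) \<in> borel_measurable M"
  by (rule borel_measurable_continuous_on[of "\<lambda>v. A *v v"])
    (auto intro: linear_continuous_on linear_linear[THEN iffD2])

lemma matrix_inv_mult:
  fixes A :: "'a::semiring_1^'n^'m"
  assumes "invertible A"
  shows "A ** matrix_inv A = mat 1" "matrix_inv A ** A = mat 1"
  using someI_ex[OF assms[unfolded invertible_def]] by (auto simp: matrix_inv_def)

text \<open>The substitution rule as an identity of measures, checked on boxes, whose preimage is a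
  linear image under the inverse matrix; the rules for both kinds of integral are read off from
  it.\<close>

lemma lborel_matrix:
  fixes A :: "real^2^2"
  assumes A: "invertible A"
  shows "(lborel :: (real^2) measure) = density (distr lborel borel (\<lambda>x. A *v x)) (\<lambda>_. ennreal \<bar>det A\<bar>)"
proof (rule lborel_eqI)
  fix l u :: "real^2" assume lu: "\<And>b. b \<in> Basis \<Longrightarrow> l \<bullet> b \<le> u \<bullet> b"
  define A' where "A' = matrix_inv A"
  have AA: "A ** A' = mat 1" "A' ** A = mat 1" using A by (auto simp: A'_def matrix_inv_mult)
  have dd: "det A * det A' = 1" using AA(1) by (metis det_I det_mul)
  have vi: "(\<lambda>x. A *v x) -` box l u = (\<lambda>x. A' *v x) ` box l u"
  proof (intro equalityI subsetI)
    fix x assume "x \<in> (\<lambda>x. A *v x) -` box l u"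
    then have "A *v x \<in> box l u" "x = A' *v (A *v x)" by (auto simp: matrix_vector_mul_assoc AA)
    then show "x \<in> (\<lambda>x. A' *v x) ` box l u" by blast
  qed (auto simp: matrix_vector_mul_assoc AA)
  have lin: "linear (\<lambda>x. A' *v x)" by (rule matrix_vector_mul_linear)
  have bl: "box l u \<in> lmeasurable" by (rule lmeasurable_box)
  have m1: "(\<lambda>x. A' *v x) ` box l u \<in> lmeasurable" using measurable_linear_image[OF lin bl] .
  have m2: "measure lebesgue ((\<lambda>x. A' *v x) ` box l u) = \<bar>det A'\<bar> * measure lebesgue (box l u)"
    using measure_linear_image[OF lin bl] by simp
  have S: "(\<lambda>x. A *v x) -` box l u \<in> sets borel"
    by (rule measurable_sets_borel[of _ borel]) auto
  have "emeasure lborel ((\<lambda>x. A *v x) -` box l u) = emeasure lebesgue ((\<lambda>x. A' *v x) ` box l u)"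
    using S by (simp add: vi)
  also have "\<dots> = ennreal (\<bar>det A'\<bar> * measure lebesgue (box l u))"
    unfolding m2[symmetric] using m1 by (intro emeasure_eq_measure2) (auto simp: fmeasurable_def)
  also have "measure lebesgue (box l u) = (\<Prod>b\<in>Basis. (u - l) \<bullet> b)"
    using lu by (simp add: measure_lborel_box_eq)
  finally have e: "emeasure lborel ((\<lambda>x. A *v x) -` box l u) = ennreal (\<bar>det A'\<bar> * (\<Prod>b\<in>Basis. (u - l) \<bullet> b))" .
  have "emeasure (density (distr lborel borel (\<lambda>x. A *v x)) (\<lambda>_. ennreal \<bar>det A\<bar>)) (box l u)
     = ennreal \<bar>det A\<bar> * emeasure lborel ((\<lambda>x. A *v x) -` box l u)"
    by (subst emeasure_density) (auto simp: nn_integral_cmult_indicator emeasure_distr)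
  also have "\<dots> = ennreal (\<bar>det A\<bar> * (\<bar>det A'\<bar> * (\<Prod>b\<in>Basis. (u - l) \<bullet> b)))"
    unfolding e by (simp add: ennreal_mult')
  also have "\<bar>det A\<bar> * (\<bar>det A'\<bar> * (\<Prod>b\<in>Basis. (u - l) \<bullet> b)) = (\<Prod>b\<in>Basis. (u - l) \<bullet> b)"
    using dd by (simp add: mult.assoc[symmetric] abs_mult[symmetric])
  finally show "emeasure (density (distr lborel borel (\<lambda>x. A *v x)) (\<lambda>_. ennreal \<bar>det A\<bar>)) (box l u)
     = ennreal (\<Prod>b\<in>Basis. (u - l) \<bullet> b)" .
qed simp

lemma nn_integral_matrix:
  fixes A :: "real^2^2" and h :: "real^2 \<Rightarrow> ennreal"
  assumes A: "invertible A" and [measurable]: "h \<in> borel_measurable borel"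
  shows "(\<integral>\<^sup>+x. h x \<partial>lborel) = ennreal \<bar>det A\<bar> * (\<integral>\<^sup>+x. h (A *v x) \<partial>lborel)"
  by (subst lborel_matrix[OF A]) (simp add: nn_integral_density nn_integral_distr nn_integral_cmult)

lemma integrable_matrix:
  fixes A :: "real^2^2" and h :: "real^2 \<Rightarrow> 'b::{banach, second_countable_topology}"
  assumes A: "invertible A" and h: "integrable lborel h"
  shows "integrable lborel (\<lambda>x. h (A *v x))"
proof -
  have [measurable]: "h \<in> borel_measurable borel" using h by auto
  have "det A \<noteq> 0" using A by (simp add: invertible_det_nz)
  moreover have "(\<integral>\<^sup>+x. norm (h x) \<partial>lborel) = ennreal \<bar>det A\<bar> * (\<integral>\<^sup>+x. norm (h (A *v x)) \<partial>lborel)"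
    by (rule nn_integral_matrix[OF A]) measurable
  moreover have "(\<integral>\<^sup>+x. norm (h x) \<partial>lborel) < \<infinity>" using h by (simp add: integrable_iff_bounded)
  ultimately show ?thesis
    by (auto simp: integrable_iff_bounded ennreal_mult_less_top)
qed

lemma integral_matrix:
  fixes A :: "real^2^2" and h :: "real^2 \<Rightarrow> 'b::{banach, second_countable_topology}"
  assumes A: "invertible A" and [measurable]: "h \<in> borel_measurable borel"
  shows "(LINT x|lborel. h x) = \<bar>det A\<bar> *\<^sub>R (LINT x|lborel. h (A *v x))"
  by (subst lborel_matrix[OF A]) (simp add: integral_density integral_distr)

lemma AE_matrix:
  fixes A :: "real^2^2"
  assumes A: "invertible A" and P: "AE x in lborel. P x"
  shows "AE x in lborel. P (A *v x)"
proof -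
  obtain N where N: "{x. \<not> P x} \<subseteq> N" "N \<in> sets borel" "emeasure lborel N = 0"
    using P by (auto simp: eventually_ae_filter null_sets_def)
  have d: "det A \<noteq> 0" using A by (simp add: invertible_det_nz)
  have [measurable]: "N \<in> sets borel" by fact
  have "(\<integral>\<^sup>+x. indicator N x \<partial>lborel) = ennreal \<bar>det A\<bar> * (\<integral>\<^sup>+x. indicator N (A *v x) \<partial>lborel)"
    by (rule nn_integral_matrix[OF A]) measurable
  then have "(\<integral>\<^sup>+x. indicator N (A *v x) \<partial>lborel) = 0"
    using N d by simp
  then have "AE x in lborel. indicator N (A *v x) = (0::ennreal)"
    by (subst (asm) nn_integral_0_iff_AE) auto
  then show ?thesis
  proof eventually_elim
    case (elim x)
    then show ?case using N(1) by (auto simp: indicator_def split: if_splits)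
  qed
qed

lemma nn_integral_shift:
  fixes h :: "real^2 \<Rightarrow> ennreal"
  assumes [measurable]: "h \<in> borel_measurable borel"
  shows "(\<integral>\<^sup>+x. h (c + x) \<partial>lborel) = (\<integral>\<^sup>+x. h x \<partial>lborel)"
  by (subst (2) lborel_distr_plus[of c, symmetric]) (simp add: nn_integral_distr)

lemma integral_shift:
  fixes h :: "real^2 \<Rightarrow> complex"
  assumes [measurable]: "h \<in> borel_measurable borel"
  shows "(LINT x|lborel. h (c + x)) = (LINT x|lborel. h x)"
  by (subst (2) lborel_distr_plus[of c, symmetric]) (simp add: integral_distr)

lemma integrable_shift:
  fixes h :: "real^2 \<Rightarrow> complex"
  assumes "integrable lborel h"
  shows "integrable lborel (\<lambda>x. h (c + x))"
proof -
  have [measurable]: "h \<in> borel_measurable borel" using assms by auto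
  have "(\<integral>\<^sup>+x. norm (h (c + x)) \<partial>lborel) = (\<integral>\<^sup>+x. norm (h x) \<partial>lborel)"
    by (rule nn_integral_shift[where h = "\<lambda>x. norm (h x)"]) measurable
  then show ?thesis using assms by (simp add: integrable_iff_bounded)
qed

lemma AE_shift:
  fixes c :: "real^2"
  assumes P: "AE x in lborel. P x"
  shows "AE x in lborel. P (c + x)"
proof -
  have "AE x in distr lborel borel ((+) c). P x" unfolding lborel_distr_plus by (rule P)
  then obtain N where N: "{x. \<not> P x} \<subseteq> N" "N \<in> sets borel" "emeasure (distr lborel borel ((+) c)) N = 0"
    by (auto simp: eventually_ae_filter null_sets_def)
  have "(+) c -` N \<in> sets borel"
    by (rule measurable_sets_borel[of _ borel]) (use N in auto)
  then have "(+) c -` N \<in> null_sets lborel" using N by (auto simp: emeasure_distr null_sets_def)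
  then show ?thesis by (rule AE_I') (use N in auto)
qed

section \<open>Fourier series on the unit cell\<close>

definition cell :: "(real^2) set" where "cell = {x. x $ 1 \<in> unit_int \<and> x $ 2 \<in> unit_int}"

definition intvec :: "(real^2) set" where "intvec = {n. \<forall>i. n $ i \<in> \<int>}"

lemma cell_borel [measurable]: "cell \<in> sets borel"
  unfolding cell_def by measurable

lemma bij_intvec: "bij_betw (\<lambda>(n, m). vector [of_int n, of_int m]) (UNIV :: (int \<times> int) set) intvec"
proof (rule bij_betw_byWitness[where f' = "\<lambda>x. (\<lfloor>x $ 1\<rfloor>, \<lfloor>x $ 2\<rfloor>)"])
  show "\<forall>x\<in>intvec. (case (\<lfloor>x $ 1\<rfloor>, \<lfloor>x $ 2\<rfloor>) of (n, m) \<Rightarrow> vector [of_int n, of_int m]) = x"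
    by (auto simp: intvec_def vec_eq_iff forall_2)
  show "(\<lambda>(n, m). vector [of_int n, of_int m]) ` (UNIV :: (int \<times> int) set) \<subseteq> intvec"
    by (auto simp: intvec_def forall_2)
qed auto

lemma countable_intvec [simp]: "countable intvec"
  using countable_image[of "UNIV :: (int \<times> int) set" "\<lambda>(n, m). vector [of_int n, of_int m] :: real^2"]
    bij_betw_imp_surj_on[OF bij_intvec] by auto

lemma intvec_diff: "n \<in> intvec \<Longrightarrow> m \<in> intvec \<Longrightarrow> n - m \<in> intvec"
  and intvec_add: "n \<in> intvec \<Longrightarrow> m \<in> intvec \<Longrightarrow> n + m \<in> intvec"
  and intvec_0 [simp]: "0 \<in> intvec"
  by (auto simp: intvec_def)

lemma intvec_inner: "n \<in> intvec \<Longrightarrow> m \<in> intvec \<Longrightarrow> n \<bullet> m \<in> \<int>"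
  by (auto simp: intvec_def inner_vec2)

lemma cis_int: "k \<in> \<int> \<Longrightarrow> cis (2 * pi * k) = 1"
  by (auto elim!: Ints_cases simp: cis_multiple_2pi)

lemma emeasure_cell: "emeasure lborel cell = 1"
proof -
  have "emeasure lborel cell = (\<integral>\<^sup>+a. \<integral>\<^sup>+b. indicator cell (vector [a, b]) \<partial>lborel \<partial>lborel)"
    by (subst nn_integral_vec2[symmetric]) auto
  also have "\<dots> = (\<integral>\<^sup>+a. \<integral>\<^sup>+b. indicator unit_int a * indicator unit_int b \<partial>lborel \<partial>lborel)"
    by (intro nn_integral_cong) (auto simp: cell_def indicator_def)
  finally show ?thesis by (simp add: nn_integral_cmult nn_integral_multc emeasure_unit_int)
qed

lemma cell_unique: "\<exists>!n. n \<in> intvec \<and> x - n \<in> cell"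
proof (rule ex1I)
  show "vector [of_int \<lfloor>x $ 1 + 1/2\<rfloor>, of_int \<lfloor>x $ 2 + 1/2\<rfloor>] \<in> intvec \<and>
    x - vector [of_int \<lfloor>x $ 1 + 1/2\<rfloor>, of_int \<lfloor>x $ 2 + 1/2\<rfloor>] \<in> cell"
    using floor_correct[of "x $ 1 + 1/2"] floor_correct[of "x $ 2 + 1/2"]
    unfolding intvec_def cell_def unit_int_def by (simp add: forall_2; intro conjI; linarith)
next
  fix n assume n: "n \<in> intvec \<and> x - n \<in> cell"
  obtain k l where kl: "n $ 1 = of_int k" "n $ 2 = of_int l" using n by (fastforce simp: intvec_def Ints_def)
  have "\<lfloor>x $ 1 + 1/2\<rfloor> = k" "\<lfloor>x $ 2 + 1/2\<rfloor> = l"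
    using n kl by (auto simp: cell_def unit_int_def floor_eq_iff)
  then show "n = vector [of_int \<lfloor>x $ 1 + 1/2\<rfloor>, of_int \<lfloor>x $ 2 + 1/2\<rfloor>]"
    using kl by (simp add: vec_eq_iff forall_2)
qed

lemma cell_sum: "(\<integral>\<^sup>+n. indicator cell (x - n) \<partial>count_space intvec) = (1 :: ennreal)"
proof -
  obtain m where m: "m \<in> intvec" "x - m \<in> cell" "\<And>n. n \<in> intvec \<Longrightarrow> x - n \<in> cell \<Longrightarrow> n = m"
    using cell_unique[of x] by metis
  have "(\<integral>\<^sup>+n. indicator cell (x - n) \<partial>count_space intvec) = (\<integral>\<^sup>+n. indicator {m} n \<partial>count_space intvec)"
  proof (rule nn_integral_cong)
    fix n assume "n \<in> space (count_space intvec)"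
    then have "x - n \<in> cell \<longleftrightarrow> n = m" using m by (metis space_count_space)
    then show "indicator cell (x - n) = (indicator {m} n :: ennreal)"
      unfolding indicator_def by simp
  qed
  also have "\<dots> = emeasure (count_space intvec) {m}" using m(1) by (intro nn_integral_indicator) auto
  also have "\<dots> = 1" using m(1) by simp
  finally show ?thesis .
qed

text \<open>The indicators of the integer translates of \<open>cell\<close> add up to 1 at every
  point: insert this sum, exchange it with the integral, and shift each piece back.\<close>

lemma nn_integral_tile:
  fixes h :: "real^2 \<Rightarrow> ennreal"
  assumes [measurable]: "h \<in> borel_measurable borel"
  shows "(\<integral>\<^sup>+x. h x \<partial>lborel) = (\<integral>\<^sup>+n. \<integral>\<^sup>+x. h (n + x) * indicator cell x \<partial>lborel \<partial>count_space intvec)"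
proof -
  have "(\<integral>\<^sup>+x. h x \<partial>lborel) = (\<integral>\<^sup>+x. \<integral>\<^sup>+n. h x * indicator cell (x - n) \<partial>count_space intvec \<partial>lborel)"
    by (intro nn_integral_cong) (simp add: nn_integral_cmult cell_sum)
  also have "\<dots> = (\<integral>\<^sup>+n. \<integral>\<^sup>+x. h x * indicator cell (x - n) \<partial>lborel \<partial>count_space intvec)"
    by (rule nn_integral_count_space_nn_integral) auto
  also have "\<dots> = (\<integral>\<^sup>+n. \<integral>\<^sup>+x. h (n + x) * indicator cell x \<partial>lborel \<partial>count_space intvec)"
  proof (rule nn_integral_cong)
    fix n
    show "(\<integral>\<^sup>+x. h x * indicator cell (x - n) \<partial>lborel) = (\<integral>\<^sup>+x. h (n + x) * indicator cell x \<partial>lborel)"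
      using nn_integral_shift[of "\<lambda>x. h x * indicator cell (x - n)" n] by simp
  qed
  finally show ?thesis .
qed

lemma L1_fourier_cis: "L1_fourier f \<xi> = (LINT x|lborel. f x * cis (- (2 * pi * (\<xi> \<bullet> x))))"
  unfolding L1_fourier_def cis_conv_exp
  by (intro Bochner_Integration.integral_cong refl) (simp add: mult_ac)

text \<open>The indicator of the cell is square integrable, and U is its own product with
  it.\<close>

lemma sqint_cell_integrable:
  assumes "U \<in> sqint lborel" "\<And>x. x \<notin> cell \<Longrightarrow> U x = 0"
  shows "integrable lborel U"
proof -
  have "(\<lambda>x. indicator cell x) \<in> sqint lborel"
  proof -
    have "(norm (indicator cell x :: complex))\<^sup>2 = indicator cell x" for x by (simp add: indicator_def)
    moreover have "integrable lborel (\<lambda>x. indicator cell x :: real)" by (simp add: emeasure_cell)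
    ultimately show ?thesis unfolding sqint_def by simp
  qed
  from sqint_prod[OF assms(1) this]
  have "integrable lborel (\<lambda>x. U x * cnj (indicator cell x))" .
  also have "(\<lambda>x. U x * cnj (indicator cell x)) = U"
    using assms(2) by (auto simp: fun_eq_iff indicator_def)
  finally show ?thesis .
qed

lemma integrable_cis [intro]:
  fixes g :: "'a \<Rightarrow> real"
  assumes "integrable M f" "g \<in> borel_measurable M"
  shows "integrable M (\<lambda>x. f x * cis (g x))"
  by (rule Bochner_Integration.integrable_bound[OF assms(1)]) (use assms in \<open>auto simp: norm_mult\<close>)

text \<open>The one-dimensional identity is used twice: in the second variable for almost every
  slice (only these are known to be square integrable), which gives the coefficients
  \<open>c m a\<close>, and then in the first variable for each function \<open>c m\<close>.\<close>

lemma parseval_cell: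
  fixes U :: "real^2 \<Rightarrow> complex"
  assumes U: "U \<in> sqint lborel" and U0: "\<And>x. x \<notin> cell \<Longrightarrow> U x = 0"
  shows "sqmass (count_space intvec) (L1_fourier U) = sqmass lborel U"
proof -
  have [measurable]: "U \<in> borel_measurable borel" using U by (auto dest: sqint_measurable)
  define V where "V a b = U (vector [a, b])" for a b
  have [measurable]: "(\<lambda>p. V (fst p) (snd p)) \<in> borel_measurable (borel \<Otimes>\<^sub>M borel)"
    unfolding V_def by measurable
  have Vb [measurable]: "V a \<in> borel_measurable borel" for a unfolding V_def by measurable
  have VU: "sqmass lborel U = (\<integral>\<^sup>+a. \<integral>\<^sup>+b. ennreal ((norm (V a b))\<^sup>2) \<partial>lborel \<partial>lborel)"
    unfolding V_def by (subst nn_integral_vec2) auto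
  have fin: "sqmass lborel U < \<infinity>" using U by (simp add: sqint_iff_nn)
  have V0: "V a b = 0" if "a \<notin> unit_int \<or> b \<notin> unit_int" for a b
    using that U0 by (auto simp: V_def cell_def)
  define c where "c m a = (LINT b|lborel. V a b * cis (- (2 * pi * of_int m * b)))" for m :: int and a
  have cm [measurable]: "c m \<in> borel_measurable borel" for m
    unfolding c_def by (rule lborel.borel_measurable_lebesgue_integral) measurable
  have c0: "c m a = 0" if "a \<notin> unit_int" for m a unfolding c_def using V0 that by simp
  have "AE a in lborel. (sqmass lborel (\<lambda>b. V a b)) \<noteq> \<infinity>"
    using fin unfolding VU by (intro nn_integral_PInf_AE) auto
  then have inner: "AE a in lborel. (sqmass (count_space UNIV) (\<lambda>m. c m a)) = sqmass lborel (\<lambda>b. V a b)"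
  proof eventually_elim
    case (elim a)
    then have "V a \<in> sqint lborel" by (auto simp: sqint_iff_nn top.not_eq_extremum)
    from parseval_interval[OF this] show ?case unfolding c_def using V0 by auto
  qed
  have tot: "(\<integral>\<^sup>+m. \<integral>\<^sup>+a. ennreal ((norm (c m a))\<^sup>2) \<partial>lborel \<partial>count_space UNIV) = sqmass lborel U"
    unfolding VU by (subst nn_integral_count_space_nn_integral[symmetric]) (auto intro!: nn_integral_cong_AE inner)
  have csq: "c m \<in> sqint lborel" for m
  proof -
    have "sqmass lborel (\<lambda>a. c m a) \<le> (\<integral>\<^sup>+m. \<integral>\<^sup>+a. ennreal ((norm (c m a))\<^sup>2) \<partial>lborel \<partial>count_space UNIV)"
      by (rule nn_integral_ge_point) simp
    then show ?thesis using fin unfolding tot sqint_iff_nn by (auto intro: le_less_trans)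
  qed
  have Ui: "integrable lborel U" using U U0 by (rule sqint_cell_integrable)
  have coef: "(LINT a|lborel. c m a * cis (- (2 * pi * of_int n * a))) = L1_fourier U (vector [of_int n, of_int m])" for n m
  proof -
    have "L1_fourier U (vector [of_int n, of_int m]) =
       (LINT x|lborel. U x * cis (- (2 * pi * (vector [of_int n, of_int m] \<bullet> x))))"
      by (rule L1_fourier_cis)
    also have "\<dots> = (LINT a|lborel. LINT b|lborel. U (vector [a, b]) * cis (- (2 * pi * (vector [of_int n, of_int m] \<bullet> (vector [a, b] :: real^2)))))"
      by (rule integral_vec2) (use Ui in auto)
    also have "\<dots> = (LINT a|lborel. LINT b|lborel. (V a b * cis (- (2 * pi * of_int m * b))) * cis (- (2 * pi * of_int n * a)))"
      by (intro Bochner_Integration.integral_cong refl) (simp add: V_def inner_vec2 mult.assoc cis_mult algebra_simps)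
    also have "\<dots> = (LINT a|lborel. c m a * cis (- (2 * pi * of_int n * a)))"
      by (simp add: c_def)
    finally show ?thesis by simp
  qed
  have "sqmass (count_space intvec) (L1_fourier U)
     = (\<integral>\<^sup>+p. ennreal ((norm (L1_fourier U (case p of (n, m) \<Rightarrow> vector [of_int n, of_int m])))\<^sup>2) \<partial>count_space (UNIV :: (int \<times> int) set))"
    by (rule nn_integral_bij_count_space[OF bij_intvec, symmetric])
  also have "\<dots> = (\<integral>\<^sup>+m. \<integral>\<^sup>+n. ennreal ((norm (L1_fourier U (vector [of_int n, of_int m])))\<^sup>2) \<partial>count_space (UNIV :: int set) \<partial>count_space (UNIV :: int set))"
    by (subst nn_integral_snd_count_space[symmetric]) simp
  also have "\<dots> = (\<integral>\<^sup>+m. \<integral>\<^sup>+a. ennreal ((norm (c m a))\<^sup>2) \<partial>lborel \<partial>count_space UNIV)"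
    unfolding coef[symmetric] using csq c0 by (intro nn_integral_cong parseval_interval) auto
  finally show ?thesis using tot by simp
qed

section \<open>The Plancherel theorem\<close>

lemma L1_fourier_measurable [measurable]:
  assumes [measurable]: "f \<in> borel_measurable borel"
  shows "L1_fourier f \<in> borel_measurable borel"
  unfolding L1_fourier_cis by (rule lborel.borel_measurable_lebesgue_integral) measurable

lemma L1_fourier_diff:
  assumes "integrable lborel f" "integrable lborel g"
  shows "L1_fourier (\<lambda>x. f x - g x) \<xi> = L1_fourier f \<xi> - L1_fourier g \<xi>"
  unfolding L1_fourier_cis left_diff_distrib
  using assms by (intro Bochner_Integration.integral_diff integrable_cis) auto

lemma L1_fourier_diff_fun:
  "integrable lborel f \<Longrightarrow> integrable lborel g \<Longrightarrow>
    (\<lambda>\<xi>. L1_fourier f \<xi> - L1_fourier g \<xi>) = L1_fourier (\<lambda>x. f x - g x)"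
  by (simp add: fun_eq_iff L1_fourier_diff)

lemma L1_fourier_add_cmult:
  assumes "integrable lborel f" "integrable lborel g"
  shows "L1_fourier (\<lambda>x. f x + c * g x) \<xi> = L1_fourier f \<xi> + c * L1_fourier g \<xi>"
proof -
  have "L1_fourier (\<lambda>x. f x + c * g x) \<xi> = (LINT x|lborel. f x * cis (- (2 * pi * (\<xi> \<bullet> x))) + c * (g x * cis (- (2 * pi * (\<xi> \<bullet> x)))))"
    unfolding L1_fourier_cis by (simp add: algebra_simps)
  also have "\<dots> = L1_fourier f \<xi> + c * L1_fourier g \<xi>"
    unfolding L1_fourier_cis using assms
    by (subst Bochner_Integration.integral_add) (auto intro!: integrable_cis integrable_mult_right)
  finally show ?thesis .
qed

lemma L1_fourier_matrix:
  assumes A: "invertible A" and [measurable]: "f \<in> borel_measurable borel"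
  shows "L1_fourier f \<xi> = of_real \<bar>det A\<bar> * L1_fourier (\<lambda>x. f (A *v x)) (transpose A *v \<xi>)"
  unfolding L1_fourier_cis
proof (subst integral_matrix[OF A])
  have "\<xi> \<bullet> (A *v x) = (transpose A *v \<xi>) \<bullet> x" for x
    by (simp add: transpose_matrix_vector dot_lmul_matrix)
  then show "\<bar>det A\<bar> *\<^sub>R (LINT x|lborel. f (A *v x) * cis (- (2 * pi * (\<xi> \<bullet> (A *v x))))) =
    of_real \<bar>det A\<bar> * (LINT x|lborel. f (A *v x) * cis (- (2 * pi * ((transpose A *v \<xi>) \<bullet> x))))"
    by (simp only: scaleR_conv_of_real)
qed measurable

lemma L1_fourier_shift:
  assumes [measurable]: "f \<in> borel_measurable borel"
  shows "L1_fourier (\<lambda>x. f (x - y)) \<xi> = cis (- (2 * pi * (\<xi> \<bullet> y))) * L1_fourier f \<xi>"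
proof -
  have "L1_fourier (\<lambda>x. f (x - y)) \<xi> = (LINT x|lborel. f (y + x - y) * cis (- (2 * pi * (\<xi> \<bullet> (y + x)))))"
    unfolding L1_fourier_cis by (rule integral_shift[symmetric]) measurable
  also have "\<dots> = (LINT x|lborel. cis (- (2 * pi * (\<xi> \<bullet> y))) * (f x * cis (- (2 * pi * (\<xi> \<bullet> x)))))"
    by (intro Bochner_Integration.integral_cong refl) (simp add: inner_add_right cis_mult algebra_simps)
  finally show ?thesis by (simp add: L1_fourier_cis)
qed

lemma L1_fourier_modulate:
  "L1_fourier (\<lambda>x. f x * cis (- (2 * pi * (\<theta> \<bullet> x)))) \<xi> = L1_fourier f (\<xi> + \<theta>)"
  unfolding L1_fourier_cis
  by (intro Bochner_Integration.integral_cong refl) (simp add: mult.assoc cis_mult inner_add_left algebra_simps)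

lemma plancherel_cell:
  assumes U: "U \<in> sqint lborel" and U0: "\<And>x. x \<notin> cell \<Longrightarrow> U x = 0"
  shows "sqmass lborel (L1_fourier U) = sqmass lborel U"
proof -
  have [measurable]: "U \<in> borel_measurable borel" using U by (auto dest: sqint_measurable)
  have "sqmass lborel (L1_fourier U) =
    (\<integral>\<^sup>+n. \<integral>\<^sup>+\<theta>. ennreal ((norm (L1_fourier U (n + \<theta>)))\<^sup>2) * indicator cell \<theta> \<partial>lborel \<partial>count_space intvec)"
    by (rule nn_integral_tile) measurable
  also have "\<dots> = (\<integral>\<^sup>+\<theta>. \<integral>\<^sup>+n. ennreal ((norm (L1_fourier U (n + \<theta>)))\<^sup>2) * indicator cell \<theta> \<partial>count_space intvec \<partial>lborel)"
    by (rule nn_integral_count_space_nn_integral[symmetric]) auto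
  also have "\<dots> = (\<integral>\<^sup>+\<theta>. (sqmass lborel U) * indicator cell \<theta> \<partial>lborel)"
  proof (rule nn_integral_cong)
    fix \<theta> :: "real^2"
    \<comment> \<open>Modulation by \<theta> turns the values at n + \<theta> into values at integer
      points and leaves absolute values alone, so Parseval holds on every shifted grid.\<close>
    define W where "W x = U x * cis (- (2 * pi * (\<theta> \<bullet> x)))" for x
    have [measurable]: "W \<in> borel_measurable borel" unfolding W_def by measurable
    have W: "W \<in> sqint lborel" using U by (rule sqint_dominated[rotated]) (auto simp: W_def norm_mult)
    have "sqmass (count_space intvec) (L1_fourier W) = sqmass lborel W"
      using W by (rule parseval_cell) (simp add: W_def U0)
    then show "(\<integral>\<^sup>+n. ennreal ((norm (L1_fourier U (n + \<theta>)))\<^sup>2) * indicator cell \<theta> \<partial>count_space intvec) =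
      (sqmass lborel U) * indicator cell \<theta>"
      unfolding W_def L1_fourier_modulate by (simp add: nn_integral_multc norm_mult)
  qed
  also have "\<dots> = sqmass lborel U"
    by (simp add: nn_integral_cmult emeasure_cell)
  finally show ?thesis .
qed

lemma invertible_mat: "(c::real) \<noteq> 0 \<Longrightarrow> invertible (mat c :: real^2^2)"
  by (simp add: invertible_det_nz det_2 mat_def)

lemma det_mat2: "det (mat c :: real^2^2) = c\<^sup>2"
  by (simp add: det_2 mat_def power2_eq_square)

lemma mat_mult_vec: "mat c *v x = c *\<^sub>R (x :: real^2)"
  by (simp add: mat_def matrix_vector_mult_def vec_eq_iff forall_2 sum_2)

lemma plancherel_bounded:
  assumes U: "U \<in> sqint lborel" and c: "c > 0" and U0: "\<And>x. (1/c) *\<^sub>R x \<notin> cell \<Longrightarrow> U x = 0"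
  shows "sqmass lborel (L1_fourier U) = sqmass lborel U"
proof -
  have [measurable]: "U \<in> borel_measurable borel" using U by (auto dest: sqint_measurable)
  define V where "V x = U (c *\<^sub>R x)" for x
  have [measurable]: "V \<in> borel_measurable borel" unfolding V_def by measurable
  have inv: "invertible (mat c :: real^2^2)" using c by (intro invertible_mat) simp
  have UV: "sqmass lborel U = ennreal (c\<^sup>2) * sqmass lborel V"
    unfolding V_def using nn_integral_matrix[OF inv, of "\<lambda>x. ennreal ((norm (U x))\<^sup>2)"] by (simp add: det_mat2 mat_mult_vec)
  have "sqmass lborel U < \<infinity>" using U by (simp add: sqint_iff_nn)
  then have V: "V \<in> sqint lborel"
    unfolding UV sqint_iff_nn using c by (auto simp: ennreal_mult_less_top)
  have F: "L1_fourier U \<xi> = of_real (c\<^sup>2) * L1_fourier V (c *\<^sub>R \<xi>)" for \<xi>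
    using L1_fourier_matrix[OF inv, of U \<xi>] by (simp add: det_mat2 mat_mult_vec V_def[abs_def])
  \<comment> \<open>The transform of a dilate brings in the square of the Jacobian,
    \<open>c\<^sup>2 * c\<^sup>2\<close>; one factor is spent on the substitution in frequency, the
    other on the one in space.\<close>
  have "sqmass lborel (L1_fourier U) =
    (\<integral>\<^sup>+\<xi>. ennreal (c\<^sup>2) * (ennreal (c\<^sup>2) * ennreal ((norm (L1_fourier V (c *\<^sub>R \<xi>)))\<^sup>2)) \<partial>lborel)"
  proof (rule nn_integral_cong)
    fix \<xi>
    have "(norm (of_real (c\<^sup>2) * z))\<^sup>2 = c\<^sup>2 * (c\<^sup>2 * (norm z)\<^sup>2)" for z :: complex
      by (simp add: norm_mult norm_power power_mult_distrib power2_eq_square)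
    then show "ennreal ((norm (L1_fourier U \<xi>))\<^sup>2) =
        ennreal (c\<^sup>2) * (ennreal (c\<^sup>2) * ennreal ((norm (L1_fourier V (c *\<^sub>R \<xi>)))\<^sup>2))"
      unfolding F by (simp only: ennreal_mult zero_le_power2 mult_nonneg_nonneg)
  qed
  also have "\<dots> = ennreal (c\<^sup>2) * (ennreal (c\<^sup>2) * (sqmass lborel (\<lambda>\<xi>. L1_fourier V (c *\<^sub>R \<xi>))))"
    by (simp add: nn_integral_cmult)
  also have "ennreal (c\<^sup>2) * sqmass lborel (\<lambda>\<xi>. L1_fourier V (c *\<^sub>R \<xi>))
     = sqmass lborel (L1_fourier V)"
    using nn_integral_matrix[OF inv, of "\<lambda>x. ennreal ((norm (L1_fourier V x))\<^sup>2)"] by (simp add: det_mat2 mat_mult_vec)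
  also have "\<dots> = sqmass lborel V"
    using V by (rule plancherel_cell) (use U0 c in \<open>auto simp: V_def\<close>)
  finally show ?thesis by (simp add: UV)
qed

text \<open>Support in a bounded box turns square integrability into integrability, so the integral
  formula for the transform applies; the boxes exhaust the plane as n grows.\<close>

definition trunc_box :: "nat \<Rightarrow> (real^2 \<Rightarrow> complex) \<Rightarrow> real^2 \<Rightarrow> complex" where
  "trunc_box n f x = (if (1 / real (Suc n)) *\<^sub>R x \<in> cell then f x else 0)"

lemma trunc_box_measurable [measurable]:
  "f \<in> borel_measurable borel \<Longrightarrow> trunc_box n f \<in> borel_measurable borel"
proof -
  assume [measurable]: "f \<in> borel_measurable borel"
  have "trunc_box n f = (\<lambda>x. indicator cell ((1 / real (Suc n)) *\<^sub>R x) * f x)"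
    by (auto simp: trunc_box_def indicator_def fun_eq_iff)
  then show ?thesis by simp
qed

lemma norm_trunc_box: "norm (trunc_box n f x) \<le> norm (f x)"
  and norm_trunc_box_diff: "norm (trunc_box n f x - f x) \<le> norm (f x)"
  by (auto simp: trunc_box_def)

lemma trunc_box_sqint: "f \<in> sqint lborel \<Longrightarrow> trunc_box n f \<in> sqint lborel"
  by (rule sqint_dominated) (auto simp: norm_trunc_box dest: sqint_measurable)

lemma trunc_box_integrable:
  assumes "f \<in> sqint lborel" shows "integrable lborel (trunc_box n f)"
proof -
  have inv: "invertible (mat (real (Suc n)) :: real^2^2)" "invertible (mat (1 / real (Suc n)) :: real^2^2)"
    by (auto intro!: invertible_mat)
  have t: "trunc_box n f \<in> sqint lborel" using assms by (rule trunc_box_sqint)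
  then have [measurable]: "trunc_box n f \<in> borel_measurable borel" by (auto dest: sqint_measurable)
  define V where "V x = trunc_box n f (real (Suc n) *\<^sub>R x)" for x
  have [measurable]: "V \<in> borel_measurable borel" unfolding V_def by measurable
  have "integrable lborel (\<lambda>x. (norm (trunc_box n f (mat (real (Suc n)) *v x)))\<^sup>2)"
    by (rule integrable_matrix[OF inv(1)]) (use t in \<open>auto simp: sqint_def\<close>)
  then have "V \<in> sqint lborel" unfolding V_def sqint_def mat_mult_vec by simp
  then have "integrable lborel V"
    by (rule sqint_cell_integrable) (auto simp: V_def trunc_box_def)
  from integrable_matrix[OF inv(2) this] show ?thesis by (simp add: V_def mat_mult_vec)
qed

lemma trunc_box_tendsto_point: "(\<lambda>n. trunc_box n f x) \<longlonglongrightarrow> f x"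
proof (rule tendsto_eventually)
  obtain k where k: "2 * norm x < real k" using reals_Archimedean2 by blast
  have "trunc_box n f x = f x" if "n \<ge> k" for n
  proof -
    have "\<bar>x $ i\<bar> / real (Suc n) < 1/2" for i
      using component_le_norm_cart[of x i] k that by (simp add: field_simps)
    from this[of 1] this[of 2] have "(1 / real (Suc n)) *\<^sub>R x \<in> cell"
      by (auto simp: cell_def unit_int_def abs_if field_simps split: if_splits)
    then show ?thesis by (simp add: trunc_box_def)
  qed
  then show "\<forall>\<^sub>F n in sequentially. trunc_box n f x = f x" by (intro eventually_sequentiallyI)
qed

lemma trunc_box_tendsto:
  assumes f: "f \<in> sqint lborel"
  shows "(\<lambda>n. sqnorm lborel (\<lambda>x. trunc_box n f x - f x)) \<longlonglongrightarrow> 0"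
proof (rule sqnorm_dominated)
  have [measurable]: "f \<in> borel_measurable borel" using f by (auto dest: sqint_measurable)
  show "integrable lborel (\<lambda>x. (norm (f x))\<^sup>2)" using f by (rule sqint_integrable)
  show "AE x in lborel. (norm (trunc_box n f x - f x))\<^sup>2 \<le> (norm (f x))\<^sup>2" for n
    by (intro AE_I2 power_mono norm_trunc_box_diff) auto
  show "trunc_box n f \<in> borel_measurable lborel" "f \<in> borel_measurable lborel" for n by auto
qed (simp add: trunc_box_tendsto_point)

lemma plancherel_trunc:
  assumes "f \<in> sqint lborel"
  shows "sqmass lborel (L1_fourier (trunc_box n f)) = sqmass lborel (\<lambda>x. trunc_box n f x)"
  by (rule plancherel_bounded[of _ "real (Suc n)"]) (use assms in \<open>auto simp: trunc_box_sqint, simp add: trunc_box_def\<close>)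

text \<open>The transforms of the truncations converge pointwise by dominated convergence and
  satisfy the identity; Fatou's lemma keeps one inequality of it.\<close>

lemma plancherel_le:
  assumes f: "f \<in> sqint lborel" "integrable lborel f"
  shows "L1_fourier f \<in> sqint lborel" "sqnorm lborel (L1_fourier f) \<le> sqnorm lborel f"
proof -
  have [measurable]: "f \<in> borel_measurable borel" using f by auto
  have lim: "(\<lambda>n. L1_fourier (trunc_box n f) \<xi>) \<longlonglongrightarrow> L1_fourier f \<xi>" for \<xi>
    unfolding L1_fourier_cis
  proof (rule integral_dominated_convergence)
    show "integrable lborel (\<lambda>x. norm (f x))" using f by simp
    show "AE x in lborel. (\<lambda>n. trunc_box n f x * cis (- (2 * pi * (\<xi> \<bullet> x)))) \<longlonglongrightarrow> f x * cis (- (2 * pi * (\<xi> \<bullet> x)))"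
      by (intro AE_I2 tendsto_mult_right trunc_box_tendsto_point)
  qed (auto simp: norm_mult norm_trunc_box)
  have "sqmass lborel (L1_fourier f) =
     (\<integral>\<^sup>+\<xi>. liminf (\<lambda>n. ennreal ((norm (L1_fourier (trunc_box n f) \<xi>))\<^sup>2)) \<partial>lborel)"
  proof (rule nn_integral_cong)
    fix \<xi> :: "real^2"
    have "(\<lambda>n. ennreal ((norm (L1_fourier (trunc_box n f) \<xi>))\<^sup>2)) \<longlonglongrightarrow> ennreal ((norm (L1_fourier f \<xi>))\<^sup>2)"
      by (intro tendsto_ennrealI tendsto_intros lim)
    then show "ennreal ((norm (L1_fourier f \<xi>))\<^sup>2) = liminf (\<lambda>n. ennreal ((norm (L1_fourier (trunc_box n f) \<xi>))\<^sup>2))"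
      using lim_imp_Liminf[OF sequentially_bot] by metis
  qed
  also have "\<dots> \<le> liminf (\<lambda>n. \<integral>\<^sup>+\<xi>. ennreal ((norm (L1_fourier (trunc_box n f) \<xi>))\<^sup>2) \<partial>lborel)"
    by (rule nn_integral_liminf) measurable
  also have "\<dots> \<le> liminf (\<lambda>n. \<integral>\<^sup>+x. ennreal ((norm (f x))\<^sup>2) \<partial>lborel)"
    unfolding plancherel_trunc[OF f(1)]
    by (intro Liminf_mono always_eventually allI nn_integral_mono ennreal_leI power_mono norm_trunc_box) auto
  also have "\<dots> = sqmass lborel f" by (simp add: Liminf_const)
  finally have le: "sqmass lborel (L1_fourier f) \<le> sqmass lborel f" .
  moreover have "sqmass lborel f < \<infinity>" using f by (simp add: sqint_iff_nn)
  ultimately show F: "L1_fourier f \<in> sqint lborel" unfolding sqint_iff_nn by auto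
  show "sqnorm lborel (L1_fourier f) \<le> sqnorm lborel f"
    using le unfolding sqnorm_nn[OF F] sqnorm_nn[OF f(1)] by (simp add: power2_le_iff_abs_le)
qed

text \<open>The inequality, applied to the truncation errors, shows that their transforms tend to 0
  in norm, so the equality for truncations passes to the limit.\<close>

lemma plancherel_L1:
  assumes f: "f \<in> sqint lborel" "integrable lborel f"
  shows "sqnorm lborel (L1_fourier f) = sqnorm lborel f"
proof -
  have t: "trunc_box n f \<in> sqint lborel" "integrable lborel (trunc_box n f)" for n
    using f by (auto intro: trunc_box_sqint trunc_box_integrable)
  have "(\<lambda>n. sqnorm lborel (\<lambda>\<xi>. L1_fourier (trunc_box n f) \<xi> - L1_fourier f \<xi>)) \<longlonglongrightarrow> 0"
  proof (rule tendsto_sandwich[OF _ _ tendsto_const trunc_box_tendsto[OF f(1)]])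
    have "sqnorm lborel (\<lambda>\<xi>. L1_fourier (trunc_box n f) \<xi> - L1_fourier f \<xi>) = sqnorm lborel (L1_fourier (\<lambda>x. trunc_box n f x - f x))" for n
      using t f by (simp add: L1_fourier_diff_fun)
    also have "\<dots> n \<le> sqnorm lborel (\<lambda>x. trunc_box n f x - f x)" for n
      using t f by (intro plancherel_le) auto
    finally show "\<forall>\<^sub>F n in sequentially. sqnorm lborel (\<lambda>\<xi>. L1_fourier (trunc_box n f) \<xi> - L1_fourier f \<xi>) \<le> sqnorm lborel (\<lambda>x. trunc_box n f x - f x)"
      by simp
  qed simp
  then have "(\<lambda>n. sqnorm lborel (L1_fourier (trunc_box n f))) \<longlonglongrightarrow> sqnorm lborel (L1_fourier f)"
    using t f by (intro sqnorm_tendsto plancherel_le)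
  moreover have "sqnorm lborel (L1_fourier (trunc_box n f)) = sqnorm lborel (trunc_box n f)" for n
    using plancherel_trunc[OF f(1), of n] plancherel_le(1)[OF t] t(1)[of n] by (simp add: sqnorm_nn)
  moreover have "(\<lambda>n. sqnorm lborel (trunc_box n f)) \<longlonglongrightarrow> sqnorm lborel f"
    using t f by (intro sqnorm_tendsto trunc_box_tendsto)
  ultimately show ?thesis using LIMSEQ_unique by fastforce
qed

section \<open>The Fourier transform of square-integrable functions\<close>

text \<open>The property by which \<open>L2_fourier\<close> chooses its value, kept as a relation:
  the rules are proved for every admissible representative and reach the chosen one through
  \<open>L2_fourier_is_ft\<close>.\<close>

definition is_ft :: "(real^2 \<Rightarrow> complex) \<Rightarrow> (real^2 \<Rightarrow> complex) \<Rightarrow> bool" where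
  "is_ft f g \<longleftrightarrow> f \<in> sqint lborel \<and> g \<in> sqint lborel \<and> (\<exists>h. (\<forall>n. h n \<in> sqint lborel \<and> integrable lborel (h n)) \<and>
     (\<lambda>n. sqnorm lborel (\<lambda>x. h n x - f x)) \<longlonglongrightarrow> 0 \<and> (\<lambda>n. sqnorm lborel (\<lambda>x. L1_fourier (h n) x - g x)) \<longlonglongrightarrow> 0)"

text \<open>The truncations converge, and the transform is isometric on their differences, so the
  transforms form a Cauchy sequence.\<close>

lemma is_ft_exists:
  assumes f: "f \<in> sqint lborel"
  shows "\<exists>g. is_ft f g"
proof -
  have t: "trunc_box n f \<in> sqint lborel" "integrable lborel (trunc_box n f)" for n
    using f by (auto intro: trunc_box_sqint trunc_box_integrable)
  have "\<exists>g\<in>sqint lborel. (\<lambda>n. sqnorm lborel (\<lambda>x. L1_fourier (trunc_box n f) x - g x)) \<longlonglongrightarrow> 0"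
  proof (rule sq_complete)
    show "L1_fourier (trunc_box n f) \<in> sqint lborel" for n using t by (intro plancherel_le)
    fix e :: real assume "e > 0"
    then have "\<forall>\<^sub>F n in sequentially. sqnorm lborel (\<lambda>x. trunc_box n f x - f x) < e / 2"
      using order_tendstoD(2)[OF trunc_box_tendsto[OF f], of "e/2"] by simp
    then obtain N where N: "\<And>n. n \<ge> N \<Longrightarrow> sqnorm lborel (\<lambda>x. trunc_box n f x - f x) < e / 2"
      by (auto simp: eventually_sequentially)
    show "\<exists>N. \<forall>m\<ge>N. \<forall>n\<ge>N. sqnorm lborel (\<lambda>x. L1_fourier (trunc_box m f) x - L1_fourier (trunc_box n f) x) < e"
    proof (intro exI[of _ N] allI impI)
      fix m n assume mn: "N \<le> m" "N \<le> n"
      have "sqnorm lborel (\<lambda>x. L1_fourier (trunc_box m f) x - L1_fourier (trunc_box n f) x) =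
        sqnorm lborel (L1_fourier (\<lambda>x. trunc_box m f x - trunc_box n f x))"
        using t by (simp add: L1_fourier_diff_fun)
      also have "\<dots> = sqnorm lborel (\<lambda>x. trunc_box m f x - trunc_box n f x)"
        using t by (intro plancherel_L1) auto
      also have "\<dots> \<le> sqnorm lborel (\<lambda>x. trunc_box m f x - f x) + sqnorm lborel (\<lambda>x. f x - trunc_box n f x)"
        using t f by (intro sqnorm_triangle_diff)
      also have "\<dots> < e" using N[OF mn(1)] N[OF mn(2)] sqnorm_minus_commute[of lborel f] by simp
      finally show "sqnorm lborel (\<lambda>x. L1_fourier (trunc_box m f) x - L1_fourier (trunc_box n f) x) < e" .
    qed
  qed
  then obtain g where "g \<in> sqint lborel"
    "(\<lambda>n. sqnorm lborel (\<lambda>x. L1_fourier (trunc_box n f) x - g x)) \<longlonglongrightarrow> 0" by blast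
  then have "is_ft f g" unfolding is_ft_def
    by (intro conjI exI[of _ "\<lambda>n. trunc_box n f"] allI f t trunc_box_tendsto)
  then show ?thesis by (rule exI[of "is_ft f"])
qed

text \<open>For square-integrable f the choice in \<open>L2_fourier\<close> ranges exactly over the
  g with \<open>is_ft f g\<close>, and there is one.\<close>

lemma L2_fourier_is_ft:
  assumes f: "f \<in> sqint lborel" shows "is_ft f (L2_fourier f)"
proof -
  have eq: "is_ft f g \<longleftrightarrow> g \<in> L2 \<and> (\<exists>h. (\<forall>n. h n \<in> L2 \<and> integrable lborel (h n)) \<and>
        L2_tendsto h f sequentially \<and> L2_tendsto (\<lambda>n. L1_fourier (h n)) g sequentially)" for g
  proof (cases "g \<in> sqint lborel")
    case True
    have "(\<forall>n. h n \<in> sqint lborel \<and> integrable lborel (h n)) \<Longrightarrow>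
      L2_tendsto h f sequentially = (\<lambda>n. sqnorm lborel (\<lambda>x. h n x - f x)) \<longlonglongrightarrow> 0 \<and>
      L2_tendsto (\<lambda>n. L1_fourier (h n)) g sequentially = (\<lambda>n. sqnorm lborel (\<lambda>x. L1_fourier (h n) x - g x)) \<longlonglongrightarrow> 0" for h
      using f True plancherel_le(1) by (intro conjI L2_tendsto_iff; simp add: L2_eq_sqint)
    with f True show ?thesis unfolding is_ft_def L2_eq_sqint by blast
  qed (simp add: is_ft_def L2_eq_sqint)
  have "is_ft f (SOME g. is_ft f g)" using is_ft_exists[OF f] by (rule someI_ex)
  then show ?thesis unfolding L2_fourier_def eq .
qed

lemma is_ft_sqint: "is_ft f g \<Longrightarrow> f \<in> sqint lborel" "is_ft f g \<Longrightarrow> g \<in> sqint lborel"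
  by (auto simp: is_ft_def)

text \<open>Stated for differences of two pairs, so that uniqueness up to null sets, independence of
  the approximating sequence and preservation of the norm all follow from it.\<close>

lemma is_ft_isometry:
  assumes "is_ft f g" "is_ft f' g'"
  shows "sqnorm lborel (\<lambda>x. g x - g' x) = sqnorm lborel (\<lambda>x. f x - f' x)"
proof -
  obtain h where h: "\<And>n. h n \<in> sqint lborel" "\<And>n. integrable lborel (h n)"
    "(\<lambda>n. sqnorm lborel (\<lambda>x. h n x - f x)) \<longlonglongrightarrow> 0" "(\<lambda>n. sqnorm lborel (\<lambda>x. L1_fourier (h n) x - g x)) \<longlonglongrightarrow> 0"
    using assms(1) by (auto simp: is_ft_def)
  obtain h' where h': "\<And>n. h' n \<in> sqint lborel" "\<And>n. integrable lborel (h' n)"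
    "(\<lambda>n. sqnorm lborel (\<lambda>x. h' n x - f' x)) \<longlonglongrightarrow> 0" "(\<lambda>n. sqnorm lborel (\<lambda>x. L1_fourier (h' n) x - g' x)) \<longlonglongrightarrow> 0"
    using assms(2) by (auto simp: is_ft_def)
  have diff: "(\<lambda>n. sqnorm lborel (\<lambda>x. u n x - u' n x)) \<longlonglongrightarrow> sqnorm lborel (\<lambda>x. k x - k' x)"
    if u: "\<And>n. u n \<in> sqint lborel" "\<And>n. u' n \<in> sqint lborel" "k \<in> sqint lborel" "k' \<in> sqint lborel"
      and ul: "(\<lambda>n. sqnorm lborel (\<lambda>x. u n x - k x)) \<longlonglongrightarrow> 0" "(\<lambda>n. sqnorm lborel (\<lambda>x. u' n x - k' x)) \<longlonglongrightarrow> 0"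
    for u u' :: "nat \<Rightarrow> real^2 \<Rightarrow> complex" and k k'
  proof (rule sqnorm_tendsto)
    show "(\<lambda>n. sqnorm lborel (\<lambda>x. (u n x - u' n x) - (k x - k' x))) \<longlonglongrightarrow> 0"
    proof (rule tendsto_sandwich[OF _ _ tendsto_const])
      show "(\<lambda>n. sqnorm lborel (\<lambda>x. u n x - k x) + sqnorm lborel (\<lambda>x. u' n x - k' x)) \<longlonglongrightarrow> 0"
        using tendsto_add[OF ul] by simp
      show "\<forall>\<^sub>F n in sequentially. sqnorm lborel (\<lambda>x. (u n x - u' n x) - (k x - k' x)) \<le>
         sqnorm lborel (\<lambda>x. u n x - k x) + sqnorm lborel (\<lambda>x. u' n x - k' x)"
      proof (intro always_eventually allI)
        fix n
        have "sqnorm lborel (\<lambda>x. (u n x - u' n x) - (k x - k' x)) = sqnorm lborel (\<lambda>x. (u n x - k x) + (k' x - u' n x))"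
          by (simp add: algebra_simps)
        also have "\<dots> \<le> sqnorm lborel (\<lambda>x. u n x - k x) + sqnorm lborel (\<lambda>x. k' x - u' n x)"
          using u by (intro sqnorm_triangle) auto
        finally show "sqnorm lborel (\<lambda>x. (u n x - u' n x) - (k x - k' x)) \<le>
            sqnorm lborel (\<lambda>x. u n x - k x) + sqnorm lborel (\<lambda>x. u' n x - k' x)"
          by (simp add: sqnorm_minus_commute[of lborel k'])
      qed
    qed simp
  qed (use u in auto)
  have "(\<lambda>n. sqnorm lborel (\<lambda>x. h n x - h' n x)) \<longlonglongrightarrow> sqnorm lborel (\<lambda>x. f x - f' x)"
    using h h' assms by (intro diff) (auto simp: is_ft_sqint)
  moreover have "(\<lambda>n. sqnorm lborel (\<lambda>x. L1_fourier (h n) x - L1_fourier (h' n) x)) \<longlonglongrightarrow> sqnorm lborel (\<lambda>x. g x - g' x)"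
    using h h' assms by (intro diff) (auto simp: is_ft_sqint plancherel_le)
  moreover have "sqnorm lborel (\<lambda>x. L1_fourier (h n) x - L1_fourier (h' n) x) = sqnorm lborel (\<lambda>x. h n x - h' n x)" for n
    using h h' plancherel_L1[of "\<lambda>x. h n x - h' n x"] by (auto simp: L1_fourier_diff_fun)
  ultimately show ?thesis using LIMSEQ_unique by fastforce
qed

lemma sqnorm_diff_zero_AE:
  "f \<in> sqint M \<Longrightarrow> g \<in> sqint M \<Longrightarrow> sqnorm M (\<lambda>x. f x - g x) = 0 \<Longrightarrow> AE x in M. f x = g x"
  using sqnorm_eq_0_AE[of "\<lambda>x. f x - g x" M] by auto

lemma sqnorm_diff_AE_zero:
  assumes "f \<in> borel_measurable M" "g \<in> borel_measurable M" "AE x in M. f x = g x"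
  shows "sqnorm M (\<lambda>x. f x - g x) = 0"
proof -
  have "sqnorm M (\<lambda>x. f x - g x) = sqnorm M (\<lambda>x. 0)"
    using assms by (intro sqnorm_cong_AE) auto
  then show ?thesis by (simp add: sqnorm_def)
qed

lemma is_ft_unique:
  assumes "is_ft f g" "is_ft f' g'" "AE x in lborel. f x = f' x"
  shows "AE x in lborel. g x = g' x"
proof (rule sqnorm_diff_zero_AE)
  have "f \<in> borel_measurable lborel" "f' \<in> borel_measurable lborel"
    using assms by (auto dest!: is_ft_sqint(1) sqint_measurable)
  then show "sqnorm lborel (\<lambda>x. g x - g' x) = 0"
    unfolding is_ft_isometry[OF assms(1,2)] using assms(3) by (rule sqnorm_diff_AE_zero)
qed (use assms in \<open>auto dest: is_ft_sqint\<close>)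

lemma L2_fourier_eq: "is_ft f g \<Longrightarrow> AE x in lborel. L2_fourier f x = g x"
  by (rule is_ft_unique[OF L2_fourier_is_ft]) (auto simp: is_ft_sqint)

lemma L2_fourier_sqint [intro]: "f \<in> sqint lborel \<Longrightarrow> L2_fourier f \<in> sqint lborel"
  using L2_fourier_is_ft is_ft_sqint by blast

lemma is_ft_zero: "is_ft (\<lambda>x. 0) (\<lambda>x. 0)"
  unfolding is_ft_def by (intro conjI exI[of _ "\<lambda>n x. 0"]) (auto simp: L1_fourier_def sqnorm_def)

lemma is_ft_norm: "is_ft f g \<Longrightarrow> sqnorm lborel g = sqnorm lborel f"
  using is_ft_isometry[OF _ is_ft_zero, of f g] by simp

lemma is_ft_add_cmult:
  assumes "is_ft f g" "is_ft f' g'"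
  shows "is_ft (\<lambda>x. f x + c * f' x) (\<lambda>x. g x + c * g' x)"
proof -
  obtain h where h: "\<And>n. h n \<in> sqint lborel" "\<And>n. integrable lborel (h n)"
    "(\<lambda>n. sqnorm lborel (\<lambda>x. h n x - f x)) \<longlonglongrightarrow> 0" "(\<lambda>n. sqnorm lborel (\<lambda>x. L1_fourier (h n) x - g x)) \<longlonglongrightarrow> 0"
    using assms(1) by (auto simp: is_ft_def)
  obtain h' where h': "\<And>n. h' n \<in> sqint lborel" "\<And>n. integrable lborel (h' n)"
    "(\<lambda>n. sqnorm lborel (\<lambda>x. h' n x - f' x)) \<longlonglongrightarrow> 0" "(\<lambda>n. sqnorm lborel (\<lambda>x. L1_fourier (h' n) x - g' x)) \<longlonglongrightarrow> 0"
    using assms(2) by (auto simp: is_ft_def)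
  have lim: "(\<lambda>n. sqnorm lborel (\<lambda>x. (u n x + c * u' n x) - (k x + c * k' x))) \<longlonglongrightarrow> 0"
    if u: "\<And>n. u n \<in> sqint lborel" "\<And>n. u' n \<in> sqint lborel" "k \<in> sqint lborel" "k' \<in> sqint lborel"
      and ul: "(\<lambda>n. sqnorm lborel (\<lambda>x. u n x - k x)) \<longlonglongrightarrow> 0" "(\<lambda>n. sqnorm lborel (\<lambda>x. u' n x - k' x)) \<longlonglongrightarrow> 0"
    for u u' :: "nat \<Rightarrow> real^2 \<Rightarrow> complex" and k k'
  proof (rule tendsto_sandwich[OF _ _ tendsto_const])
    show "(\<lambda>n. sqnorm lborel (\<lambda>x. u n x - k x) + norm c * sqnorm lborel (\<lambda>x. u' n x - k' x)) \<longlonglongrightarrow> 0"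
      using tendsto_add[OF ul(1) tendsto_mult_right_zero[OF ul(2)]] by simp
    show "\<forall>\<^sub>F n in sequentially. sqnorm lborel (\<lambda>x. (u n x + c * u' n x) - (k x + c * k' x)) \<le>
       sqnorm lborel (\<lambda>x. u n x - k x) + norm c * sqnorm lborel (\<lambda>x. u' n x - k' x)"
    proof (intro always_eventually allI)
      fix n
      have "sqnorm lborel (\<lambda>x. (u n x + c * u' n x) - (k x + c * k' x)) = sqnorm lborel (\<lambda>x. (u n x - k x) + c * (u' n x - k' x))"
        by (simp add: algebra_simps)
      also have "\<dots> \<le> sqnorm lborel (\<lambda>x. u n x - k x) + sqnorm lborel (\<lambda>x. c * (u' n x - k' x))"
        using u by (intro sqnorm_triangle sqint_cmult sqint_diff)
      finally show "sqnorm lborel (\<lambda>x. (u n x + c * u' n x) - (k x + c * k' x)) \<le>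
          sqnorm lborel (\<lambda>x. u n x - k x) + norm c * sqnorm lborel (\<lambda>x. u' n x - k' x)"
        by (simp only: sqnorm_cmult)
    qed
  qed simp
  show ?thesis unfolding is_ft_def
  proof (intro conjI exI[of _ "\<lambda>n x. h n x + c * h' n x"] allI)
    show "(\<lambda>x. f x + c * f' x) \<in> sqint lborel"
      by (intro sqint_add sqint_cmult is_ft_sqint(1)[OF assms(1)] is_ft_sqint(1)[OF assms(2)])
    show "(\<lambda>x. g x + c * g' x) \<in> sqint lborel"
      by (intro sqint_add sqint_cmult is_ft_sqint(2)[OF assms(1)] is_ft_sqint(2)[OF assms(2)])
    show "(\<lambda>n. sqnorm lborel (\<lambda>x. (h n x + c * h' n x) - (f x + c * f' x))) \<longlonglongrightarrow> 0"
      using h h' assms by (intro lim) (auto simp: is_ft_sqint)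
    have "(\<lambda>n. sqnorm lborel (\<lambda>x. (L1_fourier (h n) x + c * L1_fourier (h' n) x) - (g x + c * g' x))) \<longlonglongrightarrow> 0"
      using h h' assms by (intro lim) (auto simp: is_ft_sqint plancherel_le)
    then show "(\<lambda>n. sqnorm lborel (\<lambda>x. L1_fourier (\<lambda>x. h n x + c * h' n x) x - (g x + c * g' x))) \<longlonglongrightarrow> 0"
      using h h' by (simp add: L1_fourier_add_cmult)
    show "(\<lambda>x. h n x + c * h' n x) \<in> sqint lborel" "integrable lborel (\<lambda>x. h n x + c * h' n x)" for n
      by (intro sqint_add sqint_cmult Bochner_Integration.integrable_add integrable_mult_right h h')+
  qed
qed

lemma is_ft_inner:
  assumes "is_ft f g" "is_ft f' g'"
  shows "sqinner lborel g g' = sqinner lborel f f'"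
proof -
  have "sqnorm lborel (\<lambda>x. g x + c * g' x) = sqnorm lborel (\<lambda>x. f x + c * f' x)" for c
    using is_ft_norm[OF is_ft_add_cmult[OF assms]] .
  from this[of 1] this[of "-1"] this[of \<i>] this[of "-\<i>"] show ?thesis
    using assms by (simp add: sqinner_polarization is_ft_sqint)
qed

lemma nn_integral_reflect:
  fixes h :: "real^2 \<Rightarrow> ennreal"
  assumes [measurable]: "h \<in> borel_measurable borel"
  shows "(\<integral>\<^sup>+x. h (- x) \<partial>lborel) = (\<integral>\<^sup>+x. h x \<partial>lborel)"
  using nn_integral_matrix[OF invertible_mat, of "-1" h] by (simp add: det_mat2 mat_mult_vec)

lemma integral_reflect:
  fixes h :: "real^2 \<Rightarrow> complex"
  assumes [measurable]: "h \<in> borel_measurable borel"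
  shows "(LINT x|lborel. h (- x)) = (LINT x|lborel. h x)"
  using integral_matrix[OF invertible_mat, of "-1" h] by (simp add: det_mat2 mat_mult_vec)

lemma sqint_borel: "f \<in> sqint lborel \<Longrightarrow> f \<in> borel_measurable borel"
  by (auto dest: sqint_measurable)

lemma sqint_reflect: "f \<in> sqint lborel \<Longrightarrow> (\<lambda>x. f (- x :: real^2)) \<in> sqint lborel"
proof -
  assume f: "f \<in> sqint lborel"
  then have [measurable]: "f \<in> borel_measurable borel" by (rule sqint_borel)
  show ?thesis
    using f nn_integral_reflect[of "\<lambda>x. ennreal ((norm (f x))\<^sup>2)"] by (simp add: sqint_iff_nn)
qed

lemma sqinner_reflect:
  assumes "f \<in> sqint lborel" "g \<in> sqint lborel"
  shows "sqinner lborel (\<lambda>x. f (- x :: real^2)) (\<lambda>x. g (- x)) = sqinner lborel f g"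
proof -
  have [measurable]: "f \<in> borel_measurable borel" "g \<in> borel_measurable borel" using assms by (auto dest: sqint_borel)
  show ?thesis unfolding sqinner_def by (rule integral_reflect[where h = "\<lambda>x. f x * cnj (g x)"]) measurable
qed

lemma integrable_product_fg:
  fixes f g :: "real^2 \<Rightarrow> complex"
  assumes f: "integrable lborel f" and g: "integrable lborel g"
    and h [measurable]: "(\<lambda>p. h (fst p) (snd p)) \<in> borel_measurable (borel \<Otimes>\<^sub>M borel)"
    and n: "\<And>x y. norm (h x y :: complex) = norm (f x) * norm (g y)"
  shows "integrable (lborel \<Otimes>\<^sub>M lborel) (\<lambda>(x, y). h x y)"
proof (rule lborel_pair.Fubini_integrable)
  have [measurable]: "f \<in> borel_measurable borel" "g \<in> borel_measurable borel" using f g by auto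
  show m: "(\<lambda>(x, y). h x y) \<in> borel_measurable (lborel \<Otimes>\<^sub>M lborel)"
    unfolding case_prod_beta by measurable
  show "integrable lborel (\<lambda>x. LINT y|lborel. norm (case (x, y) of (x, y) \<Rightarrow> h x y))"
    using f g by (simp add: n)
  show "AE x in lborel. integrable lborel (\<lambda>y. case (x, y) of (x, y) \<Rightarrow> h x y)"
  proof (rule AE_I2)
    fix x
    have [measurable]: "h x \<in> borel_measurable borel"
      using measurable_compose[OF measurable_Pair1' h, of x] by simp
    have "integrable lborel (\<lambda>y. norm (f x) * norm (g y))" using g by simp
    then show "integrable lborel (\<lambda>y. case (x, y) of (x, y) \<Rightarrow> h x y)"
      by (rule Bochner_Integration.integrable_bound) (auto simp: n)
  qed
qed

text \<open>Fubini for the kernel, which is integrable on the product because h and k are;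
  conjugating the character produces the reflection.\<close>

lemma L1_fourier_adjoint:
  assumes h: "h \<in> sqint lborel" "integrable lborel h" and k: "k \<in> sqint lborel" "integrable lborel k"
  shows "sqinner lborel (L1_fourier h) k = sqinner lborel h (\<lambda>x. L1_fourier k (- x))"
proof -
  have [measurable]: "h \<in> borel_measurable borel" "k \<in> borel_measurable borel" using h k by auto
  define u where "u x \<xi> = h x * cis (- (2 * pi * (\<xi> \<bullet> x))) * cnj (k \<xi>)" for x \<xi>
  have "sqinner lborel (L1_fourier h) k = (LINT \<xi>|lborel. LINT x|lborel. u x \<xi>)"
    unfolding sqinner_def L1_fourier_cis u_def by simp
  also have "\<dots> = (LINT x|lborel. LINT \<xi>|lborel. u x \<xi>)"
    by (rule lborel_pair.Fubini_integral, rule integrable_product_fg[OF h(2) k(2)])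
      (auto simp: u_def norm_mult)
  also have "\<dots> = (LINT x|lborel. h x * cnj (L1_fourier k (- x)))"
  proof (intro Bochner_Integration.integral_cong refl)
    fix x
    have "cnj (L1_fourier k (- x)) = (LINT \<xi>|lborel. cnj (k \<xi> * cis (- (2 * pi * ((- x) \<bullet> \<xi>)))))"
      unfolding L1_fourier_cis by (simp only: Bochner_Integration.integral_cnj)
    also have "\<dots> = (LINT \<xi>|lborel. cis (- (2 * pi * (\<xi> \<bullet> x))) * cnj (k \<xi>))"
      by (intro Bochner_Integration.integral_cong refl) (simp add: cis_cnj inner_commute mult.commute)
    finally show "(LINT \<xi>|lborel. u x \<xi>) = h x * cnj (L1_fourier k (- x))"
      by (simp add: u_def mult.assoc)
  qed
  finally show ?thesis by (simp add: sqinner_def)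
qed

lemma sqnorm_reflect:
  assumes "f \<in> borel_measurable borel"
  shows "sqnorm lborel (\<lambda>x. f (- x :: real^2)) = sqnorm lborel f"
proof -
  note [measurable] = assms
  have "complex_of_real (LINT x|lborel. (norm (f (- x)))\<^sup>2) = complex_of_real (LINT x|lborel. (norm (f x))\<^sup>2)"
    unfolding integral_complex_of_real[symmetric]
    by (rule integral_reflect[where h = "\<lambda>x. complex_of_real ((norm (f x))\<^sup>2)"]) measurable
  then show ?thesis unfolding sqnorm_def by simp
qed

lemma sqinner_tendsto_right:
  assumes "\<And>i. f i \<in> sqint M" "g \<in> sqint M" "k \<in> sqint M" "((\<lambda>i. sqnorm M (\<lambda>x. f i x - g x)) \<longlongrightarrow> 0) F"
  shows "((\<lambda>i. sqinner M k (f i)) \<longlongrightarrow> sqinner M k g) F"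
  using tendsto_cnj[OF sqinner_tendsto[OF assms]] by (simp only: sqinner_cnj)

text \<open>Two successive limits: first in the second argument while the first is an integrable
  approximant, then in the first.\<close>

lemma is_ft_adjoint:
  assumes "is_ft f g" "is_ft f' g'"
  shows "sqinner lborel g f' = sqinner lborel f (\<lambda>x. g' (- x))"
proof -
  obtain h where h: "\<And>n. h n \<in> sqint lborel" "\<And>n. integrable lborel (h n)"
    "(\<lambda>n. sqnorm lborel (\<lambda>x. h n x - f x)) \<longlonglongrightarrow> 0" "(\<lambda>n. sqnorm lborel (\<lambda>x. L1_fourier (h n) x - g x)) \<longlonglongrightarrow> 0"
    using assms(1) by (auto simp: is_ft_def)
  obtain h' where h': "\<And>n. h' n \<in> sqint lborel" "\<And>n. integrable lborel (h' n)"
    "(\<lambda>n. sqnorm lborel (\<lambda>x. h' n x - f' x)) \<longlonglongrightarrow> 0" "(\<lambda>n. sqnorm lborel (\<lambda>x. L1_fourier (h' n) x - g' x)) \<longlonglongrightarrow> 0"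
    using assms(2) by (auto simp: is_ft_def)
  note sq = is_ft_sqint[OF assms(1)] is_ft_sqint[OF assms(2)]
  have F: "L1_fourier (h n) \<in> sqint lborel" "L1_fourier (h' n) \<in> sqint lborel" for n
    using h h' by (auto intro: plancherel_le)
  have 1: "sqinner lborel (L1_fourier (h n)) f' = sqinner lborel (h n) (\<lambda>x. g' (- x))" for n
  proof (rule LIMSEQ_unique)
    show "(\<lambda>m. sqinner lborel (L1_fourier (h n)) (h' m)) \<longlonglongrightarrow> sqinner lborel (L1_fourier (h n)) f'"
      using h' F sq by (intro sqinner_tendsto_right)
    have "(\<lambda>m. sqnorm lborel (\<lambda>x. L1_fourier (h' m) (- x) - g' (- x))) \<longlonglongrightarrow> 0"
    proof -
      have "sqnorm lborel (\<lambda>x. L1_fourier (h' m) (- x) - g' (- x)) = sqnorm lborel (\<lambda>x. L1_fourier (h' m) x - g' x)" for m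
        using F sq by (intro sqnorm_reflect[where f = "\<lambda>x. L1_fourier (h' m) x - g' x"]) (auto intro!: borel_measurable_diff dest: sqint_borel)
      then show ?thesis using h'(4) by simp
    qed
    then have "(\<lambda>m. sqinner lborel (h n) (\<lambda>x. L1_fourier (h' m) (- x))) \<longlonglongrightarrow> sqinner lborel (h n) (\<lambda>x. g' (- x))"
      using F sq h by (intro sqinner_tendsto_right sqint_reflect)
    then show "(\<lambda>m. sqinner lborel (L1_fourier (h n)) (h' m)) \<longlonglongrightarrow> sqinner lborel (h n) (\<lambda>x. g' (- x))"
      using h h' by (simp add: L1_fourier_adjoint)
  qed
  show ?thesis
  proof (rule LIMSEQ_unique)
    show "(\<lambda>n. sqinner lborel (L1_fourier (h n)) f') \<longlonglongrightarrow> sqinner lborel g f'"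
      using h F sq by (intro sqinner_tendsto)
    show "(\<lambda>n. sqinner lborel (L1_fourier (h n)) f') \<longlonglongrightarrow> sqinner lborel f (\<lambda>x. g' (- x))"
      unfolding 1 using h sq by (intro sqinner_tendsto sqint_reflect)
  qed
qed

text \<open>By the adjoint relation \<open>\<langle>\<F> f, g\<rangle> = \<langle>f, R \<F> g\<rangle>\<close>, with \<open>R\<close> the reflection, the adjoint of the isometry
  \<open>\<F>\<close> is again an isometry; hence \<open>\<F>\<close> is onto and \<open>R \<F> g\<close> is a preimage of \<open>g\<close>.\<close>

lemma is_ft_inverse:
  assumes g: "is_ft g k"
  shows "is_ft (\<lambda>x. k (- x)) g"
proof -
  define f where "f x = k (- x)" for x
  have f: "f \<in> sqint lborel" unfolding f_def using is_ft_sqint[OF g] by (intro sqint_reflect)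
  obtain F where F: "is_ft f F" using is_ft_exists[OF f] by blast
  have gs: "g \<in> sqint lborel" "F \<in> sqint lborel" using is_ft_sqint[OF g] is_ft_sqint[OF F] by auto
  have eq: "sqinner lborel F u = sqinner lborel g u" if u: "u \<in> sqint lborel" for u
  proof -
    obtain v where v: "is_ft u v" using is_ft_exists[OF u] by blast
    have "sqinner lborel F u = sqinner lborel f (\<lambda>x. v (- x))" using is_ft_adjoint[OF F v] .
    also have "\<dots> = sqinner lborel k v"
      unfolding f_def using is_ft_sqint[OF g] is_ft_sqint[OF v] by (intro sqinner_reflect)
    also have "\<dots> = sqinner lborel g u" using is_ft_inner[OF g v] .
    finally show ?thesis .
  qed
  have d: "(\<lambda>x. F x - g x) \<in> sqint lborel" using gs by auto
  have "sqinner lborel (\<lambda>x. F x - g x) (\<lambda>x. F x - g x) = 0"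
    using gs d by (subst sqinner_diff_left) (auto simp: eq)
  then have "sqnorm lborel (\<lambda>x. F x - g x) = 0" by (simp add: sqinner_self)
  then have ae: "AE x in lborel. F x = g x" using gs by (intro sqnorm_diff_zero_AE)
  \<comment> \<open>\<open>F\<close> and \<open>g\<close> agree almost everywhere, so the
    approximating sequence that witnesses \<open>is_ft f F\<close> also witnesses
    \<open>is_ft f g\<close>.\<close>
  obtain h where h: "\<And>n. h n \<in> sqint lborel" "\<And>n. integrable lborel (h n)"
    "(\<lambda>n. sqnorm lborel (\<lambda>x. h n x - f x)) \<longlonglongrightarrow> 0" "(\<lambda>n. sqnorm lborel (\<lambda>x. L1_fourier (h n) x - F x)) \<longlonglongrightarrow> 0"
    using F by (auto simp: is_ft_def)
  have "sqnorm lborel (\<lambda>x. L1_fourier (h n) x - F x) = sqnorm lborel (\<lambda>x. L1_fourier (h n) x - g x)" for n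
  proof (rule sqnorm_cong_AE)
    have [measurable]: "h n \<in> borel_measurable borel" "g \<in> borel_measurable borel" "F \<in> borel_measurable borel"
      using h gs by (auto dest: sqint_borel)
    show "(\<lambda>x. L1_fourier (h n) x - F x) \<in> borel_measurable lborel" "(\<lambda>x. L1_fourier (h n) x - g x) \<in> borel_measurable lborel"
      by measurable
    show "AE x in lborel. L1_fourier (h n) x - F x = L1_fourier (h n) x - g x" using ae by eventually_elim simp
  qed
  then have "is_ft f g" unfolding is_ft_def using f gs h by auto
  then show ?thesis unfolding f_def[abs_def] .
qed

text \<open>The reflected transform of g is a preimage, so the choice in
  \<open>L2_inv_fourier\<close> is made from a nonempty set.\<close>

lemma L2_inv_fourier:
  assumes g: "g \<in> sqint lborel"
  shows "L2_inv_fourier g \<in> sqint lborel" "AE \<xi> in lborel. L2_fourier (L2_inv_fourier g) \<xi> = g \<xi>"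
proof -
  obtain k where k: "is_ft g k" using is_ft_exists[OF g] by blast
  have "(\<lambda>x. k (- x)) \<in> L2 \<and> (AE \<xi> in lborel. L2_fourier (\<lambda>x. k (- x)) \<xi> = g \<xi>)"
    using is_ft_inverse[OF k] L2_fourier_eq is_ft_sqint(1) by (auto simp: L2_eq_sqint)
  from someI[of "\<lambda>f. f \<in> L2 \<and> (AE \<xi> in lborel. L2_fourier f \<xi> = g \<xi>)", OF this]
  show "L2_inv_fourier g \<in> sqint lborel" "AE \<xi> in lborel. L2_fourier (L2_inv_fourier g) \<xi> = g \<xi>"
    by (auto simp: L2_inv_fourier_def L2_eq_sqint)
qed

lemma L2_fourier_inner:
  "f \<in> sqint lborel \<Longrightarrow> g \<in> sqint lborel \<Longrightarrow> sqinner lborel (L2_fourier f) (L2_fourier g) = sqinner lborel f g"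
  by (intro is_ft_inner L2_fourier_is_ft)

lemma L2_fourier_norm: "f \<in> sqint lborel \<Longrightarrow> sqnorm lborel (L2_fourier f) = sqnorm lborel f"
  by (intro is_ft_norm L2_fourier_is_ft)

text \<open>If an isometry \<open>T\<close> on functions and an isometry \<open>T'\<close> on
  transforms are intertwined by the integral formula, approximation extends this to all
  square-integrable functions. The instances are translations and dilations.\<close>

lemma is_ft_transport:
  assumes T: "\<And>f. f \<in> sqint lborel \<Longrightarrow> T f \<in> sqint lborel"
    and T': "\<And>f. f \<in> sqint lborel \<Longrightarrow> T' f \<in> sqint lborel"
    and Ti: "\<And>f g. f \<in> sqint lborel \<Longrightarrow> g \<in> sqint lborel \<Longrightarrow> sqnorm lborel (\<lambda>x. T f x - T g x) = sqnorm lborel (\<lambda>x. f x - g x)"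
    and Ti': "\<And>f g. f \<in> sqint lborel \<Longrightarrow> g \<in> sqint lborel \<Longrightarrow> sqnorm lborel (\<lambda>x. T' f x - T' g x) = sqnorm lborel (\<lambda>x. f x - g x)"
    and Tint: "\<And>f. integrable lborel f \<Longrightarrow> integrable lborel (T f)"
    and F: "\<And>f. integrable lborel f \<Longrightarrow> L1_fourier (T f) = T' (L1_fourier f)"
    and ft: "is_ft f g"
  shows "is_ft (T f) (T' g)"
proof -
  obtain h where h: "\<And>n. h n \<in> sqint lborel" "\<And>n. integrable lborel (h n)"
    "(\<lambda>n. sqnorm lborel (\<lambda>x. h n x - f x)) \<longlonglongrightarrow> 0" "(\<lambda>n. sqnorm lborel (\<lambda>x. L1_fourier (h n) x - g x)) \<longlonglongrightarrow> 0"
    using ft by (auto simp: is_ft_def)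
  note sq = is_ft_sqint[OF ft]
  have Fh: "L1_fourier (h n) \<in> sqint lborel" for n using h by (intro plancherel_le)
  show ?thesis unfolding is_ft_def
  proof (intro conjI exI[of _ "\<lambda>n. T (h n)"] allI)
    show "(\<lambda>n. sqnorm lborel (\<lambda>x. T (h n) x - T f x)) \<longlonglongrightarrow> 0" using h sq by (simp add: Ti)
    show "(\<lambda>n. sqnorm lborel (\<lambda>x. L1_fourier (T (h n)) x - T' g x)) \<longlonglongrightarrow> 0" using h sq Fh by (simp add: F Ti')
  qed (use h sq T T' Tint in auto)
qed

lemma sqnorm_shift:
  assumes [measurable]: "f \<in> borel_measurable borel"
  shows "sqnorm lborel (\<lambda>x. f (x - y :: real^2)) = sqnorm lborel f"
proof -
  have "complex_of_real (LINT x|lborel. (norm (f (x - y)))\<^sup>2) = complex_of_real (LINT x|lborel. (norm (f x))\<^sup>2)"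
    unfolding integral_complex_of_real[symmetric]
    using integral_shift[of "\<lambda>x. complex_of_real ((norm (f x))\<^sup>2)" "- y"] by simp
  then show ?thesis unfolding sqnorm_def by simp
qed

lemma sqint_shift:
  assumes f: "f \<in> sqint lborel"
  shows "(\<lambda>x. f (x - y :: real^2)) \<in> sqint lborel"
proof -
  have [measurable]: "f \<in> borel_measurable borel" using f by (rule sqint_borel)
  show ?thesis
    using f nn_integral_shift[of "\<lambda>x. ennreal ((norm (f x))\<^sup>2)" "- y"] by (simp add: sqint_iff_nn)
qed

lemma sqnorm_matrix:
  fixes A :: "real^2^2"
  assumes A: "invertible A" and [measurable]: "f \<in> borel_measurable borel"
  shows "sqrt \<bar>det A\<bar> * sqnorm lborel (\<lambda>x. f (A *v x)) = sqnorm lborel f"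
  using integral_matrix[OF A, of "\<lambda>x. (norm (f x))\<^sup>2"] by (simp add: sqnorm_def real_sqrt_mult)

lemma sqint_matrix:
  fixes A :: "real^2^2"
  assumes A: "invertible A" and f: "f \<in> sqint lborel"
  shows "(\<lambda>x. f (A *v x)) \<in> sqint lborel"
proof -
  have [measurable]: "f \<in> borel_measurable borel" using f by (rule sqint_borel)
  show ?thesis using integrable_matrix[OF A sqint_integrable[OF f]] by (simp add: sqint_def)
qed

lemma is_ft_translate:
  assumes "is_ft f g"
  shows "is_ft (translate y f) (\<lambda>\<xi>. cis (- (2 * pi * (\<xi> \<bullet> y))) * g \<xi>)"
proof (rule is_ft_transport[where T = "translate y" and T' = "\<lambda>g \<xi>. cis (- (2 * pi * (\<xi> \<bullet> y))) * g \<xi>", OF _ _ _ _ _ _ assms])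
  fix f g :: "real^2 \<Rightarrow> complex" assume f: "f \<in> sqint lborel" and g: "g \<in> sqint lborel"
  have [measurable]: "f \<in> borel_measurable borel" "g \<in> borel_measurable borel" using f g by (auto dest: sqint_borel)
  show "translate y f \<in> sqint lborel" unfolding translate_def using f by (rule sqint_shift)
  show "(\<lambda>\<xi>. cis (- (2 * pi * (\<xi> \<bullet> y))) * f \<xi>) \<in> sqint lborel"
    by (rule sqint_dominated[OF _ f]) (auto simp: norm_mult)
  show "sqnorm lborel (\<lambda>x. translate y f x - translate y g x) = sqnorm lborel (\<lambda>x. f x - g x)"
    unfolding translate_def by (rule sqnorm_shift) measurable
  show "sqnorm lborel (\<lambda>x. cis (- (2 * pi * (x \<bullet> y))) * f x - cis (- (2 * pi * (x \<bullet> y))) * g x) = sqnorm lborel (\<lambda>x. f x - g x)"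
    by (simp add: sqnorm_def norm_mult flip: right_diff_distrib)
next
  fix f :: "real^2 \<Rightarrow> complex" assume f: "integrable lborel f"
  show "integrable lborel (translate y f)"
    using integrable_shift[OF f, of "- y"] by (simp add: translate_def)
  show "L1_fourier (translate y f) = (\<lambda>\<xi>. cis (- (2 * pi * (\<xi> \<bullet> y))) * L1_fourier f \<xi>)"
    unfolding translate_def using f by (intro ext L1_fourier_shift) auto
qed

lemma matrix_inv_inv:
  fixes A :: "real^2^2"
  assumes "invertible A"
  shows "invertible (matrix_inv A)" "det (matrix_inv A) = 1 / det A" "invertible (transpose A)"
    "A *v (matrix_inv A *v x) = x" "matrix_inv A *v (A *v x) = x"
proof -
  note AA = matrix_inv_mult[OF assms]
  show "invertible (matrix_inv A)" using AA invertible_def by blast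
  have "det A * det (matrix_inv A) = 1" using AA(1) by (metis det_I det_mul)
  moreover have "det A \<noteq> 0" using assms by (simp add: invertible_det_nz)
  ultimately show "det (matrix_inv A) = 1 / det A" by (simp add: eq_divide_eq mult.commute)
  show "invertible (transpose A)" using assms by (simp add: invertible_det_nz det_transpose)
  show "A *v (matrix_inv A *v x) = x" "matrix_inv A *v (A *v x) = x"
    by (simp_all add: matrix_vector_mul_assoc AA)
qed

lemma is_ft_dilate:
  assumes A: "invertible A" and ft: "is_ft f g"
  defines "B \<equiv> matrix_inv (transpose A)"
  shows "is_ft (dilate A f) (\<lambda>\<xi>. of_real (sqrt \<bar>det B\<bar>) * g (B *v \<xi>))"
proof (rule is_ft_transport[where T = "dilate A" and T' = "\<lambda>g \<xi>. of_real (sqrt \<bar>det B\<bar>) * g (B *v \<xi>)", OF _ _ _ _ _ _ ft])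
  have At: "invertible (transpose A)" using A by (rule matrix_inv_inv)
  have B: "invertible B" unfolding B_def using At by (rule matrix_inv_inv)
  have detA: "det A \<noteq> 0" using A by (simp add: invertible_det_nz)
  have detB: "det B = 1 / det A" unfolding B_def using matrix_inv_inv(2)[OF At] by (simp add: det_transpose)
  {
    fix f g :: "real^2 \<Rightarrow> complex" and M :: "real^2^2"
    assume f: "f \<in> sqint lborel" and g: "g \<in> sqint lborel" and M: "invertible M"
    have [measurable]: "f \<in> borel_measurable borel" "g \<in> borel_measurable borel" using f g by (auto dest: sqint_borel)
    have "sqnorm lborel (\<lambda>x. of_real (sqrt \<bar>det M\<bar>) * f (M *v x) - of_real (sqrt \<bar>det M\<bar>) * g (M *v x)) =
      sqnorm lborel (\<lambda>x. of_real (sqrt \<bar>det M\<bar>) * (f (M *v x) - g (M *v x)))"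
      by (simp only: right_diff_distrib)
    also have "\<dots> = sqnorm lborel (\<lambda>x. f x - g x)"
      using sqnorm_matrix[OF M, of "\<lambda>x. f x - g x"] by (simp add: sqnorm_cmult)
    finally have "sqnorm lborel (\<lambda>x. of_real (sqrt \<bar>det M\<bar>) * f (M *v x) - of_real (sqrt \<bar>det M\<bar>) * g (M *v x)) = sqnorm lborel (\<lambda>x. f x - g x)" .
  } note iso = this
  fix f g :: "real^2 \<Rightarrow> complex" assume f: "f \<in> sqint lborel" and g: "g \<in> sqint lborel"
  show "dilate A f \<in> sqint lborel" unfolding dilate_def using sqint_matrix[OF A f] by (rule sqint_cmult)
  show "(\<lambda>\<xi>. of_real (sqrt \<bar>det B\<bar>) * f (B *v \<xi>)) \<in> sqint lborel" using sqint_matrix[OF B f] by (rule sqint_cmult)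
  show "sqnorm lborel (\<lambda>x. dilate A f x - dilate A g x) = sqnorm lborel (\<lambda>x. f x - g x)"
    unfolding dilate_def using f g A by (rule iso)
  show "sqnorm lborel (\<lambda>x. of_real (sqrt \<bar>det B\<bar>) * f (B *v x) - of_real (sqrt \<bar>det B\<bar>) * g (B *v x)) = sqnorm lborel (\<lambda>x. f x - g x)"
    using f g B by (rule iso)
next
  have At: "invertible (transpose A)" using A by (rule matrix_inv_inv)
  have detA: "\<bar>det A\<bar> > 0" using A by (simp add: invertible_det_nz)
  have detB: "\<bar>det B\<bar> = 1 / \<bar>det A\<bar>" unfolding B_def using matrix_inv_inv(2)[OF At] by (simp add: det_transpose)
  fix f :: "real^2 \<Rightarrow> complex" assume f: "integrable lborel f"
  show "integrable lborel (dilate A f)"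
    unfolding dilate_def using integrable_matrix[OF A f] by (rule integrable_mult_right)
  show "L1_fourier (dilate A f) = (\<lambda>\<xi>. of_real (sqrt \<bar>det B\<bar>) * L1_fourier f (B *v \<xi>))"
  proof
    fix \<xi>
    have "L1_fourier f (B *v \<xi>) = of_real \<bar>det A\<bar> * L1_fourier (\<lambda>x. f (A *v x)) \<xi>"
      using L1_fourier_matrix[OF A, of f "B *v \<xi>"] f matrix_inv_inv(4)[OF At] by (auto simp: B_def)
    moreover have "L1_fourier (dilate A f) \<xi> = of_real (sqrt \<bar>det A\<bar>) * L1_fourier (\<lambda>x. f (A *v x)) \<xi>"
      unfolding dilate_def L1_fourier_cis mult.assoc by simp
    moreover have "sqrt \<bar>det A\<bar> = sqrt \<bar>det B\<bar> * \<bar>det A\<bar>"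
      using detA by (simp add: detB real_sqrt_divide real_div_sqrt)
    ultimately show "L1_fourier (dilate A f) \<xi> = of_real (sqrt \<bar>det B\<bar>) * L1_fourier f (B *v \<xi>)"
      by simp
  qed
qed

section \<open>Periodization over a lattice\<close>

text \<open>The absolute bound makes the family integrable over the product of
  \<open>count_space\<close> and \<open>lborel\<close>; all five conclusions are then parts of
  Fubini's theorem.\<close>

lemma count_space_fubini:
  fixes f :: "'i \<Rightarrow> real^2 \<Rightarrow> complex"
  assumes I: "countable I" and f: "\<And>i. i \<in> I \<Longrightarrow> f i \<in> borel_measurable borel"
    and fin: "(\<integral>\<^sup>+i. \<integral>\<^sup>+x. ennreal (norm (f i x)) \<partial>lborel \<partial>count_space I) < \<infinity>"
  shows "(LINT i|count_space I. LINT x|lborel. f i x) = (LINT x|lborel. LINT i|count_space I. f i x)"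
    and "integrable (count_space I) (\<lambda>i. LINT x|lborel. f i x)"
    and "integrable lborel (\<lambda>x. LINT i|count_space I. f i x)"
    and "AE x in lborel. integrable (count_space I) (\<lambda>i. f i x)"
    and "\<And>i. i \<in> I \<Longrightarrow> integrable lborel (f i)"
proof -
  interpret C: sigma_finite_measure "count_space I"
    using I by (rule sigma_finite_measure_count_space_countable)
  interpret pair_sigma_finite "count_space I" "lborel :: (real^2) measure" ..
  have m: "(\<lambda>(i, x). f i x) \<in> borel_measurable (count_space I \<Otimes>\<^sub>M lborel)"
    by (rule measurable_pair_measure_countable1[OF I]) (simp add: f)
  have int: "integrable (count_space I \<Otimes>\<^sub>M lborel) (\<lambda>(i, x). f i x)"
  proof (rule integrableI_bounded[OF m])
    have "(\<integral>\<^sup>+p. ennreal (norm (case p of (i, x) \<Rightarrow> f i x)) \<partial>(count_space I \<Otimes>\<^sub>M lborel)) =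
       (\<integral>\<^sup>+i. \<integral>\<^sup>+x. ennreal (norm (f i x)) \<partial>lborel \<partial>count_space I)"
      using m by (subst lborel.nn_integral_fst[symmetric]) auto
    then show "(\<integral>\<^sup>+p. ennreal (norm (case p of (i, x) \<Rightarrow> f i x)) \<partial>(count_space I \<Otimes>\<^sub>M lborel)) < \<infinity>" using fin by simp
  qed
  show "(LINT i|count_space I. LINT x|lborel. f i x) = (LINT x|lborel. LINT i|count_space I. f i x)"
    using Fubini_integral[OF int] by simp
  show "integrable (count_space I) (\<lambda>i. LINT x|lborel. f i x)" using integrable_fst[OF int] .
  show "integrable lborel (\<lambda>x. LINT i|count_space I. f i x)" using integrable_snd[OF int] .
  show "AE x in lborel. integrable (count_space I) (\<lambda>i. f i x)" using AE_integrable_snd[OF int] .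
  show "integrable lborel (f i)" if "i \<in> I" for i
    using AE_integrable_fst[OF int] that by (simp add: AE_count_space)
qed

lemma count_space_integral_measurable [measurable (raw)]:
  fixes f :: "'i \<Rightarrow> real^2 \<Rightarrow> complex"
  assumes I: "countable I" and f: "\<And>i. i \<in> I \<Longrightarrow> f i \<in> borel_measurable borel"
  shows "(\<lambda>x. LINT i|count_space I. f i x) \<in> borel_measurable borel"
proof -
  interpret C: sigma_finite_measure "count_space I"
    using I by (rule sigma_finite_measure_count_space_countable)
  have m: "(\<lambda>(i, x). f i x) \<in> borel_measurable (count_space I \<Otimes>\<^sub>M borel)"
    by (rule measurable_pair_measure_countable1[OF I]) (simp add: f)
  have "(\<lambda>(x, i). f i x) \<in> borel_measurable (borel \<Otimes>\<^sub>M count_space I)"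
    using measurable_pair_swap[OF m] by (simp add: case_prod_beta')
  then show ?thesis by (rule C.borel_measurable_lebesgue_integral)
qed

lemma count_space_nn_measurable:
  fixes f :: "'i \<Rightarrow> real^2 \<Rightarrow> ennreal"
  assumes I: "countable I" and f: "\<And>i. i \<in> I \<Longrightarrow> f i \<in> borel_measurable borel"
  shows "(\<lambda>x. \<integral>\<^sup>+i. f i x \<partial>count_space I) \<in> borel_measurable borel"
proof -
  interpret C: sigma_finite_measure "count_space I"
    using I by (rule sigma_finite_measure_count_space_countable)
  have m: "(\<lambda>(i, x). f i x) \<in> borel_measurable (count_space I \<Otimes>\<^sub>M borel)"
    by (rule measurable_pair_measure_countable1[OF I]) (simp add: f)
  have "(\<lambda>(x, i). f i x) \<in> borel_measurable (borel \<Otimes>\<^sub>M count_space I)"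
    using measurable_pair_swap[OF m] by (simp add: case_prod_beta')
  then show ?thesis by (rule C.borel_measurable_nn_integral)
qed

lemma bij_intvec_shift: "m \<in> intvec \<Longrightarrow> bij_betw (\<lambda>n. n + m) intvec intvec"
  by (rule bij_betw_byWitness[where f' = "\<lambda>n. n - m"]) (auto simp: intvec_add intvec_diff)

lemma count_space_singleton_sum:
  fixes h :: "'a \<Rightarrow> 'b::{banach, second_countable_topology}"
  assumes "m \<in> I" "\<And>n. n \<in> I \<Longrightarrow> n \<noteq> m \<Longrightarrow> h n = 0"
  shows "(LINT n|count_space I. h n) = h m"
proof -
  have "(LINT n|count_space I. h n) = (LINT n|count_space I. indicator {m} n *\<^sub>R h m)"
    using assms by (intro Bochner_Integration.integral_cong) (auto simp: indicator_def)
  also have "\<dots> = measure (count_space I) {m} *\<^sub>R h m"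
    using assms(1) by (subst has_bochner_integral_integral_eq[OF has_bochner_integral_indicator]) (auto simp: emeasure_count_space)
  finally show ?thesis using assms(1) by (simp add: measure_def)
qed

lemma integral_tile:
  fixes h :: "real^2 \<Rightarrow> complex"
  assumes h: "integrable lborel h"
  shows "(LINT x|lborel. h x) = (LINT x|lborel. indicator cell x * (LINT n|count_space intvec. h (n + x)))"
proof -
  have [measurable]: "h \<in> borel_measurable borel" using h by auto
  have b: "(\<integral>\<^sup>+x. ennreal (norm (h x)) \<partial>lborel) < \<infinity>" using h by (simp add: integrable_iff_bounded)
  have s: "(\<integral>\<^sup>+x. ennreal (norm (h x * indicator cell (x - n))) \<partial>lborel) = (\<integral>\<^sup>+x. ennreal (norm (h (n + x) * indicator cell x)) \<partial>lborel)" for n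
    using nn_integral_shift[of "\<lambda>x. ennreal (norm (h x * indicator cell (x - n)))" n] by simp
  have f2: "(\<integral>\<^sup>+n. \<integral>\<^sup>+x. ennreal (norm (h (n + x) * indicator cell x)) \<partial>lborel \<partial>count_space intvec) < \<infinity>"
  proof -
    have "ennreal (norm (h (n + x) * indicator cell x)) = ennreal (norm (h (n + x))) * indicator cell x" for n x
      by (simp add: indicator_def)
    then show ?thesis using b nn_integral_tile[of "\<lambda>x. ennreal (norm (h x))"] by simp
  qed
  have f1: "(\<integral>\<^sup>+n. \<integral>\<^sup>+x. ennreal (norm (h x * indicator cell (x - n))) \<partial>lborel \<partial>count_space intvec) < \<infinity>"
    unfolding s by (rule f2)
  have "(LINT x|lborel. h x) = (LINT x|lborel. LINT n|count_space intvec. h x * indicator cell (x - n))"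
  proof (intro Bochner_Integration.integral_cong refl)
    fix x
    obtain m where m: "m \<in> intvec" "x - m \<in> cell" "\<And>n. n \<in> intvec \<Longrightarrow> x - n \<in> cell \<Longrightarrow> n = m"
      using cell_unique[of x] by metis
    have "(LINT n|count_space intvec. h x * indicator cell (x - n)) = h x * indicator cell (x - m)"
      by (rule count_space_singleton_sum[OF m(1)]) (use m(3) in \<open>auto simp: indicator_def\<close>)
    then show "h x = (LINT n|count_space intvec. h x * indicator cell (x - n))" using m(2) by simp
  qed
  also have "\<dots> = (LINT n|count_space intvec. LINT x|lborel. h x * indicator cell (x - n))"
    by (rule count_space_fubini(1)[OF _ _ f1, symmetric]) auto
  also have "\<dots> = (LINT n|count_space intvec. LINT x|lborel. h (n + x) * indicator cell x)"
  proof (rule Bochner_Integration.integral_cong[OF refl])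
    fix n
    show "(LINT x|lborel. h x * indicator cell (x - n)) = (LINT x|lborel. h (n + x) * indicator cell x)"
      using integral_shift[of "\<lambda>x. h x * indicator cell (x - n)" n] by simp
  qed
  also have "\<dots> = (LINT x|lborel. LINT n|count_space intvec. h (n + x) * indicator cell x)"
    by (rule count_space_fubini(1)[OF _ _ f2]) auto
  finally show ?thesis by (simp add: mult.commute)
qed

lemma parseval_cell_inner:
  assumes U: "U \<in> sqint lborel" "\<And>x. x \<notin> cell \<Longrightarrow> U x = 0" and V: "V \<in> sqint lborel" "\<And>x. x \<notin> cell \<Longrightarrow> V x = 0"
  shows "L1_fourier U \<in> sqint (count_space intvec)"
    and "sqinner (count_space intvec) (L1_fourier U) (L1_fourier V) = sqinner lborel U V"
proof -
  have s: "L1_fourier W \<in> sqint (count_space intvec)" "sqnorm (count_space intvec) (L1_fourier W) = sqnorm lborel W"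
    if W: "W \<in> sqint lborel" "\<And>x. x \<notin> cell \<Longrightarrow> W x = 0" for W
  proof -
    have p: "sqmass (count_space intvec) (L1_fourier W) = sqmass lborel W"
      using W by (rule parseval_cell)
    then show 1: "L1_fourier W \<in> sqint (count_space intvec)" using W(1) by (simp add: sqint_iff_nn)
    show "sqnorm (count_space intvec) (L1_fourier W) = sqnorm lborel W"
      using p unfolding sqnorm_nn[OF 1] sqnorm_nn[OF W(1)] by simp
  qed
  show "L1_fourier U \<in> sqint (count_space intvec)" using U by (rule s)
  have add: "sqnorm (count_space intvec) (\<lambda>n. L1_fourier U n + c * L1_fourier V n) = sqnorm lborel (\<lambda>x. U x + c * V x)" for c
  proof -
    have "integrable lborel U" "integrable lborel V" using U V sqint_cell_integrable by auto
    then have "(\<lambda>n. L1_fourier U n + c * L1_fourier V n) = L1_fourier (\<lambda>x. U x + c * V x)"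
      by (simp add: fun_eq_iff L1_fourier_add_cmult)
    moreover have "(\<lambda>x. U x + c * V x) \<in> sqint lborel" using U(1) V(1) by (intro sqint_add sqint_cmult)
    ultimately show ?thesis using U(2) V(2) s(2)[of "\<lambda>x. U x + c * V x"] by simp
  qed
  show "sqinner (count_space intvec) (L1_fourier U) (L1_fourier V) = sqinner lborel U V"
    using add[of 1] add[of "-1"] add[of \<i>] add[of "-\<i>"]
    by (simp add: sqinner_polarization s U V)
qed

definition per :: "(real^2 \<Rightarrow> complex) \<Rightarrow> real^2 \<Rightarrow> complex" where
  "per u x = (LINT n|count_space intvec. u (n + x))"

definition per_norm :: "(real^2 \<Rightarrow> complex) \<Rightarrow> real^2 \<Rightarrow> ennreal" where
  "per_norm u x = (\<integral>\<^sup>+n. ennreal (norm (u (n + x))) \<partial>count_space intvec)"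

lemma per_shift:
  assumes m: "m \<in> intvec"
  shows "per u (m + x) = per u x" "per_norm u (m + x) = per_norm u x"
proof -
  note b = bij_intvec_shift[OF m]
  have "integral\<^sup>L (distr (count_space intvec) (count_space intvec) (\<lambda>n. n + m)) (\<lambda>n. u (n + x)) = (LINT n|count_space intvec. u (n + m + x))"
    by (rule integral_distr) (use b in \<open>auto simp: bij_betw_def\<close>)
  moreover have "distr (count_space intvec) (count_space intvec) (\<lambda>n. n + m) = count_space intvec"
    using b by (rule distr_bij_count_space)
  ultimately show "per u (m + x) = per u x" unfolding per_def by (simp add: add.assoc)
  show "per_norm u (m + x) = per_norm u x"
    unfolding per_norm_def using nn_integral_bij_count_space[OF b, of "\<lambda>n. ennreal (norm (u (n + x)))"] by (simp add: add.assoc)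
qed

lemma per_measurable [measurable]:
  assumes [measurable]: "u \<in> borel_measurable borel"
  shows "per u \<in> borel_measurable borel" "per_norm u \<in> borel_measurable borel"
  unfolding per_def[abs_def] per_norm_def[abs_def]
  by (intro count_space_integral_measurable count_space_nn_measurable countable_intvec; measurable)+

text \<open>Without absolute convergence \<open>per u x\<close> is 0, the default of the Bochner
  integral, so the bound holds unconditionally.\<close>

lemma norm_per_le: "ennreal (norm (per u x)) \<le> per_norm u x"
proof (cases "integrable (count_space intvec) (\<lambda>n. u (n + x))")
  case True
  then show ?thesis unfolding per_def per_norm_def by (rule integral_norm_bound_ennreal)
next
  case False
  then show ?thesis by (simp add: per_def not_integrable_integral_eq)
qed

text \<open>Unfolding: the plane is tiled by cells, \<open>per_norm u\<close> is periodic and comes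
  out of the sum, and the translates of v add up to its own periodization.\<close>

lemma per_norm_cell:
  assumes [measurable]: "u \<in> borel_measurable borel" "v \<in> borel_measurable borel"
  shows "(\<integral>\<^sup>+x. per_norm u x * ennreal (norm (v x)) \<partial>lborel) = (\<integral>\<^sup>+x. per_norm u x * per_norm v x * indicator cell x \<partial>lborel)"
proof -
  have "(\<integral>\<^sup>+x. per_norm u x * ennreal (norm (v x)) \<partial>lborel) =
    (\<integral>\<^sup>+n. \<integral>\<^sup>+x. per_norm u (n + x) * ennreal (norm (v (n + x))) * indicator cell x \<partial>lborel \<partial>count_space intvec)"
    by (rule nn_integral_tile) measurable
  also have "\<dots> = (\<integral>\<^sup>+n. \<integral>\<^sup>+x. per_norm u x * ennreal (norm (v (n + x))) * indicator cell x \<partial>lborel \<partial>count_space intvec)"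
    by (intro nn_integral_cong) (simp add: per_shift)
  also have "\<dots> = (\<integral>\<^sup>+x. \<integral>\<^sup>+n. (per_norm u x * indicator cell x) * ennreal (norm (v (n + x))) \<partial>count_space intvec \<partial>lborel)"
    by (subst nn_integral_count_space_nn_integral) (auto simp: mult_ac)
  also have "\<dots> = (\<integral>\<^sup>+x. per_norm u x * per_norm v x * indicator cell x \<partial>lborel)"
    by (intro nn_integral_cong) (simp add: nn_integral_cmult per_norm_def[of v] mult_ac)
  finally show ?thesis .
qed

lemma ennreal_mult_le_sq: "(a :: ennreal) * b \<le> a * a + b * b"
proof (cases "a \<le> b")
  case True
  then have "a * b \<le> b * b" by (intro mult_right_mono) auto
  then show ?thesis by (simp add: add_increasing)
next
  case False
  then have "a * b \<le> a * a" by (intro mult_left_mono) auto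
  then show ?thesis by (simp add: add_increasing2)
qed

text \<open>At integer points the Fourier coefficients of u are those of its periodization cut to
  the cell, because the characters are periodic. Parseval on the cell and unfolding give the
  integral of \<open>per u\<close> against v; the summand n = 0 of \<open>per u\<close> is the main
  term, the others form the error.\<close>

lemma periodization_parseval:
  assumes [measurable]: "u \<in> borel_measurable borel" "v \<in> borel_measurable borel"
    and Ju: "(\<integral>\<^sup>+x. per_norm u x * ennreal (norm (u x)) \<partial>lborel) < \<infinity>"
    and Jv: "(\<integral>\<^sup>+x. per_norm v x * ennreal (norm (v x)) \<partial>lborel) < \<infinity>"
  shows "L1_fourier u \<in> sqint (count_space intvec)"
    and "sqmass (count_space intvec) (L1_fourier u) \<le> (\<integral>\<^sup>+x. per_norm u x * ennreal (norm (u x)) \<partial>lborel)"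
    and "ennreal (norm (sqinner (count_space intvec) (L1_fourier u) (L1_fourier v) - (LINT x|lborel. u x * cnj (v x))))
      \<le> (\<integral>\<^sup>+n. \<integral>\<^sup>+x. ennreal (norm (u (n + x)) * norm (v x)) \<partial>lborel \<partial>count_space (intvec - {0}))"
proof -
  define C where "C w x = indicator cell x * per w x" for w x
  have main: "C w \<in> sqint lborel" "integrable lborel w" "\<And>m. m \<in> intvec \<Longrightarrow> L1_fourier w m = L1_fourier (C w) m"
     "sqmass lborel (C w) \<le> (\<integral>\<^sup>+x. per_norm w x * ennreal (norm (w x)) \<partial>lborel)"
    if w [measurable]: "w \<in> borel_measurable borel" and Jw: "(\<integral>\<^sup>+x. per_norm w x * ennreal (norm (w x)) \<partial>lborel) < \<infinity>" for w
  proof -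
    have [measurable]: "C w \<in> borel_measurable borel" unfolding C_def by measurable
    show le: "sqmass lborel (C w) \<le> (\<integral>\<^sup>+x. per_norm w x * ennreal (norm (w x)) \<partial>lborel)"
      unfolding per_norm_cell[OF w w]
    proof (rule nn_integral_mono)
      fix x
      have "ennreal ((norm (per w x))\<^sup>2) = ennreal (norm (per w x)) * ennreal (norm (per w x))"
        by (simp add: ennreal_mult power2_eq_square)
      also have "\<dots> \<le> per_norm w x * per_norm w x" by (intro mult_mono norm_per_le) auto
      finally show "ennreal ((norm (C w x))\<^sup>2) \<le> per_norm w x * per_norm w x * indicator cell x"
        by (simp add: C_def indicator_def)
    qed
    then show Cw: "C w \<in> sqint lborel" using Jw by (auto simp: sqint_iff_nn)
    have "(\<integral>\<^sup>+x. ennreal (norm (w x)) \<partial>lborel) = (\<integral>\<^sup>+n. \<integral>\<^sup>+x. ennreal (norm (w (n + x))) * indicator cell x \<partial>lborel \<partial>count_space intvec)"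
      by (rule nn_integral_tile) measurable
    also have "\<dots> = (\<integral>\<^sup>+x. \<integral>\<^sup>+n. ennreal (norm (w (n + x))) * indicator cell x \<partial>count_space intvec \<partial>lborel)"
      by (rule nn_integral_count_space_nn_integral[symmetric]) auto
    also have "\<dots> = (\<integral>\<^sup>+x. per_norm w x * indicator cell x \<partial>lborel)"
      by (intro nn_integral_cong) (simp add: nn_integral_multc per_norm_def)
    \<comment> \<open>The cell has measure 1, so p \<le> p^2 + 1 turns the finite quadratic quantity
      into integrability of w.\<close>
    also have "\<dots> \<le> (\<integral>\<^sup>+x. per_norm w x * per_norm w x * indicator cell x + indicator cell x \<partial>lborel)"
    proof (rule nn_integral_mono)
      fix x
      show "per_norm w x * indicator cell x \<le> per_norm w x * per_norm w x * indicator cell x + indicator cell x"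
        using ennreal_mult_le_sq[of "per_norm w x" 1] by (cases "x \<in> cell") auto
    qed
    also have "\<dots> = (\<integral>\<^sup>+x. per_norm w x * ennreal (norm (w x)) \<partial>lborel) + 1"
      by (subst nn_integral_add) (auto simp: per_norm_cell emeasure_cell)
    also have "\<dots> < \<infinity>" using Jw by (simp add: ennreal_add_eq_top less_top[symmetric])
    finally show wi: "integrable lborel w" by (simp add: integrable_iff_bounded)
    fix m assume m: "m \<in> intvec"
    have "L1_fourier w m = (LINT x|lborel. indicator cell x * (LINT n|count_space intvec. w (n + x) * cis (- (2 * pi * (m \<bullet> (n + x))))))"
      unfolding L1_fourier_cis by (rule integral_tile) (use wi in auto)
    also have "\<dots> = (LINT x|lborel. C w x * cis (- (2 * pi * (m \<bullet> x))))"
    proof (intro Bochner_Integration.integral_cong refl)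
      fix x
      have "(LINT n|count_space intvec. w (n + x) * cis (- (2 * pi * (m \<bullet> (n + x))))) =
         (LINT n|count_space intvec. w (n + x) * cis (- (2 * pi * (m \<bullet> x))))"
      proof (intro Bochner_Integration.integral_cong refl)
        fix n assume "n \<in> space (count_space intvec)"
        then have "- (m \<bullet> n) \<in> \<int>" using m by (intro Ints_minus intvec_inner) auto
        then have "cis (2 * pi * (- (m \<bullet> n))) = 1" by (rule cis_int)
        moreover have "cis (- (2 * pi * (m \<bullet> (n + x)))) = cis (2 * pi * (- (m \<bullet> n))) * cis (- (2 * pi * (m \<bullet> x)))"
          unfolding cis_mult by (simp add: inner_add_right algebra_simps)
        ultimately show "w (n + x) * cis (- (2 * pi * (m \<bullet> (n + x)))) = w (n + x) * cis (- (2 * pi * (m \<bullet> x)))" by simp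
      qed
      then show "indicator cell x * (LINT n|count_space intvec. w (n + x) * cis (- (2 * pi * (m \<bullet> (n + x))))) = C w x * cis (- (2 * pi * (m \<bullet> x)))"
        by (simp add: C_def per_def)
    qed
    finally show "L1_fourier w m = L1_fourier (C w) m" by (simp add: L1_fourier_cis)
  qed
  have C0: "x \<notin> cell \<Longrightarrow> C w x = 0" for w x by (simp add: C_def)
  note u = main[OF assms(1) Ju] and v = main[OF assms(2) Jv]
  show sq: "L1_fourier u \<in> sqint (count_space intvec)"
  proof (rule sqint_dominated)
    show "L1_fourier (C u) \<in> sqint (count_space intvec)"
      by (rule parseval_cell_inner(1)[OF u(1) _ u(1)]) (auto simp: C0)
  qed (use u(3) in \<open>auto simp: AE_count_space\<close>)
  have "sqmass (count_space intvec) (L1_fourier u) = sqmass (count_space intvec) (L1_fourier (C u))"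
    using u(3) by (intro nn_integral_cong) auto
  also have "\<dots> = sqmass lborel (C u)" using u(1) C0 by (rule parseval_cell)
  finally show "sqmass (count_space intvec) (L1_fourier u) \<le> (\<integral>\<^sup>+x. per_norm u x * ennreal (norm (u x)) \<partial>lborel)"
    using u(4) by simp
  have Juv: "(\<integral>\<^sup>+x. per_norm u x * ennreal (norm (v x)) \<partial>lborel) < \<infinity>"
  proof -
    have "(\<integral>\<^sup>+x. per_norm u x * ennreal (norm (v x)) \<partial>lborel) \<le>
      (\<integral>\<^sup>+x. per_norm u x * per_norm u x * indicator cell x + per_norm v x * per_norm v x * indicator cell x \<partial>lborel)"
      unfolding per_norm_cell[OF assms(1,2)] distrib_right[symmetric]
      by (intro nn_integral_mono mult_right_mono ennreal_mult_le_sq) auto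
    also have "\<dots> = (\<integral>\<^sup>+x. per_norm u x * ennreal (norm (u x)) \<partial>lborel) + (\<integral>\<^sup>+x. per_norm v x * ennreal (norm (v x)) \<partial>lborel)"
      by (subst nn_integral_add) (auto simp: per_norm_cell)
    also have "\<dots> < \<infinity>" using Ju Jv by (simp add: less_top[symmetric] ennreal_add_eq_top)
    finally show ?thesis .
  qed
  have puv: "integrable lborel (\<lambda>x. per u x * cnj (v x))"
  proof (rule integrableI_bounded)
    have "(\<integral>\<^sup>+x. ennreal (norm (per u x * cnj (v x))) \<partial>lborel) \<le> (\<integral>\<^sup>+x. per_norm u x * ennreal (norm (v x)) \<partial>lborel)"
      by (intro nn_integral_mono) (simp add: norm_mult ennreal_mult mult_right_mono norm_per_le)
    then show "(\<integral>\<^sup>+x. ennreal (norm (per u x * cnj (v x))) \<partial>lborel) < \<infinity>" using Juv by (rule le_less_trans)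
  qed measurable
  have uv: "integrable lborel (\<lambda>x. u x * cnj (v x))"
  proof (rule integrableI_bounded)
    have "ennreal (norm (u x)) \<le> per_norm u x" for x
    proof -
      have "ennreal (norm (u (0 + x))) \<le> per_norm u x" unfolding per_norm_def by (rule nn_integral_ge_point) simp
      then show ?thesis by simp
    qed
    then have "(\<integral>\<^sup>+x. ennreal (norm (u x * cnj (v x))) \<partial>lborel) \<le> (\<integral>\<^sup>+x. per_norm u x * ennreal (norm (v x)) \<partial>lborel)"
      by (intro nn_integral_mono) (simp add: norm_mult ennreal_mult mult_right_mono)
    then show "(\<integral>\<^sup>+x. ennreal (norm (u x * cnj (v x))) \<partial>lborel) < \<infinity>" using Juv by (rule le_less_trans)
  qed measurable
  have "sqinner (count_space intvec) (L1_fourier u) (L1_fourier v) = sqinner (count_space intvec) (L1_fourier (C u)) (L1_fourier (C v))"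
    unfolding sqinner_def using u(3) v(3) by (intro Bochner_Integration.integral_cong) auto
  also have "\<dots> = sqinner lborel (C u) (C v)"
    using u(1) C0 v(1) C0 by (rule parseval_cell_inner(2))
  also have "\<dots> = (LINT x|lborel. indicator cell x * (LINT n|count_space intvec. per u (n + x) * cnj (v (n + x))))"
    unfolding sqinner_def
  proof (intro Bochner_Integration.integral_cong refl)
    fix x
    have "(LINT n|count_space intvec. per u (n + x) * cnj (v (n + x))) = (LINT n|count_space intvec. per u x * cnj (v (n + x)))"
      by (intro Bochner_Integration.integral_cong refl) (simp add: per_shift)
    also have "\<dots> = per u x * cnj (per v x)"
      unfolding per_def[of v] by (simp only: Bochner_Integration.integral_cnj[symmetric] integral_mult_right_zero)
    finally show "C u x * cnj (C v x) = indicator cell x * (LINT n|count_space intvec. per u (n + x) * cnj (v (n + x)))"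
      by (simp add: C_def indicator_def)
  qed
  also have "\<dots> = (LINT x|lborel. per u x * cnj (v x))" using puv by (rule integral_tile[symmetric])
  finally have eq: "sqinner (count_space intvec) (L1_fourier u) (L1_fourier v) - (LINT x|lborel. u x * cnj (v x)) =
     (LINT x|lborel. per u x * cnj (v x) - u x * cnj (v x))"
    using puv uv by simp
  have "ennreal (norm (sqinner (count_space intvec) (L1_fourier u) (L1_fourier v) - (LINT x|lborel. u x * cnj (v x))))
     \<le> (\<integral>\<^sup>+x. ennreal (norm (per u x * cnj (v x) - u x * cnj (v x))) \<partial>lborel)"
    unfolding eq by (intro integral_norm_bound_ennreal Bochner_Integration.integrable_diff puv uv)
  also have "\<dots> \<le> (\<integral>\<^sup>+x. \<integral>\<^sup>+n. ennreal (norm (u (n + x)) * norm (v x)) \<partial>count_space (intvec - {0}) \<partial>lborel)"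
  proof (rule nn_integral_mono_AE)
    have "AE x in lborel. per_norm u x * ennreal (norm (v x)) \<noteq> \<infinity>"
      using Juv by (intro nn_integral_PInf_AE) auto
    then show "AE x in lborel. ennreal (norm (per u x * cnj (v x) - u x * cnj (v x)))
      \<le> (\<integral>\<^sup>+n. ennreal (norm (u (n + x)) * norm (v x)) \<partial>count_space (intvec - {0}))"
    proof eventually_elim
      case (elim x)
      show ?case
      \<comment> \<open>Finiteness of the product controls \<open>per_norm u x\<close> only where v
        x is nonzero; elsewhere the left side is 0.\<close>
      proof (cases "v x = 0")
        case False
        then have "per_norm u x < \<infinity>"
          using elim by (auto simp: ennreal_mult_eq_top_iff less_top)
        then have pi: "integrable (count_space intvec) (\<lambda>n. u (n + x))"
          by (simp add: integrable_iff_bounded per_norm_def)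
        define d where "d n = (if n = 0 then 0 else u (n + x))" for n
        have di: "integrable (count_space intvec) d"
          by (rule Bochner_Integration.integrable_bound[OF pi]) (auto simp: d_def)
        have "per u x - u x = (LINT n|count_space intvec. d n)"
        proof -
          have ii: "integrable (count_space intvec) (\<lambda>n. u (n + x) - d n)" using pi di by simp
          have "(LINT n|count_space intvec. u (n + x) - d n) = u (0 + x) - d 0"
            by (rule count_space_singleton_sum) (auto simp: d_def)
          moreover have "(LINT n|count_space intvec. u (n + x) - d n) = per u x - (LINT n|count_space intvec. d n)"
            unfolding per_def using pi di by (rule Bochner_Integration.integral_diff)
          moreover have "d 0 = 0" by (simp add: d_def)
          ultimately show ?thesis by (simp add: algebra_simps)
        qed
        then have "ennreal (norm (per u x - u x)) \<le> (\<integral>\<^sup>+n. ennreal (norm (d n)) \<partial>count_space intvec)"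
          using integral_norm_bound_ennreal[OF di] by simp
        also have "\<dots> = (\<integral>\<^sup>+n. ennreal (norm (d n)) \<partial>count_space (intvec - {0}))"
          by (rule nn_integral_count_space_eq) (auto simp: d_def)
        also have "\<dots> = (\<integral>\<^sup>+n. ennreal (norm (u (n + x))) \<partial>count_space (intvec - {0}))"
          by (intro nn_integral_cong) (auto simp: d_def)
        finally have "ennreal (norm (per u x - u x)) * ennreal (norm (v x)) \<le>
          (\<integral>\<^sup>+n. ennreal (norm (u (n + x))) \<partial>count_space (intvec - {0})) * ennreal (norm (v x))"
          by (intro mult_right_mono) auto
        then show ?thesis
          by (simp add: norm_mult ennreal_mult nn_integral_multc flip: left_diff_distrib)
      qed simp
    qed
  qed
  also have "\<dots> = (\<integral>\<^sup>+n. \<integral>\<^sup>+x. ennreal (norm (u (n + x)) * norm (v x)) \<partial>lborel \<partial>count_space (intvec - {0}))"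
    by (rule nn_integral_count_space_nn_integral) auto
  finally show "ennreal (norm (sqinner (count_space intvec) (L1_fourier u) (L1_fourier v) - (LINT x|lborel. u x * cnj (v x))))
      \<le> (\<integral>\<^sup>+n. \<integral>\<^sup>+x. ennreal (norm (u (n + x)) * norm (v x)) \<partial>lborel \<partial>count_space (intvec - {0}))" .
qed

section \<open>Wave systems on the frequency side\<close>

text \<open>The Fourier transform of a wavepacket: translation becomes a character and dilation the
  change of variable \<open>M\<close>, as \<open>wavepacket_fourier\<close> confirms.\<close>

definition atom :: "real^2^2 \<Rightarrow> (real^2 \<Rightarrow> complex) \<Rightarrow> real^2 \<Rightarrow> real^2 \<Rightarrow> complex" where
  "atom M w \<mu> \<xi> = of_real (sqrt \<bar>det M\<bar>) * (cis (- (2 * pi * ((M *v \<xi>) \<bullet> \<mu>))) * w (M *v \<xi>))"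

text \<open>The inner products of \<open>H\<close> with the atoms at the lattice points are the Fourier coefficients of
  this function.\<close>

definition chan :: "real^2^2 \<Rightarrow> (real^2 \<Rightarrow> complex) \<Rightarrow> (real^2 \<Rightarrow> complex) \<Rightarrow> real^2 \<Rightarrow> complex" where
  "chan M w H x = of_real (1 / sqrt \<bar>det M\<bar>) * (cnj (H (matrix_inv M *v x)) * w x)"

lemma atom_measurable [measurable]:
  assumes [measurable]: "w \<in> borel_measurable borel"
  shows "atom M w \<mu> \<in> borel_measurable borel"
  unfolding atom_def[abs_def] by measurable

lemma chan_measurable [measurable]:
  assumes [measurable]: "w \<in> borel_measurable borel" "H \<in> borel_measurable borel"
  shows "chan M w H \<in> borel_measurable borel"
  unfolding chan_def[abs_def] by measurable

text \<open>Substitute x = M \<xi>. The atom stands in the first argument, so \<open>H\<close>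
  enters conjugated, as in \<open>chan\<close>.\<close>

lemma atom_coeff:
  assumes M: "invertible M" and [measurable]: "w \<in> borel_measurable borel" "H \<in> borel_measurable borel"
  shows "sqinner lborel (atom M w \<mu>) H = L1_fourier (chan M w H) \<mu>"
proof -
  have d: "\<bar>det M\<bar> > 0" using M by (simp add: invertible_det_nz)
  have s: "of_real \<bar>det M\<bar> * (of_real (1 / sqrt \<bar>det M\<bar>) * z) = of_real (sqrt \<bar>det M\<bar>) * z" for z :: complex
  proof -
    have "\<bar>det M\<bar> * (1 / sqrt \<bar>det M\<bar>) = sqrt \<bar>det M\<bar>" using d by (simp add: real_div_sqrt)
    then show ?thesis by (simp only: mult.assoc[symmetric] of_real_mult[symmetric])
  qed
  have "L1_fourier (chan M w H) \<mu> = \<bar>det M\<bar> *\<^sub>R (LINT \<xi>|lborel. chan M w H (M *v \<xi>) * cis (- (2 * pi * (\<mu> \<bullet> (M *v \<xi>)))))"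
    unfolding L1_fourier_cis by (rule integral_matrix[OF M]) measurable
  also have "\<dots> = (LINT \<xi>|lborel. of_real \<bar>det M\<bar> * (chan M w H (M *v \<xi>) * cis (- (2 * pi * (\<mu> \<bullet> (M *v \<xi>))))))"
    unfolding scaleR_conv_of_real by (rule integral_mult_right_zero[symmetric])
  also have "\<dots> = (LINT \<xi>|lborel. atom M w \<mu> \<xi> * cnj (H \<xi>))"
    unfolding chan_def atom_def mult.assoc s
    by (simp add: matrix_inv_inv[OF M] inner_commute mult_ac)
  finally show ?thesis by (simp add: sqinner_def)
qed

lemma chan_inner:
  assumes M: "invertible M" and [measurable]: "w \<in> borel_measurable borel" "w' \<in> borel_measurable borel"
    "G \<in> borel_measurable borel" "K \<in> borel_measurable borel"
  shows "(LINT x|lborel. chan M w K x * cnj (chan M w' G x)) =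
    (LINT \<xi>|lborel. G \<xi> * cnj (K \<xi>) * (w (M *v \<xi>) * cnj (w' (M *v \<xi>))))"
proof -
  have d: "\<bar>det M\<bar> > 0" using M by (simp add: invertible_det_nz)
  have s: "of_real \<bar>det M\<bar> * (of_real (1 / sqrt \<bar>det M\<bar>) * (of_real (1 / sqrt \<bar>det M\<bar>) * z)) = z" for z :: complex
  proof -
    have "\<bar>det M\<bar> * (1 / sqrt \<bar>det M\<bar> * (1 / sqrt \<bar>det M\<bar>)) = 1" using d by simp
    then show ?thesis by (simp only: mult.assoc[symmetric] of_real_mult[symmetric]) simp
  qed
  have "(LINT x|lborel. chan M w K x * cnj (chan M w' G x)) =
     \<bar>det M\<bar> *\<^sub>R (LINT \<xi>|lborel. chan M w K (M *v \<xi>) * cnj (chan M w' G (M *v \<xi>)))"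
    by (rule integral_matrix[OF M]) measurable
  also have "\<dots> = (LINT \<xi>|lborel. of_real \<bar>det M\<bar> * (chan M w K (M *v \<xi>) * cnj (chan M w' G (M *v \<xi>))))"
    unfolding scaleR_conv_of_real by (rule integral_mult_right_zero[symmetric])
  also have "\<dots> = (LINT \<xi>|lborel. G \<xi> * cnj (K \<xi>) * (w (M *v \<xi>) * cnj (w' (M *v \<xi>))))"
  proof (rule Bochner_Integration.integral_cong[OF refl])
    fix \<xi>
    have "of_real \<bar>det M\<bar> * (chan M w K (M *v \<xi>) * cnj (chan M w' G (M *v \<xi>))) =
      of_real \<bar>det M\<bar> * (of_real (1 / sqrt \<bar>det M\<bar>) * (of_real (1 / sqrt \<bar>det M\<bar>) *
        (G \<xi> * cnj (K \<xi>) * (w (M *v \<xi>) * cnj (w' (M *v \<xi>))))))"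
      unfolding chan_def by (simp add: matrix_inv_inv[OF M] mult_ac)
    then show "of_real \<bar>det M\<bar> * (chan M w K (M *v \<xi>) * cnj (chan M w' G (M *v \<xi>))) =
        G \<xi> * cnj (K \<xi>) * (w (M *v \<xi>) * cnj (w' (M *v \<xi>)))" unfolding s .
  qed
  finally show ?thesis .
qed

lemma chan_weight_integral:
  fixes M :: "real^2^2"
  assumes M: "invertible M" and [measurable]: "H \<in> borel_measurable borel" "p \<in> borel_measurable borel"
  shows "(\<integral>\<^sup>+x. ennreal ((1 / \<bar>det M\<bar>) * ((norm (H (matrix_inv M *v x)))\<^sup>2 * \<bar>p x\<bar>)) \<partial>lborel) =
    (\<integral>\<^sup>+\<xi>. ennreal ((norm (H \<xi> :: complex))\<^sup>2 * \<bar>p (M *v \<xi>)\<bar>) \<partial>lborel)"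
proof -
  have d: "\<bar>det M\<bar> > 0" using M by (simp add: invertible_det_nz)
  have "(\<integral>\<^sup>+x. ennreal ((1 / \<bar>det M\<bar>) * ((norm (H (matrix_inv M *v x)))\<^sup>2 * \<bar>p x\<bar>)) \<partial>lborel) =
    ennreal \<bar>det M\<bar> * (\<integral>\<^sup>+\<xi>. ennreal ((1 / \<bar>det M\<bar>) * ((norm (H (matrix_inv M *v (M *v \<xi>))))\<^sup>2 * \<bar>p (M *v \<xi>)\<bar>)) \<partial>lborel)"
    by (rule nn_integral_matrix[OF M]) measurable
  also have "\<dots> = (\<integral>\<^sup>+\<xi>. ennreal \<bar>det M\<bar> * ennreal ((1 / \<bar>det M\<bar>) * ((norm (H \<xi>))\<^sup>2 * \<bar>p (M *v \<xi>)\<bar>)) \<partial>lborel)"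
    by (subst nn_integral_cmult) (simp_all add: matrix_inv_inv[OF M])
  also have "\<dots> = (\<integral>\<^sup>+\<xi>. ennreal ((norm (H \<xi>))\<^sup>2 * \<bar>p (M *v \<xi>)\<bar>) \<partial>lborel)"
    using d by (intro nn_integral_cong) (simp add: ennreal_mult'[symmetric])
  finally show ?thesis .
qed

text \<open>The pointwise part of the Schur test: the weighted inequality a b \<le> t/2 a^2 + 1/(2t)
  b^2 separates \<open>H\<close> from \<open>K\<close>, and each term retains a product of two
  values of \<open>w\<close>.\<close>

lemma chan_corr_le:
  assumes M: "invertible M" and [measurable]: "w \<in> borel_measurable borel"
    "v \<in> borel_measurable borel" "v' \<in> borel_measurable borel"
    "H \<in> borel_measurable borel" "K \<in> borel_measurable borel"
    and v: "\<And>x. norm (v x) \<le> norm (w x)" "\<And>x. norm (v' x) \<le> norm (w x)" and t: "t > 0"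
  shows "(\<integral>\<^sup>+x. ennreal (norm (chan M v H (\<gamma> + x)) * norm (chan M v' K x)) \<partial>lborel) \<le>
    ennreal (t / 2) * (\<integral>\<^sup>+\<xi>. ennreal ((norm (H \<xi>))\<^sup>2 * (norm (w (M *v \<xi>)) * norm (w (M *v \<xi> - \<gamma>)))) \<partial>lborel) +
    ennreal (1 / (2 * t)) * (\<integral>\<^sup>+\<xi>. ennreal ((norm (K \<xi>))\<^sup>2 * (norm (w (M *v \<xi>)) * norm (w (M *v \<xi> + \<gamma>)))) \<partial>lborel)"
proof -
  have d: "\<bar>det M\<bar> > 0" using M by (simp add: invertible_det_nz)
  define h where "h x = norm (H (matrix_inv M *v x))" for x
  define k where "k x = norm (K (matrix_inv M *v x))" for x
  have [measurable]: "h \<in> borel_measurable borel" "k \<in> borel_measurable borel" unfolding h_def k_def by measurable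
  have pt: "norm (chan M v H (\<gamma> + x)) * norm (chan M v' K x) \<le>
    t / 2 * ((1 / \<bar>det M\<bar>) * ((h (\<gamma> + x))\<^sup>2 * (norm (w (\<gamma> + x)) * norm (w x)))) +
    1 / (2 * t) * ((1 / \<bar>det M\<bar>) * ((k x)\<^sup>2 * (norm (w (\<gamma> + x)) * norm (w x))))" for x
  proof -
    have am: "a * b \<le> t / 2 * a\<^sup>2 + 1 / (2 * t) * b\<^sup>2" for a b :: real
    proof -
      have "0 \<le> (t * a - b)\<^sup>2 / (2 * t)" using t by simp
      also have "\<dots> = t / 2 * a\<^sup>2 + 1 / (2 * t) * b\<^sup>2 - a * b"
        using t by (simp add: power2_eq_square field_simps)
      finally show ?thesis by simp
    qed
    define p where "p = norm (w (\<gamma> + x)) * norm (w x) / \<bar>det M\<bar>"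
    have p: "p \<ge> 0" by (simp add: p_def)
    have "norm (chan M v H (\<gamma> + x)) * norm (chan M v' K x) = h (\<gamma> + x) * k x * (norm (v (\<gamma> + x)) * norm (v' x) / \<bar>det M\<bar>)"
      using d by (simp add: chan_def norm_mult norm_divide h_def k_def field_simps)
    also have "\<dots> \<le> h (\<gamma> + x) * k x * p"
      unfolding p_def by (intro mult_left_mono divide_right_mono mult_mono v) (auto simp: h_def k_def)
    also have "\<dots> \<le> (t / 2 * (h (\<gamma> + x))\<^sup>2 + 1 / (2 * t) * (k x)\<^sup>2) * p"
      using p by (intro mult_right_mono am)
    finally show ?thesis by (simp add: p_def algebra_simps)
  qed
  have "(\<integral>\<^sup>+x. ennreal (norm (chan M v H (\<gamma> + x)) * norm (chan M v' K x)) \<partial>lborel) \<le>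
    (\<integral>\<^sup>+x. ennreal (t / 2) * ennreal ((1 / \<bar>det M\<bar>) * ((h (\<gamma> + x))\<^sup>2 * (norm (w (\<gamma> + x)) * norm (w x)))) +
     ennreal (1 / (2 * t)) * ennreal ((1 / \<bar>det M\<bar>) * ((k x)\<^sup>2 * (norm (w (\<gamma> + x)) * norm (w x)))) \<partial>lborel)"
    using t by (intro nn_integral_mono order_trans[OF ennreal_leI[OF pt]])
      (simp add: ennreal_plus[symmetric] ennreal_mult'[symmetric] del: ennreal_plus)
  also have "\<dots> = ennreal (t / 2) * (\<integral>\<^sup>+x. ennreal ((1 / \<bar>det M\<bar>) * ((h (\<gamma> + x))\<^sup>2 * (norm (w (\<gamma> + x)) * norm (w x)))) \<partial>lborel) +
     ennreal (1 / (2 * t)) * (\<integral>\<^sup>+x. ennreal ((1 / \<bar>det M\<bar>) * ((k x)\<^sup>2 * (norm (w (\<gamma> + x)) * norm (w x)))) \<partial>lborel)"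
    by (subst nn_integral_add) (simp_all add: nn_integral_cmult)
  also have "(\<integral>\<^sup>+x. ennreal ((1 / \<bar>det M\<bar>) * ((k x)\<^sup>2 * (norm (w (\<gamma> + x)) * norm (w x)))) \<partial>lborel) =
     (\<integral>\<^sup>+\<xi>. ennreal ((norm (K \<xi>))\<^sup>2 * (norm (w (M *v \<xi>)) * norm (w (M *v \<xi> + \<gamma>)))) \<partial>lborel)"
    unfolding k_def using chan_weight_integral[OF M, of K "\<lambda>x. norm (w (\<gamma> + x)) * norm (w x)"]
    by (simp add: abs_mult mult.commute add.commute)
  \<comment> \<open>The shift by \<gamma> moves the argument of \<open>H\<close> back to x, so this
    term carries x - \<gamma> while the term of \<open>K\<close> carries x + \<gamma>. This
    asymmetry is the source of the maximum in \<open>Delta\<close>.\<close>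
  also have "(\<integral>\<^sup>+x. ennreal ((1 / \<bar>det M\<bar>) * ((h (\<gamma> + x))\<^sup>2 * (norm (w (\<gamma> + x)) * norm (w x)))) \<partial>lborel) =
     (\<integral>\<^sup>+x. ennreal ((1 / \<bar>det M\<bar>) * ((h x)\<^sup>2 * (norm (w x) * norm (w (x - \<gamma>))))) \<partial>lborel)"
    using nn_integral_shift[of "\<lambda>x. ennreal ((1 / \<bar>det M\<bar>) * ((h x)\<^sup>2 * (norm (w x) * norm (w (x - \<gamma>)))))" \<gamma>] by simp
  also have "\<dots> = (\<integral>\<^sup>+\<xi>. ennreal ((norm (H \<xi>))\<^sup>2 * (norm (w (M *v \<xi>)) * norm (w (M *v \<xi> - \<gamma>)))) \<partial>lborel)"
    unfolding h_def using chan_weight_integral[OF M, of H "\<lambda>x. norm (w x) * norm (w (x - \<gamma>))"]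
    by (simp add: abs_mult)
  finally show ?thesis .
qed

text \<open>The optimal weight is t = k/h. If h = 0 or k = 0, the bound 0 is approached by letting t
  tend to infinity or to 0.\<close>

lemma weighted_optimum:
  fixes x T h k :: real
  assumes le: "\<And>t. t > 0 \<Longrightarrow> x \<le> T * (t / 2 * h\<^sup>2 + 1 / (2 * t) * k\<^sup>2)"
    and nn: "T \<ge> 0" "h \<ge> 0" "k \<ge> 0"
  shows "x \<le> T * h * k"
proof (cases "h > 0 \<and> k > 0")
  case True
  then have "k / h / 2 * h\<^sup>2 + 1 / (2 * (k / h)) * k\<^sup>2 = h * k" by (simp add: power2_eq_square field_simps)
  then show ?thesis using le[of "k / h"] True by simp
next
  case False
  then have z: "h = 0 \<or> k = 0" using nn by auto
  have "x \<le> 0"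
  proof (rule field_le_epsilon)
    fix e :: real assume e: "e > 0"
    \<comment> \<open>Large enough that the weight \<open>q / e\<close> (for h = 0) or
      \<open>e / q\<close> (for k = 0) brings the remaining term below e/2.\<close>
    define q where "q = T * (h\<^sup>2 + k\<^sup>2) + 1"
    have q: "q > 0" using nn by (simp add: q_def add_nonneg_pos)
    show "x \<le> 0 + e"
    proof (cases "h = 0")
      case True
      have "x \<le> T * (1 / (2 * (q / e)) * k\<^sup>2)" using le[of "q / e"] q e True by simp
      also have "\<dots> = (T * k\<^sup>2 / q) * (e / 2)" using q e by (simp add: field_simps)
      also have "\<dots> \<le> 1 * (e / 2)"
        using q e nn by (intro mult_right_mono) (auto simp: q_def True field_simps)
      finally show ?thesis using e by simp
    next
      case False
      then have k: "k = 0" using z by simp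
      have "x \<le> T * ((e / q) / 2 * h\<^sup>2)" using le[of "e / q"] q e k by simp
      also have "\<dots> = (T * h\<^sup>2 / q) * (e / 2)" using q e by (simp add: field_simps)
      also have "\<dots> \<le> 1 * (e / 2)"
        using q e nn by (intro mult_right_mono) (auto simp: q_def k field_simps)
      finally show ?thesis using e by simp
    qed
  qed
  then show ?thesis using z by auto
qed

text \<open>Dual lattice vectors are written as a matrix applied to integer vectors, the index of
  the Fourier series, and \<open>T n\<close> bounds the correlations for both signs of the vector.
  The case n = 0 belongs to it: there the sum is the sum of squared windows, which the Bessel bound
  needs.\<close>

locale wave_system =
  fixes I :: "'c set" and M :: "'c \<Rightarrow> real^2^2" and w :: "'c \<Rightarrow> real^2 \<Rightarrow> complex"
    and P :: "real^2^2" and T :: "real^2 \<Rightarrow> real"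
  assumes I: "countable I" and P: "invertible P"
    and M: "\<And>c. c \<in> I \<Longrightarrow> invertible (M c)"
    and w: "\<And>c. w c \<in> borel_measurable borel"
    and T0: "\<And>n. T n \<ge> 0"
    and Tm: "\<And>n. n \<in> intvec \<Longrightarrow> AE \<xi> in lborel.
        (\<integral>\<^sup>+c. ennreal (norm (w c (M c *v \<xi>)) * norm (w c (M c *v \<xi> - transpose (matrix_inv P) *v n))) \<partial>count_space I) \<le> ennreal (T n)"
    and Tp: "\<And>n. n \<in> intvec \<Longrightarrow> AE \<xi> in lborel.
        (\<integral>\<^sup>+c. ennreal (norm (w c (M c *v \<xi>)) * norm (w c (M c *v \<xi> + transpose (matrix_inv P) *v n))) \<partial>count_space I) \<le> ennreal (T n)"
    and Tfin: "(\<integral>\<^sup>+n. ennreal (T n) \<partial>count_space intvec) < \<infinity>"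
begin

abbreviation "Q \<equiv> transpose (matrix_inv P)"

lemma w' [measurable]: "w c \<in> borel_measurable borel" by (rule w)

abbreviation corr where
  "corr v H v' K n c \<equiv> \<integral>\<^sup>+x. ennreal (norm (chan (M c) (v c) H (Q *v n + x)) * norm (chan (M c) (v' c) K x)) \<partial>lborel"

definition total :: real where "total = enn2real (\<integral>\<^sup>+n. ennreal (T n) \<partial>count_space intvec)"
definition offdiag :: real where "offdiag = enn2real (\<integral>\<^sup>+n. ennreal (T n) \<partial>count_space (intvec - {0}))"

lemma total: "(\<integral>\<^sup>+n. ennreal (T n) \<partial>count_space intvec) = ennreal total"
  using Tfin by (simp add: total_def)

lemma total_nonneg: "total \<ge> 0" by (simp add: total_def)

lemma offdiag_fin: "(\<integral>\<^sup>+n. ennreal (T n) \<partial>count_space (intvec - {0})) \<le> ennreal total"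
proof -
  have "(\<integral>\<^sup>+n. ennreal (T n) \<partial>count_space (intvec - {0})) \<le> (\<integral>\<^sup>+n. ennreal (T n) \<partial>count_space intvec)"
    unfolding nn_integral_count_space_indicator[of "intvec - {0}"] nn_integral_count_space_indicator[of intvec]
    by (simp add: nn_integral_count_space_indicator) (intro nn_integral_mono, auto simp: indicator_def)
  then show ?thesis by (simp add: total)
qed

lemma offdiag: "(\<integral>\<^sup>+n. ennreal (T n) \<partial>count_space (intvec - {0})) = ennreal offdiag"
  using offdiag_fin by (simp add: offdiag_def) (metis ennreal_enn2real_if ennreal_less_top infinity_ennreal_def leD top_neq_ennreal)

text \<open>Windows dominated by \<open>w\<close> inherit all its correlation bounds, so the
  original and the truncated window are handled with one \<open>T\<close>.\<close>

definition sub_window :: "('c \<Rightarrow> real^2 \<Rightarrow> complex) \<Rightarrow> bool" where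
  "sub_window v \<longleftrightarrow> (\<forall>c. v c \<in> borel_measurable borel) \<and> (\<forall>c x. norm (v c x) \<le> norm (w c x))"

lemma sub_windowD: "sub_window v \<Longrightarrow> v c \<in> borel_measurable borel" "sub_window v \<Longrightarrow> norm (v c x) \<le> norm (w c x)"
  by (auto simp: sub_window_def)

text \<open>Schur test for one dual vector, summed over the channels: after Tonelli the weights add
  up under the integral to at most \<open>T n\<close>, and optimising over t turns the two squared
  norms into a product.\<close>

lemma schur:
  assumes v: "sub_window v" "sub_window v'" and H: "H \<in> sqint lborel" and K: "K \<in> sqint lborel" and n: "n \<in> intvec"
  shows "(\<integral>\<^sup>+c. corr v H v' K n c \<partial>count_space I)
     \<le> ennreal (T n * sqnorm lborel H * sqnorm lborel K)" (is "?X \<le> _")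
proof -
  have [measurable]: "H \<in> borel_measurable borel" "K \<in> borel_measurable borel" using H K by (auto dest: sqint_borel)
  have weight: "(\<integral>\<^sup>+c. \<integral>\<^sup>+\<xi>. ennreal ((norm (G \<xi>))\<^sup>2 * (norm (w c (M c *v \<xi>)) * norm (w c (M c *v \<xi> + \<gamma>)))) \<partial>lborel \<partial>count_space I)
      \<le> ennreal (T n * (sqnorm lborel G)\<^sup>2)"
    if G: "G \<in> sqint lborel" and ae: "AE \<xi> in lborel.
        (\<integral>\<^sup>+c. ennreal (norm (w c (M c *v \<xi>)) * norm (w c (M c *v \<xi> + \<gamma>))) \<partial>count_space I) \<le> ennreal (T n)" for G \<gamma>
  proof -
    have [measurable]: "G \<in> borel_measurable borel" using G by (auto dest: sqint_borel)
    have "(\<integral>\<^sup>+c. \<integral>\<^sup>+\<xi>. ennreal ((norm (G \<xi>))\<^sup>2 * (norm (w c (M c *v \<xi>)) * norm (w c (M c *v \<xi> + \<gamma>)))) \<partial>lborel \<partial>count_space I)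
      = (\<integral>\<^sup>+\<xi>. \<integral>\<^sup>+c. ennreal ((norm (G \<xi>))\<^sup>2 * (norm (w c (M c *v \<xi>)) * norm (w c (M c *v \<xi> + \<gamma>)))) \<partial>count_space I \<partial>lborel)"
      by (rule nn_integral_count_space_nn_integral[OF I, symmetric]) measurable
    also have "\<dots> \<le> (\<integral>\<^sup>+\<xi>. ennreal (T n) * ennreal ((norm (G \<xi>))\<^sup>2) \<partial>lborel)"
    proof (rule nn_integral_mono_AE, use ae in eventually_elim)
      case (elim \<xi>)
      have "(\<integral>\<^sup>+c. ennreal ((norm (G \<xi>))\<^sup>2 * (norm (w c (M c *v \<xi>)) * norm (w c (M c *v \<xi> + \<gamma>)))) \<partial>count_space I) =
        ennreal ((norm (G \<xi>))\<^sup>2) * (\<integral>\<^sup>+c. ennreal (norm (w c (M c *v \<xi>)) * norm (w c (M c *v \<xi> + \<gamma>))) \<partial>count_space I)"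
        by (subst nn_integral_cmult[symmetric]) (auto simp: ennreal_mult')
      also have "\<dots> \<le> ennreal ((norm (G \<xi>))\<^sup>2) * ennreal (T n)" using elim by (intro mult_left_mono) auto
      finally show ?case by (simp add: mult.commute)
    qed
    also have "\<dots> = ennreal (T n * (sqnorm lborel G)\<^sup>2)"
      using G T0 by (simp add: nn_integral_cmult sqnorm_nn ennreal_mult')
    finally show ?thesis .
  qed
  have bound: "?X \<le> ennreal (T n * (t / 2 * (sqnorm lborel H)\<^sup>2 + 1 / (2 * t) * (sqnorm lborel K)\<^sup>2))" if t: "t > 0" for t
  proof -
    have "?X \<le> (\<integral>\<^sup>+c. ennreal (t / 2) * (\<integral>\<^sup>+\<xi>. ennreal ((norm (H \<xi>))\<^sup>2 * (norm (w c (M c *v \<xi>)) * norm (w c (M c *v \<xi> + - (Q *v n))))) \<partial>lborel) +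
       ennreal (1 / (2 * t)) * (\<integral>\<^sup>+\<xi>. ennreal ((norm (K \<xi>))\<^sup>2 * (norm (w c (M c *v \<xi>)) * norm (w c (M c *v \<xi> + Q *v n)))) \<partial>lborel) \<partial>count_space I)"
    proof (rule nn_integral_mono)
      fix c assume "c \<in> space (count_space I)"
      then have "invertible (M c)" using M by simp
      from chan_corr_le[OF this w' sub_windowD(1)[OF v(1)] sub_windowD(1)[OF v(2)] _ _ sub_windowD(2)[OF v(1)] sub_windowD(2)[OF v(2)] t, where H = H and K = K and \<gamma> = "Q *v n"]
      show "corr v H v' K n c \<le>
         ennreal (t / 2) * (\<integral>\<^sup>+\<xi>. ennreal ((norm (H \<xi>))\<^sup>2 * (norm (w c (M c *v \<xi>)) * norm (w c (M c *v \<xi> + - (Q *v n))))) \<partial>lborel) +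
         ennreal (1 / (2 * t)) * (\<integral>\<^sup>+\<xi>. ennreal ((norm (K \<xi>))\<^sup>2 * (norm (w c (M c *v \<xi>)) * norm (w c (M c *v \<xi> + Q *v n)))) \<partial>lborel)"
        by simp
    qed
    also have "\<dots> = ennreal (t / 2) * (\<integral>\<^sup>+c. \<integral>\<^sup>+\<xi>. ennreal ((norm (H \<xi>))\<^sup>2 * (norm (w c (M c *v \<xi>)) * norm (w c (M c *v \<xi> + - (Q *v n))))) \<partial>lborel \<partial>count_space I) +
       ennreal (1 / (2 * t)) * (\<integral>\<^sup>+c. \<integral>\<^sup>+\<xi>. ennreal ((norm (K \<xi>))\<^sup>2 * (norm (w c (M c *v \<xi>)) * norm (w c (M c *v \<xi> + Q *v n)))) \<partial>lborel \<partial>count_space I)"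
      by (subst nn_integral_add) (auto simp: nn_integral_cmult)
    also have "\<dots> \<le> ennreal (t / 2) * ennreal (T n * (sqnorm lborel H)\<^sup>2) + ennreal (1 / (2 * t)) * ennreal (T n * (sqnorm lborel K)\<^sup>2)"
      using Tm[OF n] Tp[OF n] by (intro add_mono mult_left_mono weight H K) auto
    also have "\<dots> = ennreal (T n * (t / 2 * (sqnorm lborel H)\<^sup>2 + 1 / (2 * t) * (sqnorm lborel K)\<^sup>2))"
      using t T0[of n] by (simp add: ennreal_mult'[symmetric] ennreal_plus[symmetric] field_simps del: ennreal_plus)
    finally show ?thesis .
  qed
  have "?X < \<infinity>" using bound[of 1] by (auto simp: less_top[symmetric] top_unique)
  then obtain x where x: "?X = ennreal x" "x \<ge> 0" by (auto simp: less_top_ennreal)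
  have "x \<le> T n * (t / 2 * (sqnorm lborel H)\<^sup>2 + 1 / (2 * t) * (sqnorm lborel K)\<^sup>2)" if "t > 0" for t
    using bound[OF that] that T0[of n] unfolding x(1) by (subst (asm) ennreal_le_iff) (auto intro!: mult_nonneg_nonneg add_nonneg_nonneg)
  then have "x \<le> T n * sqnorm lborel H * sqnorm lborel K"
    using T0 by (intro weighted_optimum) auto
  then show ?thesis unfolding x(1) by (rule ennreal_leI)
qed

end

text \<open>As a simp rule it would rewrite \<open>Q *v n\<close>, whose matrix is a transpose, into
  a row-vector product and hide it from the rules stated for matrix-vector products.\<close>

declare transpose_matrix_vector [simp del]

lemma count_space_product_nn_integral:
  assumes "countable A" "countable B"
  shows "(\<integral>\<^sup>+p. f p \<partial>count_space (A \<times> B)) = (\<integral>\<^sup>+a. \<integral>\<^sup>+b. f (a, b) \<partial>count_space B \<partial>count_space A)"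
proof -
  interpret B: sigma_finite_measure "count_space B"
    using assms by (intro sigma_finite_measure_count_space_countable)
  show ?thesis
    using assms by (subst B.nn_integral_fst) (simp_all add: pair_measure_countable)
qed

lemma count_space_product_integral:
  fixes f :: "'a \<times> 'b \<Rightarrow> complex"
  assumes "countable A" "countable B" and f: "integrable (count_space (A \<times> B)) f"
  shows "(LINT p|count_space (A \<times> B). f p) = (LINT a|count_space A. LINT b|count_space B. f (a, b))"
proof -
  interpret B: sigma_finite_measure "count_space B"
    using assms by (intro sigma_finite_measure_count_space_countable)
  interpret A: sigma_finite_measure "count_space A"
    using assms by (intro sigma_finite_measure_count_space_countable)
  interpret pair_sigma_finite "count_space A" "count_space B" ..
  have "integrable (count_space A \<Otimes>\<^sub>M count_space B) (\<lambda>(a, b). f (a, b))"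
    using assms by (simp add: pair_measure_countable)
  from integral_fst[OF this] show ?thesis using assms by (simp add: pair_measure_countable)
qed

context wave_system
begin

lemma detQ: "det Q = 1 / det P" "det P \<noteq> 0" "invertible Q"
proof -
  show "det P \<noteq> 0" using P by (simp add: invertible_det_nz)
  show "det Q = 1 / det P" using matrix_inv_inv(2)[OF P] by (simp add: det_transpose)
  show "invertible Q" using matrix_inv_inv(1)[OF P] by (simp add: invertible_det_nz det_transpose)
qed

text \<open>The substitution x = Q y carries lattice points to integer points because
  \<open>transpose Q\<close> is the inverse of \<open>P\<close>.\<close>

lemma L1_fourier_lattice:
  assumes [measurable]: "u \<in> borel_measurable borel"
  shows "L1_fourier u (P *v m) = of_real \<bar>det Q\<bar> * L1_fourier (\<lambda>x. u (Q *v x)) m"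
proof -
  have "transpose Q *v (P *v m) = m" by (simp add: transpose_transpose matrix_inv_inv[OF P])
  then show ?thesis using L1_fourier_matrix[OF detQ(3) assms, of "P *v m"] by simp
qed

lemma nn_integral_Q:
  fixes h :: "real^2 \<Rightarrow> ennreal"
  assumes "h \<in> borel_measurable borel"
  shows "(\<integral>\<^sup>+x. h (Q *v x) \<partial>lborel) = ennreal \<bar>det P\<bar> * (\<integral>\<^sup>+x. h x \<partial>lborel)"
proof -
  have "\<bar>det P\<bar> * \<bar>det Q\<bar> = 1" using detQ by simp
  then have "ennreal \<bar>det P\<bar> * ennreal \<bar>det Q\<bar> = 1" by (simp add: ennreal_mult'[symmetric])
  then show ?thesis
    unfolding nn_integral_matrix[OF detQ(3) assms] by (simp add: mult.assoc[symmetric])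
qed

definition coef :: "('c \<Rightarrow> real^2 \<Rightarrow> complex) \<Rightarrow> (real^2 \<Rightarrow> complex) \<Rightarrow> 'c \<times> (real^2) \<Rightarrow> complex" where
  "coef v H = (\<lambda>(c, m). sqinner lborel (atom (M c) (v c) (P *v m)) H)"

text \<open>Tonelli moves the sum over n outside, where \<open>schur\<close> applies to each n. It
  is used with all integer vectors for the Bessel bound and with the nonzero ones for the
  error.\<close>

lemma schur_sum:
  assumes v: "sub_window v" "sub_window v'" and H: "H \<in> sqint lborel" and K: "K \<in> sqint lborel" and N: "N \<subseteq> intvec"
  shows "(\<integral>\<^sup>+c. \<integral>\<^sup>+n. corr v H v' K n c \<partial>count_space N \<partial>count_space I)
     \<le> (\<integral>\<^sup>+n. ennreal (T n) \<partial>count_space N) * ennreal (sqnorm lborel H * sqnorm lborel K)"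
proof -
  have "(\<integral>\<^sup>+c. \<integral>\<^sup>+n. corr v H v' K n c \<partial>count_space N \<partial>count_space I)
    = (\<integral>\<^sup>+n. \<integral>\<^sup>+c. corr v H v' K n c \<partial>count_space I \<partial>count_space N)"
    by (rule nn_integral_count_space_nn_integral[OF I, symmetric]) simp
  also have "\<dots> \<le> (\<integral>\<^sup>+n. ennreal (T n) * ennreal (sqnorm lborel H * sqnorm lborel K) \<partial>count_space N)"
  proof (rule nn_integral_mono)
    fix n assume "n \<in> space (count_space N)"
    then have "n \<in> intvec" using N by auto
    from schur[OF v H K this]
    show "(\<integral>\<^sup>+c. corr v H v' K n c \<partial>count_space I)
       \<le> ennreal (T n) * ennreal (sqnorm lborel H * sqnorm lborel K)"
      using T0[of n] by (simp add: ennreal_mult'[symmetric] mult.assoc)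
  qed
  finally show ?thesis by (simp add: nn_integral_multc)
qed

text \<open>Rescaling by \<open>Q\<close> reduces this to \<open>periodization_parseval\<close>. The
  coefficients contribute |det Q|^2, of which the factor |det P| leaves |det Q|, and this cancels
  the |det P| of the rescaled correlations. Hence the lattice volume in the expansion.\<close>

lemma channel:
  assumes v: "sub_window v" "sub_window v'" and H: "H \<in> sqint lborel" and K: "K \<in> sqint lborel" and c: "c \<in> I"
  shows "(\<lambda>m. coef v H (c, m)) \<in> sqint (count_space intvec)"
    and "ennreal \<bar>det P\<bar> * sqmass (count_space intvec) (\<lambda>m. coef v H (c, m)) \<le>
      (\<integral>\<^sup>+n. corr v H v H n c \<partial>count_space intvec)"
    and "ennreal (norm (of_real \<bar>det P\<bar> * sqinner (count_space intvec) (\<lambda>m. coef v H (c, m)) (\<lambda>m. coef v' K (c, m)) -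
        (LINT x|lborel. chan (M c) (v c) H x * cnj (chan (M c) (v' c) K x))))
      \<le> (\<integral>\<^sup>+n. corr v H v' K n c \<partial>count_space (intvec - {0}))"
proof -
  define u where "u = chan (M c) (v c) H"
  define u' where "u' = chan (M c) (v' c) K"
  have [measurable]: "v c \<in> borel_measurable borel" "v' c \<in> borel_measurable borel" "H \<in> borel_measurable borel" "K \<in> borel_measurable borel"
    using v H K by (auto dest: sub_windowD sqint_borel)
  have um [measurable]: "u \<in> borel_measurable borel" "u' \<in> borel_measurable borel"
    unfolding u_def u'_def by measurable
  have dd: "\<bar>det P\<bar> * \<bar>det Q\<bar> = 1" "\<bar>det P\<bar> > 0" "\<bar>det Q\<bar> > 0" using detQ by auto
  define U where "U x = u (Q *v x)" for x
  define U' where "U' x = u' (Q *v x)" for x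
  have [measurable]: "U \<in> borel_measurable borel" "U' \<in> borel_measurable borel" unfolding U_def U'_def by measurable
  have cf: "coef v H (c, m) = of_real \<bar>det Q\<bar> * L1_fourier U m" "coef v' K (c, m) = of_real \<bar>det Q\<bar> * L1_fourier U' m" for m
    using M[OF c] by (simp_all add: coef_def atom_coeff U_def[abs_def] U'_def[abs_def] u_def u'_def L1_fourier_lattice)
  have corr: "(\<integral>\<^sup>+x. ennreal (norm (s (Q *v (n + x))) * norm (s' (Q *v x))) \<partial>lborel)
     = ennreal \<bar>det P\<bar> * (\<integral>\<^sup>+x. ennreal (norm (s (Q *v n + x)) * norm (s' x)) \<partial>lborel)"
    if [measurable]: "s \<in> borel_measurable borel" "s' \<in> borel_measurable borel" for s s' :: "real^2 \<Rightarrow> complex" and n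
    using nn_integral_Q[of "\<lambda>x. ennreal (norm (s (Q *v n + x)) * norm (s' x))"]
    by (simp add: matrix_vector_right_distrib)
  have J: "(\<integral>\<^sup>+x. per_norm (\<lambda>x. s (Q *v x)) x * ennreal (norm (s (Q *v x))) \<partial>lborel) =
      ennreal \<bar>det P\<bar> * (\<integral>\<^sup>+n. \<integral>\<^sup>+x. ennreal (norm (s (Q *v n + x)) * norm (s x)) \<partial>lborel \<partial>count_space intvec)"
    if s [measurable]: "s \<in> borel_measurable borel" for s :: "real^2 \<Rightarrow> complex"
  proof -
    have "(\<integral>\<^sup>+x. per_norm (\<lambda>x. s (Q *v x)) x * ennreal (norm (s (Q *v x))) \<partial>lborel) =
       (\<integral>\<^sup>+x. \<integral>\<^sup>+n. ennreal (norm (s (Q *v (n + x))) * norm (s (Q *v x))) \<partial>count_space intvec \<partial>lborel)"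
      by (intro nn_integral_cong) (simp add: per_norm_def ennreal_mult nn_integral_multc)
    also have "\<dots> = (\<integral>\<^sup>+n. \<integral>\<^sup>+x. ennreal (norm (s (Q *v (n + x))) * norm (s (Q *v x))) \<partial>lborel \<partial>count_space intvec)"
      by (rule nn_integral_count_space_nn_integral) auto
    also have "\<dots> = ennreal \<bar>det P\<bar> * (\<integral>\<^sup>+n. \<integral>\<^sup>+x. ennreal (norm (s (Q *v n + x)) * norm (s x)) \<partial>lborel \<partial>count_space intvec)"
      unfolding corr[OF s s] by (rule nn_integral_cmult) simp
    finally show ?thesis .
  qed
  \<comment> \<open>One channel is bounded by the sum over all of them, and that sum by the Schur
    test; this supplies the finiteness that periodization requires.\<close>
  have fin: "(\<integral>\<^sup>+n. corr z G z G n c \<partial>count_space intvec) < \<infinity>"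
    if z: "sub_window z" and G: "G \<in> sqint lborel" for z G
  proof -
    have "(\<integral>\<^sup>+n. corr z G z G n c \<partial>count_space intvec)
      \<le> (\<integral>\<^sup>+c. \<integral>\<^sup>+n. corr z G z G n c \<partial>count_space intvec \<partial>count_space I)"
      using c by (rule nn_integral_ge_point)
    also have "\<dots> \<le> (\<integral>\<^sup>+n. ennreal (T n) \<partial>count_space intvec) * ennreal (sqnorm lborel G * sqnorm lborel G)"
      by (rule schur_sum[OF z z G G]) simp
    also have "\<dots> < \<infinity>" unfolding total by (simp add: ennreal_mult_less_top)
    finally show ?thesis .
  qed
  have JU: "(\<integral>\<^sup>+x. per_norm U x * ennreal (norm (U x)) \<partial>lborel) < \<infinity>" "(\<integral>\<^sup>+x. per_norm U' x * ennreal (norm (U' x)) \<partial>lborel) < \<infinity>"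
    using J[OF um(1)] J[OF um(2)] fin[OF v(1) H] fin[OF v(2) K] unfolding U_def[abs_def] U'_def[abs_def] u_def u'_def
    by (simp_all add: ennreal_mult_less_top)
  note pp = periodization_parseval[of U U', OF _ _ JU] and pp' = periodization_parseval[of U' U, OF _ _ JU(2,1)]
  show "(\<lambda>m. coef v H (c, m)) \<in> sqint (count_space intvec)"
    unfolding cf by (rule sqint_cmult, rule pp(1)) auto
  have "ennreal \<bar>det P\<bar> * sqmass (count_space intvec) (\<lambda>m. coef v H (c, m)) =
     ennreal \<bar>det P\<bar> * (\<integral>\<^sup>+m. ennreal (\<bar>det Q\<bar>\<^sup>2) * ennreal ((norm (L1_fourier U m))\<^sup>2) \<partial>count_space intvec)"
    unfolding cf by (intro arg_cong[where f = "(*) _"] nn_integral_cong) (simp add: norm_mult power_mult_distrib ennreal_mult)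
  also have "\<dots> = ennreal (\<bar>det P\<bar> * \<bar>det Q\<bar>\<^sup>2) * sqmass (count_space intvec) (L1_fourier U)"
    by (simp add: nn_integral_cmult ennreal_mult mult.assoc)
  also have "\<bar>det P\<bar> * \<bar>det Q\<bar>\<^sup>2 = \<bar>det Q\<bar>" by (simp only: power2_eq_square mult.assoc[symmetric] dd(1) mult_1)
  also have "ennreal \<bar>det Q\<bar> * sqmass (count_space intvec) (L1_fourier U) \<le>
     ennreal \<bar>det Q\<bar> * (\<integral>\<^sup>+x. per_norm U x * ennreal (norm (U x)) \<partial>lborel)"
    by (intro mult_left_mono pp(2)) auto
  also have "\<dots> = ennreal (\<bar>det Q\<bar> * \<bar>det P\<bar>) * (\<integral>\<^sup>+n. \<integral>\<^sup>+x. ennreal (norm (u (Q *v n + x)) * norm (u x)) \<partial>lborel \<partial>count_space intvec)"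
    using J[OF um(1)] unfolding U_def[abs_def] by (simp add: ennreal_mult mult.assoc)
  finally show "ennreal \<bar>det P\<bar> * sqmass (count_space intvec) (\<lambda>m. coef v H (c, m)) \<le>
      (\<integral>\<^sup>+n. corr v H v H n c \<partial>count_space intvec)"
    using dd(1) by (simp add: mult.commute u_def)
  define s where "s = sqinner (count_space intvec) (L1_fourier U) (L1_fourier U') - (LINT x|lborel. U x * cnj (U' x))"
  have "sqinner (count_space intvec) (\<lambda>m. coef v H (c, m)) (\<lambda>m. coef v' K (c, m)) =
     of_real (\<bar>det Q\<bar>\<^sup>2) * sqinner (count_space intvec) (L1_fourier U) (L1_fourier U')"
  proof -
    have "sqinner (count_space intvec) (\<lambda>m. coef v H (c, m)) (\<lambda>m. coef v' K (c, m)) =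
      (LINT m|count_space intvec. of_real (\<bar>det Q\<bar>\<^sup>2) * (L1_fourier U m * cnj (L1_fourier U' m)))"
      unfolding sqinner_def cf by (intro Bochner_Integration.integral_cong refl)
        (simp only: complex_cnj_mult complex_cnj_complex_of_real of_real_mult power2_eq_square mult_ac)
    then show ?thesis unfolding sqinner_def by (simp only: integral_mult_right_zero)
  qed
  then have "of_real \<bar>det P\<bar> * sqinner (count_space intvec) (\<lambda>m. coef v H (c, m)) (\<lambda>m. coef v' K (c, m)) =
     of_real (\<bar>det P\<bar> * \<bar>det Q\<bar>\<^sup>2) * sqinner (count_space intvec) (L1_fourier U) (L1_fourier U')"
    by (simp only: of_real_mult mult.assoc)
  also have "\<bar>det P\<bar> * \<bar>det Q\<bar>\<^sup>2 = \<bar>det Q\<bar>" by (simp only: power2_eq_square mult.assoc[symmetric] dd(1) mult_1)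
  finally have 1: "of_real \<bar>det P\<bar> * sqinner (count_space intvec) (\<lambda>m. coef v H (c, m)) (\<lambda>m. coef v' K (c, m)) =
     of_real \<bar>det Q\<bar> * sqinner (count_space intvec) (L1_fourier U) (L1_fourier U')" .
  have 2: "(LINT x|lborel. u x * cnj (u' x)) = of_real \<bar>det Q\<bar> * (LINT x|lborel. U x * cnj (U' x))"
    using integral_matrix[OF detQ(3), of "\<lambda>x. u x * cnj (u' x)"] by (simp add: U_def U'_def scaleR_conv_of_real)
  have "ennreal (norm (of_real \<bar>det P\<bar> * sqinner (count_space intvec) (\<lambda>m. coef v H (c, m)) (\<lambda>m. coef v' K (c, m)) -
        (LINT x|lborel. u x * cnj (u' x)))) = ennreal \<bar>det Q\<bar> * ennreal (norm s)"
    unfolding 1 2 s_def right_diff_distrib[symmetric] norm_mult by (simp add: ennreal_mult')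
  also have "\<dots> \<le> ennreal \<bar>det Q\<bar> * (\<integral>\<^sup>+n. \<integral>\<^sup>+x. ennreal (norm (U (n + x)) * norm (U' x)) \<partial>lborel \<partial>count_space (intvec - {0}))"
    unfolding s_def by (intro mult_left_mono pp(3)) auto
  also have "\<dots> = ennreal \<bar>det Q\<bar> * (\<integral>\<^sup>+n. ennreal \<bar>det P\<bar> * (\<integral>\<^sup>+x. ennreal (norm (u (Q *v n + x)) * norm (u' x)) \<partial>lborel) \<partial>count_space (intvec - {0}))"
    unfolding U_def U'_def corr[OF um] ..
  also have "\<dots> = ennreal (\<bar>det Q\<bar> * \<bar>det P\<bar>) * (\<integral>\<^sup>+n. \<integral>\<^sup>+x. ennreal (norm (u (Q *v n + x)) * norm (u' x)) \<partial>lborel \<partial>count_space (intvec - {0}))"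
    by (simp add: nn_integral_cmult ennreal_mult mult.assoc)
  finally show "ennreal (norm (of_real \<bar>det P\<bar> * sqinner (count_space intvec) (\<lambda>m. coef v H (c, m)) (\<lambda>m. coef v' K (c, m)) -
        (LINT x|lborel. chan (M c) (v c) H x * cnj (chan (M c) (v' c) K x))))
      \<le> (\<integral>\<^sup>+n. corr v H v' K n c \<partial>count_space (intvec - {0}))"
    using dd(1) by (simp add: mult.commute u_def u'_def)
qed

text \<open>Pairing a function with itself, the summand n = 0 stays in the sum over n, so the
  constant is \<open>total\<close> and not \<open>offdiag\<close>.\<close>

lemma bessel:
  assumes v: "sub_window v" and H: "H \<in> sqint lborel"
  shows "ennreal \<bar>det P\<bar> * (sqmass (count_space (I \<times> intvec)) (coef v H)) \<le> ennreal (total * (sqnorm lborel H)\<^sup>2)"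
proof -
  have "ennreal \<bar>det P\<bar> * (sqmass (count_space (I \<times> intvec)) (coef v H)) =
     (\<integral>\<^sup>+c. ennreal \<bar>det P\<bar> * sqmass (count_space intvec) (\<lambda>m. coef v H (c, m)) \<partial>count_space I)"
    by (simp add: count_space_product_nn_integral[OF I countable_intvec] nn_integral_cmult)
  also have "\<dots> \<le> (\<integral>\<^sup>+c. \<integral>\<^sup>+n. corr v H v H n c \<partial>count_space intvec \<partial>count_space I)"
    by (intro nn_integral_mono channel(2)[OF v v H H]) simp
  also have "\<dots> \<le> (\<integral>\<^sup>+n. ennreal (T n) \<partial>count_space intvec) * ennreal (sqnorm lborel H * sqnorm lborel H)"
    by (rule schur_sum[OF v v H H]) simp
  finally show ?thesis using total_nonneg by (simp add: total ennreal_mult' power2_eq_square)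
qed

lemma coef_sqint:
  assumes v: "sub_window v" and H: "H \<in> sqint lborel"
  shows "coef v H \<in> sqint (count_space (I \<times> intvec))"
proof -
  have "ennreal \<bar>det P\<bar> * (sqmass (count_space (I \<times> intvec)) (coef v H)) < \<infinity>"
    using bessel[OF v H] by (rule le_less_trans) simp
  then show ?thesis using detQ(2) by (auto simp: sqint_iff_nn ennreal_mult_less_top)
qed

text \<open>In each channel the pairing of the coefficients equals its n = 0 term up to the terms
  with n \<noteq> 0. Summed over the channels, the n = 0 terms form the pairing with the multiplier,
  and the others are controlled by \<open>offdiag\<close>.\<close>

lemma duality:
  assumes v: "sub_window v" "sub_window v'" and K: "K \<in> sqint lborel" and G: "G \<in> sqint lborel"
  shows "norm (of_real \<bar>det P\<bar> * sqinner (count_space (I \<times> intvec)) (coef v K) (coef v' G) -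
      (LINT \<xi>|lborel. G \<xi> * cnj (K \<xi>) * (LINT c|count_space I. v c (M c *v \<xi>) * cnj (v' c (M c *v \<xi>)))))
    \<le> offdiag * sqnorm lborel K * sqnorm lborel G"
proof -
  have vm [measurable]: "v c \<in> borel_measurable borel" "v' c \<in> borel_measurable borel" for c
    using v by (auto dest: sub_windowD)
  have [measurable]: "G \<in> borel_measurable borel" "K \<in> borel_measurable borel" using G K by (auto dest: sqint_borel)
  define a where "a c = of_real \<bar>det P\<bar> * sqinner (count_space intvec) (\<lambda>m. coef v K (c, m)) (\<lambda>m. coef v' G (c, m))" for c
  define d where "d c = (LINT x|lborel. chan (M c) (v c) K x * cnj (chan (M c) (v' c) G x))" for c
  define f where "f c \<xi> = G \<xi> * cnj (K \<xi>) * (v c (M c *v \<xi>) * cnj (v' c (M c *v \<xi>)))" for c \<xi>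
  have fm: "f c \<in> borel_measurable borel" for c unfolding f_def by measurable
  have df: "d c = (LINT \<xi>|lborel. f c \<xi>)" if "c \<in> I" for c
    unfolding d_def f_def using M[OF that] by (rule chan_inner) measurable
  \<comment> \<open>The correlation for n = 0 is the absolute integral of the multiplier pairing, so
    its Schur bound licenses Fubini.\<close>
  have "(\<integral>\<^sup>+c. \<integral>\<^sup>+\<xi>. ennreal (norm (f c \<xi>)) \<partial>lborel \<partial>count_space I) =
    (\<integral>\<^sup>+c. corr v K v' G 0 c \<partial>count_space I)"
  proof (rule nn_integral_cong)
    fix c assume "c \<in> space (count_space I)"
    then have Mc: "invertible (M c)" using M by simp
    have dp: "\<bar>det (M c)\<bar> > 0" using Mc by (simp add: invertible_det_nz)
    have "(\<integral>\<^sup>+x. ennreal (norm (chan (M c) (v c) K x) * norm (chan (M c) (v' c) G x)) \<partial>lborel) =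
      ennreal \<bar>det (M c)\<bar> * (\<integral>\<^sup>+\<xi>. ennreal (norm (chan (M c) (v c) K (M c *v \<xi>)) * norm (chan (M c) (v' c) G (M c *v \<xi>))) \<partial>lborel)"
      by (rule nn_integral_matrix[OF Mc]) measurable
    also have "\<dots> = (\<integral>\<^sup>+\<xi>. ennreal \<bar>det (M c)\<bar> * ennreal (norm (chan (M c) (v c) K (M c *v \<xi>)) * norm (chan (M c) (v' c) G (M c *v \<xi>))) \<partial>lborel)"
      by (rule nn_integral_cmult[symmetric]) measurable
    also have "\<dots> = (\<integral>\<^sup>+\<xi>. ennreal (norm (f c \<xi>)) \<partial>lborel)"
    proof (rule nn_integral_cong)
      fix \<xi>
      have "\<bar>det (M c)\<bar> * (norm (chan (M c) (v c) K (M c *v \<xi>)) * norm (chan (M c) (v' c) G (M c *v \<xi>))) = norm (f c \<xi>)"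
        using dp by (simp add: chan_def f_def matrix_inv_inv[OF Mc] norm_mult norm_divide field_simps)
      then show "ennreal \<bar>det (M c)\<bar> * ennreal (norm (chan (M c) (v c) K (M c *v \<xi>)) * norm (chan (M c) (v' c) G (M c *v \<xi>))) = ennreal (norm (f c \<xi>))"
        by (simp add: ennreal_mult'[symmetric])
    qed
    finally show "(\<integral>\<^sup>+\<xi>. ennreal (norm (f c \<xi>)) \<partial>lborel) =
      corr v K v' G 0 c" by simp
  qed
  also have "\<dots> \<le> ennreal (T 0 * sqnorm lborel K * sqnorm lborel G)" using v K G by (rule schur) simp
  also have "\<dots> < \<infinity>" by simp
  finally have ffin: "(\<integral>\<^sup>+c. \<integral>\<^sup>+\<xi>. ennreal (norm (f c \<xi>)) \<partial>lborel \<partial>count_space I) < \<infinity>" .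
  note fub = count_space_fubini[OF I fm ffin]
  have di: "integrable (count_space I) d"
  proof (rule Bochner_Integration.integrable_cong[OF refl, THEN iffD2])
    show "integrable (count_space I) (\<lambda>c. LINT \<xi>|lborel. f c \<xi>)" by (rule fub(2))
  qed (simp add: df)
  have dI: "(LINT c|count_space I. d c) = (LINT \<xi>|lborel. G \<xi> * cnj (K \<xi>) * (LINT c|count_space I. v c (M c *v \<xi>) * cnj (v' c (M c *v \<xi>))))"
  proof -
    have "(LINT c|count_space I. d c) = (LINT c|count_space I. LINT \<xi>|lborel. f c \<xi>)"
      by (rule Bochner_Integration.integral_cong[OF refl]) (simp add: df)
    also have "\<dots> = (LINT \<xi>|lborel. LINT c|count_space I. f c \<xi>)" by (rule fub(1))
    finally show ?thesis by (simp add: f_def)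
  qed
  have int: "integrable (count_space (I \<times> intvec)) (\<lambda>p. coef v K p * cnj (coef v' G p))"
    using v K G by (intro sqint_prod coef_sqint)
  have aI: "of_real \<bar>det P\<bar> * sqinner (count_space (I \<times> intvec)) (coef v K) (coef v' G) = (LINT c|count_space I. a c)"
    unfolding sqinner_def count_space_product_integral[OF I countable_intvec int] a_def
    by (simp only: integral_mult_right_zero)
  have diff: "(\<integral>\<^sup>+c. ennreal (norm (a c - d c)) \<partial>count_space I) \<le> ennreal (offdiag * sqnorm lborel K * sqnorm lborel G)"
  proof -
    have "(\<integral>\<^sup>+c. ennreal (norm (a c - d c)) \<partial>count_space I) \<le>
      (\<integral>\<^sup>+c. \<integral>\<^sup>+n. corr v K v' G n c \<partial>count_space (intvec - {0}) \<partial>count_space I)"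
      unfolding a_def d_def by (intro nn_integral_mono channel(3)[OF v K G]) simp
    also have "\<dots> \<le> (\<integral>\<^sup>+n. ennreal (T n) \<partial>count_space (intvec - {0})) * ennreal (sqnorm lborel K * sqnorm lborel G)"
      by (rule schur_sum[OF v K G]) auto
    also have "\<dots> = ennreal (offdiag * sqnorm lborel K * sqnorm lborel G)"
      unfolding offdiag by (simp add: ennreal_mult'[symmetric] offdiag_def mult.assoc)
    finally show ?thesis .
  qed
  have adi: "integrable (count_space I) (\<lambda>c. a c - d c)"
    unfolding integrable_iff_bounded using le_less_trans[OF diff] by simp
  have "integrable (count_space I) (\<lambda>c. (a c - d c) + d c)" using adi di by (rule Bochner_Integration.integrable_add)
  then have ai: "integrable (count_space I) a" by simp
  have eq: "(LINT c|count_space I. a c) - (LINT c|count_space I. d c) = (LINT c|count_space I. a c - d c)"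
    using ai di by (rule Bochner_Integration.integral_diff[symmetric])
  have "ennreal (norm ((LINT c|count_space I. a c) - (LINT c|count_space I. d c))) \<le> ennreal (offdiag * sqnorm lborel K * sqnorm lborel G)"
    unfolding eq by (rule order_trans[OF integral_norm_bound_ennreal[OF adi] diff])
  then have "norm ((LINT c|count_space I. a c) - (LINT c|count_space I. d c)) \<le> offdiag * sqnorm lborel K * sqnorm lborel G"
    by (subst (asm) ennreal_le_iff) (auto simp: offdiag_def)
  then show ?thesis unfolding aI dI .
qed

end

section \<open>From coefficient bounds to a convergent expansion\<close>

text \<open>Duality: the squared norm of the sum h is its pairing with itself, and Cauchy-Schwarz
  with the analysis bound for h gives N^4 \<le> s C N^2.\<close>

lemma synthesis_bound:
  assumes \<phi>: "\<And>i. i \<in> J \<Longrightarrow> \<phi> i \<in> sqint M" and J: "finite J"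
    and bes: "\<And>h. h \<in> sqint M \<Longrightarrow> (\<Sum>i\<in>J. (norm (sqinner M (\<phi> i) h))\<^sup>2) \<le> C * (sqnorm M h)\<^sup>2"
    and C: "C \<ge> 0"
  shows "(sqnorm M (\<lambda>x. \<Sum>i\<in>J. a i * \<phi> i x))\<^sup>2 \<le> C * (\<Sum>i\<in>J. (norm (a i))\<^sup>2)"
proof -
  define h where "h x = (\<Sum>i\<in>J. a i * \<phi> i x)" for x
  have h: "h \<in> sqint M" unfolding h_def using \<phi> by (intro sqint_sum sqint_cmult)
  define s where "s = (\<Sum>i\<in>J. (norm (a i))\<^sup>2)"
  have s: "s \<ge> 0" unfolding s_def by (intro sum_nonneg) simp
  define N where "N = sqnorm M h"
  have "complex_of_real (N\<^sup>2) = sqinner M h h" by (simp add: N_def sqinner_self)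
  also have "\<dots> = (\<Sum>i\<in>J. sqinner M (\<lambda>x. a i * \<phi> i x) h)"
    unfolding h_def[abs_def] using \<phi> h[unfolded h_def[abs_def]] by (intro sqinner_sum_left sqint_cmult)
  also have "\<dots> = (\<Sum>i\<in>J. a i * sqinner M (\<phi> i) h)" by (simp add: sqinner_cmult_left)
  finally have "N\<^sup>2 = norm (\<Sum>i\<in>J. a i * sqinner M (\<phi> i) h)"
    by (metis abs_of_nonneg norm_of_real zero_le_power2)
  also have "\<dots> \<le> (\<Sum>i\<in>J. norm (a i) * norm (sqinner M (\<phi> i) h))"
    by (rule order_trans[OF norm_sum]) (simp add: norm_mult)
  finally have "(N\<^sup>2)\<^sup>2 \<le> (\<Sum>i\<in>J. norm (a i) * norm (sqinner M (\<phi> i) h))\<^sup>2"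
    by (intro power_mono) auto
  also have "\<dots> \<le> s * (\<Sum>i\<in>J. (norm (sqinner M (\<phi> i) h))\<^sup>2)"
    unfolding s_def by (rule Cauchy_Schwarz_ineq_sum)
  also have "\<dots> \<le> s * (C * N\<^sup>2)"
    using s bes[OF h] by (intro mult_left_mono) (auto simp: N_def)
  finally have le: "N\<^sup>2 * N\<^sup>2 \<le> (C * s) * N\<^sup>2" by (simp add: power2_eq_square mult_ac)
  have "N\<^sup>2 \<le> C * s"
  proof (cases "N = 0")
    case False
    then have "N\<^sup>2 > 0" by simp
    then show ?thesis using le by (simp only: mult_le_cancel_right_pos)
  qed (use C s in simp)
  then show ?thesis by (simp add: N_def s_def h_def[abs_def])
qed

lemma sqint_count_space_summable:
  assumes "u \<in> sqint (count_space A)"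
  shows "(\<lambda>i. (norm (u i))\<^sup>2) summable_on A"
proof -
  have "Infinite_Set_Sum.abs_summable_on (\<lambda>i. (norm (u i))\<^sup>2) A"
    using assms by (simp add: sqint_def abs_summable_on_def)
  then have "(\<lambda>i. norm ((norm (u i))\<^sup>2)) summable_on A" by (simp only: abs_summable_equivalent)
  then show ?thesis by simp
qed

lemma sqinner_count_space_has_sum:
  assumes "u \<in> sqint (count_space A)" "v \<in> sqint (count_space A)"
  shows "((\<lambda>i. u i * cnj (v i)) has_sum sqinner (count_space A) u v) A"
proof -
  have *: "Infinite_Set_Sum.abs_summable_on (\<lambda>i. u i * cnj (v i)) A"
    using sqint_prod[OF assms] by (simp add: abs_summable_on_def)
  then have "(\<lambda>i. norm (u i * cnj (v i))) summable_on A" by (simp only: abs_summable_equivalent)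
  then have "(\<lambda>i. u i * cnj (v i)) summable_on A" by (rule abs_summable_summable)
  moreover have "sqinner (count_space A) u v = infsum (\<lambda>i. u i * cnj (v i)) A"
    using infsetsum_infsum[OF *] by (simp add: infsetsum_def sqinner_def)
  ultimately show ?thesis by simp
qed

lemma sum_le_nn_integral_count_space:
  fixes u :: "'i \<Rightarrow> real"
  assumes "finite J" "J \<subseteq> A" "\<And>i. u i \<ge> 0" "(\<integral>\<^sup>+i. ennreal (u i) \<partial>count_space A) \<le> ennreal c" "c \<ge> 0"
  shows "(\<Sum>i\<in>J. u i) \<le> c"
proof -
  have "ennreal (\<Sum>i\<in>J. u i) = (\<integral>\<^sup>+i. ennreal (u i) \<partial>count_space J)"
    using assms by (simp add: nn_integral_count_space_finite)
  also have "\<dots> \<le> (\<integral>\<^sup>+i. ennreal (u i) \<partial>count_space A)"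
    unfolding nn_integral_count_space_indicator[of J] nn_integral_count_space_indicator[of A]
    using assms(2) by (simp add: nn_integral_count_space_indicator) (intro nn_integral_mono, auto simp: indicator_def)
  also have "\<dots> \<le> ennreal c" by (rule assms)
  finally show ?thesis using assms(5) by (simp add: ennreal_le_iff)
qed

context wave_system
begin

text \<open>By \<open>mul\<close>, multiplying \<open>G\<close> by the multiplier returns the
  transform of f, so \<open>duality\<close> compares |det P| S with f against any test function;
  taking the error k as test function closes the estimate after one factor of its norm is
  cancelled.\<close>

lemma expansion:
  assumes v': "sub_window v'"
    and \<Phi>: "\<And>p. p \<in> I \<times> intvec \<Longrightarrow> \<Phi> p \<in> sqint lborel"
    and F\<Phi>: "\<And>c m. c \<in> I \<Longrightarrow> m \<in> intvec \<Longrightarrow> AE \<xi> in lborel. L2_fourier (\<Phi> (c, m)) \<xi> = atom (M c) (w c) (P *v m) \<xi>"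
    and f: "f \<in> sqint lborel"
    and G: "G \<in> sqint lborel" "sqnorm lborel G \<le> b * sqnorm lborel f"
    and mul: "AE \<xi> in lborel. G \<xi> * (LINT c|count_space I. w c (M c *v \<xi>) * cnj (v' c (M c *v \<xi>))) = L2_fourier f \<xi>"
  shows "\<exists>S\<in>sqint lborel. ((\<lambda>J. sqnorm lborel (\<lambda>x. (\<Sum>p\<in>J. cnj (coef v' G p) * \<Phi> p x) - S x)) \<longlongrightarrow> 0) (finite_subsets_at_top (I \<times> intvec)) \<and>
    sqnorm lborel (\<lambda>x. f x - of_real \<bar>det P\<bar> * S x) \<le> offdiag * b * sqnorm lborel f"
proof -
  \<comment> \<open>The summand 1 makes the constant strictly positive, as
    \<open>bessel_summable\<close> asks.\<close>
  define C where "C = total / \<bar>det P\<bar> + 1"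
  have dP: "\<bar>det P\<bar> > 0" using detQ(2) by simp
  have C: "C > 0" using total_nonneg dP by (simp add: C_def add_nonneg_pos)
  have wsub: "sub_window w" using w by (simp add: sub_window_def)
  have ip: "sqinner lborel (\<Phi> p) h = coef w (L2_fourier h) p" if p: "p \<in> I \<times> intvec" and h: "h \<in> sqint lborel" for p h
  proof -
    obtain c m where cm: "p = (c, m)" "c \<in> I" "m \<in> intvec" using p by auto
    have "sqinner lborel (\<Phi> p) h = sqinner lborel (L2_fourier (\<Phi> p)) (L2_fourier h)"
      using \<Phi>[OF p] h by (simp add: L2_fourier_inner)
    also have "\<dots> = sqinner lborel (atom (M c) (w c) (P *v m)) (L2_fourier h)"
      unfolding cm(1)
      using F\<Phi>[OF cm(2,3)] L2_fourier_sqint[OF \<Phi>[OF p]] L2_fourier_sqint[OF h]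
      by (intro sqinner_cong_AE) (auto dest: sqint_borel simp: cm(1))
    finally show ?thesis by (simp add: coef_def cm(1))
  qed
  have an: "(\<Sum>p\<in>J. (norm (sqinner lborel (\<Phi> p) h))\<^sup>2) \<le> C * (sqnorm lborel h)\<^sup>2"
    if J: "finite J" "J \<subseteq> I \<times> intvec" and h: "h \<in> sqint lborel" for J h
  proof -
    have Fh: "L2_fourier h \<in> sqint lborel" using h by (rule L2_fourier_sqint)
    have "(\<integral>\<^sup>+p. ennreal (\<bar>det P\<bar> * (norm (coef w (L2_fourier h) p))\<^sup>2) \<partial>count_space (I \<times> intvec)) \<le> ennreal (total * (sqnorm lborel h)\<^sup>2)"
      using bessel[OF wsub Fh] L2_fourier_norm[OF h] by (simp add: ennreal_mult' nn_integral_cmult)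
    then have "(\<Sum>p\<in>J. \<bar>det P\<bar> * (norm (coef w (L2_fourier h) p))\<^sup>2) \<le> total * (sqnorm lborel h)\<^sup>2"
      using J total_nonneg by (intro sum_le_nn_integral_count_space) auto
    then have "(\<Sum>p\<in>J. (norm (coef w (L2_fourier h) p))\<^sup>2) \<le> total / \<bar>det P\<bar> * (sqnorm lborel h)\<^sup>2"
      using dP by (simp add: sum_distrib_left[symmetric] pos_le_divide_eq mult.commute)
    also have "\<dots> \<le> C * (sqnorm lborel h)\<^sup>2" by (intro mult_right_mono) (auto simp: C_def)
    finally have "(\<Sum>p\<in>J. (norm (coef w (L2_fourier h) p))\<^sup>2) \<le> C * (sqnorm lborel h)\<^sup>2" .
    moreover have "(\<Sum>p\<in>J. (norm (sqinner lborel (\<Phi> p) h))\<^sup>2) = (\<Sum>p\<in>J. (norm (coef w (L2_fourier h) p))\<^sup>2)"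
      using J ip[OF _ h] by (intro sum.cong) auto
    ultimately show ?thesis by simp
  qed
  define a where "a p = cnj (coef v' G p)" for p
  have cG: "coef v' G \<in> sqint (count_space (I \<times> intvec))" using v' G(1) by (rule coef_sqint)
  have "\<exists>S\<in>sqint lborel. ((\<lambda>J. sqnorm lborel (\<lambda>x. (\<Sum>p\<in>J. a p * \<Phi> p x) - S x)) \<longlongrightarrow> 0) (finite_subsets_at_top (I \<times> intvec))"
  proof (rule bessel_summable[OF \<Phi> _ _ C])
    fix J assume J: "finite J" "J \<subseteq> I \<times> intvec"
    show "(sqnorm lborel (\<lambda>x. \<Sum>p\<in>J. a p * \<Phi> p x))\<^sup>2 \<le> C * (\<Sum>p\<in>J. (norm (a p))\<^sup>2)"
      using J C \<Phi> by (intro synthesis_bound an) auto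
  next
    show "(\<lambda>p. (norm (a p))\<^sup>2) summable_on I \<times> intvec"
      using sqint_count_space_summable[OF cG] by (simp add: a_def)
  qed
  then obtain S where S: "S \<in> sqint lborel"
    and lim: "((\<lambda>J. sqnorm lborel (\<lambda>x. (\<Sum>p\<in>J. a p * \<Phi> p x) - S x)) \<longlongrightarrow> 0) (finite_subsets_at_top (I \<times> intvec))" by blast
  define k where "k x = f x - of_real \<bar>det P\<bar> * S x" for x
  have k: "k \<in> sqint lborel" unfolding k_def using f S by (intro sqint_diff sqint_cmult)
  define K where "K = L2_fourier k"
  have K: "K \<in> sqint lborel" "sqnorm lborel K = sqnorm lborel k"
    unfolding K_def using k by (auto simp: L2_fourier_norm)
  have cK: "coef w K \<in> sqint (count_space (I \<times> intvec))" using wsub K(1) by (rule coef_sqint)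
  have Sk: "sqinner lborel S k = sqinner (count_space (I \<times> intvec)) (coef w K) (coef v' G)"
  proof (rule tendsto_unique[OF finite_subsets_at_top_neq_bot])
    \<comment> \<open>Partial sums extended by 0 to sets that leave the index set, since
      \<open>sqinner_tendsto\<close> asks for square integrability at every index of the
      net.\<close>
    define R where "R J x = (if J \<subseteq> I \<times> intvec then \<Sum>p\<in>J. a p * \<Phi> p x else 0)" for J x
    have R: "R J \<in> sqint lborel" for J
      unfolding R_def[abs_def] using \<Phi> by (cases "J \<subseteq> I \<times> intvec") (auto intro!: sqint_sum sqint_cmult)
    have ev: "\<forall>\<^sub>F J in finite_subsets_at_top (I \<times> intvec). J \<subseteq> I \<times> intvec"
      by (rule eventually_finite_subsets_at_top_weakI)
    have "\<forall>\<^sub>F J in finite_subsets_at_top (I \<times> intvec). sqnorm lborel (\<lambda>x. (\<Sum>p\<in>J. a p * \<Phi> p x) - S x) = sqnorm lborel (\<lambda>x. R J x - S x)"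
      using ev by eventually_elim (simp add: R_def)
    then have "((\<lambda>J. sqnorm lborel (\<lambda>x. R J x - S x)) \<longlongrightarrow> 0) (finite_subsets_at_top (I \<times> intvec))"
      using lim by (rule Lim_transform_eventually[rotated])
    then show "((\<lambda>J. sqinner lborel (R J) k) \<longlongrightarrow> sqinner lborel S k) (finite_subsets_at_top (I \<times> intvec))"
      using R S k by (intro sqinner_tendsto)
    have "\<forall>\<^sub>F J in finite_subsets_at_top (I \<times> intvec). (\<Sum>p\<in>J. coef w K p * cnj (coef v' G p)) = sqinner lborel (R J) k"
      using ev
    proof eventually_elim
      case (elim J)
      have "sqinner lborel (R J) k = sqinner lborel (\<lambda>x. \<Sum>p\<in>J. a p * \<Phi> p x) k"
        using elim by (simp add: R_def[abs_def])
      also have "\<dots> = (\<Sum>p\<in>J. sqinner lborel (\<lambda>x. a p * \<Phi> p x) k)"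
        using elim \<Phi> k by (intro sqinner_sum_left sqint_cmult) auto
      also have "\<dots> = (\<Sum>p\<in>J. coef w K p * cnj (coef v' G p))"
        using elim ip[OF _ k] by (intro sum.cong) (auto simp: sqinner_cmult_left a_def K_def)
      finally show ?case by simp
    qed
    then show "((\<lambda>J. sqinner lborel (R J) k) \<longlongrightarrow> sqinner (count_space (I \<times> intvec)) (coef w K) (coef v' G)) (finite_subsets_at_top (I \<times> intvec))"
      using sqinner_count_space_has_sum[OF cK cG] unfolding has_sum_def by (rule Lim_transform_eventually[rotated])
  qed
  have fk: "sqinner lborel f k = (LINT \<xi>|lborel. G \<xi> * cnj (K \<xi>) * (LINT c|count_space I. w c (M c *v \<xi>) * cnj (v' c (M c *v \<xi>))))"
  proof -
    have [measurable]: "G \<in> borel_measurable borel" "K \<in> borel_measurable borel" "L2_fourier f \<in> borel_measurable borel"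
      using G K L2_fourier_sqint[OF f] by (auto dest: sqint_borel)
    have vm [measurable]: "v' c \<in> borel_measurable borel" for c using v' by (rule sub_windowD)
    have [measurable]: "(\<lambda>\<xi>. LINT c|count_space I. w c (M c *v \<xi>) * cnj (v' c (M c *v \<xi>))) \<in> borel_measurable borel"
      by (rule count_space_integral_measurable[OF I]) measurable
    have "sqinner lborel f k = (LINT \<xi>|lborel. L2_fourier f \<xi> * cnj (K \<xi>))"
      using L2_fourier_inner[OF f k] by (simp add: sqinner_def K_def)
    also have "\<dots> = (LINT \<xi>|lborel. G \<xi> * cnj (K \<xi>) * (LINT c|count_space I. w c (M c *v \<xi>) * cnj (v' c (M c *v \<xi>))))"
    proof (rule integral_cong_AE)
      show "AE \<xi> in lborel. L2_fourier f \<xi> * cnj (K \<xi>) = G \<xi> * cnj (K \<xi>) * (LINT c|count_space I. w c (M c *v \<xi>) * cnj (v' c (M c *v \<xi>)))"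
        using mul
      proof eventually_elim
        case (elim \<xi>)
        show ?case unfolding elim[symmetric] by (simp only: mult_ac)
      qed
    qed measurable
    finally show ?thesis .
  qed
  have "norm (of_real \<bar>det P\<bar> * sqinner lborel S k - sqinner lborel f k) \<le> offdiag * sqnorm lborel K * sqnorm lborel G"
    unfolding Sk fk by (rule duality[OF wsub v' K(1) G(1)])
  moreover have "sqinner lborel f k - of_real \<bar>det P\<bar> * sqinner lborel S k = of_real ((sqnorm lborel k)\<^sup>2)"
  proof -
    have "sqinner lborel k k = sqinner lborel f k - sqinner lborel (\<lambda>x. of_real \<bar>det P\<bar> * S x) k"
      using sqinner_diff_left[OF f sqint_cmult[OF S] k, of "of_real \<bar>det P\<bar>"] by (simp only: k_def[abs_def])
    then show ?thesis by (simp only: sqinner_self sqinner_cmult_left)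
  qed
  ultimately have "(sqnorm lborel k)\<^sup>2 \<le> offdiag * sqnorm lborel k * sqnorm lborel G"
    using K(2) by (metis abs_of_nonneg norm_minus_commute norm_of_real zero_le_power2)
  then have "sqnorm lborel k * sqnorm lborel k \<le> (offdiag * sqnorm lborel G) * sqnorm lborel k"
    by (simp add: power2_eq_square mult_ac)
  then have "sqnorm lborel k \<le> offdiag * sqnorm lborel G"
  proof (cases "sqnorm lborel k = 0")
    case True
    then show ?thesis by (simp add: offdiag_def)
  next
    case False
    then have "sqnorm lborel k > 0" using sqnorm_nonneg[of lborel k] by linarith
    moreover assume "sqnorm lborel k * sqnorm lborel k \<le> (offdiag * sqnorm lborel G) * sqnorm lborel k"
    ultimately show ?thesis by (simp only: mult_le_cancel_right_pos)
  qed
  also have "\<dots> \<le> offdiag * (b * sqnorm lborel f)"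
    using G(2) by (intro mult_left_mono) (auto simp: offdiag_def)
  finally have "sqnorm lborel k \<le> offdiag * b * sqnorm lborel f" by (simp add: mult.assoc)
  then show ?thesis using S lim unfolding k_def[abs_def] a_def by blast
qed

end

section \<open>The wavepacket channels\<close>

text \<open>\<open>None\<close> is the coarse channel, \<open>Some (j, k)\<close> the channel of scale \<open>j\<close> and orientation \<open>k\<close>.\<close>

definition channels :: "(nat \<times> nat) option set" where
  "channels = insert None (Some ` {(j, k). 1 \<le> j \<and> k \<le> 2 ^ j - 1})"

fun chan_mat :: "(nat \<times> nat) option \<Rightarrow> real^2^2" where
  "chan_mat None = mat 1"
| "chan_mat (Some (j, k)) = B_mat j k"

fun chan_win :: "(real^2 \<Rightarrow> complex) \<Rightarrow> (real^2 \<Rightarrow> complex) \<Rightarrow> (nat \<times> nat) option \<Rightarrow> real^2 \<Rightarrow> complex" where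
  "chan_win g\<^sub>0 g None = g\<^sub>0"
| "chan_win g\<^sub>0 g (Some c) = g"

lemma invertible_B_mat: "invertible (A_mat j k)" "invertible (B_mat j k)"
proof -
  have r: "det (rotation_matrix t) = 1" for t
    unfolding rotation_matrix_def det_2 by (simp add: power2_eq_square[symmetric])
  have "det (scaling_matrix j) = 4 ^ j * 2 ^ j"
    unfolding scaling_matrix_def det_2 by simp
  then have "det (A_mat j k) \<noteq> 0" unfolding A_mat_def det_mul r by simp
  then show A: "invertible (A_mat j k)" by (simp add: invertible_det_nz)
  show "invertible (B_mat j k)" unfolding B_mat_def by (intro matrix_inv_inv A)
qed

lemma invertible_chan_mat: "invertible (chan_mat c)"
proof (cases c)
  case None
  then show ?thesis using invertible_mat[of 1] by simp
next
  case (Some p)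
  then show ?thesis by (cases p) (simp add: invertible_B_mat)
qed

text \<open>Lets the series in \<open>Theta\<close>, \<open>covering_sum\<close> and
  \<open>multiplier\<close> be treated as integrals over one countable index set.\<close>

lemma channels_nn_integral:
  "(\<integral>\<^sup>+c. h c \<partial>count_space channels) = h None + (\<Sum>j. \<Sum>k\<le>2 ^ Suc j - 1. h (Some (Suc j, k)))"
proof -
  define S :: "(nat \<times> nat) set" where "S = {(j, k). 1 \<le> j \<and> k \<le> 2 ^ j - 1}"
  define S' :: "(nat \<times> nat) set" where "S' = (SIGMA j:UNIV. {..2 ^ Suc j - 1})"
  have ch: "channels = {None} \<union> Some ` S" by (auto simp: channels_def S_def)
  have "(\<integral>\<^sup>+c. h c \<partial>count_space channels) = (\<integral>\<^sup>+c. h c * indicator {None} c + h c * indicator (Some ` S) c \<partial>count_space UNIV)"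
    unfolding nn_integral_count_space_indicator[of channels] ch
    by (simp add: nn_integral_count_space_indicator) (intro nn_integral_cong, auto simp: indicator_def)
  also have "\<dots> = (\<integral>\<^sup>+c. h c * indicator {None} c \<partial>count_space UNIV) + (\<integral>\<^sup>+c. h c * indicator (Some ` S) c \<partial>count_space UNIV)"
    by (rule nn_integral_add) auto
  also have "(\<integral>\<^sup>+c. h c * indicator {None} c \<partial>count_space UNIV) = h None"
    by (simp add: nn_integral_count_space_indicator[symmetric] nn_integral_count_space_finite)
  also have "(\<integral>\<^sup>+c. h c * indicator (Some ` S) c \<partial>count_space UNIV) = (\<integral>\<^sup>+c. h c \<partial>count_space (Some ` S))"
    by (simp add: nn_integral_count_space_indicator)
  also have "\<dots> = (\<integral>\<^sup>+p. h (Some (Suc (fst p), snd p)) \<partial>count_space S')"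
  proof (rule nn_integral_bij_count_space[symmetric])
    show "bij_betw (\<lambda>p. Some (Suc (fst p), snd p)) S' (Some ` S)"
    proof (rule bij_betw_byWitness[where f' = "\<lambda>c. (fst (the c) - 1, snd (the c))"])
      show "\<forall>c\<in>Some ` S. Some (Suc (fst (fst (the c) - 1, snd (the c))), snd (fst (the c) - 1, snd (the c))) = c"
        by (auto simp: S_def)
      show "(\<lambda>p. Some (Suc (fst p), snd p)) ` S' \<subseteq> Some ` S"
        unfolding S_def S'_def by (rule image_subsetI, rule imageI) auto
      show "(\<lambda>c. (fst (the c) - 1, snd (the c))) ` Some ` S \<subseteq> S'"
      proof (safe)
        fix j k assume "(j, k) \<in> S"
        then have "j \<ge> 1" "k \<le> 2 ^ j - 1" by (auto simp: S_def)
        then show "(fst (the (Some (j, k))) - 1, snd (the (Some (j, k)))) \<in> S'"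
          by (cases j) (auto simp: S'_def)
      qed
    qed auto
  qed
  also have "\<dots> = (\<integral>\<^sup>+p. h (Some (Suc (fst p), snd p)) * indicator S' p \<partial>count_space UNIV)"
    by (simp add: nn_integral_count_space_indicator)
  also have "\<dots> = (\<integral>\<^sup>+j. \<integral>\<^sup>+k. h (Some (Suc j, k)) * indicator {..2 ^ Suc j - 1} k \<partial>count_space UNIV \<partial>count_space UNIV)"
    by (subst nn_integral_fst_count_space[symmetric])
      (intro nn_integral_cong, auto simp: S'_def indicator_def)
  also have "\<dots> = (\<integral>\<^sup>+j. (\<Sum>k\<le>2 ^ Suc j - 1. h (Some (Suc j, k))) \<partial>count_space UNIV)"
  proof (rule nn_integral_cong)
    fix j :: nat
    have "(\<integral>\<^sup>+k. h (Some (Suc j, k)) * indicator {..2 ^ Suc j - 1} k \<partial>count_space UNIV) = (\<integral>\<^sup>+k. h (Some (Suc j, k)) \<partial>count_space {..2 ^ Suc j - 1})"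
      by (simp add: nn_integral_count_space_indicator del: power_Suc)
    then show "(\<integral>\<^sup>+k. h (Some (Suc j, k)) * indicator {..2 ^ Suc j - 1} k \<partial>count_space UNIV) = (\<Sum>k\<le>2 ^ Suc j - 1. h (Some (Suc j, k)))"
      by (simp add: nn_integral_count_space_finite)
  qed
  also have "\<dots> = (\<Sum>j. \<Sum>k\<le>2 ^ Suc j - 1. h (Some (Suc j, k)))" by (rule nn_integral_count_space_nat)
  finally show ?thesis .
qed

lemma Theta_channels:
  "Theta \<phi>\<^sub>0 \<phi> \<zeta> = esssup lborel (\<lambda>\<xi>. \<integral>\<^sup>+c. ennreal (norm (chan_win (L2_fourier \<phi>\<^sub>0) (L2_fourier \<phi>) c (chan_mat c *v \<xi>)) *
     norm (chan_win (L2_fourier \<phi>\<^sub>0) (L2_fourier \<phi>) c (chan_mat c *v \<xi> - \<zeta>))) \<partial>count_space channels)"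
  unfolding Theta_def channels_nn_integral by simp

lemma covering_sum_channels:
  "covering_sum \<phi>\<^sub>0 \<phi> \<xi> = sqmass (count_space channels) (\<lambda>c. chan_win (L2_fourier \<phi>\<^sub>0) (L2_fourier \<phi>) c (chan_mat c *v \<xi>))"
  unfolding covering_sum_def channels_nn_integral by simp

text \<open>Both sides are suprema of finite sums: the left one by
  \<open>nonneg_infsum_complete\<close>, the right one along an enumeration of A.\<close>

lemma infsum_ennreal_eq_nn_integral:
  fixes f :: "'a \<Rightarrow> ennreal"
  assumes A: "countable A"
  shows "infsum f A = (\<integral>\<^sup>+x. f x \<partial>count_space A)"
proof (cases "finite A")
  case True
  then show ?thesis by (simp add: nn_integral_count_space_finite)
next
  case False
  have S: "infsum f A = (SUP F\<in>{F. finite F \<and> F\<subseteq>A}. sum f F)"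
    by (rule nonneg_infsum_complete) simp
  show ?thesis
  proof (rule antisym)
    show "infsum f A \<le> (\<integral>\<^sup>+x. f x \<partial>count_space A)"
      unfolding S
    proof (rule SUP_least)
      fix F assume "F \<in> {F. finite F \<and> F\<subseteq>A}"
      then have F: "finite F" "F \<subseteq> A" by auto
      then have "sum f F = (\<integral>\<^sup>+x. f x \<partial>count_space F)" by (simp add: nn_integral_count_space_finite)
      also have "\<dots> \<le> (\<integral>\<^sup>+x. f x \<partial>count_space A)"
        unfolding nn_integral_count_space_indicator[of F] nn_integral_count_space_indicator[of A]
        using F by (simp add: nn_integral_count_space_indicator) (intro nn_integral_mono, auto simp: indicator_def)
      finally show "sum f F \<le> (\<integral>\<^sup>+x. f x \<partial>count_space A)" .
    qed
    have b: "bij_betw (from_nat_into A) UNIV A" using A False by (rule bij_betw_from_nat_into)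
    have "(\<integral>\<^sup>+x. f x \<partial>count_space A) = (\<Sum>i. f (from_nat_into A i))"
      by (simp add: nn_integral_bij_count_space[OF b, symmetric] nn_integral_count_space_nat)
    also have "\<dots> = (SUP n. \<Sum>i<n. f (from_nat_into A i))" by (rule suminf_eq_SUP)
    also have "\<dots> \<le> infsum f A"
      unfolding S
    proof (rule SUP_least)
      fix n
      have "(\<Sum>i<n. f (from_nat_into A i)) = sum f (from_nat_into A ` {..<n})"
        using b by (subst sum.reindex) (auto simp: bij_betw_def intro: inj_on_subset)
      also have "\<dots> \<le> (SUP F\<in>{F. finite F \<and> F\<subseteq>A}. sum f F)"
        using b by (intro SUP_upper) (auto simp: bij_betw_def)
      finally show "(\<Sum>i<n. f (from_nat_into A i)) \<le> (SUP F\<in>{F. finite F \<and> F\<subseteq>A}. sum f F)" .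
    qed
    finally show "(\<integral>\<^sup>+x. f x \<partial>count_space A) \<le> infsum f A" .
  qed
qed

lemma lattice_of_image: "lattice_of P = (\<lambda>n. P *v n) ` intvec"
  by (auto simp: lattice_of_def intvec_def)

lemma inj_matrix: "invertible (P :: real^2^2) \<Longrightarrow> inj (\<lambda>n. P *v n)"
  by (rule inj_on_inverseI[where g = "\<lambda>x. matrix_inv P *v x"]) (simp add: matrix_inv_inv)

text \<open>The dual matrix is injective, so nonzero dual lattice vectors can be indexed by nonzero
  integer vectors, as in the locale \<open>wave_system\<close>.\<close>

lemma Delta_nn_integral:
  assumes P: "invertible P"
  defines "Q \<equiv> transpose (matrix_inv P)"
  shows "Delta \<phi>\<^sub>0 \<phi> P = (\<integral>\<^sup>+n. max (Theta \<phi>\<^sub>0 \<phi> (Q *v n)) (Theta \<phi>\<^sub>0 \<phi> (- (Q *v n))) \<partial>count_space (intvec - {0}))"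
proof -
  have Q: "invertible Q" unfolding Q_def using P by (intro matrix_inv_inv)
  have i: "inj (\<lambda>n. Q *v n)" using Q by (rule inj_matrix)
  have d: "dual_lattice_of P - {0} = (\<lambda>n. Q *v n) ` (intvec - {0})"
    using i by (simp add: dual_lattice_of_def lattice_of_image Q_def[symmetric] image_set_diff)
  have c: "countable (intvec - {0})" by simp
  have b: "bij_betw (\<lambda>n. Q *v n) (intvec - {0}) ((\<lambda>n. Q *v n) ` (intvec - {0}))"
    using i by (intro bij_betw_imageI) (auto intro: inj_on_subset)
  show ?thesis
    unfolding Delta_def d using c
    by (subst infsum_ennreal_eq_nn_integral) (simp_all add: nn_integral_bij_count_space[OF b, symmetric])
qed

section \<open>Wavepackets as atoms on the frequency side\<close>

definition wp_of :: "real^2^2 \<Rightarrow> (nat \<times> nat) option \<times> (real^2) \<Rightarrow> wp_index" where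
  "wp_of P = (\<lambda>(c, m). case c of None \<Rightarrow> Coarse (P *v m) | Some (j, k) \<Rightarrow> Fine j k (P *v m))"

lemma wp_of_image: "wp_of P ` (channels \<times> intvec) = wp_indices (lattice_of P)"
  by (force simp: wp_of_def wp_indices_def channels_def lattice_of_image image_iff)

lemma wp_of_inj: "invertible P \<Longrightarrow> inj_on (wp_of P) (channels \<times> intvec)"
  using inj_matrix[of P] by (auto simp: inj_on_def wp_of_def split: option.splits)

lemma wavepacket_sqint:
  assumes "\<phi>\<^sub>0 \<in> sqint lborel" "\<phi> \<in> sqint lborel"
  shows "wavepacket \<phi>\<^sub>0 \<phi> i \<in> sqint lborel"
proof (cases i)
  case (Coarse \<mu>)
  then show ?thesis using is_ft_sqint(1)[OF is_ft_translate[OF L2_fourier_is_ft[OF assms(1)]]] by simp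
next
  case (Fine j k \<mu>)
  then show ?thesis
    using is_ft_sqint(1)[OF is_ft_dilate[OF invertible_B_mat(1) is_ft_translate[OF L2_fourier_is_ft[OF assms(2)]]]] by simp
qed

lemma wavepacket_fourier:
  assumes g0: "\<phi>\<^sub>0 \<in> sqint lborel" and g: "\<phi> \<in> sqint lborel"
  shows "AE \<xi> in lborel. L2_fourier (wavepacket \<phi>\<^sub>0 \<phi> (wp_of P (c, m))) \<xi> =
    atom (chan_mat c) (chan_win (L2_fourier \<phi>\<^sub>0) (L2_fourier \<phi>) c) (P *v m) \<xi>"
proof (cases c)
  case None
  have "det (mat 1 :: real^2^2) = 1" by simp
  then show ?thesis
    using L2_fourier_eq[OF is_ft_translate[OF L2_fourier_is_ft[OF g0]], of "P *v m"] None
    by (simp add: wp_of_def atom_def)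
next
  case (Some p)
  obtain j k where p: "p = (j, k)" by (cases p)
  show ?thesis
    using L2_fourier_eq[OF is_ft_dilate[OF invertible_B_mat(1)[of j k] is_ft_translate[OF L2_fourier_is_ft[OF g], of "P *v m"]]] Some p
    by (simp add: wp_of_def atom_def B_mat_def)
qed

lemma atom_sqint:
  assumes "invertible M" "w \<in> sqint lborel"
  shows "atom M w \<mu> \<in> sqint lborel"
proof (rule sqint_dominated)
  have [measurable]: "w \<in> borel_measurable borel" using assms(2) by (rule sqint_borel)
  show "atom M w \<mu> \<in> borel_measurable lborel" by simp
  show "(\<lambda>\<xi>. of_real (sqrt \<bar>det M\<bar>) * w (M *v \<xi>)) \<in> sqint lborel"
    using sqint_matrix[OF assms] by (rule sqint_cmult)
qed (simp add: atom_def norm_mult)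

lemma atom_cong_AE:
  assumes M: "invertible M" and "AE x in lborel. w x = w' x"
  shows "AE \<xi> in lborel. atom M w \<mu> \<xi> = atom M w' \<mu> \<xi>"
  using AE_matrix[OF M assms(2)] by eventually_elim (simp add: atom_def)

text \<open>The terms of the complex series are nonnegative reals, so a finite integral over the
  channels gives summability, and only then is the \<open>suminf\<close> in
  \<open>multiplier\<close> the expected value rather than a default.\<close>

lemma multiplier_channels:
  assumes psi: "\<And>j k. L2_fourier \<psi> (B_mat (Suc j) k *v \<xi>) = of_real (\<eta> (B_mat (Suc j) k *v \<xi>)) * L2_fourier \<phi> (B_mat (Suc j) k *v \<xi>)"
    and \<eta>: "\<And>x. 0 \<le> \<eta> x"
    and fin: "(\<integral>\<^sup>+c. ennreal (case c of None \<Rightarrow> (norm (L2_fourier \<phi>\<^sub>0 \<xi>))\<^sup>2 |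
        Some (j, k) \<Rightarrow> \<eta> (B_mat j k *v \<xi>) * (norm (L2_fourier \<phi> (B_mat j k *v \<xi>)))\<^sup>2) \<partial>count_space channels) = ennreal r"
    and r: "r \<ge> 0"
  shows "multiplier \<phi>\<^sub>0 \<phi> \<psi> \<xi> = of_real r"
proof -
  define s where "s j = (\<Sum>k\<le>2 ^ Suc j - 1. \<eta> (B_mat (Suc j) k *v \<xi>) * (norm (L2_fourier \<phi> (B_mat (Suc j) k *v \<xi>)))\<^sup>2)" for j
  have s0: "s j \<ge> 0" for j unfolding s_def using \<eta> by (intro sum_nonneg) auto
  have "ennreal r = ennreal ((norm (L2_fourier \<phi>\<^sub>0 \<xi>))\<^sup>2) + (\<Sum>j. ennreal (s j))"
    unfolding fin[symmetric] channels_nn_integral s_def using \<eta> by (simp add: sum_ennreal)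
  moreover from this have "(\<Sum>j. ennreal (s j)) \<noteq> top"
    by (metis ennreal_add_eq_top ennreal_neq_top)
  then have sm: "summable s" using s0 by (intro summable_suminf_not_top)
  ultimately have "ennreal r = ennreal ((norm (L2_fourier \<phi>\<^sub>0 \<xi>))\<^sup>2 + suminf s)"
    using s0 by (simp add: suminf_ennreal2 suminf_nonneg)
  then have rr: "r = (norm (L2_fourier \<phi>\<^sub>0 \<xi>))\<^sup>2 + suminf s"
    using r suminf_nonneg[OF sm s0] by (subst (asm) ennreal_inj) (auto intro!: add_nonneg_nonneg)
  have "(\<Sum>k\<le>2 ^ Suc j - 1. L2_fourier \<phi> (B_mat (Suc j) k *v \<xi>) * cnj (L2_fourier \<psi> (B_mat (Suc j) k *v \<xi>))) = of_real (s j)" for j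
    unfolding s_def of_real_sum psi
    by (intro sum.cong refl) (simp add: complex_norm_square mult_ac del: of_real_power)
  then have "multiplier \<phi>\<^sub>0 \<phi> \<psi> \<xi> = of_real ((norm (L2_fourier \<phi>\<^sub>0 \<xi>))\<^sup>2) + (\<Sum>j. of_real (s j))"
    by (simp add: multiplier_def)
  also have "(\<Sum>j. complex_of_real (s j)) = of_real (suminf s)" using sm by (rule suminf_of_real[symmetric])
  finally show ?thesis by (simp add: rr)
qed

lemma sqnorm_mono_AE:
  assumes "f \<in> borel_measurable M" "g \<in> sqint M" "AE x in M. norm (f x) \<le> norm (g x)"
  shows "sqnorm M f \<le> sqnorm M g"
  unfolding sqnorm_def
proof (intro real_sqrt_le_mono integral_mono_AE sqint_integrable)
  show "f \<in> sqint M" using assms by (rule sqint_dominated)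
  show "AE x in M. (norm (f x))\<^sup>2 \<le> (norm (g x))\<^sup>2"
    using assms(3) by eventually_elim (auto intro: power_mono)
qed fact

text \<open>The matrices are invertible and countably many, so one null set serves all scales and
  orientations.\<close>

lemma AE_B_mat:
  assumes "AE x in lborel. Pr x"
  shows "AE \<xi> in lborel. \<forall>j k. Pr (B_mat j k *v \<xi>)"
  unfolding AE_all_countable using AE_matrix[OF invertible_B_mat(2) assms] by blast

section \<open>The expansion for the wavepacket windows\<close>

text \<open>The wave system is instantiated with the transforms of the windows as \<open>w\<close>;
  the truncated transforms serve as \<open>v'\<close>, and \<open>G\<close> is the transform of f
  divided by the multiplier.\<close>

lemma window_expansion:
  assumes win: "window_assumptions \<phi>\<^sub>0 \<phi> A B" and \<epsilon>: "\<epsilon> > 0"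
    and star: "ennreal \<epsilon> * star_norm (L2_fourier \<phi>) < ennreal A"
    and cut: "cutoff \<epsilon> \<phi> \<eta>" and P: "invertible P"
    and Del: "Delta \<phi>\<^sub>0 \<phi> P < ennreal (A - \<epsilon> * enn2real (star_norm (L2_fourier \<phi>)))"
    and f: "f \<in> L2"
  shows "\<exists>f'\<in>L2. approx_expansion \<phi>\<^sub>0 \<phi> \<eta> P f f' \<and>
    L2_norm (\<lambda>x. f x - f' x) \<le> enn2real (Delta \<phi>\<^sub>0 \<phi> P) / (A - \<epsilon> * enn2real (star_norm (L2_fourier \<phi>))) * L2_norm f"
proof -
  define g0 where "g0 = L2_fourier \<phi>\<^sub>0"
  define g where "g = L2_fourier \<phi>"
  define N where "N = enn2real (star_norm g)"
  define a0 where "a0 = A - \<epsilon> * N"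
  define Q where "Q = transpose (matrix_inv P)"
  have phi: "\<phi>\<^sub>0 \<in> sqint lborel" "\<phi> \<in> sqint lborel" and A: "0 < A" "A \<le> B"
    and cov: "AE \<xi> in lborel. ennreal A \<le> covering_sum \<phi>\<^sub>0 \<phi> \<xi> \<and> covering_sum \<phi>\<^sub>0 \<phi> \<xi> \<le> ennreal B"
    using win by (auto simp: window_assumptions_def L2_eq_sqint)
  have gs: "g0 \<in> sqint lborel" "g \<in> sqint lborel" unfolding g0_def g_def using phi by auto
  have gm [measurable]: "g0 \<in> borel_measurable borel" "g \<in> borel_measurable borel" using gs by (auto dest: sqint_borel)
  have starN: "star_norm g = ennreal N"
  proof -
    have "star_norm g \<noteq> top" using star \<epsilon> by (auto simp: g_def ennreal_mult_eq_top_iff)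
    then show ?thesis by (simp add: N_def less_top)
  qed
  have N0: "N \<ge> 0" by (simp add: N_def)
  have a0: "a0 > 0"
    using star \<epsilon> A N0 unfolding g_def[symmetric] starN by (simp add: ennreal_mult'[symmetric] a0_def ennreal_less_iff)
  have \<eta>c: "continuous_on UNIV \<eta>"
  proof -
    have "Ck 0 \<eta>" using cut by (simp add: cutoff_def smooth_def)
    then show ?thesis by simp
  qed
  have [measurable]: "\<eta> \<in> borel_measurable borel" using \<eta>c by (rule borel_measurable_continuous_onI)
  have "range \<eta> \<subseteq> {0..1}" using cut by (simp add: cutoff_def)
  then have "\<eta> x \<in> {0..1}" for x by blast
  then have \<eta>01: "0 \<le> \<eta> x" "\<eta> x \<le> 1" for x by auto
  have \<eta>1: "AE \<xi> in lborel. norm (g \<xi>) > \<epsilon> \<longrightarrow> \<eta> \<xi> = 1" using cut by (simp add: cutoff_def g_def)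
  define h where "h x = of_real (\<eta> x) * g x" for x
  have [measurable]: "h \<in> borel_measurable borel" unfolding h_def by measurable
  have hle: "norm (h x) \<le> norm (g x)" for x
    using \<eta>01[of x] by (simp add: h_def norm_mult mult_left_le_one_le)
  have hs: "h \<in> sqint lborel" by (rule sqint_dominated[OF _ gs(2)]) (auto simp: hle)
  define \<psi> where "\<psi> = dual_window \<phi> \<eta>"
  have psi: "\<psi> \<in> sqint lborel" "AE \<xi> in lborel. L2_fourier \<psi> \<xi> = h \<xi>"
    using L2_inv_fourier[OF hs] unfolding \<psi>_def dual_window_def h_def[abs_def] g_def by auto
  define w where "w = chan_win g0 g"
  define v' where "v' = chan_win g0 h"
  have wm: "w c \<in> borel_measurable borel" for c by (cases c) (auto simp: w_def)
  have v'm: "v' c \<in> borel_measurable borel" for c by (cases c) (auto simp: v'_def)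
  note [measurable] = wm v'm
  define Tm where "Tm n = max (Theta \<phi>\<^sub>0 \<phi> (Q *v n)) (Theta \<phi>\<^sub>0 \<phi> (- (Q *v n)))" for n
  define T where "T n = enn2real (Tm n)" for n
  \<comment> \<open>At 0 the correlation is the covering sum, so the upper covering bound supplies
    the finite value \<open>T 0\<close> on which the Bessel bound rests.\<close>
  have Theta0: "Theta \<phi>\<^sub>0 \<phi> 0 \<le> ennreal B"
    unfolding Theta_channels
  proof (rule esssup_I)
    have "(\<lambda>\<xi>. \<integral>\<^sup>+c. ennreal (norm (w c (chan_mat c *v \<xi>)) * norm (w c (chan_mat c *v \<xi> - 0))) \<partial>count_space channels) \<in> borel_measurable borel"
      by (rule count_space_nn_measurable) auto
    then show "(\<lambda>\<xi>. \<integral>\<^sup>+c. ennreal (norm (chan_win (L2_fourier \<phi>\<^sub>0) (L2_fourier \<phi>) c (chan_mat c *v \<xi>)) *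
     norm (chan_win (L2_fourier \<phi>\<^sub>0) (L2_fourier \<phi>) c (chan_mat c *v \<xi> - 0))) \<partial>count_space channels) \<in> borel_measurable lborel"
      unfolding g0_def[symmetric] g_def[symmetric] w_def[symmetric] by simp
    show "AE \<xi> in lborel. (\<integral>\<^sup>+c. ennreal (norm (chan_win (L2_fourier \<phi>\<^sub>0) (L2_fourier \<phi>) c (chan_mat c *v \<xi>)) *
     norm (chan_win (L2_fourier \<phi>\<^sub>0) (L2_fourier \<phi>) c (chan_mat c *v \<xi> - 0))) \<partial>count_space channels) \<le> ennreal B"
      using cov unfolding covering_sum_channels by eventually_elim (simp add: power2_eq_square)
  qed
  have DT: "Delta \<phi>\<^sub>0 \<phi> P = (\<integral>\<^sup>+n. Tm n \<partial>count_space (intvec - {0}))"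
    unfolding Delta_nn_integral[OF P] Tm_def Q_def ..
  have Dfin: "Delta \<phi>\<^sub>0 \<phi> P < top" using Del by (rule less_trans) simp
  have Tn: "Tm n = ennreal (T n)" if n: "n \<in> intvec" for n
  proof -
    have "Tm n < top"
    proof (cases "n = 0")
      case True
      then show ?thesis using le_less_trans[OF Theta0] by (simp add: Tm_def)
    next
      case False
      then have "Tm n \<le> Delta \<phi>\<^sub>0 \<phi> P" unfolding DT using n by (intro nn_integral_ge_point) auto
      then show ?thesis using Dfin by (rule le_less_trans)
    qed
    then show ?thesis by (simp add: T_def)
  qed
  have DT': "(\<integral>\<^sup>+n. ennreal (T n) \<partial>count_space (intvec - {0})) = Delta \<phi>\<^sub>0 \<phi> P"
    unfolding DT by (intro nn_integral_cong) (simp add: Tn)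
  interpret wave_system channels chan_mat w P T
  proof
    show "countable channels" "invertible P" "\<And>c. invertible (chan_mat c)" "\<And>c. w c \<in> borel_measurable borel" "\<And>n. 0 \<le> T n"
      using P by (auto simp: invertible_chan_mat T_def wm)
    fix n assume n: "n \<in> intvec"
    have ae: "AE \<xi> in lborel. (\<integral>\<^sup>+c. ennreal (norm (w c (chan_mat c *v \<xi>)) * norm (w c (chan_mat c *v \<xi> - \<zeta>))) \<partial>count_space channels) \<le> Theta \<phi>\<^sub>0 \<phi> \<zeta>" for \<zeta>
      unfolding Theta_channels w_def g0_def g_def by (rule esssup_AE)
    have T1: "Theta \<phi>\<^sub>0 \<phi> (Q *v n) \<le> ennreal (T n)" "Theta \<phi>\<^sub>0 \<phi> (- (Q *v n)) \<le> ennreal (T n)"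
      unfolding Tn[OF n, symmetric] by (auto simp: Tm_def)
    show "AE \<xi> in lborel. (\<integral>\<^sup>+c. ennreal (norm (w c (chan_mat c *v \<xi>)) * norm (w c (chan_mat c *v \<xi> - transpose (matrix_inv P) *v n))) \<partial>count_space channels) \<le> ennreal (T n)"
      using ae[of "Q *v n"] unfolding Q_def[symmetric] by eventually_elim (rule order_trans[OF _ T1(1)])
    show "AE \<xi> in lborel. (\<integral>\<^sup>+c. ennreal (norm (w c (chan_mat c *v \<xi>)) * norm (w c (chan_mat c *v \<xi> + transpose (matrix_inv P) *v n))) \<partial>count_space channels) \<le> ennreal (T n)"
      using ae[of "- (Q *v n)"] unfolding Q_def[symmetric]
    proof eventually_elim
      case (elim \<xi>)
      then show ?case using order_trans[OF _ T1(2)] by simp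
    qed
  next
    have "(\<integral>\<^sup>+n. ennreal (T n) \<partial>count_space intvec) = (\<integral>\<^sup>+n. ennreal (T n) * indicator {0} n + ennreal (T n) * indicator (intvec - {0}) n \<partial>count_space UNIV)"
      by (simp add: nn_integral_count_space_indicator) (intro nn_integral_cong, auto simp: indicator_def)
    also have "\<dots> = (\<integral>\<^sup>+n. ennreal (T n) * indicator {0} n \<partial>count_space UNIV) + (\<integral>\<^sup>+n. ennreal (T n) * indicator (intvec - {0}) n \<partial>count_space UNIV)"
      by (rule nn_integral_add) auto
    also have "(\<integral>\<^sup>+n. ennreal (T n) * indicator {0} n \<partial>count_space UNIV) = ennreal (T 0)"
      by (simp add: nn_integral_count_space_indicator[symmetric] nn_integral_count_space_finite)
    also have "(\<integral>\<^sup>+n. ennreal (T n) * indicator (intvec - {0}) n \<partial>count_space UNIV) = Delta \<phi>\<^sub>0 \<phi> P"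
      unfolding DT'[symmetric] by (simp add: nn_integral_count_space_indicator)
    also have "ennreal (T 0) + Delta \<phi>\<^sub>0 \<phi> P < \<infinity>" using Dfin by (simp add: ennreal_add_eq_top less_top)
    finally show "(\<integral>\<^sup>+n. ennreal (T n) \<partial>count_space intvec) < \<infinity>" .
  qed
  have off: "offdiag = enn2real (Delta \<phi>\<^sub>0 \<phi> P)" unfolding offdiag_def DT' ..
  have sub: "sub_window v'"
    unfolding sub_window_def
  proof (intro conjI allI v'm)
    show "norm (v' c x) \<le> norm (w c x)" for c x by (cases c) (auto simp: v'_def w_def hle)
  qed
  \<comment> \<open>The channel terms of the multiplier: real and nonnegative, because the truncated
    window is a nonnegative multiple of the original one.\<close>
  define \<kappa> where "\<kappa> c \<xi> = (case c of None \<Rightarrow> (norm (g0 \<xi>))\<^sup>2 |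
        Some (j, k) \<Rightarrow> \<eta> (B_mat j k *v \<xi>) * (norm (g (B_mat j k *v \<xi>)))\<^sup>2)" for c \<xi>
  have [measurable]: "\<kappa> c \<in> borel_measurable borel" for c
    unfolding \<kappa>_def by (cases c) (auto split: prod.split)
  have \<kappa>0: "\<kappa> c \<xi> \<ge> 0" for c \<xi> unfolding \<kappa>_def using \<eta>01 by (auto split: option.split)
  have wv: "w c (chan_mat c *v \<xi>) * cnj (v' c (chan_mat c *v \<xi>)) = of_real (\<kappa> c \<xi>)" for c \<xi>
    by (cases c) (auto simp: w_def v'_def \<kappa>_def h_def complex_norm_square mult_ac simp del: of_real_power)
  define r where "r \<xi> = enn2real (\<integral>\<^sup>+c. ennreal (\<kappa> c \<xi>) \<partial>count_space channels)" for \<xi>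
  have rm [measurable]: "r \<in> borel_measurable borel"
  proof -
    have [measurable]: "(\<lambda>\<xi>. \<integral>\<^sup>+c. ennreal (\<kappa> c \<xi>) \<partial>count_space channels) \<in> borel_measurable borel"
      by (rule count_space_nn_measurable) auto
    show ?thesis unfolding r_def by measurable
  qed
  have LI: "(LINT c|count_space channels. w c (chan_mat c *v \<xi>) * cnj (v' c (chan_mat c *v \<xi>))) = of_real (r \<xi>)" for \<xi>
  proof -
    have "(LINT c|count_space channels. \<kappa> c \<xi>) = r \<xi>"
      unfolding r_def by (rule integral_eq_nn_integral) (auto simp: \<kappa>0)
    then show ?thesis unfolding wv by simp
  qed
  have wle: "\<kappa> c \<xi> \<le> (norm (w c (chan_mat c *v \<xi>)))\<^sup>2" for c \<xi>
    using \<eta>01 by (cases c) (auto simp: \<kappa>_def w_def mult_left_le_one_le)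
  have fin: "AE \<xi> in lborel. (\<integral>\<^sup>+c. ennreal (\<kappa> c \<xi>) \<partial>count_space channels) = ennreal (r \<xi>)"
    using cov unfolding covering_sum_channels g0_def[symmetric] g_def[symmetric] w_def[symmetric]
  proof eventually_elim
    case (elim \<xi>)
    have "(\<integral>\<^sup>+c. ennreal (\<kappa> c \<xi>) \<partial>count_space channels) \<le> sqmass (count_space channels) (\<lambda>c. w c (chan_mat c *v \<xi>))"
      by (intro nn_integral_mono ennreal_leI wle)
    then have "(\<integral>\<^sup>+c. ennreal (\<kappa> c \<xi>) \<partial>count_space channels) \<le> ennreal B" using elim by auto
    then have "(\<integral>\<^sup>+c. ennreal (\<kappa> c \<xi>) \<partial>count_space channels) < top" by (rule le_less_trans) simp
    then show ?case by (simp add: r_def)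
  qed
  have starAE: "AE \<xi> in lborel. (\<Sum>j. \<Sum>k\<le>2 ^ Suc j - 1. ennreal (norm (g (B_mat (Suc j) k *v \<xi>)))) \<le> ennreal N"
    unfolding starN[symmetric] star_norm_def by (rule esssup_AE)
  \<comment> \<open>Almost everywhere, where the cutoff is not 1 the window is at most \<epsilon>,
    so the lost part of |g|^2 is at most \<epsilon> |g|; over all channels the loss is at most
    \<epsilon> times the star norm.\<close>
  have low: "AE \<xi> in lborel. a0 \<le> r \<xi>"
    using cov starAE fin AE_B_mat[OF \<eta>1] unfolding covering_sum_channels g0_def[symmetric] g_def[symmetric] w_def[symmetric]
  proof eventually_elim
    case (elim \<xi>)
    define q where "q c = (case c of None \<Rightarrow> 0 | Some (j, k) \<Rightarrow> norm (g (B_mat j k *v \<xi>)))" for c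
    have r0: "r \<xi> \<ge> 0" by (simp add: r_def)
    have q0: "q c \<ge> 0" for c by (auto simp: q_def split: option.split)
    have pt: "(norm (w c (chan_mat c *v \<xi>)))\<^sup>2 \<le> \<kappa> c \<xi> + \<epsilon> * q c" for c
    proof (cases c)
      case None
      then show ?thesis by (simp add: w_def \<kappa>_def q_def)
    next
      case (Some p)
      obtain j k where p: "p = (j, k)" by (cases p)
      define y where "y = B_mat j k *v \<xi>"
      have "(norm (g y))\<^sup>2 \<le> \<eta> y * (norm (g y))\<^sup>2 + \<epsilon> * norm (g y)"
      proof (cases "norm (g y) > \<epsilon>")
        case True
        then show ?thesis using elim(4) \<epsilon> by (simp add: y_def)
      next
        case False
        then have "(norm (g y))\<^sup>2 \<le> \<epsilon> * norm (g y)" by (simp add: power2_eq_square mult_right_mono)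
        moreover have "0 \<le> \<eta> y * (norm (g y))\<^sup>2" using \<eta>01 by simp
        ultimately show ?thesis by linarith
      qed
      then show ?thesis using Some p by (simp add: w_def \<kappa>_def q_def y_def)
    qed
    have "ennreal A \<le> sqmass (count_space channels) (\<lambda>c. w c (chan_mat c *v \<xi>))" using elim by simp
    also have "\<dots> \<le> (\<integral>\<^sup>+c. ennreal (\<kappa> c \<xi>) + ennreal \<epsilon> * ennreal (q c) \<partial>count_space channels)"
      using \<epsilon> \<kappa>0 q0 by (intro nn_integral_mono order_trans[OF ennreal_leI[OF pt]])
        (simp add: ennreal_mult'[symmetric])
    also have "\<dots> = (\<integral>\<^sup>+c. ennreal (\<kappa> c \<xi>) \<partial>count_space channels) + ennreal \<epsilon> * (\<integral>\<^sup>+c. ennreal (q c) \<partial>count_space channels)"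
      by (subst nn_integral_add) (auto simp: nn_integral_cmult)
    also have "\<dots> \<le> (\<integral>\<^sup>+c. ennreal (\<kappa> c \<xi>) \<partial>count_space channels) + ennreal \<epsilon> * ennreal N"
      using elim(2) unfolding channels_nn_integral by (intro add_left_mono mult_left_mono) (simp_all add: q_def)
    also have "(\<integral>\<^sup>+c. ennreal (\<kappa> c \<xi>) \<partial>count_space channels) + ennreal \<epsilon> * ennreal N = ennreal (r \<xi> + \<epsilon> * N)"
      unfolding elim(3) using \<epsilon> N0 r0 by (simp add: ennreal_mult'[symmetric])
    finally have "ennreal A \<le> ennreal (r \<xi> + \<epsilon> * N)" .
    then have "A \<le> r \<xi> + \<epsilon> * N" using \<epsilon> N0 by (subst (asm) ennreal_le_iff) (auto intro: add_nonneg_nonneg r0)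
    then show ?case by (simp add: a0_def)
  qed
  have mult: "AE \<xi> in lborel. multiplier \<phi>\<^sub>0 \<phi> \<psi> \<xi> = of_real (r \<xi>)"
    using fin AE_B_mat[OF psi(2)]
  proof eventually_elim
    case (elim \<xi>)
    show ?case
    proof (rule multiplier_channels[where \<eta> = \<eta>])
      show "L2_fourier \<psi> (B_mat (Suc j) k *v \<xi>) = of_real (\<eta> (B_mat (Suc j) k *v \<xi>)) * L2_fourier \<phi> (B_mat (Suc j) k *v \<xi>)" for j k
        using elim(2) by (simp add: h_def g_def)
      show "r \<xi> \<ge> 0" by (simp add: r_def)
    qed (use elim(1) \<eta>01 in \<open>unfold \<kappa>_def g0_def g_def\<close>)
  qed
  have psim [measurable]: "L2_fourier \<psi> \<in> borel_measurable borel" "L2_fourier \<phi> \<in> borel_measurable borel" "L2_fourier \<phi>\<^sub>0 \<in> borel_measurable borel"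
    using L2_fourier_sqint[OF psi(1)] gm by (auto dest: sqint_borel simp: g_def g0_def)
  have multm [measurable]: "multiplier \<phi>\<^sub>0 \<phi> \<psi> \<in> borel_measurable borel"
    unfolding multiplier_def[abs_def] by measurable
  have fs: "f \<in> sqint lborel" using f by (simp add: L2_eq_sqint)
  define F where "F = L2_fourier f"
  have Fs: "F \<in> sqint lborel" "sqnorm lborel F = sqnorm lborel f"
    unfolding F_def using fs by (auto simp: L2_fourier_norm)
  have [measurable]: "F \<in> borel_measurable borel" using Fs by (auto dest: sqint_borel)
  define G where "G \<xi> = F \<xi> / of_real (r \<xi>)" for \<xi>
  have [measurable]: "G \<in> borel_measurable borel" unfolding G_def by measurable
  have inv_le: "AE \<xi> in lborel. norm (inverse (of_real (r \<xi>)) * z \<xi>) \<le> norm (of_real (1 / a0) * z \<xi>)" for z :: "real^2 \<Rightarrow> complex"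
    using low
  proof eventually_elim
    case (elim \<xi>)
    then have "inverse (r \<xi>) \<le> 1 / a0" using a0 by (simp add: inverse_eq_divide frac_le)
    moreover have "0 < r \<xi>" using elim a0 by linarith
    ultimately have "norm (inverse (complex_of_real (r \<xi>))) \<le> norm (complex_of_real (1 / a0))"
      using a0 by (simp add: norm_inverse norm_divide)
    then show ?case unfolding norm_mult by (intro mult_right_mono) auto
  qed
  have aF: "(\<lambda>\<xi>. of_real (1 / a0) * F \<xi>) \<in> sqint lborel" using Fs(1) by (rule sqint_cmult)
  have Gle: "AE \<xi> in lborel. norm (G \<xi>) \<le> norm (of_real (1 / a0) * F \<xi>)"
    using inv_le[of F] by (simp add: G_def divide_inverse mult.commute)
  have Gs: "G \<in> sqint lborel" by (rule sqint_dominated[OF _ aF Gle]) simp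
  have Gn: "sqnorm lborel G \<le> 1 / a0 * sqnorm lborel f"
  proof -
    have "sqnorm lborel G \<le> sqnorm lborel (\<lambda>\<xi>. of_real (1 / a0) * F \<xi>)"
      by (rule sqnorm_mono_AE[OF _ aF Gle]) simp
    then show ?thesis using a0 unfolding sqnorm_cmult Fs(2) by (simp add: norm_divide)
  qed
  have mul: "AE \<xi> in lborel. G \<xi> * (LINT c|count_space channels. w c (chan_mat c *v \<xi>) * cnj (v' c (chan_mat c *v \<xi>))) = L2_fourier f \<xi>"
    using low unfolding LI
  proof eventually_elim
    case (elim \<xi>)
    then have "r \<xi> \<noteq> 0" using a0 by auto
    then show ?case by (simp add: G_def F_def)
  qed
  \<comment> \<open>The multiplier is real almost everywhere, so its inverse moves in the pairing
    from the dual wavepacket to the transform of f; the coefficient becomes one of \<open>G\<close>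
    against an atom of \<open>v'\<close>.\<close>
  have co: "L2_inner f (dual_wavepacket \<phi>\<^sub>0 \<phi> \<eta> (wp_of P p)) = cnj (coef v' G p)" for p
  proof -
    obtain c m where p: "p = (c, m)" by (cases p)
    define t where "t = atom (chan_mat c) (v' c) (P *v m)"
    define d where "d \<xi> = inverse (multiplier \<phi>\<^sub>0 \<phi> \<psi> \<xi>) * L2_fourier (wavepacket \<phi>\<^sub>0 \<psi> (wp_of P p)) \<xi>" for \<xi>
    have ws: "wavepacket \<phi>\<^sub>0 \<psi> (wp_of P p) \<in> sqint lborel" using phi(1) psi(1) by (rule wavepacket_sqint)
    have [measurable]: "L2_fourier (wavepacket \<phi>\<^sub>0 \<psi> (wp_of P p)) \<in> borel_measurable borel"
      using L2_fourier_sqint[OF ws] by (rule sqint_borel)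
    have [measurable]: "d \<in> borel_measurable borel" unfolding d_def by measurable
    have ts: "t \<in> sqint lborel"
      unfolding t_def using gs(1) hs by (intro atom_sqint invertible_chan_mat) (cases c; simp add: v'_def)
    then have [measurable]: "t \<in> borel_measurable borel" by (rule sqint_borel)
    have wt: "AE \<xi> in lborel. L2_fourier (wavepacket \<phi>\<^sub>0 \<psi> (wp_of P p)) \<xi> = t \<xi>"
    proof -
      have "AE \<xi> in lborel. atom (chan_mat c) (chan_win (L2_fourier \<phi>\<^sub>0) (L2_fourier \<psi>) c) (P *v m) \<xi> = t \<xi>"
        unfolding t_def
      proof (rule atom_cong_AE[OF invertible_chan_mat])
        show "AE x in lborel. chan_win (L2_fourier \<phi>\<^sub>0) (L2_fourier \<psi>) c x = v' c x"
          using psi(2) by (cases c) (auto simp: v'_def g0_def)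
      qed
      with wavepacket_fourier[OF phi(1) psi(1), of P c m] show ?thesis
        unfolding p by eventually_elim simp
    qed
    have dt: "AE \<xi> in lborel. d \<xi> = inverse (of_real (r \<xi>)) * t \<xi>"
      using wt mult by eventually_elim (simp add: d_def)
    have "AE \<xi> in lborel. norm (d \<xi>) \<le> norm (of_real (1 / a0) * t \<xi>)"
      using dt inv_le[of t] by eventually_elim simp
    then have ds: "d \<in> sqint lborel"
      by (rule sqint_dominated[OF _ sqint_cmult[OF ts, of "of_real (1 / a0)"], rotated]) simp
    have dual: "dual_wavepacket \<phi>\<^sub>0 \<phi> \<eta> (wp_of P p) = L2_inv_fourier d"
      by (simp add: dual_wavepacket_def Let_def \<psi>_def d_def[abs_def])
    note inv = L2_inv_fourier[OF ds]
    have "sqinner lborel f (L2_inv_fourier d) = sqinner lborel F (L2_fourier (L2_inv_fourier d))"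
      unfolding F_def using L2_fourier_inner[OF fs inv(1)] by simp
    also have "\<dots> = sqinner lborel F d"
      using inv(2) sqint_borel[OF L2_fourier_sqint[OF inv(1)]] by (intro sqinner_cong_AE) auto
    also have "\<dots> = sqinner lborel G t"
      unfolding sqinner_def
    proof (rule integral_cong_AE)
      show "AE \<xi> in lborel. F \<xi> * cnj (d \<xi>) = G \<xi> * cnj (t \<xi>)"
        using dt by eventually_elim (simp add: G_def divide_inverse mult_ac)
    qed measurable
    also have "\<dots> = cnj (sqinner lborel t G)" by (simp add: sqinner_cnj)
    finally show ?thesis unfolding dual L2_inner_eq_sqinner by (simp add: coef_def p t_def)
  qed
  define \<Phi> where "\<Phi> p = wavepacket \<phi>\<^sub>0 \<phi> (wp_of P p)" for p
  have "\<exists>S\<in>sqint lborel. ((\<lambda>J. sqnorm lborel (\<lambda>x. (\<Sum>p\<in>J. cnj (coef v' G p) * \<Phi> p x) - S x)) \<longlongrightarrow> 0) (finite_subsets_at_top (channels \<times> intvec)) \<and>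
    sqnorm lborel (\<lambda>x. f x - of_real \<bar>det P\<bar> * S x) \<le> offdiag * (1 / a0) * sqnorm lborel f"
  proof (rule expansion[OF sub _ _ fs Gs Gn mul])
    show "\<Phi> p \<in> sqint lborel" for p unfolding \<Phi>_def using phi by (rule wavepacket_sqint)
    show "AE \<xi> in lborel. L2_fourier (\<Phi> (c, m)) \<xi> = atom (chan_mat c) (w c) (P *v m) \<xi>" for c m
      unfolding \<Phi>_def w_def g0_def g_def using phi by (rule wavepacket_fourier)
  qed
  then obtain S where S: "S \<in> sqint lborel"
    and lim: "((\<lambda>J. sqnorm lborel (\<lambda>x. (\<Sum>p\<in>J. cnj (coef v' G p) * \<Phi> p x) - S x)) \<longlongrightarrow> 0) (finite_subsets_at_top (channels \<times> intvec))"
    and err: "sqnorm lborel (\<lambda>x. f x - of_real \<bar>det P\<bar> * S x) \<le> offdiag * (1 / a0) * sqnorm lborel f" by blast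
  define f' where "f' x = of_real (lattice_volume P) * S x" for x
  define Fi where "Fi i x = L2_inner f (dual_wavepacket \<phi>\<^sub>0 \<phi> \<eta> i) * wavepacket \<phi>\<^sub>0 \<phi> i x" for i x
  have Fis: "(\<lambda>x. \<Sum>i\<in>J. Fi i x) \<in> L2" for J
    unfolding L2_eq_sqint Fi_def using wavepacket_sqint[OF phi] by (intro sqint_sum sqint_cmult)
  have "L2_has_sum Fi (wp_indices (lattice_of P)) S"
    unfolding L2_has_sum_def
  proof
    show "S \<in> L2" using S by (simp add: L2_eq_sqint)
    \<comment> \<open>The injection \<open>wp_of P\<close> carries the net over finite sets of
      channels and integer vectors to the net over finite sets of wavepacket indices.\<close>
    note inj = wp_of_inj[OF P]
    have ev: "\<forall>\<^sub>F J in finite_subsets_at_top (channels \<times> intvec). J \<subseteq> channels \<times> intvec"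
      by (rule eventually_finite_subsets_at_top_weakI)
    have "\<forall>\<^sub>F J in finite_subsets_at_top (channels \<times> intvec). sqnorm lborel (\<lambda>x. (\<Sum>p\<in>J. cnj (coef v' G p) * \<Phi> p x) - S x) =
       sqnorm lborel (\<lambda>x. (\<Sum>i\<in>wp_of P ` J. Fi i x) - S x)"
      using ev
    proof eventually_elim
      case (elim J)
      then have "inj_on (wp_of P) J" using inj inj_on_subset by blast
      then show ?case by (simp add: sum.reindex Fi_def co \<Phi>_def)
    qed
    then have "((\<lambda>J. sqnorm lborel (\<lambda>x. (\<Sum>i\<in>wp_of P ` J. Fi i x) - S x)) \<longlongrightarrow> 0) (finite_subsets_at_top (channels \<times> intvec))"
      using lim by (rule Lim_transform_eventually[rotated])
    then have "((\<lambda>J. sqnorm lborel (\<lambda>x. (\<Sum>i\<in>J. Fi i x) - S x)) \<longlongrightarrow> 0) (filtermap ((`) (wp_of P)) (finite_subsets_at_top (channels \<times> intvec)))"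
      by (simp add: filterlim_filtermap)
    then have "((\<lambda>J. sqnorm lborel (\<lambda>x. (\<Sum>i\<in>J. Fi i x) - S x)) \<longlongrightarrow> 0) (finite_subsets_at_top (wp_indices (lattice_of P)))"
      by (simp only: filtermap_image_finite_subsets_at_top[OF inj] wp_of_image)
    then show "L2_tendsto (\<lambda>J x. \<Sum>i\<in>J. Fi i x) S (finite_subsets_at_top (wp_indices (lattice_of P)))"
      by (subst L2_tendsto_iff) (use S Fis in \<open>auto simp: L2_eq_sqint\<close>)
  qed
  then have "approx_expansion \<phi>\<^sub>0 \<phi> \<eta> P f f'"
    unfolding approx_expansion_def f'_def[abs_def] Fi_def[abs_def] by blast
  moreover have "f' \<in> L2" unfolding L2_eq_sqint f'_def using S by (rule sqint_cmult)
  moreover have "L2_norm (\<lambda>x. f x - f' x) \<le> enn2real (Delta \<phi>\<^sub>0 \<phi> P) / a0 * L2_norm f"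
    using err unfolding off f'_def lattice_volume_def L2_norm_eq_sqnorm by simp
  ultimately show ?thesis unfolding a0_def N_def g_def by blast
qed

section \<open>Gaussian decay of the correlations\<close>

text \<open>From x - x^3/6 and x \<le> 2; a linear lower bound with any positive slope would
  serve.\<close>

lemma sin_ge_third: "0 \<le> x \<Longrightarrow> x \<le> pi / 2 \<Longrightarrow> x / 3 \<le> sin (x::real)"
proof -
  assume x: "0 \<le> x" "x \<le> pi / 2"
  have "x \<le> 2" using x pi_less_4 by linarith
  then have "x * x\<^sup>2 \<le> x * 2\<^sup>2" using x by (intro mult_left_mono power_mono) auto
  then have c: "x ^ 3 / 6 \<le> 2 * x / 3" by (simp add: power3_eq_cube power2_eq_square)
  have "\<bar>sin x - (\<Sum>m<3. sin_coeff m * x ^ m)\<bar> \<le> inverse (fact 3) * \<bar>x\<bar> ^ 3"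
    by (rule Maclaurin_sin_bound)
  then have "\<bar>sin x - x\<bar> \<le> x ^ 3 / 6"
    using x by (simp add: sin_coeff_def eval_nat_numeral fact_reduce)
  then show ?thesis using c by linarith
qed

lemma sum_periodic_shift:
  fixes G :: "nat \<Rightarrow> real"
  assumes "\<And>k. G (k + m) = G k"
  shows "(\<Sum>k<m. G (k + z)) = (\<Sum>k<m. G k)"
proof (induction z)
  case (Suc z)
  have "(\<Sum>k<Suc m. G (k + z)) = G z + (\<Sum>k<m. G (k + Suc z))"
    unfolding sum.lessThan_Suc_shift by simp
  moreover have "(\<Sum>k<Suc m. G (k + z)) = (\<Sum>k<m. G (k + z)) + G z"
    using assms[of z] by (simp add: add.commute)
  ultimately show ?case using Suc by simp
qed simp

lemma sum_lessThan_add: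
  fixes f :: "nat \<Rightarrow> real"
  shows "(\<Sum>k<m + n. f k) = (\<Sum>k<m. f k) + (\<Sum>k<n. f (m + k))"
  by (induction n) simp_all

text \<open>Every term after the first is at most 2 / ((1 + y') (1 + y)) with y - y' = q, and this
  telescopes.\<close>

lemma gauss_sum_le:
  assumes q: "q > 0"
  shows "(\<Sum>l<m. exp (- (q * real l)\<^sup>2)) \<le> 1 + 2 / q"
proof -
  have telescope: "exp (- (q * real (Suc l))\<^sup>2) \<le> (2 / q) * (1 / (1 + q * real l) - 1 / (1 + q * real (Suc l)))" for l
  proof -
    define y where "y = q * real (Suc l)"
    define y' where "y' = q * real l"
    have y: "y = y' + q" "y' \<ge> 0" using q by (auto simp: y_def y'_def algebra_simps)
    have "exp (- y\<^sup>2) = 1 / exp (y\<^sup>2)" by (simp add: exp_minus inverse_eq_divide)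
    also have "\<dots> \<le> 1 / (1 + y\<^sup>2)" by (intro divide_left_mono exp_ge_add_one_self) (auto intro!: mult_pos_pos add_pos_nonneg)
    also have "\<dots> \<le> 2 / ((1 + y') * (1 + y))"
    proof -
      have "(1 + y') * (1 + y) \<le> (1 + y) * (1 + y)" using y q by (intro mult_right_mono) auto
      also have "\<dots> \<le> 2 * (1 + y\<^sup>2)" using sum_squares_bound[of 1 y] by (simp add: power2_eq_square algebra_simps)
      finally have "(1 + y') * (1 + y) \<le> 2 * (1 + y\<^sup>2)" .
      moreover have "0 < (1 + y') * (1 + y)" "0 < 1 + y\<^sup>2" using y q by (auto intro!: mult_pos_pos add_pos_nonneg)
      ultimately show ?thesis by (simp add: field_simps)
    qed
    also have "\<dots> = (2 / q) * (1 / (1 + y') - 1 / (1 + y))"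
    proof -
      have "1 + y' \<noteq> 0" "1 + y \<noteq> 0" using y q by auto
      then have "1 / (1 + y') - 1 / (1 + y) = q / ((1 + y') * (1 + y))" using y(1) by (simp add: field_simps)
      then show ?thesis using q by simp
    qed
    finally show ?thesis by (simp add: y_def y'_def)
  qed
  show ?thesis
  proof (cases m)
    case 0
    then show ?thesis using q by simp
  next
    case (Suc n)
    have "(\<Sum>l<m. exp (- (q * real l)\<^sup>2)) = 1 + (\<Sum>l<n. exp (- (q * real (Suc l))\<^sup>2))"
      unfolding Suc sum.lessThan_Suc_shift by simp
    also have "\<dots> \<le> 1 + (\<Sum>l<n. (2 / q) * (1 / (1 + q * real l) - 1 / (1 + q * real (Suc l))))"
      by (intro add_left_mono sum_mono telescope)
    also have "\<dots> = 1 + (2 / q) * (1 / (1 + q * real 0) - 1 / (1 + q * real n))"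
      unfolding sum_distrib_left[symmetric] sum_lessThan_telescope'[of "\<lambda>l. 1 / (1 + q * real l)"] ..
    also have "\<dots> \<le> 1 + 2 / q * 1"
      using q by (intro add_left_mono mult_left_mono) (auto intro!: divide_nonneg_nonneg add_nonneg_nonneg)
    finally show ?thesis by simp
  qed
qed

text \<open>The angles \<open>\<alpha> + \<pi> k / m\<close> stay away from the zeros of the sine at the rate of an arithmetic
  progression, so the sum over the orientations is dominated by a Gaussian sum.\<close>

lemma gauss_sin_sum:
  assumes m: "m > 0" and b: "b > 0" and \<alpha>: "\<alpha> \<ge> 0"
  shows "(\<Sum>k<2 * m. exp (- b * (sin (\<alpha> + pi * real k / real m))\<^sup>2)) \<le> 4 * (1 + 4 * real m / sqrt b)"
proof -
  define q where "q = sqrt b / (2 * real m)"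
  have q: "q > 0" using m b by (simp add: q_def)
  \<comment> \<open>The number of whole steps pi/m in \<alpha>. The remainder \<beta> lies in [0,
    pi/m), so the angles \<beta> + pi k / m with k < m are spread evenly over [0, pi).\<close>
  define z where "z = nat \<lfloor>\<alpha> * real m / pi\<rfloor>"
  define \<beta> where "\<beta> = \<alpha> - pi * real z / real m"
  have z: "real z \<le> \<alpha> * real m / pi" "\<alpha> * real m / pi < real z + 1"
    using \<alpha> m unfolding z_def by (auto simp: of_nat_nat intro!: divide_nonneg_nonneg mult_nonneg_nonneg)
  have "\<alpha> < pi * (real z + 1) / real m" using z(2) m by (simp add: field_simps)
  moreover have "pi * (real z + 1) / real m = pi * real z / real m + pi / real m"
    by (simp add: distrib_left add_divide_distrib)
  moreover have "pi * real z / real m \<le> \<alpha>" using z(1) m by (simp add: field_simps)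
  ultimately have \<beta>: "\<beta> \<ge> 0" "\<beta> < pi / real m"
    by (auto simp: \<beta>_def)
  define G where "G k = exp (- b * (sin (\<beta> + pi * real k / real m))\<^sup>2)" for k
  \<comment> \<open>Adding pi changes only the sign of the sine, so the summands have period m and
    the 2 m terms form two equal blocks.\<close>
  have per: "G (k + m) = G k" for k
  proof -
    have "\<beta> + pi * real (k + m) / real m = (\<beta> + pi * real k / real m) + pi"
      using m by (simp add: field_simps)
    then have "sin (\<beta> + pi * real (k + m) / real m) = - sin (\<beta> + pi * real k / real m)"
      by (simp only: sin_periodic_pi)
    then show ?thesis unfolding G_def by (simp only: power2_minus)
  qed
  have "(\<Sum>k<2 * m. exp (- b * (sin (\<alpha> + pi * real k / real m))\<^sup>2)) = (\<Sum>k<2 * m. G (k + z))"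
    using m by (intro sum.cong refl) (simp add: G_def \<beta>_def field_simps)
  also have "\<dots> = (\<Sum>k<m. G (k + z)) + (\<Sum>k<m. G (m + k + z))"
    unfolding mult_2 by (rule sum_lessThan_add)
  also have "(\<Sum>k<m. G (m + k + z)) = (\<Sum>k<m. G (k + z))"
    using per by (intro sum.cong refl) (metis add.assoc add.commute)
  also have "(\<Sum>k<m. G (k + z)) = (\<Sum>k<m. G k)" using per by (rule sum_periodic_shift)
  \<comment> \<open>Up to pi/2 the angle itself bounds the sine from below, beyond it the distance
    to pi does. Adding both Gaussians covers the two cases, and reversing the index turns the second
    sum into the first.\<close>
  also have "(\<Sum>k<m. G k) \<le> (\<Sum>k<m. exp (- (q * real k)\<^sup>2) + exp (- (q * real (m - Suc k))\<^sup>2))"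
  proof (rule sum_mono)
    fix k assume "k \<in> {..<m}"
    then have k: "k < m" by simp
    define x where "x = \<beta> + pi * real k / real m"
    have x0: "pi * real k / real m \<le> x" using \<beta> by (simp add: x_def)
    have x1: "pi * real (m - Suc k) / real m \<le> pi - x"
    proof -
      have "real (m - Suc k) = real m - 1 - real k" using k by (simp add: of_nat_diff)
      then have "pi * real (m - Suc k) / real m = pi - pi / real m - pi * real k / real m"
        using m by (simp add: field_simps)
      then show ?thesis using \<beta> by (simp add: x_def)
    qed
    have nn: "0 \<le> pi * real k / real m" "0 \<le> pi * real (m - Suc k) / real m" by auto
    have xx: "0 \<le> x" "0 \<le> pi - x" by (rule order_trans[OF nn(1) x0], rule order_trans[OF nn(2) x1])
    have main: "G k \<le> exp (- (q * real l)\<^sup>2)" if y: "sin x \<ge> y / 3" "pi * real l / real m \<le> y" for y l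
    proof -
      have "real l / (2 * real m) \<le> pi * real l / real m / 3"
      proof -
        have "2 * real l \<le> pi * real l" using pi_ge_two by (intro mult_right_mono) auto
        then show ?thesis using m by (simp add: field_simps)
      qed
      also have "\<dots> \<le> sin x" by (rule order_trans[OF divide_right_mono[OF y(2)] y(1)]) simp
      finally have "(real l / (2 * real m))\<^sup>2 \<le> (sin x)\<^sup>2" by (intro power_mono) auto
      then have "b * (real l / (2 * real m))\<^sup>2 \<le> b * (sin x)\<^sup>2" using b by (intro mult_left_mono) auto
      moreover have "b * (real l / (2 * real m))\<^sup>2 = (q * real l)\<^sup>2"
        using b by (simp add: q_def power_mult_distrib power_divide)
      ultimately show ?thesis by (simp add: G_def x_def)
    qed
    show "G k \<le> exp (- (q * real k)\<^sup>2) + exp (- (q * real (m - Suc k))\<^sup>2)"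
    proof (cases "x \<le> pi / 2")
      case True
      then have "x / 3 \<le> sin x" using xx by (intro sin_ge_third) auto
      then have "G k \<le> exp (- (q * real k)\<^sup>2)" using x0 by (rule main)
      then show ?thesis by (simp add: add_increasing2)
    next
      case False
      then have "(pi - x) / 3 \<le> sin (pi - x)" using xx by (intro sin_ge_third) auto
      then have "(pi - x) / 3 \<le> sin x" by simp
      then have "G k \<le> exp (- (q * real (m - Suc k))\<^sup>2)" using x1 by (rule main)
      then show ?thesis by (simp add: add_increasing)
    qed
  qed
  also have "\<dots> = 2 * (\<Sum>k<m. exp (- (q * real k)\<^sup>2))"
    using sum.nat_diff_reindex[of "\<lambda>k. exp (- (q * real k)\<^sup>2)" m] by (simp add: sum.distrib)
  also have "\<dots> \<le> 2 * (1 + 2 / q)" by (intro mult_left_mono gauss_sum_le q) auto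
  finally have "(\<Sum>k<2 * m. exp (- b * (sin (\<alpha> + pi * real k / real m))\<^sup>2)) \<le> 4 * (1 + 2 / q)" by simp
  then show ?thesis by (simp add: q_def)
qed

text \<open>Along the factor 4 the increments of s / (1 + s) are 3 s / ((1 + s) (4 + s)), comparable
  to the minimum of s and 1/s. The constant comes from (1 + s) (4 + s) being at most 10 for s \<le>
  1 and at most 10 s^2 for s > 1.\<close>

lemma scale_sum:
  assumes r: "r \<ge> 0"
  shows "(\<Sum>j<n. min (r / 4 ^ Suc j) (1 / (r / 4 ^ Suc j))) \<le> 10 / (3::real)"
proof -
  define p where "p s = s / (1 + s)" for s :: real
  have telescope: "min s (1 / s) \<le> 10 / 3 * (p s - p (s / 4))" if s: "s \<ge> 0" for s
  proof -
    have ps: "p s - p (s / 4) = 3 * s / ((1 + s) * (4 + s))"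
      using s by (simp add: p_def field_simps)
    have pos: "(1 + s) * (4 + s) > 0" using s by (intro mult_pos_pos) auto
    show ?thesis
    proof (cases "s \<le> 1")
      case True
      have "(1 + s) * (4 + s) \<le> 2 * 5" using s True by (intro mult_mono) auto
      then have "s * ((1 + s) * (4 + s)) \<le> s * 10" using s by (intro mult_left_mono) auto
      then have "s \<le> 10 / 3 * (p s - p (s / 4))" unfolding ps using pos by (simp add: field_simps)
      then show ?thesis by simp
    next
      case False
      then have s1: "s > 1" by simp
      have "(1 + s) * (4 + s) \<le> (2 * s) * (5 * s)" using s1 by (intro mult_mono) auto
      then have "1 / s \<le> 10 / 3 * (p s - p (s / 4))" unfolding ps using pos s1 by (simp add: field_simps)
      then show ?thesis by simp
    qed
  qed
  have "(\<Sum>j<n. min (r / 4 ^ Suc j) (1 / (r / 4 ^ Suc j))) \<le> (\<Sum>j<n. 10 / 3 * (p (r / 4 ^ Suc j) - p (r / 4 ^ Suc (Suc j))))"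
  proof (rule sum_mono)
    fix j
    show "min (r / 4 ^ Suc j) (1 / (r / 4 ^ Suc j)) \<le> 10 / 3 * (p (r / 4 ^ Suc j) - p (r / 4 ^ Suc (Suc j)))"
      using telescope[of "r / 4 ^ Suc j"] r by (simp add: field_simps)
  qed
  also have "\<dots> = 10 / 3 * (p (r / 4 ^ Suc 0) - p (r / 4 ^ Suc n))"
    unfolding sum_distrib_left[symmetric] sum_lessThan_telescope'[of "\<lambda>j. p (r / 4 ^ Suc j)"] ..
  also have "\<dots> \<le> 10 / 3 * 1"
  proof (intro mult_left_mono)
    have "p (r / 4 ^ Suc 0) \<le> 1" using r by (simp add: p_def)
    moreover have "0 \<le> p (r / 4 ^ Suc n)" using r by (simp add: p_def)
    ultimately show "p (r / 4 ^ Suc 0) - p (r / 4 ^ Suc n) \<le> 1" by linarith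
  qed simp
  finally show ?thesis by simp
qed

text \<open>The matrix rotates first and then shrinks the axes by 4^j and 2^j. This follows from
  \<open>transpose (A_mat j k) *v y = \<xi>\<close> by combining its two rows with the cosine and
  sine of the rotation angle.\<close>

lemma B_mat_polar:
  assumes "\<xi> $ 1 = r * cos \<alpha>" "\<xi> $ 2 = r * sin \<alpha>"
  shows "(B_mat j k *v \<xi>) $ 1 = r / 4 ^ j * cos (\<alpha> + 2 * real k * pi / 2 ^ j)"
    and "(B_mat j k *v \<xi>) $ 2 = r / 2 ^ j * sin (\<alpha> + 2 * real k * pi / 2 ^ j)"
proof -
  define \<theta> where "\<theta> = 2 * real k * pi / 2 ^ j"
  define y where "y = B_mat j k *v \<xi>"
  have "transpose (A_mat j k) *v y = \<xi>"
    unfolding y_def B_mat_def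
    by (intro matrix_inv_inv(4)) (use invertible_B_mat(1) in \<open>auto intro: matrix_inv_inv(3)\<close>)
  then have e: "\<xi> $ 1 = 4 ^ j * cos \<theta> * y $ 1 + 2 ^ j * sin \<theta> * y $ 2"
      "\<xi> $ 2 = - (4 ^ j * sin \<theta>) * y $ 1 + 2 ^ j * cos \<theta> * y $ 2"
    by (auto simp: A_mat_def scaling_matrix_def rotation_matrix_def transpose_def matrix_matrix_mult_def
        matrix_vector_mult_def sum_2 \<theta>_def)
  have sc: "(cos \<theta>)\<^sup>2 + (sin \<theta>)\<^sup>2 = 1" by simp
  have alg: "c * (p * c * a + q * d * b) - d * (- (p * d) * a + q * c * b) = p * a * (c\<^sup>2 + d\<^sup>2)"
    "d * (p * c * a + q * d * b) + c * (- (p * d) * a + q * c * b) = q * b * (c\<^sup>2 + d\<^sup>2)" for a b c d p q :: real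
    by (simp_all add: power2_eq_square algebra_simps)
  have "cos \<theta> * \<xi> $ 1 - sin \<theta> * \<xi> $ 2 = 4 ^ j * y $ 1 * ((cos \<theta>)\<^sup>2 + (sin \<theta>)\<^sup>2)"
    unfolding e by (rule alg)
  then have "r * cos (\<alpha> + \<theta>) = 4 ^ j * y $ 1"
    unfolding sc assms cos_add by (simp add: algebra_simps)
  then show "(B_mat j k *v \<xi>) $ 1 = r / 4 ^ j * cos (\<alpha> + 2 * real k * pi / 2 ^ j)"
    by (simp add: y_def \<theta>_def field_simps)
  have "sin \<theta> * \<xi> $ 1 + cos \<theta> * \<xi> $ 2 = 2 ^ j * y $ 2 * ((cos \<theta>)\<^sup>2 + (sin \<theta>)\<^sup>2)"
    unfolding e by (rule alg)
  then have "r * sin (\<alpha> + \<theta>) = 2 ^ j * y $ 2"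
    unfolding sc assms sin_add by (simp add: algebra_simps)
  then show "(B_mat j k *v \<xi>) $ 2 = r / 2 ^ j * sin (\<alpha> + 2 * real k * pi / 2 ^ j)"
    by (simp add: y_def \<theta>_def field_simps)
qed

lemma norm_vec2_sq: "(norm (x :: real^2))\<^sup>2 = (x $ 1)\<^sup>2 + (x $ 2)\<^sup>2"
  by (simp add: norm_vec_def L2_set_def sum_2)

lemma polar_vec2: "\<exists>r \<alpha>. r \<ge> 0 \<and> \<alpha> \<ge> 0 \<and> (\<xi> :: real^2) $ 1 = r * cos \<alpha> \<and> \<xi> $ 2 = r * sin \<alpha>"
proof -
  define z where "z = Complex (\<xi> $ 1) (\<xi> $ 2)"
  have "\<xi> $ 1 = norm z * cos (Arg2pi z)" "\<xi> $ 2 = norm z * sin (Arg2pi z)"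
    unfolding cos_Arg2pi sin_Arg2pi by (auto simp: z_def)
  then show ?thesis by (intro exI[of _ "norm z"] exI[of _ "Arg2pi z"]) (simp add: Arg2pi)
qed

text \<open>For a point at radius r, a scale sees two lengths, s = r / 4^j and t = r / 2^j. The
  Gaussian in t sin leaves, up to constants, 1 + 1/s orientations. For small s this is compensated
  by the factor s^2 obtained from \<sigma> > 2, for large s by the Gaussian in s; what remains is
  the minimum of s and 1/s, summable over the scales.\<close>

lemma window_sum_bound:
  assumes \<delta>: "\<delta> > 0" and \<sigma>: "\<sigma> > 2"
  shows "\<exists>C\<ge>0. \<forall>\<xi>. (\<Sum>j. \<Sum>k\<le>2 ^ Suc j - 1. ennreal (min 1 (\<bar>(B_mat (Suc j) k *v \<xi>) $ 1\<bar> powr \<sigma>) *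
     exp (- \<delta> * (norm (B_mat (Suc j) k *v \<xi>))\<^sup>2))) \<le> ennreal C"
proof -
  define c where "c = sqrt (\<delta> / 2)"
  have c: "c > 0" "c\<^sup>2 = \<delta> / 2" using \<delta> by (auto simp: c_def)
  \<comment> \<open>The factor 4 (1 + 2/c) comes from the sum over orientations, the factor 1 +
    2/\<delta> from the bound exp(-\<delta> s^2 / 2) \<le> (1 + 2/\<delta>) / s for s > 1.\<close>
  define D where "D = 4 * (1 + 2 / c) * (1 + 2 / \<delta>)"
  have D: "D \<ge> 0" using c \<delta> by (simp add: D_def)
  have scale: "(\<Sum>k\<le>2 ^ Suc j - 1. min 1 (\<bar>(B_mat (Suc j) k *v \<xi>) $ 1\<bar> powr \<sigma>) *
     exp (- \<delta> * (norm (B_mat (Suc j) k *v \<xi>))\<^sup>2)) \<le> D * min (r / 4 ^ Suc j) (1 / (r / 4 ^ Suc j))"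
    if r: "r \<ge> 0" "\<alpha> \<ge> 0" and pol: "\<xi> $ 1 = r * cos \<alpha>" "\<xi> $ 2 = r * sin \<alpha>" for \<xi> :: "real^2" and r \<alpha> j
  proof -
    define s where "s = r / 4 ^ Suc j"
    have s0: "s \<ge> 0" using r by (simp add: s_def)
    \<comment> \<open>Scale \<open>Suc j\<close> has 2 m orientations with angular step pi/m, the
      form of \<open>gauss_sin_sum\<close>.\<close>
    define m :: nat where "m = 2 ^ j"
    have m: "m > 0" by (simp add: m_def)
    define \<beta> where "\<beta> k = \<alpha> + pi * real k / real m" for k :: nat
    have ang: "\<alpha> + 2 * real k * pi / 2 ^ Suc j = \<beta> k" for k by (simp add: \<beta>_def m_def)
    define t where "t = 2 * real m * s"
    have ts: "r / 2 ^ Suc j = t"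
    proof -
      have "(4::real) ^ j = 2 ^ j * 2 ^ j" by (simp add: power_mult_distrib[symmetric])
      then show ?thesis by (simp add: t_def s_def m_def)
    qed
    have y: "(B_mat (Suc j) k *v \<xi>) $ 1 = s * cos (\<beta> k)" "(B_mat (Suc j) k *v \<xi>) $ 2 = t * sin (\<beta> k)" for k
      using B_mat_polar[OF pol, of "Suc j" k] unfolding ang ts s_def[symmetric] by auto
    have ts': "s \<le> t"
    proof -
      have "1 * s \<le> (2 * real m) * s" using m s0 by (intro mult_right_mono) auto
      then show ?thesis by (simp add: t_def)
    qed
    show ?thesis
    proof (cases "s = 0")
      case True
      then show ?thesis using \<sigma> unfolding s_def[symmetric] by (simp add: y)
    next
      case False
      then have s: "s > 0" using s0 by simp
      have t: "t > 0" using s ts' by linarith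
      have pt: "min 1 (\<bar>(B_mat (Suc j) k *v \<xi>) $ 1\<bar> powr \<sigma>) * exp (- \<delta> * (norm (B_mat (Suc j) k *v \<xi>))\<^sup>2) \<le>
         (min 1 (s\<^sup>2) * exp (- (\<delta> / 2) * s\<^sup>2)) * exp (- (\<delta> / 2 * t\<^sup>2) * (sin (\<beta> k))\<^sup>2)" for k
      proof -
        have "\<bar>s * cos (\<beta> k)\<bar> \<le> s" using s abs_cos_le_one[of "\<beta> k"] by (simp add: abs_mult mult_left_le)
        then have "\<bar>s * cos (\<beta> k)\<bar> powr \<sigma> \<le> s powr \<sigma>" using \<sigma> by (intro powr_mono2) auto
        moreover have "min 1 (s powr \<sigma>) \<le> min 1 (s\<^sup>2)"
        proof (cases "s \<le> 1")
          case True
          then have "s powr \<sigma> \<le> s powr 2" using s \<sigma> by (intro powr_mono') auto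
          then show ?thesis using s by (simp add: min_def)
        next
          case False
          then have "1 \<le> s\<^sup>2" by (simp add: one_le_power)
          then show ?thesis by simp
        qed
        ultimately have 1: "min 1 (\<bar>s * cos (\<beta> k)\<bar> powr \<sigma>) \<le> min 1 (s\<^sup>2)" by linarith
        have "s\<^sup>2 = s\<^sup>2 * (cos (\<beta> k))\<^sup>2 + s\<^sup>2 * (sin (\<beta> k))\<^sup>2"
          unfolding distrib_left[symmetric] by simp
        also have "\<dots> \<le> s\<^sup>2 * (cos (\<beta> k))\<^sup>2 + t\<^sup>2 * (sin (\<beta> k))\<^sup>2"
          using ts' s0 by (intro add_left_mono mult_right_mono power_mono) auto
        finally have "s\<^sup>2 \<le> (s * cos (\<beta> k))\<^sup>2 + (t * sin (\<beta> k))\<^sup>2" by (simp add: power_mult_distrib)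
        moreover have "(t * sin (\<beta> k))\<^sup>2 \<le> (s * cos (\<beta> k))\<^sup>2 + (t * sin (\<beta> k))\<^sup>2" by simp
        moreover have "t\<^sup>2 * (sin (\<beta> k))\<^sup>2 = (t * sin (\<beta> k))\<^sup>2" by (simp add: power_mult_distrib)
        moreover have "a + z \<le> 2 * (x + y)" if "a \<le> x + y" "y \<le> x + y" "z = y" for a x y z :: real
          using that by simp
        \<comment> \<open>Since \<open>s \<le> t\<close>, the squared norm dominates both s^2 and
          the square of t sin; half of the exponent is spent on each.\<close>
        ultimately have "s\<^sup>2 + t\<^sup>2 * (sin (\<beta> k))\<^sup>2 \<le> 2 * ((s * cos (\<beta> k))\<^sup>2 + (t * sin (\<beta> k))\<^sup>2)"
          by blast
        then have "\<delta> / 2 * (s\<^sup>2 + t\<^sup>2 * (sin (\<beta> k))\<^sup>2) \<le> \<delta> / 2 * (2 * ((s * cos (\<beta> k))\<^sup>2 + (t * sin (\<beta> k))\<^sup>2))"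
          using \<delta> by (intro mult_left_mono) auto
        then have 2: "exp (- \<delta> * ((s * cos (\<beta> k))\<^sup>2 + (t * sin (\<beta> k))\<^sup>2)) \<le> exp (- (\<delta> / 2) * s\<^sup>2) * exp (- (\<delta> / 2 * t\<^sup>2) * (sin (\<beta> k))\<^sup>2)"
          unfolding exp_add[symmetric] by (subst exp_le_cancel_iff) (simp add: algebra_simps)
        show ?thesis unfolding norm_vec2_sq y mult.assoc[of "min 1 (s\<^sup>2)"]
          by (intro mult_mono 1 2) auto
      qed
      have card: "{..2 ^ Suc j - 1} = {..<2 * m}"
      proof -
        have e: "(2::nat) ^ Suc j = 2 * m" by (simp add: m_def)
        show ?thesis unfolding e using m by auto
      qed
      have "(\<Sum>k\<le>2 ^ Suc j - 1. min 1 (\<bar>(B_mat (Suc j) k *v \<xi>) $ 1\<bar> powr \<sigma>) * exp (- \<delta> * (norm (B_mat (Suc j) k *v \<xi>))\<^sup>2))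
        \<le> (\<Sum>k<2 * m. (min 1 (s\<^sup>2) * exp (- (\<delta> / 2) * s\<^sup>2)) * exp (- (\<delta> / 2 * t\<^sup>2) * (sin (\<beta> k))\<^sup>2))"
        unfolding card by (intro sum_mono pt)
      also have "\<dots> = (min 1 (s\<^sup>2) * exp (- (\<delta> / 2) * s\<^sup>2)) * (\<Sum>k<2 * m. exp (- (\<delta> / 2 * t\<^sup>2) * (sin (\<beta> k))\<^sup>2))"
        by (rule sum_distrib_left[symmetric])
      also have "\<dots> \<le> (min 1 (s\<^sup>2) * exp (- (\<delta> / 2) * s\<^sup>2)) * (4 * (1 + 4 * real m / sqrt (\<delta> / 2 * t\<^sup>2)))"
        unfolding \<beta>_def using m r(2) \<delta> t by (intro mult_left_mono gauss_sin_sum) auto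
      also have "4 * real m / sqrt (\<delta> / 2 * t\<^sup>2) = 2 / (c * s)"
      proof -
        have "sqrt (\<delta> / 2 * t\<^sup>2) = c * (2 * real m * s)"
          using t unfolding real_sqrt_mult c_def[symmetric] by (simp add: t_def)
        then show ?thesis using m by (simp add: field_simps)
      qed
      also have "(min 1 (s\<^sup>2) * exp (- (\<delta> / 2) * s\<^sup>2)) * (4 * (1 + 2 / (c * s))) \<le> D * min s (1 / s)"
      proof (cases "s \<le> 1")
        case True
        have "(min 1 (s\<^sup>2) * exp (- (\<delta> / 2) * s\<^sup>2)) * (4 * (1 + 2 / (c * s))) \<le> (s\<^sup>2 * 1) * (4 * (1 + 2 / (c * s)))"
          using \<delta> c s by (intro mult_right_mono mult_mono) auto
        also have "\<dots> = 4 * (s + 2 / c) * s" using c s by (simp add: power2_eq_square field_simps)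
        also have "\<dots> \<le> 4 * (1 + 2 / c) * s" using True s by (intro mult_right_mono mult_left_mono) auto
        also have "\<dots> \<le> D * s"
        proof (rule mult_right_mono)
          have "4 * (1 + 2 / c) * 1 \<le> D"
            unfolding D_def using c \<delta> by (intro mult_left_mono) (auto intro!: add_nonneg_nonneg divide_nonneg_nonneg)
          then show "4 * (1 + 2 / c) \<le> D" by simp
        qed (use s in simp)
        also have "\<dots> = D * min s (1 / s)"
        proof -
          have "s * s \<le> 1" using s True by (intro mult_le_one) auto
          then have "s \<le> 1 / s" using s by (simp add: field_simps)
          then show ?thesis by (simp add: min_def)
        qed
        finally show ?thesis .
      next
        case False
        then have s1: "s > 1" by simp
        have e: "exp (- (\<delta> / 2) * s\<^sup>2) \<le> (1 + 2 / \<delta>) * (1 / s)"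
        proof -
          have p: "\<delta> / 2 * s\<^sup>2 > 0" using \<delta> s by simp
          have "\<delta> / 2 * s\<^sup>2 \<le> exp (\<delta> / 2 * s\<^sup>2)" using exp_ge_add_one_self[of "\<delta> / 2 * s\<^sup>2"] by linarith
          then have "1 / exp (\<delta> / 2 * s\<^sup>2) \<le> 1 / (\<delta> / 2 * s\<^sup>2)" using p by (intro divide_left_mono) auto
          also have "\<dots> = (2 / \<delta>) * (1 / s) * (1 / s)" using s \<delta> by (simp add: power2_eq_square field_simps)
          also have "\<dots> \<le> (2 / \<delta>) * (1 / s) * 1" using s1 \<delta> by (intro mult_left_mono) auto
          also have "\<dots> \<le> (1 + 2 / \<delta>) * (1 / s)" unfolding mult_1_right using s by (intro mult_right_mono) auto
          finally show ?thesis by (simp add: exp_minus inverse_eq_divide)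
        qed
        have "(min 1 (s\<^sup>2) * exp (- (\<delta> / 2) * s\<^sup>2)) * (4 * (1 + 2 / (c * s))) \<le> (1 * ((1 + 2 / \<delta>) * (1 / s))) * (4 * (1 + 2 / c))"
        proof (intro mult_mono e)
          have "c * 1 \<le> c * s" using c s1 by (intro mult_left_mono) auto
          then have "2 / (c * s) \<le> 2 / c" using c s by (intro divide_left_mono) auto
          then show "1 + 2 / (c * s) \<le> 1 + 2 / c" by simp
        qed (use c \<delta> s in auto)
        also have "\<dots> = D * (1 / s)" by (simp add: D_def)
        also have "\<dots> = D * min s (1 / s)"
        proof -
          have "1 / s \<le> 1" using s1 by simp
          then have "1 / s \<le> s" using s1 by linarith
          then show ?thesis by (simp only: min_absorb2)
        qed
        finally show ?thesis .
      qed
      finally show ?thesis by (simp add: s_def)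
    qed
  qed
  show ?thesis
  proof (intro exI[of _ "D * (10 / 3)"] conjI allI)
    show "0 \<le> D * (10 / 3)" using D by simp
    fix \<xi> :: "real^2"
    obtain r \<alpha> where pol: "r \<ge> 0" "\<alpha> \<ge> 0" "\<xi> $ 1 = r * cos \<alpha>" "\<xi> $ 2 = r * sin \<alpha>" using polar_vec2[of \<xi>] by auto
    define u where "u j = (\<Sum>k\<le>2 ^ Suc j - 1. min 1 (\<bar>(B_mat (Suc j) k *v \<xi>) $ 1\<bar> powr \<sigma>) * exp (- \<delta> * (norm (B_mat (Suc j) k *v \<xi>))\<^sup>2))" for j
    have u0: "u j \<ge> 0" for j unfolding u_def by (intro sum_nonneg) auto
    have "(\<Sum>j. \<Sum>k\<le>2 ^ Suc j - 1. ennreal (min 1 (\<bar>(B_mat (Suc j) k *v \<xi>) $ 1\<bar> powr \<sigma>) *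
     exp (- \<delta> * (norm (B_mat (Suc j) k *v \<xi>))\<^sup>2))) = (\<Sum>j. ennreal (u j))"
      unfolding u_def by (subst sum_ennreal) auto
    also have "\<dots> = (SUP n. \<Sum>j<n. ennreal (u j))" by (rule suminf_eq_SUP)
    also have "\<dots> \<le> ennreal (D * (10 / 3))"
    proof (rule SUP_least)
      fix n
      have "(\<Sum>j<n. u j) \<le> (\<Sum>j<n. D * min (r / 4 ^ Suc j) (1 / (r / 4 ^ Suc j)))"
        unfolding u_def by (intro sum_mono scale[OF pol])
      also have "\<dots> = D * (\<Sum>j<n. min (r / 4 ^ Suc j) (1 / (r / 4 ^ Suc j)))"
        by (rule sum_distrib_left[symmetric])
      also have "\<dots> \<le> D * (10 / 3)" using D pol by (intro mult_left_mono scale_sum)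
      finally show "(\<Sum>j<n. ennreal (u j)) \<le> ennreal (D * (10 / 3))"
        using u0 by (simp add: sum_ennreal ennreal_leI)
    qed
    finally show "(\<Sum>j. \<Sum>k\<le>2 ^ Suc j - 1. ennreal (min 1 (\<bar>(B_mat (Suc j) k *v \<xi>) $ 1\<bar> powr \<sigma>) *
     exp (- \<delta> * (norm (B_mat (Suc j) k *v \<xi>))\<^sup>2))) \<le> ennreal (D * (10 / 3))" .
  qed
qed

text \<open>The triangle inequality squared: Gaussians centred at 0 and at \<zeta> cannot both be
  large.\<close>

lemma sum_squares_ge: "(norm \<zeta>)\<^sup>2 / 2 \<le> (norm x)\<^sup>2 + (norm (x - \<zeta> :: real^2))\<^sup>2"
proof -
  have "norm \<zeta> \<le> norm x + norm (x - \<zeta>)" using norm_triangle_ineq4[of x "x - \<zeta>"] by simp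
  then have "(norm \<zeta>)\<^sup>2 \<le> (norm x + norm (x - \<zeta>))\<^sup>2" by (intro power_mono) auto
  also have "\<dots> \<le> 2 * ((norm x)\<^sup>2 + (norm (x - \<zeta>))\<^sup>2)"
    using sum_squares_bound[of "norm x" "norm (x - \<zeta>)"] by (simp add: power2_sum)
  finally show ?thesis by simp
qed

text \<open>In the fine channels the Gaussian of the first factor is split: one half is summed over
  the channels by \<open>window_sum_bound\<close>, the other joins the second factor and yields the
  decay in \<zeta>.\<close>

lemma Theta_decay:
  assumes win: "window_assumptions \<phi>\<^sub>0 \<phi> A B"
  shows "\<exists>C>0. \<exists>\<tau>>0. \<forall>\<zeta>. Theta \<phi>\<^sub>0 \<phi> \<zeta> \<le> ennreal (C * exp (- \<tau> * (norm \<zeta>)\<^sup>2))"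
proof -
  have phi: "\<phi>\<^sub>0 \<in> sqint lborel" "\<phi> \<in> sqint lborel"
    using win by (auto simp: window_assumptions_def L2_eq_sqint)
  obtain \<delta> \<sigma> c0 c where par: "\<delta> > 0" "\<sigma> > 2" "c0 > 0" "c > 0"
    and b0: "AE \<xi> in lborel. norm (L2_fourier \<phi>\<^sub>0 \<xi>) \<le> c0 * exp (- \<delta> * (norm \<xi>)\<^sup>2)"
    and b: "AE \<xi> in lborel. norm (L2_fourier \<phi> \<xi>) \<le> c * (min 1 (\<bar>\<xi> $ 1\<bar> powr \<sigma>) * exp (- \<delta> * (norm \<xi>)\<^sup>2))"
    using win unfolding window_assumptions_def by blast
  obtain M where M: "M \<ge> 0" and Mb: "\<And>\<xi>. (\<Sum>j. \<Sum>k\<le>2 ^ Suc j - 1. ennreal (min 1 (\<bar>(B_mat (Suc j) k *v \<xi>) $ 1\<bar> powr \<sigma>) *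
     exp (- (\<delta> / 2) * (norm (B_mat (Suc j) k *v \<xi>))\<^sup>2))) \<le> ennreal M"
    using window_sum_bound[of "\<delta> / 2" \<sigma>] par by auto
  define g0 where "g0 = L2_fourier \<phi>\<^sub>0"
  define g where "g = L2_fourier \<phi>"
  have [measurable]: "g0 \<in> borel_measurable borel" "g \<in> borel_measurable borel"
    unfolding g0_def g_def using phi by (auto intro: sqint_borel)
  have main: "Theta \<phi>\<^sub>0 \<phi> \<zeta> \<le> ennreal ((c0\<^sup>2 + c\<^sup>2 * M) * exp (- (\<delta> / 4) * (norm \<zeta>)\<^sup>2))" for \<zeta>
    unfolding Theta_def g0_def[symmetric] g_def[symmetric]
  proof (rule esssup_I)
    define E where "E = exp (- (\<delta> / 4) * (norm \<zeta>)\<^sup>2)"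
    show "(\<lambda>\<xi>. ennreal (norm (g0 \<xi>) * norm (g0 (\<xi> - \<zeta>))) +
       (\<Sum>j. \<Sum>k\<le>2 ^ Suc j - 1. ennreal (norm (g (B_mat (Suc j) k *v \<xi>)) * norm (g (B_mat (Suc j) k *v \<xi> - \<zeta>))))) \<in> borel_measurable lborel"
      by measurable
    \<comment> \<open>Used with d = \<delta> for the coarse term and with d = \<delta>/2 for the
      fine terms, where the rest of the exponent is reserved for the summation.\<close>
    have EE: "exp (- d * (norm x)\<^sup>2) * exp (- d * (norm (x - \<zeta>))\<^sup>2) \<le> E" if d: "d \<ge> \<delta> / 2" for d x
    proof -
      have "\<delta> / 2 * ((norm \<zeta>)\<^sup>2 / 2) \<le> d * ((norm x)\<^sup>2 + (norm (x - \<zeta>))\<^sup>2)"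
        using par d sum_squares_ge by (intro mult_mono) auto
      then show ?thesis unfolding E_def exp_add[symmetric] by (subst exp_le_cancel_iff) (simp add: algebra_simps)
    qed
    have shift: "AE x in lborel. Pr (x - \<zeta>)" if "AE x in lborel. Pr x" for Pr
      using AE_shift[OF that, of "- \<zeta>"] by simp
    show "AE \<xi> in lborel. ennreal (norm (g0 \<xi>) * norm (g0 (\<xi> - \<zeta>))) +
       (\<Sum>j. \<Sum>k\<le>2 ^ Suc j - 1. ennreal (norm (g (B_mat (Suc j) k *v \<xi>)) * norm (g (B_mat (Suc j) k *v \<xi> - \<zeta>))))
       \<le> ennreal ((c0\<^sup>2 + c\<^sup>2 * M) * exp (- (\<delta> / 4) * (norm \<zeta>)\<^sup>2))"
      using b0 shift[OF b0] AE_B_mat[OF b] AE_B_mat[OF shift[OF b]]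
      unfolding g0_def[symmetric] g_def[symmetric] E_def[symmetric]
    proof eventually_elim
      case (elim \<xi>)
      have "norm (g0 \<xi>) * norm (g0 (\<xi> - \<zeta>)) \<le> (c0 * exp (- \<delta> * (norm \<xi>)\<^sup>2)) * (c0 * exp (- \<delta> * (norm (\<xi> - \<zeta>))\<^sup>2))"
        using elim(1,2) par by (intro mult_mono) auto
      also have "\<dots> = c0\<^sup>2 * (exp (- \<delta> * (norm \<xi>)\<^sup>2) * exp (- \<delta> * (norm (\<xi> - \<zeta>))\<^sup>2))"
        by (simp add: power2_eq_square)
      also have "\<dots> \<le> c0\<^sup>2 * E" using par by (intro mult_left_mono EE) auto
      finally have 1: "ennreal (norm (g0 \<xi>) * norm (g0 (\<xi> - \<zeta>))) \<le> ennreal (c0\<^sup>2 * E)" by (rule ennreal_leI)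
      define e where "e x = min 1 (\<bar>x $ 1\<bar> powr \<sigma>) * exp (- (\<delta> / 2) * (norm x)\<^sup>2)" for x :: "real^2"
      have e0: "e x \<ge> 0" for x by (simp add: e_def)
      have pt: "norm (g (B_mat j k *v \<xi>)) * norm (g (B_mat j k *v \<xi> - \<zeta>)) \<le> c\<^sup>2 * E * e (B_mat j k *v \<xi>)" for j k
      proof -
        define x where "x = B_mat j k *v \<xi>"
        have "norm (g x) * norm (g (x - \<zeta>)) \<le> (c * (min 1 (\<bar>x $ 1\<bar> powr \<sigma>) * exp (- \<delta> * (norm x)\<^sup>2))) *
            (c * (min 1 (\<bar>(x - \<zeta>) $ 1\<bar> powr \<sigma>) * exp (- \<delta> * (norm (x - \<zeta>))\<^sup>2)))"
          using elim(3,4) par unfolding x_def by (intro mult_mono) auto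
        also have "\<dots> \<le> (c * (min 1 (\<bar>x $ 1\<bar> powr \<sigma>) * exp (- \<delta> * (norm x)\<^sup>2))) * (c * (1 * exp (- (\<delta> / 2) * (norm (x - \<zeta>))\<^sup>2)))"
          using par by (intro mult_left_mono mult_mono) auto
        also have "exp (- \<delta> * (norm x)\<^sup>2) = exp (- (\<delta> / 2) * (norm x)\<^sup>2) * exp (- (\<delta> / 2) * (norm x)\<^sup>2)"
          unfolding exp_add[symmetric] by (simp add: algebra_simps)
        also have "(c * (min 1 (\<bar>x $ 1\<bar> powr \<sigma>) * (exp (- (\<delta> / 2) * (norm x)\<^sup>2) * exp (- (\<delta> / 2) * (norm x)\<^sup>2)))) * (c * (1 * exp (- (\<delta> / 2) * (norm (x - \<zeta>))\<^sup>2)))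
           = c\<^sup>2 * e x * (exp (- (\<delta> / 2) * (norm x)\<^sup>2) * exp (- (\<delta> / 2) * (norm (x - \<zeta>))\<^sup>2))"
          by (simp add: e_def power2_eq_square mult_ac)
        also have "\<dots> \<le> c\<^sup>2 * e x * E" using e0 by (intro mult_left_mono EE) auto
        finally show ?thesis by (simp add: x_def mult_ac)
      qed
      have "(\<Sum>j. \<Sum>k\<le>2 ^ Suc j - 1. ennreal (norm (g (B_mat (Suc j) k *v \<xi>)) * norm (g (B_mat (Suc j) k *v \<xi> - \<zeta>))))
        \<le> (\<Sum>j. \<Sum>k\<le>2 ^ Suc j - 1. ennreal (c\<^sup>2 * E * e (B_mat (Suc j) k *v \<xi>)))"
        by (intro suminf_le sum_mono ennreal_leI pt summableI)
      also have "\<dots> = (\<Sum>j. ennreal (c\<^sup>2 * E) * (\<Sum>k\<le>2 ^ Suc j - 1. ennreal (e (B_mat (Suc j) k *v \<xi>))))"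
        unfolding sum_distrib_left using e0 by (simp add: ennreal_mult' E_def del: power_Suc)
      also have "\<dots> = ennreal (c\<^sup>2 * E) * (\<Sum>j. \<Sum>k\<le>2 ^ Suc j - 1. ennreal (e (B_mat (Suc j) k *v \<xi>)))"
        by (rule ennreal_suminf_cmult)
      also have "\<dots> \<le> ennreal (c\<^sup>2 * E) * ennreal M"
        using Mb[of \<xi>] unfolding e_def by (intro mult_left_mono) auto
      also have "\<dots> = ennreal (c\<^sup>2 * E * M)" using M by (simp add: ennreal_mult'')
      finally have 2: "(\<Sum>j. \<Sum>k\<le>2 ^ Suc j - 1. ennreal (norm (g (B_mat (Suc j) k *v \<xi>)) * norm (g (B_mat (Suc j) k *v \<xi> - \<zeta>)))) \<le> ennreal (c\<^sup>2 * E * M)" .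
      have "ennreal (c0\<^sup>2 * E) + ennreal (c\<^sup>2 * E * M) = ennreal ((c0\<^sup>2 + c\<^sup>2 * M) * E)"
        using M by (subst ennreal_plus[symmetric]) (auto simp: E_def algebra_simps)
      then show ?case using add_mono[OF 1 2] by simp
    qed
  qed
  have "c0\<^sup>2 + c\<^sup>2 * M > 0" using par M by (intro add_pos_nonneg) auto
  moreover have "\<delta> / 4 > 0" using par by simp
  ultimately show ?thesis using main by blast
qed

section \<open>Gaussian sums over the dual lattice\<close>

text \<open>The naturals and their negatives cover the integers, and n^2 \<ge> |n| reduces each half
  to a geometric series.\<close>

lemma int_gauss_summable:
  assumes t: "t > 0"
  shows "(\<integral>\<^sup>+n. ennreal (exp (- t * (of_int n)\<^sup>2)) \<partial>count_space (UNIV :: int set)) < \<infinity>"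
proof -
  define f where "f n = ennreal (exp (- t * (of_int n)\<^sup>2))" for n :: int
  have half: "(\<integral>\<^sup>+n. f n \<partial>count_space (range h)) < \<infinity>" if h: "inj h" "\<And>i. \<bar>h i\<bar> = int i" for h :: "nat \<Rightarrow> int"
  proof -
    have "(\<integral>\<^sup>+n. f n \<partial>count_space (range h)) = (\<integral>\<^sup>+i. f (h i) \<partial>count_space UNIV)"
      using h(1) by (intro nn_integral_bij_count_space[symmetric]) (simp add: bij_betw_imageI)
    also have "\<dots> = (\<Sum>i. f (h i))" by (rule nn_integral_count_space_nat)
    also have "\<dots> \<le> (\<Sum>i. ennreal (exp (- t) ^ i))"
    proof (intro suminf_le summableI)
      fix i
      have "(of_int (h i))\<^sup>2 = (real i)\<^sup>2"
        using h(2)[of i] by (metis of_int_abs of_int_of_nat_eq power2_abs)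
      moreover have "real i \<le> (real i)\<^sup>2" by (cases i) (auto simp: power2_eq_square)
      ultimately have "exp (- t * (of_int (h i))\<^sup>2) \<le> exp (real i * (- t))"
        using t by (subst exp_le_cancel_iff) simp
      then show "f (h i) \<le> ennreal (exp (- t) ^ i)"
        unfolding f_def exp_of_nat_mult[symmetric] by (rule ennreal_leI)
    qed
    also have "\<dots> = ennreal (\<Sum>i. exp (- t) ^ i)"
      using t by (intro suminf_ennreal2 summable_geometric) auto
    also have "\<dots> < \<infinity>" by simp
    finally show ?thesis .
  qed
  have "(\<integral>\<^sup>+n. f n \<partial>count_space UNIV) \<le> (\<integral>\<^sup>+n. f n * indicator (range int) n + f n * indicator (range (\<lambda>i. - int i)) n \<partial>count_space UNIV)"
  proof (rule nn_integral_mono)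
    fix n :: int
    have "n \<in> range int \<or> n \<in> range (\<lambda>i. - int i)" by (cases n rule: int_cases2) auto
    then show "f n \<le> f n * indicator (range int) n + f n * indicator (range (\<lambda>i. - int i)) n"
      by (auto simp: indicator_def add_increasing2)
  qed
  also have "\<dots> = (\<integral>\<^sup>+n. f n \<partial>count_space (range int)) + (\<integral>\<^sup>+n. f n \<partial>count_space (range (\<lambda>i. - int i)))"
    by (subst nn_integral_add) (auto simp: nn_integral_count_space_indicator)
  also have "\<dots> < \<infinity>"
    using half[of int] half[of "\<lambda>i. - int i"] by (simp add: ennreal_add_eq_top less_top inj_def)
  finally show ?thesis by (simp add: f_def)
qed

lemma intvec_gauss_summable:
  assumes t: "t > 0"
  shows "(\<integral>\<^sup>+n. ennreal (exp (- t * (norm n)\<^sup>2)) \<partial>count_space intvec) < \<infinity>"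
proof -
  define f where "f n = ennreal (exp (- t * (of_int n)\<^sup>2))" for n :: int
  have "(\<integral>\<^sup>+n. ennreal (exp (- t * (norm n)\<^sup>2)) \<partial>count_space intvec) =
    (\<integral>\<^sup>+p. ennreal (exp (- t * (norm ((case p of (n, m) \<Rightarrow> vector [of_int n, of_int m]) :: real^2))\<^sup>2)) \<partial>count_space (UNIV :: (int \<times> int) set))"
    by (rule nn_integral_bij_count_space[OF bij_intvec, symmetric])
  also have "\<dots> = (\<integral>\<^sup>+p. f (fst p) * f (snd p) \<partial>count_space UNIV)"
  proof (rule nn_integral_cong)
    fix p :: "int \<times> int"
    show "ennreal (exp (- t * (norm ((case p of (n, m) \<Rightarrow> vector [of_int n, of_int m]) :: real^2))\<^sup>2)) = f (fst p) * f (snd p)"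
      by (cases p) (simp add: norm_vec2_sq f_def ennreal_mult'[symmetric] exp_add[symmetric] algebra_simps)
  qed
  also have "\<dots> = (\<integral>\<^sup>+n. f n \<partial>count_space UNIV) * (\<integral>\<^sup>+n. f n \<partial>count_space UNIV)"
    by (subst nn_integral_fst_count_space[symmetric]) (simp add: nn_integral_cmult nn_integral_multc)
  also have "\<dots> < \<infinity>" using int_gauss_summable[OF t] by (simp add: f_def ennreal_mult_less_top)
  finally show ?thesis .
qed

lemma intvec_norm_ge_1:
  assumes "n \<in> intvec" "n \<noteq> 0" shows "1 \<le> (norm n)\<^sup>2"
proof -
  obtain k l where kl: "n $ 1 = of_int k" "n $ 2 = of_int l" using assms(1) by (fastforce simp: intvec_def Ints_def)
  have "k \<noteq> 0 \<or> l \<noteq> 0" using assms(2) kl by (auto simp: vec_eq_iff forall_2)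
  then have "1 \<le> k\<^sup>2 + l\<^sup>2"
    by (smt (verit) zero_less_power2 zero_le_power2)
  then have "1 \<le> real_of_int (k\<^sup>2 + l\<^sup>2)" by linarith
  then show ?thesis by (simp add: norm_vec2_sq kl)
qed

text \<open>The symmetric matrix with diagonal p, s and off-diagonal entry -q has determinant 0 and
  nonnegative trace, hence is positive semidefinite.\<close>

lemma quadratic_form_nonneg:
  fixes p s q x y :: real
  assumes "p * s = q\<^sup>2" "p + s \<ge> 0"
  shows "0 \<le> p * x\<^sup>2 - 2 * q * x * y + s * y\<^sup>2"
proof -
  have "p * s \<ge> 0" using assms(1) by simp
  then have ps: "p \<ge> 0" "s \<ge> 0" using assms(2) by (auto simp: zero_le_mult_iff)
  show ?thesis
  proof (cases "p = 0")
    case True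
    then show ?thesis using assms ps by simp
  next
    case False
    then have p: "p > 0" using ps by simp
    have "p * (p * x\<^sup>2 - 2 * q * x * y + s * y\<^sup>2) = (p * x - q * y)\<^sup>2 + (p * s - q\<^sup>2) * y\<^sup>2"
      by (simp add: power2_eq_square algebra_simps)
    also have "\<dots> \<ge> 0" using assms(1) by simp
    finally show ?thesis using p by (simp add: zero_le_mult_iff)
  qed
qed

text \<open>n is \<open>transpose P\<close> applied to its dual vector v, so the factor is the
  larger eigenvalue L of \<open>P ** transpose P\<close>: L times the identity minus this matrix is
  singular with nonnegative trace, hence positive semidefinite.\<close>

lemma dual_vector_norm:
  assumes P: "invertible P" and ab: "a > 0" "b > 0" and sv: "singular_values P a b"
  shows "(norm n)\<^sup>2 \<le> (max a b)\<^sup>2 * (norm (transpose (matrix_inv P) *v n))\<^sup>2"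
proof -
  define v where "v = transpose (matrix_inv P) *v n"
  \<comment> \<open>A, C and D are the entries of \<open>P ** transpose P\<close>, which has the
    same characteristic polynomial as \<open>transpose P ** P\<close>.\<close>
  define A where "A = (P $ 1 $ 1)\<^sup>2 + (P $ 1 $ 2)\<^sup>2"
  define C where "C = P $ 1 $ 1 * P $ 2 $ 1 + P $ 1 $ 2 * P $ 2 $ 2"
  define D where "D = (P $ 2 $ 1)\<^sup>2 + (P $ 2 $ 2)\<^sup>2"
  define L where "L = (max a b)\<^sup>2"
  have det: "det (mat t - transpose P ** P) = t\<^sup>2 - (A + D) * t + (A * D - C\<^sup>2)" for t
    by (simp add: det_2 mat_def transpose_def matrix_matrix_mult_def sum_2 A_def C_def D_def power2_eq_square algebra_simps)
  have sv': "t\<^sup>2 - (A + D) * t + (A * D - C\<^sup>2) = (t - a\<^sup>2) * (t - b\<^sup>2)" for t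
    using sv unfolding singular_values_def det[symmetric] by blast
  have e0: "A * D - C\<^sup>2 = a\<^sup>2 * b\<^sup>2" using sv'[of 0] by simp
  have e1: "A + D = a\<^sup>2 + b\<^sup>2" using sv'[of 1] e0 by (simp add: algebra_simps)
  have L: "a\<^sup>2 \<le> L" "b\<^sup>2 \<le> L" unfolding L_def using ab by (auto intro: power_mono)
  have "(L - a\<^sup>2) * (L - b\<^sup>2) = 0" unfolding L_def using ab by (auto simp: max_def)
  then have "L\<^sup>2 - (A + D) * L + (A * D - C\<^sup>2) = 0" using sv'[of L] by simp
  then have "(L - A) * (L - D) = C\<^sup>2" by (simp add: power2_eq_square algebra_simps)
  moreover have "(L - A) + (L - D) \<ge> 0" using L e1 by linarith
  ultimately have "0 \<le> (L - A) * (v $ 1)\<^sup>2 - 2 * C * v $ 1 * v $ 2 + (L - D) * (v $ 2)\<^sup>2"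
    by (rule quadratic_form_nonneg)
  moreover have "(norm (transpose P *v v))\<^sup>2 = A * (v $ 1)\<^sup>2 + 2 * C * v $ 1 * v $ 2 + D * (v $ 2)\<^sup>2"
    unfolding norm_vec2_sq
    by (simp add: transpose_def matrix_vector_mult_def sum_2 A_def C_def D_def power2_eq_square algebra_simps)
  ultimately have "(norm (transpose P *v v))\<^sup>2 \<le> L * ((v $ 1)\<^sup>2 + (v $ 2)\<^sup>2)"
    by (simp add: algebra_simps)
  moreover have "transpose P *v v = n"
  proof -
    have "transpose P ** transpose (matrix_inv P) = mat 1"
      unfolding matrix_transpose_mul[symmetric] matrix_inv_mult(2)[OF P] by (rule transpose_mat)
    then show ?thesis unfolding v_def by (simp add: matrix_vector_mul_assoc)
  qed
  ultimately show ?thesis by (simp add: L_def v_def norm_vec2_sq)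
qed

text \<open>For m = max a b \<le> 1 both 1/m^2 and |n|^2 are at most |v|^2, where v is the dual
  vector of n \<noteq> 0. So half of the exponent gives the factor in m, and the other half leaves a
  sum over n that does not depend on the lattice.\<close>

lemma Delta_decay:
  assumes win: "window_assumptions \<phi>\<^sub>0 \<phi> A B"
  shows "\<exists>K>0. \<exists>\<tau>>0. \<forall>P a b. invertible P \<and> a > 0 \<and> b > 0 \<and> singular_values P a b \<and> max a b \<le> 1 \<longrightarrow>
    Delta \<phi>\<^sub>0 \<phi> P \<le> ennreal (K * exp (- \<tau> / (max a b)\<^sup>2))"
proof -
  obtain C t where C: "C > 0" "t > 0" and Th: "\<And>\<zeta>. Theta \<phi>\<^sub>0 \<phi> \<zeta> \<le> ennreal (C * exp (- t * (norm \<zeta>)\<^sup>2))"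
    using Theta_decay[OF win] by auto
  define S where "S = enn2real (\<integral>\<^sup>+n. ennreal (exp (- (t / 2) * (norm n)\<^sup>2)) \<partial>count_space intvec)"
  have S: "(\<integral>\<^sup>+n. ennreal (exp (- (t / 2) * (norm n)\<^sup>2)) \<partial>count_space intvec) = ennreal S"
    using intvec_gauss_summable[of "t / 2"] C by (simp add: S_def)
  have S0: "S \<ge> 0" by (simp add: S_def)
  show ?thesis
  \<comment> \<open>\<open>S\<close> is recorded only as nonnegative; the summand 1 secures a
    positive constant.\<close>
  proof (rule exI[of _ "C * S + 1"], intro conjI exI[of _ "t / 2"] allI impI)
    show "C * S + 1 > 0" using C S0 by (intro add_nonneg_pos) auto
    show "t / 2 > 0" using C by simp
    fix P :: "real^2^2" and a b :: real
    assume *: "invertible P \<and> a > 0 \<and> b > 0 \<and> singular_values P a b \<and> max a b \<le> 1"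
    define m where "m = max a b"
    have m: "m > 0" "m \<le> 1" using * by (auto simp: m_def less_max_iff_disj)
    have m2: "m\<^sup>2 > 0" "m\<^sup>2 \<le> 1" using m by (auto simp: power_le_one)
    define E where "E = exp (- (t / 2) / m\<^sup>2)"
    have pt: "max (Theta \<phi>\<^sub>0 \<phi> (transpose (matrix_inv P) *v n)) (Theta \<phi>\<^sub>0 \<phi> (- (transpose (matrix_inv P) *v n)))
       \<le> ennreal (C * E) * ennreal (exp (- (t / 2) * (norm n)\<^sup>2))" if n: "n \<in> intvec - {0}" for n
    proof -
      define v where "v = transpose (matrix_inv P) *v n"
      have n1: "1 \<le> (norm n)\<^sup>2" using n by (intro intvec_norm_ge_1) auto
      have "(norm n)\<^sup>2 \<le> m\<^sup>2 * (norm v)\<^sup>2" unfolding m_def v_def using * by (intro dual_vector_norm) auto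
      then have "(norm n)\<^sup>2 / m\<^sup>2 \<le> (norm v)\<^sup>2" using m2 by (simp add: field_simps)
      moreover have "1 / m\<^sup>2 \<le> (norm n)\<^sup>2 / m\<^sup>2" using n1 m2 by (intro divide_right_mono) auto
      moreover have "(norm n)\<^sup>2 \<le> (norm n)\<^sup>2 / m\<^sup>2"
      proof -
        have "(norm n)\<^sup>2 * m\<^sup>2 \<le> (norm n)\<^sup>2 * 1" using m2 by (intro mult_left_mono) auto
        then show ?thesis using m2(1) by (simp add: pos_le_divide_eq)
      qed
      ultimately have "1 / m\<^sup>2 + (norm n)\<^sup>2 \<le> 2 * (norm v)\<^sup>2" by linarith
      then have "t / 2 * (1 / m\<^sup>2 + (norm n)\<^sup>2) \<le> t / 2 * (2 * (norm v)\<^sup>2)" using C by (intro mult_left_mono) auto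
      then have "- t * (norm v)\<^sup>2 \<le> - (t / 2) / m\<^sup>2 + - (t / 2) * (norm n)\<^sup>2" by (simp add: distrib_left)
      then have "exp (- t * (norm v)\<^sup>2) \<le> E * exp (- (t / 2) * (norm n)\<^sup>2)"
        unfolding E_def exp_add[symmetric] by (subst exp_le_cancel_iff)
      then have "ennreal (C * exp (- t * (norm v)\<^sup>2)) \<le> ennreal (C * (E * exp (- (t / 2) * (norm n)\<^sup>2)))"
        using C by (intro ennreal_leI mult_left_mono) auto
      also have "\<dots> = ennreal (C * E) * ennreal (exp (- (t / 2) * (norm n)\<^sup>2))"
        using C by (subst ennreal_mult[symmetric]) (auto simp: E_def mult.assoc)
      finally have 1: "ennreal (C * exp (- t * (norm v)\<^sup>2)) \<le> ennreal (C * E) * ennreal (exp (- (t / 2) * (norm n)\<^sup>2))" .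
      have "max (Theta \<phi>\<^sub>0 \<phi> v) (Theta \<phi>\<^sub>0 \<phi> (- v)) \<le> ennreal (C * exp (- t * (norm v)\<^sup>2))"
        using Th[of v] Th[of "- v"] by simp
      from order_trans[OF this 1] show ?thesis unfolding v_def .
    qed
    have "Delta \<phi>\<^sub>0 \<phi> P \<le> (\<integral>\<^sup>+n. ennreal (C * E) * ennreal (exp (- (t / 2) * (norm n)\<^sup>2)) \<partial>count_space (intvec - {0}))"
      unfolding Delta_nn_integral[OF conjunct1[OF *]] by (intro nn_integral_mono pt) simp
    also have "\<dots> \<le> (\<integral>\<^sup>+n. ennreal (C * E) * ennreal (exp (- (t / 2) * (norm n)\<^sup>2)) \<partial>count_space intvec)"
      unfolding nn_integral_count_space_indicator[of "intvec - {0}"] nn_integral_count_space_indicator[of intvec]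
      by (simp add: nn_integral_count_space_indicator) (intro nn_integral_mono, auto simp: indicator_def)
    also have "\<dots> = ennreal (C * E) * ennreal S" unfolding S[symmetric] by (rule nn_integral_cmult) simp
    also have "\<dots> = ennreal (C * E * S)" using S0 by (simp add: ennreal_mult'')
    also have "\<dots> \<le> ennreal ((C * S + 1) * E)" by (intro ennreal_leI) (simp add: E_def algebra_simps)
    finally show "Delta \<phi>\<^sub>0 \<phi> P \<le> ennreal ((C * S + 1) * exp (- (t / 2) / (max a b)\<^sup>2))" by (simp add: E_def m_def)
  qed
qed

theorem theorem3p12:
  fixes \<phi>\<^sub>0 \<phi> :: "real^2 \<Rightarrow> complex" and A B \<epsilon> :: real and \<eta> :: "real^2 \<Rightarrow> real"
  assumes "window_assumptions \<phi>\<^sub>0 \<phi> A B"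
    and "\<epsilon> > 0"
    and "ennreal \<epsilon> * star_norm (L2_fourier \<phi>) < ennreal A"
    and "cutoff \<epsilon> \<phi> \<eta>"
  shows "\<exists>\<tau>>0. \<exists>C>0. \<forall>(P :: real^2^2) a b.
    invertible P \<and> a > 0 \<and> b > 0 \<and> singular_values P a b \<and>
    Delta \<phi>\<^sub>0 \<phi> P < ennreal (A - \<epsilon> * enn2real (star_norm (L2_fourier \<phi>))) \<longrightarrow>
    (\<forall>f\<in>L2. \<exists>f'\<in>L2.
       approx_expansion \<phi>\<^sub>0 \<phi> \<eta> P f f' \<and>
       L2_norm (\<lambda>x. f x - f' x)
         \<le> enn2real (Delta \<phi>\<^sub>0 \<phi> P) / (A - \<epsilon> * enn2real (star_norm (L2_fourier \<phi>))) * L2_norm f \<and>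
       enn2real (Delta \<phi>\<^sub>0 \<phi> P) / (A - \<epsilon> * enn2real (star_norm (L2_fourier \<phi>))) * L2_norm f
         \<le> C * (exp (- \<tau> / a\<^sup>2) + exp (- \<tau> / b\<^sup>2)) * L2_norm f)"
proof -
  define a0 where "a0 = A - \<epsilon> * enn2real (star_norm (L2_fourier \<phi>))"
  have a0: "a0 > 0"
  proof -
    have "star_norm (L2_fourier \<phi>) \<noteq> top" using assms(2,3) by (auto simp: ennreal_mult_eq_top_iff)
    then have "star_norm (L2_fourier \<phi>) = ennreal (enn2real (star_norm (L2_fourier \<phi>)))" by (simp add: less_top)
    then have "ennreal (\<epsilon> * enn2real (star_norm (L2_fourier \<phi>))) < ennreal A"
      using assms(2,3) by (metis ennreal_mult' less_imp_le)
    then show ?thesis using assms(2) by (simp add: a0_def ennreal_less_iff)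
  qed
  obtain K \<tau> where K: "K > 0" "\<tau> > 0"
    and D: "\<And>P a b. invertible P \<Longrightarrow> a > 0 \<Longrightarrow> b > 0 \<Longrightarrow> singular_values P a b \<Longrightarrow> max a b \<le> 1 \<Longrightarrow>
      Delta \<phi>\<^sub>0 \<phi> P \<le> ennreal (K * exp (- \<tau> / (max a b)\<^sup>2))"
    using Delta_decay[OF assms(1)] by blast
  \<comment> \<open>\<open>K\<close> serves lattices with max a b \<le> 1. Otherwise \<Delta> < a0
    by hypothesis while the factor \<open>E\<close> is at least exp(-\<tau>), which the term
    \<open>a0 * exp \<tau>\<close> offsets.\<close>
  define C where "C = (K + a0 * exp \<tau>) / a0"
  have C: "C > 0" using K a0 by (simp add: C_def add_pos_pos)
  show ?thesis
  proof (rule exI[of _ \<tau>], intro exI[of _ C] conjI allI impI ballI K C)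
    fix P :: "real^2^2" and a b :: real and f :: "real^2 \<Rightarrow> complex"
    assume *: "invertible P \<and> a > 0 \<and> b > 0 \<and> singular_values P a b \<and>
      Delta \<phi>\<^sub>0 \<phi> P < ennreal (A - \<epsilon> * enn2real (star_norm (L2_fourier \<phi>)))" and f: "f \<in> L2"
    define d where "d = enn2real (Delta \<phi>\<^sub>0 \<phi> P)"
    have Dd: "Delta \<phi>\<^sub>0 \<phi> P = ennreal d"
      using * by (simp add: d_def) (metis ennreal_enn2real less_trans ennreal_less_top)
    have d0: "d \<ge> 0" by (simp add: d_def)
    have da: "d < a0" using * d0 unfolding Dd a0_def[symmetric] by (simp add: ennreal_less_iff)
    define m where "m = max a b"
    have m: "m > 0" using * by (simp add: m_def less_max_iff_disj)
    define E where "E = exp (- \<tau> / m\<^sup>2)"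
    have "d \<le> (K + a0 * exp \<tau>) * E"
    proof (cases "m \<le> 1")
      case True
      then have "ennreal d \<le> ennreal (K * E)"
        using D[of P a b] * unfolding Dd E_def m_def by blast
      then have "d \<le> K * E" using K by (simp add: E_def ennreal_le_iff)
      then show ?thesis using a0 by (simp add: E_def distrib_right add_increasing2)
    next
      case False
      then have "1 \<le> m\<^sup>2" by (simp add: one_le_power)
      then have "\<tau> / m\<^sup>2 \<le> \<tau> / 1" using K by (intro divide_left_mono) auto
      then have "exp \<tau> * E \<ge> 1" unfolding E_def exp_add[symmetric] by simp
      then have "a0 * 1 \<le> a0 * (exp \<tau> * E)" using a0 by (intro mult_left_mono) auto
      then have "d \<le> a0 * exp \<tau> * E" using da by (simp add: mult.assoc)
      moreover have "0 \<le> K * E" using K by (simp add: E_def)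
      ultimately show ?thesis by (simp add: distrib_right)
    qed
    then have "d / a0 \<le> C * E" using a0 by (simp add: C_def divide_right_mono)
    \<comment> \<open>The maximum is a or b, so \<open>E\<close> is one of the two summands.\<close>
    also have "E \<le> exp (- \<tau> / a\<^sup>2) + exp (- \<tau> / b\<^sup>2)"
      by (auto simp: E_def m_def max_def add_increasing add_increasing2)
    finally have dC: "d / a0 \<le> C * (exp (- \<tau> / a\<^sup>2) + exp (- \<tau> / b\<^sup>2))" using C by (simp add: mult_left_mono)
    have "d / a0 * L2_norm f \<le> C * (exp (- \<tau> / a\<^sup>2) + exp (- \<tau> / b\<^sup>2)) * L2_norm f"
      using dC by (rule mult_right_mono) (simp add: L2_norm_eq_sqnorm)
    with window_expansion[OF assms, of P f] * f
    show "\<exists>f'\<in>L2. approx_expansion \<phi>\<^sub>0 \<phi> \<eta> P f f' \<and>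
       L2_norm (\<lambda>x. f x - f' x)
         \<le> enn2real (Delta \<phi>\<^sub>0 \<phi> P) / (A - \<epsilon> * enn2real (star_norm (L2_fourier \<phi>))) * L2_norm f \<and>
       enn2real (Delta \<phi>\<^sub>0 \<phi> P) / (A - \<epsilon> * enn2real (star_norm (L2_fourier \<phi>))) * L2_norm f
         \<le> C * (exp (- \<tau> / a\<^sup>2) + exp (- \<tau> / b\<^sup>2)) * L2_norm f"
      unfolding d_def a0_def by blast
  qed
qed

end
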